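(* Let $(M,\langle\cdot,\cdot\rangle^*,dv_M)$ be a subriemannian manifold of dimension $m+1$ with background volume form, having isometric translations $\Psi_a$ near $p_0\in M$, transversal to a hypersurface $\Sigma$ passing through $p_0$; assume $\dim\xi$ is constant, equal to $m+1-l$. Take a system of translation-isometric coordinates $x^1,\dots,x^{m+1}$ in a neighborhood $\Omega$ of $p_0$ such that $x^{m+1}=0$ on $\Sigma\cap\Omega$, with $\Sigma\cap\Omega$ connected. Let $u,v:\Sigma\cap\Omega\to\mathbb{R}$ be ($C^\infty$) functions defining graphs $\{(x^1,\dots,x^m,u(x^1,\dots,x^m))\}\subset\Omega$ and $\{(x^1,\dots,x^m,v(x^1,\dots,x^m))\}\subset\Omega$. Let $(w,w')=(u,v)$ (respectively, $(w,w')=(v,u)$). Assume: (1) $v\ge u$ on $\Sigma\cap\Omega$, $S_{\Sigma\cap\Omega}(w)=\{p_0\}$, $p_0=(0,\dots,0)$, and $v(p_0)=u(p_0)=0$; (2) $H(v)\le H(u)$ in $(\Sigma\cap\Omega)\setminus(\{p_0\}\cup S_{\Sigma\cap\Omega}(w'))$. Suppose $\mathcal{H}_{m-1}(\overline{S_{\Sigma\cap\Omega}(w')})=0$. Moreover, assume the rank condition: $\operatorname{rank}\mathcal{L}(X_1,\dots,X_{m-l})\ge m$ for any local sections $X_1,\dots,X_{m-l}$ of $\xi$ which are linearly independent wherever defined. Then $v\equiv u$ in $\Sigma\cap\Omega$.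
   Context: A subriemannian manifold is a $C^\infty$ manifold $M$ with a (smooth) nonnegative definite inner product $\langle\cdot,\cdot\rangle^*$ on $T^*M$ (possibly degenerate); $|\omega|_*:=(\langle\omega,\omega\rangle^* )^{1/2}$. A background volume form $dv_M$ is a nowhere vanishing $(m+1)$-form. For a 1-form $\omega$, $\omega\lrcorner dv_M$ is the $m$-form with $\eta\wedge(\omega\lrcorner dv_M)=\langle\eta,\omega\rangle^*dv_M$ for all 1-forms $\eta$. $G:T^*M\to TM$ is defined by $\omega(G(\eta))=\langle\omega,\eta\rangle^*$, and $\xi:=\operatorname{Range}(G)$. Isometric translations near $p_0$: a one-parameter family of local diffeomorphisms $\Psi_a$, $a\in(-\delta,\delta)$ ($\delta>0$ small), in a small neighborhood of $p_0$, with $\Psi_0=\mathrm{Id}$, $\Psi_{a+b}=\Psi_a\circ\Psi_b$ wherever defined, preserving $\langle\cdot,\cdot\rangle^*$ (i.e. $\langle\Psi_a^*\omega,\Psi_a^*\eta\rangle^*=\langle\omega,\eta\rangle^*$) and $dv_M$ (i.e. $\Psi_a^*dv_M=dv_M$). They are transversal to $\Sigma$ if $\frac{d}{da}\Psi_a(x)|_{a=0}\notin T_x\Sigma$ for all $x\in\Sigma$. Translation-isometric coordinates in $\Omega$ (they exist under transversality) are local coordinates $x^1,\dots,x^{m+1}$ such that $\Sigma=\{x^{m+1}=0\}$ in $\Omega$, $p_0$ is the origin, $x^j\circ\Psi_a=x^j$ ($1\le j\le m$) and $x^{m+1}\circ\Psi_a=x^{m+1}+a$ whenever both points lie in $\Omega$,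 and the density $A$ in $dv_M=A\,dx^1\wedge\dots\wedge dx^{m+1}$ satisfies $A\circ\Psi_a=A$. A point $\tilde q$ of a hypersurface $\tilde\Sigma$ is singular if $\xi\subset T\tilde\Sigma$ at $\tilde q$ (equivalently $|d\phi|_*=0$ at $\tilde q$ for a defining function $\phi$). For a graph of $w$ over $D$ in the coordinates, $S_D(w)$ is the set of $q\in D$ such that $(q,w(q))$ is a singular point of the graph. For $\phi=u(x^1,\dots,x^m)-x^{m+1}$, where $|d\phi|_*\ne0$ let $H_\phi$ be defined by $d\big(\frac{d\phi}{|d\phi|_*}\lrcorner dv_M\big)=H_\phi\,dv_M$, and $H(u)(x^1,\dots,x^m):=H_\phi(x^1,\dots,x^m,u(x^1,\dots,x^m))$; similarly for $v$. $\mathcal{H}_{m-1}$ is $(m-1)$-dimensional Hausdorff measure. $\mathcal{L}(X_1,\dots,X_r)$ is the smallest $C^\infty$-module of vector fields containing the $C^\infty$ vector fields $X_1,\dots,X_r$ and closed under Lie bracket; its rank at $q$ is the dimension of the span of $\{Z(q):Z\in\mathcal{L}(X_1,\dots,X_r)\}$. *)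

theory Defs
  imports "HOL-Analysis.Analysis"
begin

section \<open>Smooth functions on open subsets of Euclidean spaces\<close>

fun Ck_on :: "nat \<Rightarrow> 'e::euclidean_space set \<Rightarrow> ('e \<Rightarrow> 'f::real_normed_vector) \<Rightarrow> bool" where
  "Ck_on 0 S f \<longleftrightarrow> continuous_on S f"
| "Ck_on (Suc k) S f \<longleftrightarrow> (\<forall>x\<in>S. f differentiable (at x)) \<and>
     (\<forall>v. Ck_on k S (\<lambda>x. frechet_derivative f (at x) v))"

text \<open>Only used for open \<open>S\<close>, since the derivatives are full (not one-sided) derivatives.\<close>

definition smooth_on :: "'e::euclidean_space set \<Rightarrow> ('e \<Rightarrow> 'f::real_normed_vector) \<Rightarrow> bool" where
  "smooth_on S f \<longleftrightarrow> (\<forall>k. Ck_on k S f)"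


section \<open>Smooth manifolds\<close>

text \<open>The underlying set of the manifold is a whole type \<open>'a\<close>, which the statement takes to be
  Hausdorff and second countable. A chart is a pair of its domain and a function that is
  only meaningful on the domain.\<close>

type_synonym ('a, 'e) chart = "'a set \<times> ('a \<Rightarrow> 'e)"

abbreviation dom_of :: "('a, 'e) chart \<Rightarrow> 'a set" where "dom_of c \<equiv> fst c"

abbreviation crd :: "('a, 'e) chart \<Rightarrow> 'a \<Rightarrow> 'e" where "crd c \<equiv> snd c"

abbreviation img_of :: "('a, 'e) chart \<Rightarrow> 'e set" where "img_of c \<equiv> crd c ` dom_of c"

abbreviation crd_inv :: "('a, 'e) chart \<Rightarrow> 'e \<Rightarrow> 'a" where
  "crd_inv c \<equiv> inv_into (dom_of c) (crd c)"

definition local_rep :: "('a, 'e) chart \<Rightarrow> ('a, 'e) chart \<Rightarrow> ('a \<Rightarrow> 'a) \<Rightarrow> 'e \<Rightarrow> 'e" where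
  "local_rep c c' f = crd c' \<circ> f \<circ> crd_inv c"

definition is_chart :: "('a::topological_space, 'e::euclidean_space) chart \<Rightarrow> bool" where
  "is_chart c \<longleftrightarrow> open (dom_of c) \<and> open (img_of c) \<and>
     homeomorphism (dom_of c) (img_of c) (crd c) (crd_inv c)"

definition smooth_compatible ::
  "('a, 'e::euclidean_space) chart \<Rightarrow> ('a, 'e) chart \<Rightarrow> bool" where
  "smooth_compatible c c' \<longleftrightarrow>
     smooth_on (crd c ` (dom_of c \<inter> dom_of c')) (local_rep c c' id) \<and>
     smooth_on (crd c' ` (dom_of c \<inter> dom_of c')) (local_rep c' c id)"

text \<open>A smooth structure is a maximal smooth atlas.\<close>

definition smooth_structure :: "('a::topological_space, 'e::euclidean_space) chart set \<Rightarrow> bool" where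
  "smooth_structure \<A> \<longleftrightarrow>
     (\<forall>c\<in>\<A>. is_chart c) \<and> (\<Union>c\<in>\<A>. dom_of c) = UNIV \<and>
     (\<forall>c\<in>\<A>. \<forall>c'\<in>\<A>. smooth_compatible c c') \<and>
     (\<forall>c. is_chart c \<and> (\<forall>c'\<in>\<A>. smooth_compatible c c') \<longrightarrow> c \<in> \<A>)"

definition smooth_map ::
  "('a::topological_space, 'e::euclidean_space) chart set \<Rightarrow> 'a set \<Rightarrow> ('a \<Rightarrow> 'a) \<Rightarrow> bool" where
  "smooth_map \<A> W f \<longleftrightarrow> continuous_on W f \<and>
     (\<forall>c\<in>\<A>. \<forall>c'\<in>\<A>. smooth_on (crd c ` {p \<in> dom_of c \<inter> W. f p \<in> dom_of c'}) (local_rep c c' f))"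

definition local_diffeo ::
  "('a::topological_space, 'e::euclidean_space) chart set \<Rightarrow> 'a set \<Rightarrow> ('a \<Rightarrow> 'a) \<Rightarrow> bool" where
  "local_diffeo \<A> N f \<longleftrightarrow>
     (\<forall>p\<in>N. \<exists>W. open W \<and> p \<in> W \<and> W \<subseteq> N \<and> inj_on f W \<and> open (f ` W) \<and>
        smooth_map \<A> W f \<and> smooth_map \<A> (f ` W) (inv_into W f))"

text \<open>Tangent space at \<open>y\<close> of a submanifold \<open>S\<close> of Euclidean space: the velocities at \<open>y\<close>
  of curves that run in \<open>S\<close>.\<close>

definition tangent_space :: "'e::euclidean_space set \<Rightarrow> 'e \<Rightarrow> 'e set" where
  "tangent_space S y = {v. \<exists>\<gamma> e. 0 < e \<and> (\<forall>t\<in>{-e<..<e}. \<gamma> t \<in> S) \<and> \<gamma> 0 = y \<and>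
     (\<gamma> has_vector_derivative v) (at (0::real))}"


section \<open>Differential forms on open subsets of Euclidean spaces\<close>

type_synonym 'e covector = "'e \<Rightarrow>\<^sub>L real"

text \<open>Alternating \<open>k\<close>-linear forms are functions on lists of vectors, with value \<open>0\<close> on the lists
  of any length other than \<open>k\<close>.\<close>

definition alt_form :: "nat \<Rightarrow> ('e::euclidean_space list \<Rightarrow> real) \<Rightarrow> bool" where
  "alt_form k \<theta> \<longleftrightarrow>
     (\<forall>vs i. length vs = k \<and> i < k \<longrightarrow> linear (\<lambda>v. \<theta> (vs[i := v]))) \<and>
     (\<forall>vs. length vs = k \<and> \<not> distinct vs \<longrightarrow> \<theta> vs = 0) \<and>
     (\<forall>vs. length vs \<noteq> k \<longrightarrow> \<theta> vs = 0)"

definition omit :: "nat \<Rightarrow> 'b list \<Rightarrow> 'b list" where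
  "omit i vs = take i vs @ drop (Suc i) vs"

definition wedge1 :: "'e::euclidean_space covector \<Rightarrow> ('e list \<Rightarrow> real) \<Rightarrow> 'e list \<Rightarrow> real" where
  "wedge1 \<eta> \<theta> vs = (\<Sum>i<length vs. (-1) ^ i * blinfun_apply \<eta> (vs ! i) * \<theta> (omit i vs))"

text \<open>The exterior derivative, in the normalization in which \<open>d (f \<theta>) = df \<and> \<theta>\<close> for constant \<open>\<theta>\<close>
  and the wedge product above.\<close>

definition ext_deriv :: "('e::euclidean_space \<Rightarrow> 'e list \<Rightarrow> real) \<Rightarrow> 'e \<Rightarrow> 'e list \<Rightarrow> real" where
  "ext_deriv \<theta> y vs =
     (\<Sum>i<length vs. (-1) ^ i * frechet_derivative (\<lambda>z. \<theta> z (omit i vs)) (at y) (vs ! i))"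

definition differential :: "('e::euclidean_space \<Rightarrow> real) \<Rightarrow> 'e \<Rightarrow> 'e covector" where
  "differential \<phi> y = Blinfun (frechet_derivative \<phi> (at y))"

definition pullback :: "('e::euclidean_space \<Rightarrow> 'e) \<Rightarrow> 'e \<Rightarrow> 'e covector \<Rightarrow> 'e covector" where
  "pullback F y \<omega> = \<omega> o\<^sub>L Blinfun (frechet_derivative F (at y))"


section \<open>Subriemannian manifolds with a background volume form\<close>

text \<open>Tensor fields on the manifold are given by their components in each chart, as functions on the
  image of the chart, subject to the usual transformation law. This law is invariance
  under the identity map of the manifold.\<close>

type_synonym 'e coinner = "'e covector \<Rightarrow> 'e covector \<Rightarrow> real"

definition preserves_cometric ::
  "('a, 'e::euclidean_space) chart set \<Rightarrow> (('a, 'e) chart \<Rightarrow> 'e \<Rightarrow> 'e coinner) \<Rightarrow> 'a set \<Rightarrow> ('a \<Rightarrow> 'a) \<Rightarrow> bool"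
where
  "preserves_cometric \<A> g W f \<longleftrightarrow>
     (\<forall>c\<in>\<A>. \<forall>c'\<in>\<A>. \<forall>p\<in>W. p \<in> dom_of c \<and> f p \<in> dom_of c' \<longrightarrow> (\<forall>\<omega> \<eta>.
        g c (crd c p) (pullback (local_rep c c' f) (crd c p) \<omega>) (pullback (local_rep c c' f) (crd c p) \<eta>)
        = g c' (crd c' (f p)) \<omega> \<eta>))"

definition preserves_form ::
  "('a, 'e::euclidean_space) chart set \<Rightarrow> (('a, 'e) chart \<Rightarrow> 'e \<Rightarrow> 'e list \<Rightarrow> real) \<Rightarrow> 'a set \<Rightarrow> ('a \<Rightarrow> 'a) \<Rightarrow> bool"
where
  "preserves_form \<A> \<mu> W f \<longleftrightarrow>
     (\<forall>c\<in>\<A>. \<forall>c'\<in>\<A>. \<forall>p\<in>W. p \<in> dom_of c \<and> f p \<in> dom_of c' \<longrightarrow> (\<forall>vs.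
        \<mu> c' (crd c' (f p)) (map (frechet_derivative (local_rep c c' f) (at (crd c p))) vs)
        = \<mu> c (crd c p) vs))"

definition subriemannian ::
  "('a::topological_space, 'e::euclidean_space) chart set \<Rightarrow> (('a, 'e) chart \<Rightarrow> 'e \<Rightarrow> 'e coinner) \<Rightarrow> bool" where
  "subriemannian \<A> g \<longleftrightarrow> smooth_structure \<A> \<and> preserves_cometric \<A> g UNIV id \<and>
     (\<forall>c\<in>\<A>.
        (\<forall>y\<in>img_of c. bilinear (g c y) \<and> (\<forall>\<omega> \<eta>. g c y \<omega> \<eta> = g c y \<eta> \<omega>) \<and> (\<forall>\<omega>. 0 \<le> g c y \<omega> \<omega>)) \<and>
        (\<forall>\<omega> \<eta>. smooth_on (img_of c) (\<lambda>y. g c y \<omega> \<eta>)))"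

definition volume_form ::
  "('a, 'e::euclidean_space) chart set \<Rightarrow> (('a, 'e) chart \<Rightarrow> 'e \<Rightarrow> 'e list \<Rightarrow> real) \<Rightarrow> bool" where
  "volume_form \<A> \<mu> \<longleftrightarrow> preserves_form \<A> \<mu> UNIV id \<and>
     (\<forall>c\<in>\<A>.
        (\<forall>y\<in>img_of c. alt_form DIM('e) (\<mu> c y) \<and> (\<exists>vs. \<mu> c y vs \<noteq> 0)) \<and>
        (\<forall>vs. smooth_on (img_of c) (\<lambda>y. \<mu> c y vs)))"

definition conorm :: "'e::euclidean_space coinner \<Rightarrow> 'e covector \<Rightarrow> real" where
  "conorm \<gamma> \<omega> = sqrt (\<gamma> \<omega> \<omega>)"

definition sharp :: "'e::euclidean_space coinner \<Rightarrow> 'e covector \<Rightarrow> 'e" where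
  "sharp \<gamma> \<eta> = (THE v. \<forall>\<omega>. blinfun_apply \<omega> v = \<gamma> \<omega> \<eta>)"

text \<open>The horizontal space \<open>\<xi>\<close> at a point.\<close>

definition horizontal :: "'e::euclidean_space coinner \<Rightarrow> 'e set" where
  "horizontal \<gamma> = range (sharp \<gamma>)"

text \<open>The form obtained by contracting a covector \<open>\<omega>\<close> with a volume element \<open>\<nu>\<close>.\<close>

definition contract ::
  "'e::euclidean_space coinner \<Rightarrow> ('e list \<Rightarrow> real) \<Rightarrow> 'e covector \<Rightarrow> 'e list \<Rightarrow> real" where
  "contract \<gamma> \<nu> \<omega> = (THE \<theta>. alt_form (DIM('e) - 1) \<theta> \<and> (\<forall>\<eta> vs. wedge1 \<eta> \<theta> vs = \<gamma> \<eta> \<omega> * \<nu> vs))"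

text \<open>The function \<open>H\<^sub>\<phi>\<close>, meaningful at the points at which the conorm of \<open>d\<phi>\<close> does not vanish.\<close>

definition mean_curvature ::
  "('e::euclidean_space \<Rightarrow> 'e coinner) \<Rightarrow> ('e \<Rightarrow> 'e list \<Rightarrow> real) \<Rightarrow> ('e \<Rightarrow> real) \<Rightarrow> 'e \<Rightarrow> real" where
  "mean_curvature \<gamma> \<mu> \<phi> y = (THE h. \<forall>vs.
     ext_deriv (\<lambda>z. contract (\<gamma> z) (\<mu> z) (differential \<phi> z /\<^sub>R conorm (\<gamma> z) (differential \<phi> z))) y vs
     = h * \<mu> y vs)"


section \<open>Modules of vector fields closed under Lie bracket\<close>

definition lie_bracket :: "('e::euclidean_space \<Rightarrow> 'e) \<Rightarrow> ('e \<Rightarrow> 'e) \<Rightarrow> 'e \<Rightarrow> 'e" where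
  "lie_bracket X Y y = frechet_derivative Y (at y) (X y) - frechet_derivative X (at y) (Y y)"

inductive_set lie_module :: "'e::euclidean_space set \<Rightarrow> ('e \<Rightarrow> 'e) list \<Rightarrow> ('e \<Rightarrow> 'e) set"
  for V Xs where
  generator: "X \<in> set Xs \<Longrightarrow> X \<in> lie_module V Xs"
| zero: "(\<lambda>y. 0) \<in> lie_module V Xs"
| add: "X \<in> lie_module V Xs \<Longrightarrow> Y \<in> lie_module V Xs \<Longrightarrow> (\<lambda>y. X y + Y y) \<in> lie_module V Xs"
| scale: "X \<in> lie_module V Xs \<Longrightarrow> smooth_on V f \<Longrightarrow> (\<lambda>y. f y *\<^sub>R X y) \<in> lie_module V Xs"
| bracket: "X \<in> lie_module V Xs \<Longrightarrow> Y \<in> lie_module V Xs \<Longrightarrow> lie_bracket X Y \<in> lie_module V Xs"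

definition lie_rank :: "'e::euclidean_space set \<Rightarrow> ('e \<Rightarrow> 'e) list \<Rightarrow> 'e \<Rightarrow> nat" where
  "lie_rank V Xs y = dim (span {Z y | Z. Z \<in> lie_module V Xs})"

text \<open>Local sections of \<open>\<xi>\<close> on an open subset \<open>V\<close> of the image of a chart. An arbitrary local
  section on the manifold restricts to such sections.\<close>

definition independent_sections ::
  "('e::euclidean_space \<Rightarrow> 'e coinner) \<Rightarrow> 'e set \<Rightarrow> ('e \<Rightarrow> 'e) list \<Rightarrow> bool" where
  "independent_sections \<gamma> V Xs \<longleftrightarrow>
     (\<forall>X\<in>set Xs. smooth_on V X \<and> (\<forall>y\<in>V. X y \<in> horizontal (\<gamma> y))) \<and>
     (\<forall>y\<in>V. distinct (map (\<lambda>X. X y) Xs) \<and> independent (set (map (\<lambda>X. X y) Xs)))"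

definition rank_condition ::
  "('a, 'e::euclidean_space) chart set \<Rightarrow> (('a, 'e) chart \<Rightarrow> 'e \<Rightarrow> 'e coinner) \<Rightarrow> nat \<Rightarrow> nat \<Rightarrow> bool" where
  "rank_condition \<A> g r m \<longleftrightarrow>
     (\<forall>c\<in>\<A>. \<forall>V Xs. open V \<and> V \<subseteq> img_of c \<and> length Xs = r \<and> independent_sections (g c) V Xs \<longrightarrow>
        (\<forall>y\<in>V. lie_rank V Xs y \<ge> m))"


section \<open>Isometric translations and adapted coordinates\<close>

text \<open>The local diffeomorphisms \<open>\<Psi> a\<close>, for \<open>\<bar>a\<bar> < \<delta>\<close>, are defined on a neighborhood \<open>N\<close> of \<open>p\<close>;
  the family is smooth in \<open>a\<close> and the point together.\<close>

definition isometric_translations ::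
  "('a::topological_space, 'e::euclidean_space) chart set \<Rightarrow> (('a, 'e) chart \<Rightarrow> 'e \<Rightarrow> 'e coinner) \<Rightarrow>
   (('a, 'e) chart \<Rightarrow> 'e \<Rightarrow> 'e list \<Rightarrow> real) \<Rightarrow> 'a \<Rightarrow> 'a set \<Rightarrow> real \<Rightarrow> (real \<Rightarrow> 'a \<Rightarrow> 'a) \<Rightarrow> bool" where
  "isometric_translations \<A> g \<mu> p N \<delta> \<Psi> \<longleftrightarrow>
     open N \<and> p \<in> N \<and> 0 < \<delta> \<and>
     continuous_on ({-\<delta><..<\<delta>} \<times> N) (\<lambda>(a, q). \<Psi> a q) \<and>
     (\<forall>c\<in>\<A>. \<forall>c'\<in>\<A>.
        smooth_on {(a, y). a \<in> {-\<delta><..<\<delta>} \<and> y \<in> crd c ` (dom_of c \<inter> N) \<and> \<Psi> a (crd_inv c y) \<in> dom_of c'}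
          (\<lambda>(a, y). local_rep c c' (\<Psi> a) y)) \<and>
     (\<forall>a\<in>{-\<delta><..<\<delta>}. local_diffeo \<A> N (\<Psi> a) \<and>
        preserves_cometric \<A> g N (\<Psi> a) \<and> preserves_form \<A> \<mu> N (\<Psi> a)) \<and>
     (\<forall>q\<in>N. \<Psi> 0 q = q) \<and>
     (\<forall>a\<in>{-\<delta><..<\<delta>}. \<forall>b\<in>{-\<delta><..<\<delta>}. \<forall>q\<in>N.
        a + b \<in> {-\<delta><..<\<delta>} \<and> \<Psi> b q \<in> N \<longrightarrow> \<Psi> (a + b) q = \<Psi> a (\<Psi> b q))"

definition transversal_translations ::
  "('a, 'e::euclidean_space) chart set \<Rightarrow> 'a set \<Rightarrow> (real \<Rightarrow> 'a \<Rightarrow> 'a) \<Rightarrow> 'a set \<Rightarrow> bool" where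
  "transversal_translations \<A> N \<Psi> \<Sigma> \<longleftrightarrow>
     (\<forall>c\<in>\<A>. \<forall>p \<in> \<Sigma> \<inter> N \<inter> dom_of c.
        vector_derivative (\<lambda>a. crd c (\<Psi> a p)) (at 0) \<notin> tangent_space (crd c ` (\<Sigma> \<inter> dom_of c)) (crd c p))"

text \<open>From here on \<open>\<real>\<^bsup>m+1\<^esup>\<close> is \<open>\<real>\<^bsup>m\<^esup> \<times> \<real>\<close> with \<open>m = CARD('m)\<close>: the first component consists of
  \<open>x\<^sup>1, \<dots>, x\<^sup>m\<close> and the second one is \<open>x\<^bsup>m+1\<^esup>\<close>. The linear order on \<open>'m\<close> only serves to order the
  coordinates in \<open>dx\<^sup>1 \<and> \<dots> \<and> dx\<^bsup>m+1\<^esup>\<close>.\<close>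

type_synonym 'm ambient = "(real, 'm) vec \<times> real"

definition hypersurface ::
  "('a, 'm ambient) chart set \<Rightarrow> 'a set \<Rightarrow> bool" where
  "hypersurface \<A> \<Sigma> \<longleftrightarrow>
     (\<forall>p\<in>\<Sigma>. \<exists>c\<in>\<A>. p \<in> dom_of c \<and> \<Sigma> \<inter> dom_of c = {q \<in> dom_of c. snd (crd c q) = 0})"

definition coordinate_frame :: "'m::{finite,linorder} ambient list" where
  "coordinate_frame = map (\<lambda>i. (axis i 1, 0)) (sorted_list_of_set (UNIV :: 'm set)) @ [(0, 1)]"

text \<open>The density \<open>A\<close> in \<open>dv = A dx\<^sup>1 \<and> \<dots> \<and> dx\<^bsup>m+1\<^esup>\<close> is the value of \<open>dv\<close> on the coordinate frame.\<close>

definition vol_density ::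
  "(('a, 'm::{finite,linorder} ambient) chart \<Rightarrow> 'm ambient \<Rightarrow> 'm ambient list \<Rightarrow> real)
   \<Rightarrow> ('a, 'm ambient) chart \<Rightarrow> 'a \<Rightarrow> real" where
  "vol_density \<mu> c p = \<mu> c (crd c p) coordinate_frame"

definition translation_isometric_coordinates ::
  "('a, 'm::{finite,linorder} ambient) chart set \<Rightarrow>
   (('a, 'm ambient) chart \<Rightarrow> 'm ambient \<Rightarrow> 'm ambient list \<Rightarrow> real) \<Rightarrow>
   'a \<Rightarrow> 'a set \<Rightarrow> real \<Rightarrow> (real \<Rightarrow> 'a \<Rightarrow> 'a) \<Rightarrow> 'a set \<Rightarrow> ('a, 'm ambient) chart \<Rightarrow> bool" where
  "translation_isometric_coordinates \<A> \<mu> p\<^sub>0 N \<delta> \<Psi> \<Sigma> c \<longleftrightarrow>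
     c \<in> \<A> \<and> dom_of c \<subseteq> N \<and> p\<^sub>0 \<in> dom_of c \<and> crd c p\<^sub>0 = 0 \<and>
     \<Sigma> \<inter> dom_of c = {q \<in> dom_of c. snd (crd c q) = 0} \<and>
     (\<forall>a\<in>{-\<delta><..<\<delta>}. \<forall>q\<in>dom_of c. \<Psi> a q \<in> dom_of c \<longrightarrow>
        fst (crd c (\<Psi> a q)) = fst (crd c q) \<and>
        snd (crd c (\<Psi> a q)) = snd (crd c q) + a \<and>
        vol_density \<mu> c (\<Psi> a q) = vol_density \<mu> c q)"

text \<open>The coordinate picture in \<open>\<real>\<^bsup>m\<^esup>\<close> of the slice on which \<open>x\<^bsup>m+1\<^esup> = 0\<close>.\<close>

definition slice :: "('a, 'm ambient) chart \<Rightarrow> (real, 'm) vec set" where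
  "slice c = {q. (q, 0) \<in> img_of c}"


section \<open>Graphs\<close>

definition graph_over :: "(real, 'm) vec set \<Rightarrow> ((real, 'm) vec \<Rightarrow> real) \<Rightarrow> 'm ambient set" where
  "graph_over D w = (\<lambda>q. (q, w q)) ` D"

definition singular_set ::
  "('m::finite ambient \<Rightarrow> 'm ambient coinner) \<Rightarrow> (real, 'm) vec set \<Rightarrow> ((real, 'm) vec \<Rightarrow> real) \<Rightarrow> (real, 'm) vec set"
where
  "singular_set \<gamma> D w =
     {q \<in> D. horizontal (\<gamma> (q, w q)) \<subseteq> tangent_space (graph_over D w) (q, w q)}"

definition graph_mean_curvature ::
  "('m::finite ambient \<Rightarrow> 'm ambient coinner) \<Rightarrow>
   ('m ambient \<Rightarrow> 'm ambient list \<Rightarrow> real) \<Rightarrow> ((real, 'm) vec \<Rightarrow> real) \<Rightarrow> (real, 'm) vec \<Rightarrow> real" where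
  "graph_mean_curvature \<gamma> \<mu> w q = mean_curvature \<gamma> \<mu> (\<lambda>(x, t). w x - t) (q, w q)"


section \<open>Hausdorff measure\<close>

text \<open>The normalization makes the \<open>s\<close>-dimensional measure agree with Lebesgue measure on \<open>\<real>\<^bsup>s\<^esup>\<close>. Empty
  covering sets contribute \<open>0\<close> even if \<open>s = 0\<close>; boundedness is required explicitly since
  the library gives unbounded sets the diameter \<open>0\<close>.\<close>

definition hausdorff_content :: "nat \<Rightarrow> real \<Rightarrow> 'e::metric_space set \<Rightarrow> ennreal" where
  "hausdorff_content s \<epsilon> A =
     (INF U \<in> {U :: nat \<Rightarrow> 'e set. A \<subseteq> (\<Union>i. U i) \<and> (\<forall>i. bounded (U i) \<and> diameter (U i) \<le> \<epsilon>)}.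
        (\<Sum>i. ennreal (if U i = {} then 0 else unit_ball_vol (real s) * (diameter (U i) / 2) ^ s)))"

definition hausdorff_measure :: "nat \<Rightarrow> 'e::metric_space set \<Rightarrow> ennreal" where
  "hausdorff_measure s A = (SUP \<epsilon>\<in>{0<..}. hausdorff_content s \<epsilon> A)"

end

theory Submission
  imports Defs
begin

text \<open>Let \<open>m\<close> be the dimension of \<open>\<Sigma>\<close>. Since the cometric and the density do not depend on
  \<open>x\<^bsup>m+1\<^esup>\<close>, near a contact point of the graphs \<open>H(w)\<close> is \<open>1/A\<close> times the divergence of a flux
  \<open>F(x, \<nabla>w)\<close> that does not involve \<open>w\<close> itself, and \<open>H(v) \<le> H(u)\<close> is a comparison inequality for a
  degenerate elliptic operator.

  At a nonsingular contact point, Hopf's barrier argument shows that every exterior normal of the contact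
  set is null for the symbol. Hence the cylinder over the contact set has only normals that are orthogonal to
  the sections \<open>X\<^sub>1, \<dots>, X\<^bsub>m-l\<^esub>\<close> of \<open>\<xi>\<close> tangent to the graph of \<open>u\<close> and its vertical translates. By Bony's
  lemma the same holds for all iterated brackets, and by the rank condition these span the
  tangent space of the graph. So there is no normal, and the contact set is open away from the origin.

  If \<open>u < v\<close> except at the origin, integrating \<open>(\<epsilon> - w)\<^sub>+\<^sup>2 (F(v) - F(u))\<close> with \<open>w = v - u\<close>, cut off
  near the singular set, against the inequality shows that the conormals of \<open>u\<close> and \<open>v\<close> are parallel
  modulo the kernel of the cometric where \<open>w < \<epsilon>\<close>. By the rank condition \<open>\<nabla>w = 0\<close> there, a contradiction. It
  remains to see that the punctured slice is connected, which holds for \<open>m > 1\<close>; for \<open>m = 1\<close> the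
  hypothesis on the Hausdorff measure fails, since the counting measure of a nonempty set is
  positive.\<close>

section \<open>Smooth functions\<close>

text \<open>At a contact point the two graphs share their tangent plane, so a singular contact point
  is singular for both; as one of the singular sets is the origin alone, every other contact point
  is regular for both graphs.

  Horizontal sections live on the ambient space and do not project to the slice, whereas the contact
  set lives in the slice; hence the cylinder over it. Its exterior normals have the form
  \<open>(\<nu>, 0)\<close>. Brackets of the sections stay tangent to the vertical translates of the
  graph, so they are orthogonal to the conormal \<open>(grad u, -1)\<close>. A nonzero
  \<open>(\<nu>, 0)\<close> orthogonal to them as well would be independent of the conormal and
  leave the brackets at most m - 1 dimensions out of m + 1.

  At the origin the operator degenerates and no barrier is available, which leads to the integral
  argument. It works because the flux is bounded wherever it is defined, while a covering of the
  singular set by balls of radii \<rho>_i has a cutoff whose gradient has integral of the order of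
  the sum of \<rho>_i^(m-1).\<close>

lemma Ck_on_cong:
  assumes "open S" "\<And>x. x \<in> S \<Longrightarrow> f x = g x"
  shows "Ck_on k S f \<longleftrightarrow> Ck_on k S g"
  using assms(2)
proof (induction k arbitrary: f g)
  case 0
  then show ?case by (auto intro: continuous_on_cong)
next
  case (Suc k)
  have d: "f differentiable at x \<longleftrightarrow> g differentiable at x" if "x \<in> S" for x
    using that Suc.prems assms(1) unfolding differentiable_def
    by (metis has_derivative_transform_within_open)
  have fd: "frechet_derivative f (at x) = frechet_derivative g (at x)" if "x \<in> S" "f differentiable at x" for x
    using frechet_derivative_transform_within_open[OF that(2) assms(1) that(1)] Suc.prems by blast
  have "Ck_on k S (\<lambda>x. frechet_derivative f (at x) v) \<longleftrightarrow> Ck_on k S (\<lambda>x. frechet_derivative g (at x) v)"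
    if "\<forall>x\<in>S. f differentiable at x" for v
    by (rule Suc.IH) (use that fd in auto)
  then show ?case using d unfolding Ck_on.simps by blast
qed

lemma Ck_on_subset: "Ck_on k S f \<Longrightarrow> T \<subseteq> S \<Longrightarrow> Ck_on k T f"
  by (induction k arbitrary: f) (auto intro: continuous_on_subset)

lemma Ck_on_SucD: "Ck_on (Suc k) S f \<Longrightarrow> Ck_on k S f"
proof (induction k arbitrary: f)
  case 0
  then show ?case
    by (auto intro!: continuous_at_imp_continuous_on differentiable_imp_continuous_within)
next
  case (Suc k)
  then show ?case by (metis Ck_on.simps(2))
qed

lemma Ck_on_has_derivative:
  "Ck_on (Suc k) S f \<Longrightarrow> x \<in> S \<Longrightarrow> (f has_derivative frechet_derivative f (at x)) (at x)"
  by (simp add: frechet_derivative_works)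

lemma Ck_on_SucI:
  assumes "open S" "\<And>x. x \<in> S \<Longrightarrow> (f has_derivative f' x) (at x)" "\<And>v. Ck_on k S (\<lambda>x. f' x v)"
  shows "Ck_on (Suc k) S f"
proof -
  have "frechet_derivative f (at x) = f' x" if "x \<in> S" for x
    using assms(2)[OF that] frechet_derivative_at by force
  then have "Ck_on k S (\<lambda>x. frechet_derivative f (at x) v)" for v
    using Ck_on_cong[OF assms(1), of "\<lambda>x. frechet_derivative f (at x) v" "\<lambda>x. f' x v"] assms(3) by simp
  then show ?thesis using assms(2) by (auto simp: differentiable_def)
qed

text \<open>Derivatives are full derivatives, hence pointwise conditions, and only continuity has to
  be glued. Serves the test field of the integral argument, which is a formula on one open set and
  zero on another.\<close>

lemma Ck_on_Un:
  assumes "open S" "open T" "Ck_on k S f" "Ck_on k T f"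
  shows "Ck_on k (S \<union> T) f"
  using assms(3,4)
  by (induction k arbitrary: f) (auto intro: continuous_on_open_Un assms(1,2))

lemma Ck_on_const: "Ck_on k S (\<lambda>x. c)"
proof (induction k arbitrary: c)
  case (Suc k)
  then show ?case by simp
qed auto

lemma Ck_on_bounded_linear:
  assumes "open S" "bounded_linear L" "Ck_on k S f"
  shows "Ck_on k S (\<lambda>x. L (f x))"
  using assms(3)
proof (induction k arbitrary: f)
  case 0
  then show ?case using assms(2) by (auto intro: bounded_linear.continuous_on)
next
  case (Suc k)
  show ?case
  proof (rule Ck_on_SucI[OF assms(1), where f' = "\<lambda>x h. L (frechet_derivative f (at x) h)"])
    show "((\<lambda>x. L (f x)) has_derivative (\<lambda>h. L (frechet_derivative f (at x) h))) (at x)" if "x \<in> S" for x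
      by (rule bounded_linear.has_derivative[OF assms(2)]) (rule Ck_on_has_derivative[OF Suc.prems that])
    show "Ck_on k S (\<lambda>x. L (frechet_derivative f (at x) v))" for v
      using Suc by simp
  qed
qed

lemma Ck_on_add:
  assumes "open S" "Ck_on k S f" "Ck_on k S g"
  shows "Ck_on k S (\<lambda>x. f x + g x)"
  using assms(2,3)
proof (induction k arbitrary: f g)
  case 0
  then show ?case by (auto intro: continuous_intros)
next
  case (Suc k)
  show ?case
  proof (rule Ck_on_SucI[OF assms(1)])
    show "((\<lambda>x. f x + g x) has_derivative (\<lambda>h. frechet_derivative f (at x) h + frechet_derivative g (at x) h)) (at x)"
      if "x \<in> S" for x
      by (intro has_derivative_add Ck_on_has_derivative[OF Suc.prems(1) that] Ck_on_has_derivative[OF Suc.prems(2) that])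
    show "Ck_on k S (\<lambda>x. frechet_derivative f (at x) v + frechet_derivative g (at x) v)" for v
      using Suc by simp
  qed
qed

lemma Ck_on_bilinear:
  assumes "open S" "bounded_bilinear p" "Ck_on k S f" "Ck_on k S g"
  shows "Ck_on k S (\<lambda>x. p (f x) (g x))"
  using assms(3,4)
proof (induction k arbitrary: f g)
  case 0
  then show ?case using assms(2) by (auto intro: bounded_bilinear.continuous_on)
next
  case (Suc k)
  note k = Suc.prems[THEN Ck_on_SucD]
  show ?case
  proof (rule Ck_on_SucI[OF assms(1)])
    show "((\<lambda>x. p (f x) (g x)) has_derivative
        (\<lambda>h. p (f x) (frechet_derivative g (at x) h) + p (frechet_derivative f (at x) h) (g x))) (at x)"
      if "x \<in> S" for x
      by (intro bounded_bilinear.FDERIV[OF assms(2)] Ck_on_has_derivative[OF Suc.prems(1) that]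
          Ck_on_has_derivative[OF Suc.prems(2) that])
    show "Ck_on k S (\<lambda>x. p (f x) (frechet_derivative g (at x) v) + p (frechet_derivative f (at x) v) (g x))" for v
      using Suc.prems k by (intro Ck_on_add assms(1) Suc.IH) auto
  qed
qed

text \<open>The exponent varies in the induction, since each differentiation lowers it by
  one.\<close>

lemma Ck_on_powr:
  fixes f :: "'e::euclidean_space \<Rightarrow> real"
  assumes "open S" "Ck_on k S f" "\<And>x. x \<in> S \<Longrightarrow> f x > 0"
  shows "Ck_on k S (\<lambda>x. f x powr a)"
  using assms(2)
proof (induction k arbitrary: a)
  case 0
  then show ?case using assms(3) by (fastforce intro!: continuous_on_powr continuous_on_const)
next
  case (Suc k)
  note k = Suc.prems[THEN Ck_on_SucD]
  show ?case
  proof (rule Ck_on_SucI[OF assms(1)])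
    show "((\<lambda>x. f x powr a) has_derivative
        (\<lambda>h. (a * f x powr (a - 1)) * frechet_derivative f (at x) h)) (at x)"
      if "x \<in> S" for x
    proof -
      have "((\<lambda>y. y powr a) has_derivative (\<lambda>y. a * f x powr (a - 1) * y)) (at (f x))"
        using has_real_derivative_powr[OF assms(3)[OF that], of a]
        by (simp add: has_field_derivative_def)
      from has_derivative_compose[OF Ck_on_has_derivative[OF Suc.prems that] this]
      show ?thesis .
    qed
    show "Ck_on k S (\<lambda>x. (a * f x powr (a - 1)) * frechet_derivative f (at x) v)" for v
      using Suc.prems Suc.IH[OF k]
      by (intro Ck_on_bilinear[OF assms(1) bounded_bilinear_mult] Ck_on_const) auto
  qed
qed

lemma Ck_on_linear_compose:
  assumes "open S" "bounded_linear L" "Ck_on k S f"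
  shows "Ck_on k (L -` S) (\<lambda>x. f (L x))"
proof -
  have o: "open (L -` S)"
    using assms(1,2) by (simp add: continuous_open_vimage linear_continuous_at)
  show ?thesis using assms(3)
  proof (induction k arbitrary: f)
    case 0
    then show ?case using assms(2)
      by (simp add: continuous_on_compose2[OF _ linear_continuous_on])
  next
    case (Suc k)
    show ?case
    proof (rule Ck_on_SucI[OF o])
      show "((\<lambda>x. f (L x)) has_derivative (\<lambda>h. frechet_derivative f (at (L x)) (L h))) (at x)"
        if "x \<in> L -` S" for x
        using has_derivative_compose[OF bounded_linear_imp_has_derivative[OF assms(2)], of f _ x UNIV]
          Ck_on_has_derivative[OF Suc.prems, of "L x"] that by auto
      show "Ck_on k (L -` S) (\<lambda>x. frechet_derivative f (at (L x)) (L v))" for v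
        using Suc.IH[of "\<lambda>x. frechet_derivative f (at x) (L v)"] Suc.prems by simp
    qed
  qed
qed

lemma smooth_on_subset: "smooth_on S f \<Longrightarrow> T \<subseteq> S \<Longrightarrow> smooth_on T f"
  by (auto simp: smooth_on_def intro: Ck_on_subset)

lemma smooth_on_cong:
  "open S \<Longrightarrow> (\<And>x. x \<in> S \<Longrightarrow> f x = g x) \<Longrightarrow> smooth_on S f \<longleftrightarrow> smooth_on S g"
  using Ck_on_cong[of S f g] by (simp add: smooth_on_def)

lemma smooth_on_const: "smooth_on S (\<lambda>x. c)"
  by (simp add: smooth_on_def Ck_on_const)

lemma smooth_on_add:
  "open S \<Longrightarrow> smooth_on S f \<Longrightarrow> smooth_on S g \<Longrightarrow> smooth_on S (\<lambda>x. f x + g x)"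
  by (simp add: smooth_on_def Ck_on_add)

lemma smooth_on_bilinear:
  "open S \<Longrightarrow> bounded_bilinear p \<Longrightarrow> smooth_on S f \<Longrightarrow> smooth_on S g \<Longrightarrow> smooth_on S (\<lambda>x. p (f x) (g x))"
  by (simp add: smooth_on_def Ck_on_bilinear)

lemma smooth_on_bounded_linear:
  "open S \<Longrightarrow> bounded_linear L \<Longrightarrow> smooth_on S f \<Longrightarrow> smooth_on S (\<lambda>x. L (f x))"
  by (simp add: smooth_on_def Ck_on_bounded_linear)

lemmas smooth_on_mult = smooth_on_bilinear[OF _ bounded_bilinear_mult]
lemmas smooth_on_scaleR = smooth_on_bilinear[OF _ bounded_bilinear_scaleR]

lemma smooth_on_diff:
  assumes "open S" "smooth_on S f" "smooth_on S g"
  shows "smooth_on S (\<lambda>x. f x - g x)"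
  using smooth_on_add[OF assms(1,2) smooth_on_bounded_linear[OF assms(1) bounded_linear_minus[OF bounded_linear_ident] assms(3)]]
  by simp

lemma smooth_on_sum:
  "open S \<Longrightarrow> (\<And>i. i \<in> I \<Longrightarrow> smooth_on S (f i)) \<Longrightarrow> smooth_on S (\<lambda>x. \<Sum>i\<in>I. f i x)"
  by (induction I rule: infinite_finite_induct) (auto intro: smooth_on_const smooth_on_add)

lemma smooth_on_powr:
  fixes f :: "'e::euclidean_space \<Rightarrow> real"
  shows "open S \<Longrightarrow> smooth_on S f \<Longrightarrow> (\<And>x. x \<in> S \<Longrightarrow> f x > 0) \<Longrightarrow> smooth_on S (\<lambda>x. f x powr a)"
  by (simp add: smooth_on_def Ck_on_powr)

lemma smooth_on_linear_compose:
  "open S \<Longrightarrow> bounded_linear L \<Longrightarrow> smooth_on S f \<Longrightarrow> smooth_on (L -` S) (\<lambda>x. f (L x))"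
  by (simp add: smooth_on_def Ck_on_linear_compose)

lemma smooth_on_has_derivative:
  "smooth_on S f \<Longrightarrow> x \<in> S \<Longrightarrow> (f has_derivative frechet_derivative f (at x)) (at x)"
  unfolding smooth_on_def by (metis Ck_on_has_derivative)

lemma smooth_on_linear_derivative:
  "smooth_on S f \<Longrightarrow> x \<in> S \<Longrightarrow> linear (frechet_derivative f (at x))"
  by (rule has_derivative_linear[OF smooth_on_has_derivative])

lemma smooth_on_frechet_derivative: "smooth_on S f \<Longrightarrow> smooth_on S (\<lambda>x. frechet_derivative f (at x) v)"
  unfolding smooth_on_def by (metis Ck_on.simps(2))

lemma smooth_on_continuous_on: "smooth_on S f \<Longrightarrow> continuous_on S f"
  unfolding smooth_on_def by (metis Ck_on.simps(1))

lemma bounded_linear_smooth_on: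
  assumes "open S" "bounded_linear L"
  shows "smooth_on S L"
proof -
  have "Ck_on k S L" for k
  proof (cases k)
    case 0
    then show ?thesis using assms(2) by (simp add: linear_continuous_on)
  next
    case (Suc j)
    show ?thesis unfolding Suc
      by (rule Ck_on_SucI[OF assms(1) bounded_linear_imp_has_derivative[OF assms(2)] Ck_on_const])
  qed
  then show ?thesis by (simp add: smooth_on_def)
qed

lemma linear_basis_sum: "linear L \<Longrightarrow> L v = (\<Sum>b\<in>Basis. (v \<bullet> b) *\<^sub>R L b)"
  for v :: "'e::euclidean_space"
  using linear_sum[of L "\<lambda>b. (v \<bullet> b) *\<^sub>R b" Basis] by (simp add: euclidean_representation linear_cmul)

text \<open>The direction moves with the point, while smoothness is phrased with fixed directions;
  expansion of \<open>X\<close> in the basis reduces one to the other.\<close>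

lemma smooth_on_directional:
  fixes f :: "'e::euclidean_space \<Rightarrow> 'f::real_normed_vector"
  assumes "open S" "smooth_on S f" "smooth_on S X"
  shows "smooth_on S (\<lambda>x. frechet_derivative f (at x) (X x))"
proof -
  have "smooth_on S (\<lambda>x. \<Sum>b\<in>Basis. (X x \<bullet> b) *\<^sub>R frechet_derivative f (at x) b)"
    by (intro smooth_on_sum smooth_on_scaleR smooth_on_frechet_derivative assms
        smooth_on_bounded_linear[OF assms(1) bounded_linear_inner_left])
  then show ?thesis
    by (subst smooth_on_cong[OF assms(1)])
      (rule linear_basis_sum[OF smooth_on_linear_derivative[OF assms(2)]])
qed

lemma smooth_on_lie_bracket:
  "open S \<Longrightarrow> smooth_on S X \<Longrightarrow> smooth_on S Y \<Longrightarrow> smooth_on S (lie_bracket X Y)"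
  unfolding lie_bracket_def by (intro smooth_on_diff smooth_on_directional)

lemma smooth_on_lie_module:
  assumes "open V" "\<And>X. X \<in> set Xs \<Longrightarrow> smooth_on V X" "Z \<in> lie_module V Xs"
  shows "smooth_on V Z"
  using assms(3)
  by (induction rule: lie_module.induct)
    (auto intro: assms(1,2) smooth_on_const smooth_on_add smooth_on_scaleR smooth_on_lie_bracket)

text \<open>Supplies constants for the later estimates. Derivatives in the finitely many basis
  directions are continuous, hence bounded on the compact ball; summation gives an operator bound,
  and convexity of the ball turns it into a Lipschitz bound.\<close>

lemma smooth_on_compact_bounds:
  fixes f :: "'e::euclidean_space \<Rightarrow> 'f::euclidean_space"
  assumes "smooth_on S f" "cball y R \<subseteq> S"
  obtains C where "0 < C" "\<And>x. x \<in> cball y R \<Longrightarrow> norm (f x) \<le> C"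
    "\<And>x v. x \<in> cball y R \<Longrightarrow> norm (frechet_derivative f (at x) v) \<le> C * norm v"
    "\<And>x x'. x \<in> cball y R \<Longrightarrow> x' \<in> cball y R \<Longrightarrow> norm (f x - f x') \<le> C * norm (x - x')"
proof -
  have bdd: "\<exists>C. \<forall>x\<in>cball y R. norm (h x) \<le> C" if "smooth_on S h" for h :: "'e \<Rightarrow> 'f"
  proof -
    have "compact (h ` cball y R)"
      using smooth_on_continuous_on[OF smooth_on_subset[OF that assms(2)]]
      by (intro compact_continuous_image) auto
    then have "bounded (h ` cball y R)" by (rule compact_imp_bounded)
    then show ?thesis unfolding bounded_iff by simp
  qed
  obtain C0 where C0: "\<And>x. x \<in> cball y R \<Longrightarrow> norm (f x) \<le> C0" using bdd[OF assms(1)] by blast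
  have "\<forall>b. \<exists>C. \<forall>x\<in>cball y R. norm (frechet_derivative f (at x) b) \<le> C"
    by (intro allI bdd[OF smooth_on_frechet_derivative[OF assms(1)]])
  then obtain C1 where C1: "\<And>b x. x \<in> cball y R \<Longrightarrow> norm (frechet_derivative f (at x) b) \<le> C1 b" by metis
  define C where "C = \<bar>C0\<bar> + (\<Sum>b\<in>Basis. \<bar>C1 b\<bar>) + 1"
  have pos: "0 \<le> (\<Sum>b\<in>(Basis::'e set). \<bar>C1 b\<bar>)" by (intro sum_nonneg) auto
  have d: "norm (frechet_derivative f (at x) v) \<le> C * norm v" if x: "x \<in> cball y R" for x v
  proof -
    have lin: "linear (frechet_derivative f (at x))"
      by (rule smooth_on_linear_derivative[OF assms(1) subsetD[OF assms(2) x]])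
    have "norm (frechet_derivative f (at x) v) \<le> (\<Sum>b\<in>Basis. norm ((v \<bullet> b) *\<^sub>R frechet_derivative f (at x) b))"
      by (subst linear_basis_sum[OF lin]) (rule norm_sum)
    also have "\<dots> \<le> (\<Sum>b\<in>Basis. norm v * \<bar>C1 b\<bar>)"
      using C1[OF x] by (intro sum_mono) (auto intro!: mult_mono simp: Basis_le_norm intro: order_trans[OF _ abs_ge_self])
    also have "\<dots> = (\<Sum>b\<in>Basis. \<bar>C1 b\<bar>) * norm v" by (simp add: sum_distrib_left mult.commute)
    also have "\<dots> \<le> C * norm v" by (intro mult_right_mono) (auto simp: C_def)
    finally show ?thesis .
  qed
  have "norm (f x - f x') \<le> C * norm (x - x')" if "x \<in> cball y R" "x' \<in> cball y R" for x x'
  proof (rule differentiable_bound[where S = "cball y R" and f' = "\<lambda>x. frechet_derivative f (at x)"])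
    show "(f has_derivative frechet_derivative f (at z)) (at z within cball y R)" if "z \<in> cball y R" for z
      by (rule has_derivative_at_withinI[OF smooth_on_has_derivative[OF assms(1) subsetD[OF assms(2) that]]])
    show "onorm (frechet_derivative f (at z)) \<le> C" if "z \<in> cball y R" for z
      using d[OF that] by (intro onorm_le) auto
  qed (use that in auto)
  moreover have "norm (f x) \<le> C" if "x \<in> cball y R" for x using C0[OF that] pos unfolding C_def by linarith
  moreover have "C > 0" using pos unfolding C_def by linarith
  ultimately show ?thesis using that d by blast
qed

section \<open>Alternating forms and the mean curvature\<close>

lemma alt_form_linear:
  "alt_form k \<theta> \<Longrightarrow> length vs = k \<Longrightarrow> i < k \<Longrightarrow> linear (\<lambda>v. \<theta> (vs[i := v]))"
  by (simp add: alt_form_def)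

lemma alt_form_not_distinct: "alt_form k \<theta> \<Longrightarrow> \<not> distinct vs \<Longrightarrow> \<theta> vs = 0"
  unfolding alt_form_def by metis

lemma alt_form_length: "alt_form k \<theta> \<Longrightarrow> length vs \<noteq> k \<Longrightarrow> \<theta> vs = 0"
  by (simp add: alt_form_def)

text \<open>Polarization: the form vanishes at \<open>x + y\<close> in both slots.\<close>

lemma alt_form_swap:
  assumes "alt_form k \<theta>"
  shows "\<theta> (p @ x # y # r) = - \<theta> (p @ y # x # r)"
proof (cases "length (p @ x # y # r) = k")
  case False
  then show ?thesis using alt_form_length[OF assms] by simp
next
  case True
  let ?n = "length p"
  define f where "f u v = \<theta> (p @ u # v # r)" for u v
  have 1: "linear (\<lambda>u. f u v)" for v
    using alt_form_linear[OF assms, of "p @ x # v # r" ?n] True by (simp add: f_def)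
  have 2: "linear (f u)" for u
    using alt_form_linear[OF assms, of "p @ u # y # r" "Suc ?n"] True
    by (simp add: f_def[abs_def] list_update_append)
  have z: "f u u = 0" for u unfolding f_def by (rule alt_form_not_distinct[OF assms]) simp
  have "0 = f (x + y) (x + y)" by (simp add: z)
  also have "\<dots> = f x x + f x y + (f y x + f y y)"
    by (simp add: linear_add[OF 1] linear_add[OF 2])
  finally show ?thesis by (simp add: z f_def)
qed

lemma alt_form_move:
  assumes "alt_form k \<theta>"
  shows "\<theta> (p @ q @ x # r) = (-1) ^ length q * \<theta> (p @ x # q @ r)"
proof (induction q arbitrary: p)
  case (Cons y q)
  have "\<theta> (p @ (y # q) @ x # r) = (-1) ^ length q * \<theta> (p @ y # x # q @ r)"
    using Cons[of "p @ [y]"] by simp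
  then show ?case using alt_form_swap[OF assms, of p y x "q @ r"] by simp
qed simp

lemma length_omit: "i < length vs \<Longrightarrow> length (omit i vs) = length vs - 1"
  by (simp add: omit_def)

lemma nth_omit:
  "i < length vs \<Longrightarrow> j < length vs - 1 \<Longrightarrow> omit i vs ! j = (if j < i then vs ! j else vs ! Suc j)"
  by (auto simp: omit_def nth_append min_def)

lemma omit_list_update:
  assumes "i < length vs" "j < length vs"
  shows "omit j (vs[i := v]) = (if i = j then omit j vs else if i < j then (omit j vs)[i := v] else (omit j vs)[i - 1 := v])"
  using assms by (auto simp: omit_def list_update_append take_update_swap drop_update_swap
      intro!: nth_equalityI simp: nth_append nth_list_update)

text \<open>Only the two summands that omit one of the two equal vectors can survive. They differ by
  moving the remaining copy across the block \<open>q\<close>, and the sign of that move cancels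
  against the signs of the expansion.\<close>

lemma wedge1_not_distinct:
  assumes "alt_form k \<theta>" "\<not> distinct vs"
  shows "wedge1 \<eta> \<theta> vs = 0"
proof -
  obtain p q r x where vs: "vs = p @ [x] @ q @ [x] @ r" using not_distinct_decomp[OF assms(2)] by metis
  let ?a = "length p" and ?b = "length p + 1 + length q"
  let ?f = "\<lambda>i. (-1) ^ i * blinfun_apply \<eta> (vs ! i) * \<theta> (omit i vs)"
  have "?f i = 0" if "i < length vs" "i \<noteq> ?a" "i \<noteq> ?b" for i
  proof -
    have "\<not> distinct (omit i vs)"
    proof -
      \<comment> \<open>Positions of the two copies of \<open>x\<close> after the omission: an entry
        behind \<open>i\<close> moves forward by one. Truncated subtraction is harmless because such
        an entry is not at position 0.\<close>
      define j1 where "j1 = (if ?a < i then ?a else ?a - 1)"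
      define j2 where "j2 = (if ?b < i then ?b else ?b - 1)"
      have a: "Suc (length p - Suc 0) = length p" if "\<not> length p < i" using that \<open>i \<noteq> ?a\<close> by auto
      have va: "vs ! ?a = x" and vb: "vs ! ?b = x" by (auto simp: vs nth_append)
      have "j1 < length (omit i vs)" "j2 < length (omit i vs)" "j1 \<noteq> j2"
        using that by (auto simp: j1_def j2_def length_omit vs)
      moreover have "omit i vs ! j1 = x" "omit i vs ! j2 = x"
        using that va vb \<open>j1 < _\<close> \<open>j2 < _\<close> nth_omit[OF that(1), of j1] nth_omit[OF that(1), of j2]
          a by (auto simp: j1_def j2_def length_omit split: if_splits)
      ultimately show ?thesis by (metis distinct_conv_nth)
    qed
    then show ?thesis using alt_form_not_distinct[OF assms(1)] by simp
  qed
  then have "wedge1 \<eta> \<theta> vs = (\<Sum>i\<in>{?a, ?b}. ?f i)"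
    unfolding wedge1_def by (intro sum.mono_neutral_right) (auto simp: vs)
  also have "\<dots> = ?f ?a + ?f ?b" by simp
  also have "\<theta> (omit ?a vs) = (-1) ^ length q * \<theta> (omit ?b vs)"
    using alt_form_move[OF assms(1), of p q x r] by (simp add: omit_def vs)
  also have "(-1) ^ ?a * blinfun_apply \<eta> (vs ! ?a) * ((-1) ^ length q * \<theta> (omit ?b vs)) + ?f ?b = 0"
    by (simp add: vs nth_append power_add)
  finally show ?thesis .
qed

lemma alt_form_wedge1:
  assumes "alt_form k \<theta>"
  shows "alt_form (Suc k) (wedge1 \<eta> \<theta>)"
  unfolding alt_form_def
proof (intro conjI allI impI)
  fix vs :: "'a list" and i assume vi: "length vs = Suc k \<and> i < Suc k"
  have "linear (\<lambda>v. blinfun_apply \<eta> (vs[i := v] ! j) * \<theta> (omit j (vs[i := v])))" if j: "j < Suc k" for j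
  proof (cases "i = j")
    case True
    have "linear (\<lambda>v. \<theta> (omit j vs) *\<^sub>R blinfun_apply \<eta> v)"
      by (intro linear_compose_scale_right bounded_linear.linear[OF blinfun.bounded_linear_right])
    then show ?thesis using True vi by (simp add: omit_list_update mult.commute)
  next
    case False
    define i' where "i' = (if i < j then i else i - 1)"
    have o: "omit j (vs[i := v]) = (omit j vs)[i' := v]" for v
      using omit_list_update[of i vs j v] False vi j by (simp add: i'_def)
    have "linear (\<lambda>v. \<theta> ((omit j vs)[i' := v]))"
      using vi j False by (intro alt_form_linear[OF assms]) (auto simp: length_omit i'_def)
    then have "linear (\<lambda>v. blinfun_apply \<eta> (vs ! j) *\<^sub>R \<theta> ((omit j vs)[i' := v]))"
      by (rule linear_compose_scale_right)
    then show ?thesis using False by (simp add: o)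
  qed
  then have "linear (\<lambda>v. \<Sum>j<Suc k. (-1) ^ j *\<^sub>R (blinfun_apply \<eta> (vs[i := v] ! j) * \<theta> (omit j (vs[i := v]))))"
    by (intro linear_compose_sum ballI linear_compose_scale_right) simp
  then show "linear (\<lambda>v. wedge1 \<eta> \<theta> (vs[i := v]))"
    using vi by (simp add: wedge1_def mult.assoc)
next
  fix vs :: "'a list" assume "length vs = Suc k \<and> \<not> distinct vs"
  then show "wedge1 \<eta> \<theta> vs = 0" using wedge1_not_distinct[OF assms] by blast
next
  fix vs :: "'a list" assume "length vs \<noteq> Suc k"
  then have "\<theta> (omit i vs) = 0" if "i < length vs" for i
    using that by (intro alt_form_length[OF assms]) (auto simp: length_omit)
  then show "wedge1 \<eta> \<theta> vs = 0" by (simp add: wedge1_def)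
qed

text \<open>More vectors than the dimension are dependent. One of them is then in the span of the
  others, and in its slot the form is a linear map that vanishes on each of the others by
  repetition.\<close>

lemma alt_form_above_dimension:
  fixes \<theta> :: "'e::euclidean_space list \<Rightarrow> real"
  assumes "alt_form k \<theta>" "DIM('e) < k"
  shows "\<theta> vs = 0"
proof (cases "length vs = k \<and> distinct vs")
  case False
  then show ?thesis using alt_form_length[OF assms(1)] alt_form_not_distinct[OF assms(1)] by blast
next
  case True
  then have "card (set vs) > DIM('e)" using assms(2) by (simp add: distinct_card)
  then have "dependent (set vs)" 
    using independent_bound_general[of "set vs"] dim_subset_UNIV[of "set vs"] by linarith
  then obtain a where a: "a \<in> set vs" "a \<in> span (set vs - {a})" by (auto simp: dependent_def)
  then obtain i where i: "i < length vs" "vs ! i = a" by (auto simp: in_set_conv_nth)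
  have lin: "linear (\<lambda>v. \<theta> (vs[i := v]))" using True i by (intro alt_form_linear[OF assms(1)]) auto
  have "\<theta> (vs[i := a]) = 0"
  proof (rule linear_eq_0_on_span[OF lin _ a(2)])
    fix x assume "x \<in> set vs - {a}"
    then obtain j where j: "j < length vs" "vs ! j = x" "j \<noteq> i" using i by (auto simp: in_set_conv_nth)
    then have "(vs[i := x]) ! i = (vs[i := x]) ! j" using i by simp
    then have "\<not> distinct (vs[i := x])" using i j by (metis distinct_conv_nth length_list_update)
    then show "\<theta> (vs[i := x]) = 0" by (rule alt_form_not_distinct[OF assms(1)])
  qed
  then show ?thesis using i by (metis list_update_id)
qed

text \<open>The wedge of \<eta> with a top form has degree above the dimension and vanishes;
  expanding it on \<open>X # vs\<close> along the first entry gives the identity, known as \<eta>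
  \<and> i_X \<theta> = \<eta>(X) \<theta>.\<close>

lemma alt_form_Cramer:
  fixes \<theta> :: "'e::euclidean_space list \<Rightarrow> real"
  assumes "alt_form DIM('e) \<theta>"
  shows "wedge1 \<eta> (\<lambda>ws. \<theta> (X # ws)) vs = blinfun_apply \<eta> X * \<theta> vs"
proof -
  have "wedge1 \<eta> \<theta> (X # vs) = 0"
    using alt_form_above_dimension[OF alt_form_wedge1[OF assms]] by simp
  then have "0 = (\<Sum>i<Suc (length vs). (-1) ^ i * blinfun_apply \<eta> ((X # vs) ! i) * \<theta> (omit i (X # vs)))"
    by (simp add: wedge1_def)
  also have "\<dots> = blinfun_apply \<eta> X * \<theta> vs
      + (\<Sum>i<length vs. (-1) ^ Suc i * blinfun_apply \<eta> (vs ! i) * \<theta> (X # omit i vs))"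
    by (subst sum.lessThan_Suc_shift) (simp add: omit_def)
  also have "\<dots> = blinfun_apply \<eta> X * \<theta> vs - wedge1 \<eta> (\<lambda>ws. \<theta> (X # ws)) vs"
    by (simp add: wedge1_def sum_negf)
  finally show ?thesis by simp
qed

lemma alt_form_interior:
  fixes \<theta> :: "'e::euclidean_space list \<Rightarrow> real"
  assumes "alt_form DIM('e) \<theta>"
  shows "alt_form (DIM('e) - 1) (\<lambda>ws. \<theta> (X # ws))"
  unfolding alt_form_def
proof (intro conjI allI impI)
  fix vs :: "'e list" and i assume "length vs = DIM('e) - 1 \<and> i < DIM('e) - 1"
  then show "linear (\<lambda>v. \<theta> (X # vs[i := v]))"
    using alt_form_linear[OF assms, of "X # vs" "Suc i"] by auto
next
  fix vs :: "'e list" assume "length vs = DIM('e) - 1 \<and> \<not> distinct vs"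
  then show "\<theta> (X # vs) = 0" by (intro alt_form_not_distinct[OF assms]) auto
next
  fix vs :: "'e list" assume "length vs \<noteq> DIM('e) - 1"
  then show "\<theta> (X # vs) = 0" by (intro alt_form_length[OF assms]) auto
qed

text \<open>Downward induction on the length \<open>j\<close> of the prefix shared with
  \<open>bs\<close>: Cramer's identity for the vector \<open>bs ! j\<close> expresses the value on a
  list with prefix of length \<open>j\<close> by values on lists whose prefix is longer by
  one.\<close>

lemma alt_form_eq_0:
  fixes \<theta> :: "'e::euclidean_space list \<Rightarrow> real"
  assumes \<theta>: "alt_form DIM('e) \<theta>" and bs: "distinct bs" "set bs = Basis" and 0: "\<theta> bs = 0"
  shows "\<theta> vs = 0"
proof (cases "length vs = DIM('e)")
  case False
  then show ?thesis by (rule alt_form_length[OF \<theta>])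
next
  case True
  have n: "length bs = DIM('e)" using bs distinct_card by metis
  let ?P = "\<lambda>j. \<forall>vs. length vs = DIM('e) \<and> take j vs = take j bs \<longrightarrow> \<theta> vs = 0"
  have "?P 0"
  proof (rule inc_induct[of 0 "DIM('e)" ?P])
    show "?P DIM('e)" using 0 n by auto
  next
    fix j assume j: "j < DIM('e)" and IH: "?P (Suc j)"
    show "?P j"
    proof (intro allI impI)
      fix vs :: "'e list" assume vs: "length vs = DIM('e) \<and> take j vs = take j bs"
      define X where "X = bs ! j"
      let ?\<eta> = "blinfun_inner_right X"
      have XB: "X \<in> Basis" using bs(2) j n by (metis X_def nth_mem)
      \<comment> \<open>An entry before position \<open>j\<close> is a basis vector orthogonal to
        \<open>X\<close>. For a later one, \<open>X\<close> is moved behind the prefix, where it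
        continues \<open>bs\<close>.\<close>
      have "blinfun_apply ?\<eta> (vs ! i) * \<theta> (X # omit i vs) = 0" if i: "i < length vs" for i
      proof (cases "i < j")
        case True
        then have "vs ! i = bs ! i" using vs by (metis nth_take)
        moreover have "bs ! i \<noteq> X" using True j n bs(1) by (simp add: X_def nth_eq_iff_index_eq)
        moreover have "bs ! i \<in> Basis" using True j n bs(2) by (metis less_trans nth_mem)
        ultimately show ?thesis using XB by (simp add: inner_not_same_Basis)
      next
        case False
        define r where "r = drop j (omit i vs)"
        have o: "omit i vs = take j bs @ r"
        proof -
          have "take j (omit i vs) = take j vs" using False by (simp add: omit_def min_def)
          then show ?thesis using vs unfolding r_def by (metis append_take_drop_id)
        qed
        have l: "length (omit i vs) = DIM('e) - 1" using vs i by (simp add: length_omit)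
        have "\<theta> (X # omit i vs) = \<theta> ([] @ X # take j bs @ r)" by (simp add: o)
        moreover have "\<theta> ([] @ take j bs @ X # r) = 0"
        proof -
          have "length (take j bs @ X # r) = DIM('e)" using l by (simp add: o)
          moreover have "take (Suc j) (take j bs @ X # r) = take (Suc j) bs"
            using j n by (simp add: X_def take_Suc_conv_app_nth)
          ultimately show ?thesis using IH by simp
        qed
        ultimately show ?thesis using alt_form_move[OF \<theta>, of "[]" "take j bs" X r] by simp
      qed
      then have "wedge1 ?\<eta> (\<lambda>ws. \<theta> (X # ws)) vs = 0" 
        unfolding wedge1_def by (intro sum.neutral ballI) (auto simp: mult.assoc)
      then show "\<theta> vs = 0" using alt_form_Cramer[OF \<theta>, of ?\<eta> X vs] XB by simp
    qed
  qed auto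
  then show ?thesis using True by simp
qed

lemma alt_form_lincomb:
  "alt_form k \<theta> \<Longrightarrow> alt_form k \<theta>' \<Longrightarrow> alt_form k (\<lambda>vs. a * \<theta> vs - b * \<theta>' vs)"
  unfolding alt_form_def
  by (auto intro!: linear_compose_sub linear_compose_scale_right[where 'b = real, unfolded real_scaleR_def])

lemma alt_form_proportional:
  fixes \<theta> :: "'e::euclidean_space list \<Rightarrow> real"
  assumes "alt_form DIM('e) \<theta>" "alt_form DIM('e) \<theta>'" "distinct bs" "set bs = Basis"
  shows "\<theta> bs * \<theta>' vs = \<theta>' bs * \<theta> vs"
  using alt_form_eq_0[OF alt_form_lincomb[OF assms(2,1), of "\<theta> bs" "\<theta>' bs"] assms(3,4), of vs] by simp

section \<open>Raised covectors, contraction and the curvature in coordinates\<close>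

lemma blinfun_eq_sum_Basis:
  "\<eta> = (\<Sum>b\<in>Basis. blinfun_apply \<eta> b *\<^sub>R blinfun_inner_right b)" for \<eta> :: "'e::euclidean_space \<Rightarrow>\<^sub>L real"
proof (rule blinfun_eqI)
  fix v :: 'e
  show "blinfun_apply \<eta> v = blinfun_apply (\<Sum>b\<in>Basis. blinfun_apply \<eta> b *\<^sub>R blinfun_inner_right b) v"
    using linear_basis_sum[OF bounded_linear.linear[OF blinfun.bounded_linear_right], of \<eta> v]
    by (simp add: blinfun.sum_left blinfun.scaleR_left inner_commute mult.commute)
qed

lemma apply_sum_Basis:
  fixes \<gamma> :: "'e::euclidean_space coinner"
  assumes "\<And>\<omega>. linear (\<lambda>\<eta>. \<gamma> \<eta> \<omega>)"
  shows "blinfun_apply \<eta> (\<Sum>b\<in>Basis. \<gamma> (blinfun_inner_right b) \<omega> *\<^sub>R b) = \<gamma> \<eta> \<omega>"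
proof -
  have "\<gamma> \<eta> \<omega> = (\<Sum>b\<in>Basis. blinfun_apply \<eta> b *\<^sub>R \<gamma> (blinfun_inner_right b) \<omega>)"
    by (subst blinfun_eq_sum_Basis[of \<eta>]) (simp add: linear_sum[OF assms] linear_cmul[OF assms])
  then show ?thesis by (simp add: blinfun.sum_right blinfun.scaleR_right mult.commute)
qed

lemma sharp_eq:
  fixes \<gamma> :: "'e::euclidean_space coinner"
  assumes "\<And>\<omega>. linear (\<lambda>\<eta>. \<gamma> \<eta> \<omega>)"
  shows "sharp \<gamma> \<omega> = (\<Sum>b\<in>Basis. \<gamma> (blinfun_inner_right b) \<omega> *\<^sub>R b)"
    and "blinfun_apply \<eta> (sharp \<gamma> \<omega>) = \<gamma> \<eta> \<omega>"
proof -
  show *: "sharp \<gamma> \<omega> = (\<Sum>b\<in>Basis. \<gamma> (blinfun_inner_right b) \<omega> *\<^sub>R b)"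
    unfolding sharp_def
  proof (rule the_equality)
    fix v assume v: "\<forall>\<eta>. blinfun_apply \<eta> v = \<gamma> \<eta> \<omega>"
    have "v = (\<Sum>b\<in>Basis. (v \<bullet> b) *\<^sub>R b)" by (simp add: euclidean_representation)
    also have "\<dots> = (\<Sum>b\<in>Basis. \<gamma> (blinfun_inner_right b) \<omega> *\<^sub>R b)"
      by (intro sum.cong refl) (metis blinfun_inner_right.rep_eq inner_commute v)
    finally show "v = (\<Sum>b\<in>Basis. \<gamma> (blinfun_inner_right b) \<omega> *\<^sub>R b)" .
  qed (simp add: apply_sum_Basis assms)
  show "blinfun_apply \<eta> (sharp \<gamma> \<omega>) = \<gamma> \<eta> \<omega>" unfolding * by (rule apply_sum_Basis[OF assms])
qed

text \<open>Existence is Cramer's identity with the raised covector. For uniqueness, fewer vectors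
  than the dimension have a common orthogonal vector \<open>X\<close>; on \<open>X # vs\<close> the
  wedge with its dual covector reduces to one summand, which recovers the value on
  \<open>vs\<close>.\<close>

lemma contract_eq:
  fixes \<gamma> :: "'e::euclidean_space coinner"
  assumes "\<And>\<omega>. linear (\<lambda>\<eta>. \<gamma> \<eta> \<omega>)" "alt_form DIM('e) \<nu>"
  shows "contract \<gamma> \<nu> \<omega> = (\<lambda>vs. \<nu> (sharp \<gamma> \<omega> # vs))"
  unfolding contract_def
proof (rule the_equality)
  show "alt_form (DIM('e) - 1) (\<lambda>vs. \<nu> (sharp \<gamma> \<omega> # vs)) \<and>
    (\<forall>\<eta> vs. wedge1 \<eta> (\<lambda>vs. \<nu> (sharp \<gamma> \<omega> # vs)) vs = \<gamma> \<eta> \<omega> * \<nu> vs)"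
    using alt_form_interior[OF assms(2)] alt_form_Cramer[OF assms(2)] sharp_eq(2)[of \<gamma>, OF assms(1)] by auto
next
  fix \<theta> assume \<theta>: "alt_form (DIM('e) - 1) \<theta> \<and> (\<forall>\<eta> vs. wedge1 \<eta> \<theta> vs = \<gamma> \<eta> \<omega> * \<nu> vs)"
  let ?\<theta>' = "\<lambda>vs. \<nu> (sharp \<gamma> \<omega> # vs)"
  show "\<theta> = ?\<theta>'"
  proof
    fix vs :: "'e list"
    show "\<theta> vs = ?\<theta>' vs"
    proof (cases "length vs = DIM('e) - 1")
      case False
      then show ?thesis using \<theta> alt_form_length[OF alt_form_interior[OF assms(2)]] by (auto simp: alt_form_def)
    next
      case True
      have "dim (set vs) \<le> card (set vs)" by (rule dim_le_card) (auto intro: span_base)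
      also have "\<dots> \<le> length vs" by (rule card_length)
      also have "\<dots> < DIM('e)" using True by simp
      finally obtain X :: 'e where X: "X \<noteq> 0" "\<And>v. v \<in> span (set vs) \<Longrightarrow> orthogonal X v"
        using orthogonal_to_subspace_exists[of "set vs"] by metis
      let ?\<eta> = "blinfun_inner_right X"
      have o: "X \<bullet> v = 0" if "v \<in> set vs" for v
        using X(2)[OF span_base[OF that]] by (simp add: orthogonal_def)
      have "wedge1 ?\<eta> \<tau> (X # vs) = (X \<bullet> X) * \<tau> vs" for \<tau>
        unfolding wedge1_def by (simp add: sum.lessThan_Suc_shift omit_def o del: sum.lessThan_Suc)
      moreover have "wedge1 ?\<eta> \<theta> (X # vs) = wedge1 ?\<eta> ?\<theta>' (X # vs)"
        using \<theta> by (simp add: alt_form_Cramer[OF assms(2)] del: blinfun_inner_right.rep_eq)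
          (simp only: sharp_eq(2)[of \<gamma>, OF assms(1)] simp_thms)
      ultimately show ?thesis using X(1) by simp
    qed
  qed
qed

text \<open>Up to a scalar function, \<mu> is the constant form \<open>D0\<close>, its own value at
  \<open>y\<close> normalized on \<open>bs\<close>. The contraction then has the scalar components
  \<open>f b\<close>, and in the exterior derivative Cramer's identity leaves only the diagonal
  derivatives: curvature times density is the divergence of density times raised unit
  conormal.\<close>

lemma mean_curvature_eq:
  fixes \<gamma> :: "'e::euclidean_space \<Rightarrow> 'e coinner" and bs :: "'e list"
  defines "\<omega> \<equiv> \<lambda>\<phi> z. differential \<phi> z /\<^sub>R conorm (\<gamma> z) (differential \<phi> z)"
  assumes V: "open V" "y \<in> V"
    and lin: "\<And>z \<eta>. z \<in> V \<Longrightarrow> linear (\<lambda>\<omega>. \<gamma> z \<omega> \<eta>)"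
    and alt: "\<And>z. z \<in> V \<Longrightarrow> alt_form DIM('e) (\<mu> z)"
    and bs: "distinct bs" "set bs = Basis" and A: "\<mu> y bs \<noteq> 0"
    and d: "\<And>b. b \<in> Basis \<Longrightarrow> (\<lambda>z. \<mu> z bs * \<gamma> z (blinfun_inner_right b) (\<omega> \<phi> z)) differentiable at y"
  shows "mean_curvature \<gamma> \<mu> \<phi> y * \<mu> y bs =
    (\<Sum>b\<in>Basis. frechet_derivative (\<lambda>z. \<mu> z bs * \<gamma> z (blinfun_inner_right b) (\<omega> \<phi> z)) (at y) b)"
proof -
  define f where "f b z = \<mu> z bs * \<gamma> z (blinfun_inner_right b) (\<omega> \<phi> z)" for b z
  define D0 where "D0 = (\<lambda>vs. \<mu> y vs / \<mu> y bs)"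
  let ?f' = "\<lambda>b. frechet_derivative (f b) (at y)"
  have d': "(f b has_derivative ?f' b) (at y)" if "b \<in> Basis" for b
    using d[OF that] by (simp add: f_def[abs_def] frechet_derivative_works)
  have altD: "alt_form DIM('e) D0"
    using alt_form_lincomb[OF alt[OF V(2)] alt[OF V(2)], of "1 / \<mu> y bs" 0] by (simp add: D0_def)
  have D0b: "D0 bs = 1" using A by (simp add: D0_def)
  have \<mu>D: "\<mu> z vs = \<mu> z bs * D0 vs" if "z \<in> V" for z vs
    using alt_form_proportional[OF altD alt[OF that] bs, of vs] by (simp add: D0b)
  have con: "contract (\<gamma> z) (\<mu> z) (\<omega> \<phi> z) ws = (\<Sum>b\<in>Basis. f b z * D0 (b # ws))" if z: "z \<in> V" for z ws
  proof -
    have "contract (\<gamma> z) (\<mu> z) (\<omega> \<phi> z) ws = \<mu> z bs * D0 (sharp (\<gamma> z) (\<omega> \<phi> z) # ws)"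
      by (simp add: contract_eq[of "\<gamma> z", OF lin[OF z] alt[OF z]] \<mu>D[OF z, of "_ # _"])
    also have "D0 (sharp (\<gamma> z) (\<omega> \<phi> z) # ws) = (\<Sum>b\<in>Basis. \<gamma> z (blinfun_inner_right b) (\<omega> \<phi> z) * D0 (b # ws))"
    proof (cases "length ws = DIM('e) - 1")
      case False
      then have "D0 (v # ws) = 0" for v by (intro alt_form_length[OF altD]) auto
      then show ?thesis by simp
    next
      case True
      have l: "linear (\<lambda>v. D0 (v # ws))"
        using alt_form_linear[OF altD, of "0 # ws" 0] True by simp
      show ?thesis unfolding sharp_eq(1)[of "\<gamma> z", OF lin[OF z]]
        by (simp add: linear_sum[OF l] linear_cmul[OF l])
    qed
    finally show ?thesis by (simp add: f_def sum_distrib_left mult.assoc)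
  qed
  have fd: "frechet_derivative (\<lambda>z. contract (\<gamma> z) (\<mu> z) (\<omega> \<phi> z) ws) (at y) = (\<lambda>h. \<Sum>b\<in>Basis. ?f' b h * D0 (b # ws))" for ws
  proof -
    have "((\<lambda>z. \<Sum>b\<in>Basis. f b z * D0 (b # ws)) has_derivative (\<lambda>h. \<Sum>b\<in>Basis. ?f' b h * D0 (b # ws))) (at y)"
      by (intro has_derivative_sum has_derivative_mult_left d')
    then have "((\<lambda>z. contract (\<gamma> z) (\<mu> z) (\<omega> \<phi> z) ws) has_derivative (\<lambda>h. \<Sum>b\<in>Basis. ?f' b h * D0 (b # ws))) (at y)"
      by (rule has_derivative_transform_within_open[OF _ V]) (simp add: con)
    then show ?thesis by (rule frechet_derivative_at[symmetric])
  qed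
  define h where "h = (\<Sum>b\<in>Basis. ?f' b b)"
  have ext: "ext_deriv (\<lambda>z. contract (\<gamma> z) (\<mu> z) (\<omega> \<phi> z)) y vs = h / \<mu> y bs * \<mu> y vs" for vs
  proof -
    have "ext_deriv (\<lambda>z. contract (\<gamma> z) (\<mu> z) (\<omega> \<phi> z)) y vs
      = (\<Sum>b\<in>Basis. \<Sum>i<length vs. (-1) ^ i * ?f' b (vs ! i) * D0 (b # omit i vs))"
    proof -
      have "(-1) ^ i * (\<Sum>b\<in>Basis. ?f' b (vs ! i) * D0 (b # omit i vs))
        = (\<Sum>b\<in>Basis. (-1) ^ i * ?f' b (vs ! i) * D0 (b # omit i vs))" for i
        by (simp only: sum_distrib_left mult.assoc)
      then show ?thesis unfolding ext_deriv_def fd by (subst sum.swap) simp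
    qed
    also have "\<dots> = (\<Sum>b\<in>Basis. wedge1 (Blinfun (?f' b)) (\<lambda>ws. D0 (b # ws)) vs)"
      unfolding wedge1_def
      by (intro sum.cong refl) (simp add: bounded_linear_Blinfun_apply has_derivative_bounded_linear[OF d'])
    also have "\<dots> = (\<Sum>b\<in>Basis. ?f' b b * D0 vs)"
      by (intro sum.cong refl)
        (simp add: alt_form_Cramer[OF altD] bounded_linear_Blinfun_apply has_derivative_bounded_linear[OF d'])
    also have "\<dots> = h / \<mu> y bs * \<mu> y vs" by (simp add: h_def D0_def sum_distrib_right sum_divide_distrib)
    finally show ?thesis .
  qed
  have "mean_curvature \<gamma> \<mu> \<phi> y = h / \<mu> y bs"
    unfolding mean_curvature_def
  proof (rule the_equality)
    show "\<forall>vs. ext_deriv (\<lambda>z. contract (\<gamma> z) (\<mu> z) (differential \<phi> z /\<^sub>R conorm (\<gamma> z) (differential \<phi> z))) y vs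
      = h / \<mu> y bs * \<mu> y vs" using ext by (simp add: \<omega>_def)
  next
    fix k assume "\<forall>vs. ext_deriv (\<lambda>z. contract (\<gamma> z) (\<mu> z) (differential \<phi> z /\<^sub>R conorm (\<gamma> z) (differential \<phi> z))) y vs
      = k * \<mu> y vs"
    then have "k * \<mu> y bs = h / \<mu> y bs * \<mu> y bs" using ext[of bs] by (simp add: \<omega>_def)
    then show "k = h / \<mu> y bs" using A by (simp add: field_simps)
  qed
  then show ?thesis using A by (simp add: h_def f_def[abs_def])
qed

section \<open>Vector fields tangential to a closed set\<close>

text \<open>The derivative is Lipschitz on the ball. The linearization estimate is applied on the
  intersection with the ball of radius \<open>norm (x' - x)\<close> about \<open>x\<close>, where
  the derivative differs from the one at \<open>x\<close> by at most
  \<open>C * norm (x' - x)\<close>.\<close>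

lemma smooth_on_taylor:
  fixes f :: "'e::euclidean_space \<Rightarrow> 'f::euclidean_space"
  assumes "smooth_on S f" "cball y R \<subseteq> S"
  obtains C where "0 < C" "\<And>x x'. x \<in> cball y R \<Longrightarrow> x' \<in> cball y R \<Longrightarrow>
    norm (f x' - f x - frechet_derivative f (at x) (x' - x)) \<le> C * (norm (x' - x))\<^sup>2"
proof -
  let ?D = "\<lambda>x. frechet_derivative f (at x)"
  have lin: "linear (?D x)" if "x \<in> cball y R" for x
    by (rule smooth_on_linear_derivative[OF assms(1) subsetD[OF assms(2) that]])
  have "\<exists>C. 0 < C \<and> (\<forall>x\<in>cball y R. \<forall>x'\<in>cball y R. norm (?D x b - ?D x' b) \<le> C * norm (x - x'))" for b
    using smooth_on_compact_bounds[OF smooth_on_frechet_derivative[OF assms(1), of b] assms(2)] by metis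
  then obtain Cb where Cb: "\<And>b. 0 < Cb b"
    "\<And>b x x'. x \<in> cball y R \<Longrightarrow> x' \<in> cball y R \<Longrightarrow> norm (?D x b - ?D x' b) \<le> Cb b * norm (x - x')"
    by metis
  define C where "C = (\<Sum>b\<in>Basis. Cb b) + 1"
  have C: "0 < C" unfolding C_def using sum_nonneg[of Basis Cb] Cb(1) by (smt (verit) )
  have D: "norm (?D x v - ?D x' v) \<le> C * norm (x - x') * norm v"
    if x: "x \<in> cball y R" "x' \<in> cball y R" for x x' v
  proof -
    have "?D x v - ?D x' v = (\<Sum>b\<in>Basis. (v \<bullet> b) *\<^sub>R (?D x b - ?D x' b))"
      unfolding linear_basis_sum[OF lin[OF x(1)], of v] linear_basis_sum[OF lin[OF x(2)], of v]
      by (simp add: sum_subtractf scaleR_diff_right)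
    also have "norm \<dots> \<le> (\<Sum>b\<in>Basis. norm ((v \<bullet> b) *\<^sub>R (?D x b - ?D x' b)))" by (rule norm_sum)
    also have "\<dots> \<le> (\<Sum>b\<in>Basis. norm v * (Cb b * norm (x - x')))"
      using Cb(2)[OF x] by (intro sum_mono) (auto intro!: mult_mono simp: Basis_le_norm)
    also have "\<dots> = (\<Sum>b\<in>Basis. Cb b) * (norm (x - x') * norm v)"
      unfolding sum_distrib_right by (intro sum.cong refl) (simp add: mult_ac)
    also have "\<dots> \<le> C * (norm (x - x') * norm v)" by (intro mult_right_mono) (auto simp: C_def)
    finally show ?thesis by (simp add: mult_ac)
  qed
  have "norm (f x' - f x - ?D x (x' - x)) \<le> C * (norm (x' - x))\<^sup>2"
    if x: "x \<in> cball y R" "x' \<in> cball y R" for x x'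
  proof -
    let ?S = "cball y R \<inter> cball x (norm (x' - x))"
    have "norm (f x' - f x - ?D x (x' - x)) \<le> norm (x' - x) * (C * norm (x' - x))"
    proof (rule differentiable_bound_linearization[where S = ?S and f' = ?D and ?x0.0 = x])
      show "x + t *\<^sub>R (x' - x) \<in> ?S" if "t \<in> {0..1}" for t
      proof -
        have "(1 - t) *\<^sub>R x + t *\<^sub>R x' \<in> cball y R"
          using convex_cball[of y R] x that unfolding convex_alt by auto
        moreover have "(1 - t) *\<^sub>R x + t *\<^sub>R x' = x + t *\<^sub>R (x' - x)" by (simp add: algebra_simps)
        moreover have "norm (t *\<^sub>R (x' - x)) \<le> norm (x' - x)"
          using that by (simp add: mult_left_le_one_le)
        ultimately show ?thesis by (simp add: dist_norm)
      qed
      show "(f has_derivative ?D z) (at z within ?S)" if "z \<in> ?S" for z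
        using that by (intro has_derivative_at_withinI[OF smooth_on_has_derivative[OF assms(1) subsetD[OF assms(2)]]]) simp
      show "onorm (?D z - ?D x) \<le> C * norm (x' - x)" if "z \<in> ?S" for z
      proof (rule onorm_le)
        fix v
        have "norm (?D z v - ?D x v) \<le> C * norm (z - x) * norm v" using D[of z x v] that x by simp
        also have "\<dots> \<le> C * norm (x' - x) * norm v"
          using that C by (intro mult_right_mono mult_left_mono) (auto simp: dist_norm norm_minus_commute)
        finally show "norm ((?D z - ?D x) v) \<le> C * norm (x' - x) * norm v" by simp
      qed
      show "x \<in> ?S" using x by simp
    qed
    then show ?thesis by (simp add: power2_eq_square mult_ac)
  qed
  with C show ?thesis using that by blast
qed

text \<open>The vectors \<open>\<nu>\<close> below are the exterior normals of \<open>Z\<close> at \<open>y\<close> in the sense of Bony.\<close>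

definition tangential :: "'e::euclidean_space set \<Rightarrow> 'e set \<Rightarrow> ('e \<Rightarrow> 'e) \<Rightarrow> bool" where
  "tangential V Z X \<longleftrightarrow> (\<forall>y\<in>Z \<inter> V. \<forall>\<nu>. ball (y + \<nu>) (norm \<nu>) \<inter> Z = {} \<longrightarrow> X y \<bullet> \<nu> = 0)"

text \<open>Euler polygons with \<open>n\<close> steps leave \<open>Z\<close> by at most \<open>O(1/sqrt n)\<close>, since \<open>X\<close> at a nearest
  point of \<open>Z\<close> is orthogonal to the connecting vector; then \<open>n\<close> tends to infinity.\<close>

lemma tangential_near_flow:
  fixes X :: "'e::euclidean_space \<Rightarrow> 'e"
  assumes Z: "closed Z" and tan: "tangential V Z X" and sm: "smooth_on V X"
    and R: "0 < R" "cball y R \<subseteq> V"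
  obtains C t0 where "0 < C" "0 < t0" "\<And>x t. x \<in> Z \<Longrightarrow> x \<in> cball y (R/2) \<Longrightarrow> \<bar>t\<bar> \<le> t0 \<Longrightarrow>
    infdist (x + t *\<^sub>R X x + (t\<^sup>2 / 2) *\<^sub>R frechet_derivative X (at x) (X x)) Z \<le> C * \<bar>t\<bar> ^ 3"
proof -
  let ?D = "\<lambda>x. frechet_derivative X (at x)"
  obtain M where M: "0 < M" "\<And>x. x \<in> cball y R \<Longrightarrow> norm (X x) \<le> M"
    "\<And>x v. x \<in> cball y R \<Longrightarrow> norm (?D x v) \<le> M * norm v"
    "\<And>x x'. x \<in> cball y R \<Longrightarrow> x' \<in> cball y R \<Longrightarrow> norm (X x - X x') \<le> M * norm (x - x')"
    using smooth_on_compact_bounds[OF sm R(2)] by metis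
  obtain T where T: "0 < T" "\<And>x x'. x \<in> cball y R \<Longrightarrow> x' \<in> cball y R \<Longrightarrow>
    norm (X x' - X x - ?D x (x' - x)) \<le> T * (norm (x' - x))\<^sup>2"
    using smooth_on_taylor[OF sm R(2)] by metis
  define C where "C = T * M\<^sup>2 + M^3"
  \<comment> \<open>This bound on t keeps every polygon within R/4 of \<open>x\<close>. A nearest
    point of \<open>Z\<close> is no farther from a vertex than \<open>x\<close> is, so it lies
    within R/2 + R/4 + R/4 of \<open>y\<close>, inside the ball where the bounds hold.\<close>
  define t0 where "t0 = R / (4 * M)"
  have "infdist (x + t *\<^sub>R X x + (t\<^sup>2 / 2) *\<^sub>R ?D x (X x)) Z \<le> C * \<bar>t\<bar> ^ 3"
    if x: "x \<in> Z" "x \<in> cball y (R/2)" and t: "\<bar>t\<bar> \<le> t0" for x t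
  proof -
    have tM: "\<bar>t\<bar> * M \<le> R / 4" using t M(1) by (simp add: t0_def field_simps)
    define K where "K = \<bar>t\<bar> * M * exp (\<bar>t\<bar> * M) + t\<^sup>2 * M\<^sup>2"
    let ?E = "\<lambda>s. x + s *\<^sub>R X x + (s\<^sup>2 / 2) *\<^sub>R ?D x (X x)"
    have xR: "x \<in> cball y R" using x(2) R(1) by auto
    have main: "infdist (?E t) Z \<le> C * \<bar>t\<bar> ^ 3 + K * (1 / sqrt (real n))" if n: "0 < n" for n
    proof -
      define h where "h = t / real n"
      have nh: "real n * h = t" using n by (simp add: h_def)
      have kh: "real k * \<bar>h\<bar> \<le> \<bar>t\<bar>" if "k \<le> n" for k
      proof -
        have "real k * \<bar>h\<bar> \<le> real n * \<bar>h\<bar>" using that by (intro mult_right_mono) auto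
        also have "\<dots> = \<bar>t\<bar>" using nh by (metis abs_mult abs_of_nat)
        finally show ?thesis .
      qed
      define xs where "xs = (\<lambda>k. ((\<lambda>p. p + h *\<^sub>R X p) ^^ k) x)"
      have xs0: "xs 0 = x" and xsS: "xs (Suc k) = xs k + h *\<^sub>R X (xs k)" for k
        by (simp_all add: xs_def)
      have inR: "xs k \<in> cball y R" "norm (xs k - x) \<le> R / 4" if "norm (xs k - x) \<le> real k * \<bar>h\<bar> * M" "k \<le> n" for k
      proof -
        have "real k * \<bar>h\<bar> * M \<le> \<bar>t\<bar> * M" using kh[OF that(2)] M(1) by (intro mult_right_mono) auto
        then show *: "norm (xs k - x) \<le> R / 4" using that tM by linarith
        have "dist y (xs k) \<le> dist y x + dist x (xs k)" by (rule dist_triangle)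
        then show "xs k \<in> cball y R" using * x(2) R(1) by (simp add: dist_norm norm_minus_commute)
      qed
      have A: "norm (xs k - x) \<le> real k * \<bar>h\<bar> * M" if "k \<le> n" for k
        using that
      proof (induction k)
        case (Suc k)
        then have IH: "norm (xs k - x) \<le> real k * \<bar>h\<bar> * M" and k: "k \<le> n" by auto
        have "norm (xs (Suc k) - x) \<le> norm (xs k - x) + norm (h *\<^sub>R X (xs k))"
          unfolding xsS by (metis add_diff_eq add.commute norm_triangle_ineq)
        also have "\<dots> \<le> real k * \<bar>h\<bar> * M + \<bar>h\<bar> * M"
          using IH M(2)[OF inR(1)[OF IH k]] by (auto intro!: add_mono mult_left_mono)
        finally show ?case by (simp add: algebra_simps)
      qed (simp add: xs0)
      have xsR: "xs k \<in> cball y R" and xsR4: "norm (xs k - x) \<le> R / 4" if "k \<le> n" for k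
        using inR[OF A] that by blast+
      have At: "norm (xs k - x) \<le> \<bar>t\<bar> * M" if "k \<le> n" for k
        using A[OF that] mult_right_mono[OF kh[OF that], of M] M(1) by linarith
      define q where "q = 1 + 2 * \<bar>h\<bar> * M"
      have q1: "1 \<le> q" using M(1) by (simp add: q_def)
      \<comment> \<open>One step multiplies the squared distance to \<open>Z\<close> by at most
        \<open>q\<close> and adds \<open>h\<^sup>2 * M\<^sup>2\<close>. After n steps the factor
        stays below exp(2 |t| M), and the n additions amount to t^2 M^2 / n.\<close>
      have Dst: "(infdist (xs k) Z)\<^sup>2 \<le> real k * (h\<^sup>2 * M\<^sup>2) * q ^ k" if "k \<le> n" for k
        using that
      proof (induction k)
        case 0
        then show ?case using x(1) by (simp add: xs0)
      next
        case (Suc k)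
        then have k: "k \<le> n" by simp
        obtain z where z: "z \<in> Z" "infdist (xs k) Z = dist (xs k) z"
          using infdist_attains_inf[OF Z] x(1) by blast
        define \<nu> where "\<nu> = xs k - z"
        have nd: "norm \<nu> = infdist (xs k) Z" by (simp add: z \<nu>_def dist_norm)
        have "norm \<nu> \<le> R / 4"
          using infdist_le[OF x(1), of "xs k"] xsR4[OF k] nd by (simp add: dist_norm)
        moreover have "dist y z \<le> dist y x + dist x (xs k) + dist (xs k) z"
          by (meson dist_triangle dist_triangle_le order_refl add_mono order_trans)
        ultimately have zR: "z \<in> cball y R"
          using x(2) xsR4[OF k] by (simp add: \<nu>_def dist_norm norm_minus_commute)
        have "ball (z + \<nu>) (norm \<nu>) \<inter> Z = {}"
        proof -
          have "\<not> dist (xs k) p < norm \<nu>" if "p \<in> Z" for p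
            using infdist_le[OF that, of "xs k"] nd by linarith
          then show ?thesis by (auto simp: \<nu>_def)
        qed
        then have orth: "X z \<bullet> \<nu> = 0" using tan z(1) zR R(2) unfolding tangential_def by blast
        have "\<nu> \<bullet> X (xs k) = \<nu> \<bullet> (X (xs k) - X z)" using orth by (simp add: inner_diff_right inner_commute)
        then have "\<bar>\<nu> \<bullet> X (xs k)\<bar> \<le> norm \<nu> * norm (X (xs k) - X z)"
          by (metis Cauchy_Schwarz_ineq2)
        also have "\<dots> \<le> norm \<nu> * (M * norm \<nu>)"
          using M(4)[OF xsR[OF k] zR] by (intro mult_left_mono) (auto simp: \<nu>_def)
        finally have CS: "\<bar>\<nu> \<bullet> X (xs k)\<bar> \<le> M * (norm \<nu>)\<^sup>2" by (simp add: power2_eq_square mult_ac)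
        have "(infdist (xs (Suc k)) Z)\<^sup>2 \<le> (norm (\<nu> + h *\<^sub>R X (xs k)))\<^sup>2"
          using infdist_le[OF z(1), of "xs (Suc k)"] infdist_nonneg
          by (intro power_mono) (auto simp: xsS dist_norm \<nu>_def algebra_simps)
        also have "\<dots> = (norm \<nu>)\<^sup>2 + 2 * (h * (\<nu> \<bullet> X (xs k))) + h\<^sup>2 * (norm (X (xs k)))\<^sup>2"
          unfolding power2_norm_eq_inner
          by (simp add: inner_add_left inner_add_right inner_commute[of "X (xs k)" \<nu>] power2_eq_square algebra_simps)
        also have "h * (\<nu> \<bullet> X (xs k)) \<le> \<bar>h\<bar> * (M * (norm \<nu>)\<^sup>2)"
          using mult_left_mono[OF CS abs_ge_zero[of h]] by (metis abs_ge_self abs_mult order_trans)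
        also have "h\<^sup>2 * (norm (X (xs k)))\<^sup>2 \<le> h\<^sup>2 * M\<^sup>2"
          using M(2)[OF xsR[OF k]] by (intro mult_left_mono power_mono) auto
        finally have "(infdist (xs (Suc k)) Z)\<^sup>2 \<le> q * (infdist (xs k) Z)\<^sup>2 + h\<^sup>2 * M\<^sup>2"
          by (simp add: q_def nd algebra_simps)
        also have "\<dots> \<le> q * (real k * (h\<^sup>2 * M\<^sup>2) * q ^ k) + (h\<^sup>2 * M\<^sup>2) * q ^ Suc k"
          using Suc.IH[OF k] q1 one_le_power[OF q1, of "Suc k"]
          by (intro add_mono mult_left_mono) (auto intro: mult_left_mono[of 1 "q ^ Suc k" "h\<^sup>2 * M\<^sup>2", simplified])
        also have "\<dots> = real (Suc k) * (h\<^sup>2 * M\<^sup>2) * q ^ Suc k" by (simp add: algebra_simps)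
        finally show ?case .
      qed
      have "q ^ n \<le> exp (2 * \<bar>h\<bar> * M) ^ n"
        using q1 exp_ge_add_one_self[of "2 * \<bar>h\<bar> * M"] by (intro power_mono) (auto simp: q_def)
      also have "\<dots> = exp (real n * (2 * \<bar>h\<bar> * M))" by (simp only: exp_of_nat_mult)
      also have "real n * (2 * \<bar>h\<bar> * M) = 2 * (\<bar>t\<bar> * M)" using nh by (metis abs_mult abs_of_nat mult.assoc mult.left_commute)
      also have "exp (2 * (\<bar>t\<bar> * M)) = (exp (\<bar>t\<bar> * M))\<^sup>2" by (simp add: exp_double)
      finally have qn: "q ^ n \<le> (exp (\<bar>t\<bar> * M))\<^sup>2" .
      have nh2: "real n * h\<^sup>2 = t\<^sup>2 / real n" using n by (simp add: h_def power2_eq_square)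
      have "(infdist (xs n) Z)\<^sup>2 \<le> (t\<^sup>2 / real n) * M\<^sup>2 * q ^ n" using Dst[of n] by (simp add: mult.assoc[symmetric] nh2)
      also have "\<dots> \<le> (t\<^sup>2 / real n) * M\<^sup>2 * (exp (\<bar>t\<bar> * M))\<^sup>2" by (intro mult_left_mono qn) auto
      also have "\<dots> = (\<bar>t\<bar> * M * exp (\<bar>t\<bar> * M) * (1 / sqrt (real n)))\<^sup>2"
        using n by (simp add: power_mult_distrib power_divide)
      finally have d1: "infdist (xs n) Z \<le> \<bar>t\<bar> * M * exp (\<bar>t\<bar> * M) * (1 / sqrt (real n))"
        by (rule power2_le_imp_le) (use M(1) in auto)
      have E1: "norm (xs k - x - (real k * h) *\<^sub>R X x) \<le> real k * \<bar>h\<bar> * (M * (\<bar>t\<bar> * M))" if "k \<le> n" for k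
        using that
      proof (induction k)
        case (Suc k)
        then have k: "k \<le> n" by simp
        have "xs (Suc k) - x - (real (Suc k) * h) *\<^sub>R X x
            = (xs k - x - (real k * h) *\<^sub>R X x) + h *\<^sub>R (X (xs k) - X x)"
          by (simp add: xsS algebra_simps)
        also have "norm \<dots> \<le> norm (xs k - x - (real k * h) *\<^sub>R X x) + \<bar>h\<bar> * norm (X (xs k) - X x)"
          by (metis norm_scaleR norm_triangle_ineq)
        also have "\<dots> \<le> real k * \<bar>h\<bar> * (M * (\<bar>t\<bar> * M)) + \<bar>h\<bar> * (M * (\<bar>t\<bar> * M))"
        proof (intro add_mono mult_left_mono)
          show "norm (X (xs k) - X x) \<le> M * (\<bar>t\<bar> * M)"
            using M(4)[OF xsR[OF k] xR] mult_left_mono[OF At[OF k], of M] M(1) by linarith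
        qed (use Suc k in auto)
        finally show ?case by (simp add: algebra_simps)
      qed (simp add: xs0)
      \<comment> \<open>The term \<open>h\<^sup>2 * M\<^sup>2\<close> pays for the difference
        between the second order sum of the polygon and (k h)^2 / 2. Over n steps it amounts to t^2
        M^2 / n and disappears in the limit, so that only the cubic error remains.\<close>
      have E2: "norm (xs k - ?E (real k * h)) \<le> real k * (\<bar>h\<bar> * (C * t\<^sup>2) + h\<^sup>2 * M\<^sup>2)" if "k \<le> n" for k
        using that
      proof (induction k)
        case (Suc k)
        then have k: "k \<le> n" by simp
        define r1 where "r1 = X (xs k) - X x - ?D x (xs k - x)"
        define r2 where "r2 = ?D x (xs k - x - (real k * h) *\<^sub>R X x)"
        have lin: "linear (?D x)" by (rule smooth_on_linear_derivative[OF sm subsetD[OF R(2) xR]])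
        have r: "X (xs k) = X x + (real k * h) *\<^sub>R ?D x (X x) + r1 + r2"
          by (simp add: r1_def r2_def linear_diff[OF lin] linear_cmul[OF lin])
        have "norm r1 \<le> T * (norm (xs k - x))\<^sup>2" unfolding r1_def by (rule T(2)[OF xR xsR[OF k]])
        also have "\<dots> \<le> T * (\<bar>t\<bar> * M)\<^sup>2" using At[OF k] T(1) by (intro mult_left_mono power_mono) auto
        finally have r1: "norm r1 \<le> T * M\<^sup>2 * t\<^sup>2" by (simp add: power_mult_distrib mult_ac)
        have "norm r2 \<le> M * norm (xs k - x - (real k * h) *\<^sub>R X x)" unfolding r2_def by (rule M(3)[OF xR])
        also have "\<dots> \<le> M * (\<bar>t\<bar> * (M * (\<bar>t\<bar> * M)))"
          by (intro mult_left_mono order_trans[OF E1[OF k] mult_right_mono[OF kh[OF k]]]) (use M(1) in auto)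
        finally have r2: "norm r2 \<le> M^3 * t\<^sup>2" by (simp add: power2_eq_square power3_eq_cube mult_ac)
        have "xs (Suc k) - ?E (real (Suc k) * h)
            = (xs k - ?E (real k * h)) + h *\<^sub>R (r1 + r2) - (h\<^sup>2 / 2) *\<^sub>R ?D x (X x)"
        proof -
          have s: "(real (Suc k) * h)\<^sup>2 / 2 = (real k * h)\<^sup>2 / 2 + real k * h\<^sup>2 + h\<^sup>2 / 2"
            by (simp add: power2_eq_square field_simps)
          show ?thesis unfolding xsS r s
            by (simp add: algebra_simps power2_eq_square)
        qed
        also have "norm \<dots> \<le> norm (xs k - ?E (real k * h)) + norm (h *\<^sub>R (r1 + r2)) + norm ((h\<^sup>2 / 2) *\<^sub>R ?D x (X x))"
          by (meson add_right_mono norm_triangle_ineq norm_triangle_ineq4 order_trans)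
        also have "norm (h *\<^sub>R (r1 + r2)) \<le> \<bar>h\<bar> * (C * t\<^sup>2)"
        proof -
          have "norm (r1 + r2) \<le> C * t\<^sup>2"
            using norm_triangle_ineq[of r1 r2] r1 r2 by (simp add: C_def algebra_simps)
          then show ?thesis by (simp add: mult_left_mono)
        qed
        also have "norm ((h\<^sup>2 / 2) *\<^sub>R ?D x (X x)) \<le> h\<^sup>2 * M\<^sup>2"
        proof -
          have "norm (?D x (X x)) \<le> M * M" using M(3)[OF xR, of "X x"] mult_left_mono[OF M(2)[OF xR], of M] M(1) by linarith
          then have "h\<^sup>2 / 2 * norm (?D x (X x)) \<le> h\<^sup>2 * (M * M)"
            by (intro mult_mono) auto
          then show ?thesis by (simp add: power2_eq_square)
        qed
        finally have "norm (xs (Suc k) - ?E (real (Suc k) * h))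
          \<le> norm (xs k - ?E (real k * h)) + \<bar>h\<bar> * (C * t\<^sup>2) + h\<^sup>2 * M\<^sup>2" by simp
        then show ?case using Suc.IH[OF k] by (simp add: algebra_simps)
      qed (simp add: xs0)
      have "norm (xs n - ?E t) \<le> real n * \<bar>h\<bar> * (C * t\<^sup>2) + (real n * h\<^sup>2) * M\<^sup>2"
        using E2[of n, unfolded nh] by (simp add: algebra_simps)
      also have "real n * \<bar>h\<bar> = \<bar>t\<bar>" using nh by (metis abs_mult abs_of_nat)
      also have "real n * h\<^sup>2 = t\<^sup>2 / real n" by (rule nh2)
      also have "t\<^sup>2 / real n * M\<^sup>2 \<le> t\<^sup>2 * M\<^sup>2 * (1 / sqrt (real n))"
      proof -
        have "sqrt (real n) \<le> real n" using n by (intro real_le_lsqrt) (auto simp: power2_eq_square)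
        then have "1 / real n \<le> 1 / sqrt (real n)" using n by (simp add: frac_le)
        then have "t\<^sup>2 * M\<^sup>2 * (1 / real n) \<le> t\<^sup>2 * M\<^sup>2 * (1 / sqrt (real n))" by (intro mult_left_mono) auto
        then show ?thesis by simp
      qed
      also have "\<bar>t\<bar> * (C * t\<^sup>2) = C * \<bar>t\<bar> ^ 3" by (simp add: power3_eq_cube power2_eq_square abs_mult_self_eq mult_ac)
      finally have e: "norm (xs n - ?E t) \<le> C * \<bar>t\<bar> ^ 3 + t\<^sup>2 * M\<^sup>2 * (1 / sqrt (real n))" by simp
      have "infdist (?E t) Z \<le> infdist (xs n) Z + dist (?E t) (xs n)" by (rule infdist_triangle)
      then show ?thesis using d1 e by (simp add: K_def dist_norm norm_minus_commute algebra_simps)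
    qed
    have "(\<lambda>n. 1 / sqrt (real n)) \<longlonglongrightarrow> 0"
      by (intro tendsto_divide_0[OF tendsto_const] filterlim_at_top_imp_at_infinity
          filterlim_compose[OF sqrt_at_top filterlim_real_sequentially])
    then have "(\<lambda>n. C * \<bar>t\<bar> ^ 3 + K * (1 / sqrt (real n))) \<longlonglongrightarrow> C * \<bar>t\<bar> ^ 3 + K * 0"
      by (intro tendsto_intros)
    then show ?thesis using main
      by (intro tendsto_lowerbound[of "\<lambda>n. C * \<bar>t\<bar> ^ 3 + K * (1 / sqrt (real n))"])
        (auto intro: eventually_mono[OF eventually_gt_at_top[of 0]])
  qed
  moreover have "0 < C" using T(1) M(1) by (simp add: C_def add_pos_pos)
  moreover have "0 < t0" using R(1) M(1) by (simp add: t0_def)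
  ultimately show ?thesis using that by blast
qed



text \<open>Continuity of \<open>z\<close> is not imposed, since its values are chosen separately
  for each t as nearest points of \<open>Z\<close>. The second order coefficient is taken without
  the factor 1/2.\<close>

definition second_order_path :: "'e::euclidean_space set \<Rightarrow> 'e \<Rightarrow> 'e \<Rightarrow> 'e \<Rightarrow> (real \<Rightarrow> 'e) \<Rightarrow> bool" where
  "second_order_path Z y a b z \<longleftrightarrow> (\<exists>C. \<forall>\<^sub>F t in at_right 0.
     z t \<in> Z \<and> norm (z t - (y + t *\<^sub>R a + t\<^sup>2 *\<^sub>R b)) \<le> C * t ^ 3)"

text \<open>Follows the flow of \<open>\<sigma> X\<close> for time \<open>t\<close> from \<open>z t\<close>.\<close>

lemma second_order_path_extend:
  fixes X :: "'e::euclidean_space \<Rightarrow> 'e"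
  assumes Z: "closed Z" and V: "open V" and tan: "tangential V Z X" and sm: "smooth_on V X"
    and y: "y \<in> V" and z: "second_order_path Z y a b z" and \<sigma>: "\<bar>\<sigma>\<bar> = 1"
  obtains z' where "second_order_path Z y (a + \<sigma> *\<^sub>R X y)
    (b + \<sigma> *\<^sub>R frechet_derivative X (at y) a + (1/2) *\<^sub>R frechet_derivative X (at y) (X y)) z'"
proof -
  let ?D = "\<lambda>x. frechet_derivative X (at x)"
  obtain R where R: "0 < R" "cball y R \<subseteq> V" using V y unfolding open_contains_cball by metis
  have yR: "y \<in> cball y R" using R(1) by simp
  obtain C1 t1 where C1: "0 < C1" "0 < t1" "\<And>x t. x \<in> Z \<Longrightarrow> x \<in> cball y (R/2) \<Longrightarrow> \<bar>t\<bar> \<le> t1 \<Longrightarrow>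
    infdist (x + t *\<^sub>R X x + (t\<^sup>2 / 2) *\<^sub>R ?D x (X x)) Z \<le> C1 * \<bar>t\<bar> ^ 3"
    by (rule tangential_near_flow[OF Z tan sm R]) (rule that)
  obtain T where T: "0 < T" "\<And>x x'. x \<in> cball y R \<Longrightarrow> x' \<in> cball y R \<Longrightarrow>
    norm (X x' - X x - ?D x (x' - x)) \<le> T * (norm (x' - x))\<^sup>2"
    by (rule smooth_on_taylor[OF sm R(2)]) (rule that)
  obtain M where M: "0 < M" "\<And>x v. x \<in> cball y R \<Longrightarrow> norm (?D x v) \<le> M * norm v"
    by (rule smooth_on_compact_bounds[OF sm R(2)]) (rule that)
  obtain L where L: "0 < L" "\<And>x x'. x \<in> cball y R \<Longrightarrow> x' \<in> cball y R \<Longrightarrow>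
    norm (?D x (X x) - ?D x' (X x')) \<le> L * norm (x - x')"
    by (rule smooth_on_compact_bounds[OF smooth_on_directional[OF V sm sm] R(2)]) (rule that)
  obtain C0 where C0: "\<forall>\<^sub>F t in at_right 0. z t \<in> Z \<and> norm (z t - (y + t *\<^sub>R a + t\<^sup>2 *\<^sub>R b)) \<le> C0 * t ^ 3"
    using z unfolding second_order_path_def by (rule exE)
  define C where "C = \<bar>C0\<bar>"
  have "C \<ge> 0" by (simp add: C_def)
  define G where "G = norm a + norm b + C"
  have G: "0 \<le> G" using \<open>C \<ge> 0\<close> by (simp add: G_def)
  define z' where "z' = (\<lambda>t. SOME p. p \<in> Z \<and> infdist (z t + (\<sigma> * t) *\<^sub>R X (z t) + ((\<sigma> * t)\<^sup>2 / 2) *\<^sub>R ?D (z t) (X (z t))) Z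
     = dist (z t + (\<sigma> * t) *\<^sub>R X (z t) + ((\<sigma> * t)\<^sup>2 / 2) *\<^sub>R ?D (z t) (X (z t))) p)"
  \<comment> \<open>One summand per source of error: the flow estimate, the remainder of
    \<open>z\<close>, the Taylor remainder of \<open>X\<close>, its derivative on the second order
    part of \<open>z t - y\<close>, and the variation of the second order term of the flow.\<close>
  define K where "K = C1 + C + T * G\<^sup>2 + M * (norm b + C) + L * G"
  have "second_order_path Z y (a + \<sigma> *\<^sub>R X y) (b + \<sigma> *\<^sub>R ?D y a + (1/2) *\<^sub>R ?D y (X y)) z'"
    unfolding second_order_path_def
  proof (rule exI[of _ K])
    have small: "\<forall>\<^sub>F t in at_right (0::real). t < min 1 (min t1 (R / (2 * (G + 1))))"
      using C1(2) R(1) G by (intro order_tendstoD[OF tendsto_ident_at]) auto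
    have pos: "\<forall>\<^sub>F t in at_right (0::real). 0 < t" by (simp add: eventually_at_filter)
    show "\<forall>\<^sub>F t in at_right 0. z' t \<in> Z \<and>
      norm (z' t - (y + t *\<^sub>R (a + \<sigma> *\<^sub>R X y) + t\<^sup>2 *\<^sub>R (b + \<sigma> *\<^sub>R ?D y a + (1/2) *\<^sub>R ?D y (X y)))) \<le> K * t ^ 3"
      using C0 small pos
    proof eventually_elim
      case (elim t)
      then have t: "0 < t" "t < 1" "t < t1" "t < R / (2 * (G + 1))" and zZ: "z t \<in> Z" by auto
      have s2: "\<sigma> * \<sigma> = 1" using \<sigma> by (metis abs_mult_self_eq mult_1)
      define \<zeta> where "\<zeta> = z t - (y + t *\<^sub>R a + t\<^sup>2 *\<^sub>R b)"
      have "C0 * t^3 \<le> C * t^3" using t(1) by (intro mult_right_mono) (auto simp: C_def)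
      moreover have "norm \<zeta> \<le> C0 * t^3" using elim by (simp add: \<zeta>_def)
      ultimately have \<zeta>: "norm \<zeta> \<le> C * t^3" by (rule order_trans[rotated])
      have t32: "t^3 \<le> t\<^sup>2" "t\<^sup>2 \<le> t" using power_decreasing[of 2 3 t] power_decreasing[of 1 2 t] t by auto
      have "C * t^3 \<le> C * t\<^sup>2" "norm b * t\<^sup>2 \<le> norm b * t" "C * t\<^sup>2 \<le> C * t"
        using t32 \<open>C \<ge> 0\<close> by (auto intro: mult_left_mono)
      note cb = this
      have "norm (z t - y - t *\<^sub>R a) \<le> norm (t\<^sup>2 *\<^sub>R b) + norm \<zeta>"
        unfolding \<zeta>_def by (rule order_trans[OF _ norm_triangle_ineq]) (simp add: algebra_simps)
      then have z2: "norm (z t - y - t *\<^sub>R a) \<le> (norm b + C) * t\<^sup>2"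
        using \<zeta> cb by (simp add: algebra_simps)
      have "norm (z t - y) \<le> norm (t *\<^sub>R a) + norm (z t - y - t *\<^sub>R a)"
        by (rule order_trans[OF _ norm_triangle_ineq]) simp
      then have z1: "norm (z t - y) \<le> G * t"
        using z2 cb t(1) by (simp add: G_def algebra_simps)
      also have "G * t \<le> R / 2"
      proof -
        have "G * t \<le> (G + 1) * t" using t(1) by (simp add: algebra_simps)
        also have "\<dots> \<le> R / 2" using t(4) G by (simp add: field_simps)
        finally show ?thesis .
      qed
      finally have zb: "z t \<in> cball y (R/2)" by (simp add: dist_norm norm_minus_commute)
      then have zR: "z t \<in> cball y R" using R(1) by auto
      let ?E = "z t + (\<sigma> * t) *\<^sub>R X (z t) + ((\<sigma> * t)\<^sup>2 / 2) *\<^sub>R ?D (z t) (X (z t))"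
      have "\<exists>p. p \<in> Z \<and> infdist ?E Z = dist ?E p" using infdist_attains_inf[OF Z] zZ by blast
      from someI_ex[OF this] have z': "z' t \<in> Z" "infdist ?E Z = dist ?E (z' t)" by (auto simp: z'_def)
      have st: "\<bar>\<sigma> * t\<bar> = t" using \<sigma> t(1) by (simp add: abs_mult)
      have e0: "norm (z' t - ?E) \<le> C1 * t^3"
        using C1(3)[OF zZ zb, of "\<sigma> * t"] st t(3) z'(2) by (simp add: dist_norm norm_minus_commute)
      define r1 where "r1 = X (z t) - X y - ?D y (z t - y)"
      define r2 where "r2 = ?D y (z t - y - t *\<^sub>R a)"
      define r3 where "r3 = ?D (z t) (X (z t)) - ?D y (X y)"
      have lin: "linear (?D y)" by (rule smooth_on_linear_derivative[OF sm y])
      have Xz: "X (z t) = X y + t *\<^sub>R ?D y a + r1 + r2"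
        by (simp add: r1_def r2_def linear_diff[OF lin] linear_cmul[OF lin])
      have Dz: "?D (z t) (X (z t)) = ?D y (X y) + r3" by (simp add: r3_def)
      have "norm r1 \<le> T * (norm (z t - y))\<^sup>2" unfolding r1_def by (rule T(2)[OF yR zR])
      also have "\<dots> \<le> T * (G * t)\<^sup>2" using z1 T(1) by (intro mult_left_mono power_mono) auto
      finally have r1: "norm r1 \<le> T * G\<^sup>2 * t\<^sup>2" by (simp add: power_mult_distrib mult_ac)
      have "norm r2 \<le> M * norm (z t - y - t *\<^sub>R a)" unfolding r2_def by (rule M(2)[OF yR])
      also have "\<dots> \<le> M * ((norm b + C) * t\<^sup>2)" using z2 M(1) by (intro mult_left_mono) auto
      finally have r2: "norm r2 \<le> M * (norm b + C) * t\<^sup>2" by (simp add: mult_ac)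
      have "norm r3 \<le> L * norm (z t - y)" unfolding r3_def by (rule L(2)[OF zR yR])
      also have "\<dots> \<le> L * (G * t)" using z1 L(1) by (intro mult_left_mono) auto
      finally have r3: "norm r3 \<le> L * G * t" by (simp add: mult_ac)
      have "z' t - (y + t *\<^sub>R (a + \<sigma> *\<^sub>R X y) + t\<^sup>2 *\<^sub>R (b + \<sigma> *\<^sub>R ?D y a + (1/2) *\<^sub>R ?D y (X y)))
        = (z' t - ?E) + \<zeta> + (\<sigma> * t) *\<^sub>R (r1 + r2) + (t\<^sup>2 / 2) *\<^sub>R r3"
      proof -
        have s: "(\<sigma> * t)\<^sup>2 = t\<^sup>2" using s2 by (simp add: power2_eq_square mult_ac)
        show ?thesis unfolding s Dz unfolding Xz unfolding \<zeta>_def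
          by (simp add: algebra_simps power2_eq_square)
      qed
      also have "norm \<dots> \<le> norm (z' t - ?E) + norm \<zeta> + norm ((\<sigma> * t) *\<^sub>R (r1 + r2)) + norm ((t\<^sup>2 / 2) *\<^sub>R r3)"
        by (intro order_trans[OF norm_triangle_ineq] add_mono order_refl)
      also have "norm ((\<sigma> * t) *\<^sub>R (r1 + r2)) \<le> t * ((T * G\<^sup>2 + M * (norm b + C)) * t\<^sup>2)"
      proof -
        have "norm (r1 + r2) \<le> (T * G\<^sup>2 + M * (norm b + C)) * t\<^sup>2"
          using norm_triangle_ineq[of r1 r2] r1 r2 unfolding distrib_right[of _ _ "t\<^sup>2"] by linarith
        then show ?thesis unfolding norm_scaleR st using t(1) by (intro mult_left_mono) auto
      qed
      also have "norm ((t\<^sup>2 / 2) *\<^sub>R r3) \<le> t\<^sup>2 * (L * G * t)"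
        unfolding norm_scaleR using r3 by (intro mult_mono) auto
      finally show ?case using e0 \<zeta> z'(1)
        by (simp add: K_def power2_eq_square power3_eq_cube algebra_simps)
    qed
  qed
  then show ?thesis by (rule that)
qed

text \<open>The commutator of the two flows is a second order path in \<open>Z\<close> with second order term
  \<open>[X, Y]\<close>, and cannot enter the exterior ball.\<close>

lemma tangential_bracket_half:
  fixes X Y :: "'e::euclidean_space \<Rightarrow> 'e"
  assumes Z: "closed Z" and V: "open V" and X: "tangential V Z X" "smooth_on V X"
    and Y: "tangential V Z Y" "smooth_on V Y"
    and y: "y \<in> V" "y \<in> Z" and \<nu>: "ball (y + \<nu>) (norm \<nu>) \<inter> Z = {}"
  shows "lie_bracket X Y y \<bullet> \<nu> \<le> 0"
proof -
  let ?X = "frechet_derivative X (at y)" and ?Y = "frechet_derivative Y (at y)"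
  note linX = smooth_on_linear_derivative[OF X(2) y(1)] and linY = smooth_on_linear_derivative[OF Y(2) y(1)]
  let ?B = "lie_bracket X Y y"
  \<comment> \<open>The flows of X, Y, -X and -Y are followed in turn, starting from the constant
    path; the first order terms cancel.\<close>
  have "second_order_path Z y 0 0 (\<lambda>t. y)"
    unfolding second_order_path_def using y(2) by (intro exI[of _ 0]) simp
  from second_order_path_extend[OF Z V X y(1) this, of 1]
  obtain z1 where "second_order_path Z y (X y) ((1/2) *\<^sub>R ?X (X y)) z1"
    by (auto simp: linear_0[OF linX])
  from second_order_path_extend[OF Z V Y y(1) this, of 1]
  obtain z2 where "second_order_path Z y (X y + Y y)
    ((1/2) *\<^sub>R ?X (X y) + ?Y (X y) + (1/2) *\<^sub>R ?Y (Y y)) z2" by auto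
  from second_order_path_extend[OF Z V X y(1) this, of "-1"]
  obtain z3 where "second_order_path Z y (Y y)
    ((1/2) *\<^sub>R ?X (X y) + ?Y (X y) + (1/2) *\<^sub>R ?Y (Y y) - ?X (X y + Y y) + (1/2) *\<^sub>R ?X (X y)) z3" by auto
  moreover have "(1/2) *\<^sub>R ?X (X y) + ?Y (X y) + (1/2) *\<^sub>R ?Y (Y y) - ?X (X y + Y y) + (1/2) *\<^sub>R ?X (X y)
      = ?B + (1/2) *\<^sub>R ?Y (Y y)"
  proof -
    have "(1/2) *\<^sub>R ?X (X y) + (1/2) *\<^sub>R ?X (X y) = ?X (X y)" by (metis scaleR_half_double scaleR_add_right)
    then show ?thesis by (simp add: lie_bracket_def linear_add[OF linX] algebra_simps)
  qed
  ultimately have z3: "second_order_path Z y (Y y) (?B + (1/2) *\<^sub>R ?Y (Y y)) z3" by simp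
  from second_order_path_extend[OF Z V Y y(1) this, of "-1"]
  obtain z4 where "second_order_path Z y 0 (?B + (1/2) *\<^sub>R ?Y (Y y) - ?Y (Y y) + (1/2) *\<^sub>R ?Y (Y y)) z4" by auto
  moreover have "?B + (1/2) *\<^sub>R ?Y (Y y) - ?Y (Y y) + (1/2) *\<^sub>R ?Y (Y y) = ?B"
  proof -
    have "(1/2) *\<^sub>R ?Y (Y y) + (1/2) *\<^sub>R ?Y (Y y) = ?Y (Y y)" by (metis scaleR_half_double scaleR_add_right)
    then show ?thesis by (simp add: algebra_simps)
  qed
  ultimately have "second_order_path Z y 0 ?B z4" by simp
  then obtain C where C: "\<forall>\<^sub>F t in at_right 0. z4 t \<in> Z \<and> norm (z4 t - (y + t\<^sup>2 *\<^sub>R ?B)) \<le> C * t ^ 3"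
    unfolding second_order_path_def by auto
  define N where "N = norm ?B + \<bar>C\<bar>"
  have ev: "\<forall>\<^sub>F t in at_right 0. 2 * (?B \<bullet> \<nu>) \<le> t\<^sup>2 * N\<^sup>2 + 2 * \<bar>C\<bar> * t * norm \<nu>"
  proof -
    have pos: "\<forall>\<^sub>F t in at_right (0::real). 0 < t" by (simp add: eventually_at_filter)
    have small: "\<forall>\<^sub>F t in at_right (0::real). t < 1" by (intro order_tendstoD[OF tendsto_ident_at]) auto
    show ?thesis using C pos small
    proof eventually_elim
      case (elim t)
      define e where "e = z4 t - (y + t\<^sup>2 *\<^sub>R ?B)"
      have t: "0 < t" "t < 1" using elim by auto
      have "C * t^3 \<le> \<bar>C\<bar> * t^3" using t by (intro mult_right_mono) auto
      moreover have "norm e \<le> C * t^3" using elim by (simp add: e_def)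
      ultimately have e: "norm e \<le> \<bar>C\<bar> * t^3" by (rule order_trans[rotated])
      have "t^3 \<le> t\<^sup>2" using t by (intro power_decreasing) auto
      then have "\<bar>C\<bar> * t^3 \<le> \<bar>C\<bar> * t\<^sup>2" by (intro mult_left_mono) auto
      with e have e2: "norm e \<le> \<bar>C\<bar> * t\<^sup>2" by linarith
      define d where "d = t\<^sup>2 *\<^sub>R ?B + e"
      have d: "norm d \<le> t\<^sup>2 * N" using norm_triangle_ineq[of "t\<^sup>2 *\<^sub>R ?B" e] e2 by (simp add: d_def N_def algebra_simps)
      have "z4 t = y + d" by (simp add: d_def e_def)
      moreover have "\<not> dist (y + \<nu>) (z4 t) < norm \<nu>" using elim(1) \<nu> by (auto simp: disjoint_iff)
      moreover have "(y + \<nu>) - (y + d) = \<nu> - d" by simp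
      \<comment> \<open>Being outside the exterior ball means that twice the inner product of
        \<open>d\<close> and \<nu> is at most |d|^2. The former is of order t^2 and the latter of
        order t^4, so division by t^2 leaves the bracket against terms that vanish with t.\<close>
      ultimately have "norm \<nu> \<le> norm (\<nu> - d)" by (simp add: dist_norm not_less)
      then have "\<nu> \<bullet> \<nu> \<le> (\<nu> - d) \<bullet> (\<nu> - d)" by (simp add: norm_le)
      then have "2 * (d \<bullet> \<nu>) \<le> d \<bullet> d" by (simp add: inner_diff_left inner_diff_right inner_commute)
      also have "\<dots> \<le> (t\<^sup>2 * N)\<^sup>2" using d by (metis norm_ge_zero power2_norm_eq_inner power_mono)
      finally have "2 * (t\<^sup>2 * (?B \<bullet> \<nu>)) \<le> (t\<^sup>2 * N)\<^sup>2 + 2 * - (e \<bullet> \<nu>)"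
        by (simp add: d_def inner_add_left)
      also have "- (e \<bullet> \<nu>) \<le> \<bar>C\<bar> * t^3 * norm \<nu>"
      proof -
        have "- (e \<bullet> \<nu>) \<le> norm e * norm \<nu>" using Cauchy_Schwarz_ineq2[of e \<nu>] by linarith
        also have "\<dots> \<le> \<bar>C\<bar> * t^3 * norm \<nu>" using e by (intro mult_right_mono) auto
        finally show ?thesis .
      qed
      finally have "t\<^sup>2 * (2 * (?B \<bullet> \<nu>)) \<le> t\<^sup>2 * (t\<^sup>2 * N\<^sup>2 + 2 * \<bar>C\<bar> * t * norm \<nu>)"
        by (simp add: power2_eq_square power3_eq_cube algebra_simps)
      then show ?case using t(1) by simp
    qed
  qed
  have lim: "((\<lambda>t. t\<^sup>2 * N\<^sup>2 + 2 * \<bar>C\<bar> * t * norm \<nu>) \<longlongrightarrow> 0\<^sup>2 * N\<^sup>2 + 2 * \<bar>C\<bar> * 0 * norm \<nu>) (at_right 0)"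
    by (intro tendsto_intros)
  have "2 * (?B \<bullet> \<nu>) \<le> 0\<^sup>2 * N\<^sup>2 + 2 * \<bar>C\<bar> * 0 * norm \<nu>"
    by (rule tendsto_lowerbound[OF lim ev]) simp
  then show ?thesis by simp
qed

text \<open>Exchanging \<open>X\<close> and \<open>Y\<close> changes the sign of the bracket, so the
  one-sided bound holds in both directions.\<close>

lemma tangential_lie_bracket:
  assumes "closed Z" "open V" "tangential V Z X" "smooth_on V X" "tangential V Z Y" "smooth_on V Y"
  shows "tangential V Z (lie_bracket X Y)"
proof -
  have "lie_bracket X Y y \<bullet> \<nu> = 0" if "y \<in> Z" "y \<in> V" "ball (y + \<nu>) (norm \<nu>) \<inter> Z = {}" for y \<nu>
  proof -
    have "lie_bracket Y X y = - lie_bracket X Y y" by (simp add: lie_bracket_def)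
    then show ?thesis
      using tangential_bracket_half[OF assms(1,2,3,4,5,6) that(2,1,3)]
        tangential_bracket_half[OF assms(1,2,5,6,3,4) that(2,1,3)] by simp
  qed
  then show ?thesis by (auto simp: tangential_def)
qed

lemma tangential_lie_module:
  assumes "closed Z" "open V" "\<And>X. X \<in> set Xs \<Longrightarrow> smooth_on V X" "\<And>X. X \<in> set Xs \<Longrightarrow> tangential V Z X"
    and "W \<in> lie_module V Xs"
  shows "tangential V Z W"
  using assms(5)
proof (induction rule: lie_module.induct)
  case (generator X)
  then show ?case by (rule assms(4))
next
  case (bracket X Y)
  have "smooth_on V X" "smooth_on V Y"
    using smooth_on_lie_module[OF assms(2), of Xs] assms(3) bracket.hyps by auto
  then show ?case by (intro tangential_lie_bracket[OF assms(1,2)] bracket.IH)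
qed (simp_all add: tangential_def inner_add_left)

section \<open>Functions annihilated by a Lie module\<close>

text \<open>The mean value theorem in direction \<open>u\<close>, applied to the difference in
  direction \<open>v\<close>, followed by a Taylor expansion of the derivative along
  \<open>u\<close>.\<close>

lemma smooth_on_second_difference:
  fixes f :: "'e::euclidean_space \<Rightarrow> real"
  assumes "open S" "smooth_on S f" "x \<in> S"
  obtains C \<delta> where "0 < C" "0 < \<delta>" "\<And>t. 0 < t \<Longrightarrow> t < \<delta> \<Longrightarrow>
    \<bar>(f (x + t *\<^sub>R u + t *\<^sub>R v) - f (x + t *\<^sub>R u) - f (x + t *\<^sub>R v) + f x)
      - t\<^sup>2 * frechet_derivative (\<lambda>z. frechet_derivative f (at z) u) (at x) v\<bar> \<le> C * t ^ 3"
proof -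
  let ?h = "\<lambda>z. frechet_derivative f (at z) u"
  let ?Dh = "frechet_derivative ?h (at x)"
  obtain R where R: "0 < R" "cball x R \<subseteq> S" using assms(1,3) unfolding open_contains_cball by metis
  have sh: "smooth_on S ?h" by (rule smooth_on_frechet_derivative[OF assms(2)])
  obtain T where T: "0 < T" "\<And>z z'. z \<in> cball x R \<Longrightarrow> z' \<in> cball x R \<Longrightarrow>
    norm (?h z' - ?h z - frechet_derivative ?h (at z) (z' - z)) \<le> T * (norm (z' - z))\<^sup>2"
    by (rule smooth_on_taylor[OF sh R(2)]) (rule that)
  define G where "G = norm u + norm v + 1"
  have G: "0 < G" by (simp add: G_def add_nonneg_pos)
  define \<delta> where "\<delta> = R / G"
  have "\<bar>(f (x + t *\<^sub>R u + t *\<^sub>R v) - f (x + t *\<^sub>R u) - f (x + t *\<^sub>R v) + f x) - t\<^sup>2 * ?Dh v\<bar> \<le> (2 * T * G\<^sup>2) * t ^ 3"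
    if t: "0 < t" "t < \<delta>" for t
  proof -
    have tG: "t * G \<le> R" using t G by (simp add: \<delta>_def field_simps)
    have nb: "norm (s *\<^sub>R u + r *\<^sub>R v) \<le> t * G" if "0 \<le> s" "s \<le> t" "0 \<le> r" "r \<le> t" for s r
    proof -
      have "norm (s *\<^sub>R u + r *\<^sub>R v) \<le> s * norm u + r * norm v"
        using norm_triangle_ineq[of "s *\<^sub>R u" "r *\<^sub>R v"] that by simp
      also have "\<dots> \<le> t * norm u + t * norm v" using that by (intro add_mono mult_right_mono) auto
      also have "\<dots> \<le> t * G" using t by (simp add: G_def algebra_simps)
      finally show ?thesis .
    qed
    have inR: "x + (s *\<^sub>R u + r *\<^sub>R v) \<in> cball x R" if "0 \<le> s" "s \<le> t" "0 \<le> r" "r \<le> t" for s r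
      using order_trans[OF nb[OF that] tG] unfolding mem_cball dist_norm norm_minus_commute[of x] by simp
    let ?g = "\<lambda>s. f (x + (s *\<^sub>R u + t *\<^sub>R v)) - f (x + (s *\<^sub>R u + 0 *\<^sub>R v))"
    have der: "((\<lambda>s. f (x + (s *\<^sub>R u + r *\<^sub>R v))) has_real_derivative ?h (x + (s *\<^sub>R u + r *\<^sub>R v))) (at s)"
      if "0 \<le> s" "s \<le> t" "0 \<le> r" "r \<le> t" for s r
    proof -
      have l: "((\<lambda>s. x + (s *\<^sub>R u + r *\<^sub>R v)) has_derivative (\<lambda>h. h *\<^sub>R u)) (at s)"
        by (auto intro!: derivative_eq_intros)
      have F: "(f has_derivative frechet_derivative f (at (x + (s *\<^sub>R u + r *\<^sub>R v)))) (at (x + (s *\<^sub>R u + r *\<^sub>R v)))"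
        by (rule smooth_on_has_derivative[OF assms(2) subsetD[OF R(2) inR[OF that]]])
      have "linear (frechet_derivative f (at (x + (s *\<^sub>R u + r *\<^sub>R v))))" using F by (rule has_derivative_linear)
      then show ?thesis
        using has_derivative_compose[OF l F] by (simp add: has_field_derivative_def linear_cmul mult_commute_abs)
    qed
    have "\<exists>\<theta>. 0 < \<theta> \<and> \<theta> < t \<and> ?g t - ?g 0 = (t - 0) * (?h (x + (\<theta> *\<^sub>R u + t *\<^sub>R v)) - ?h (x + (\<theta> *\<^sub>R u + 0 *\<^sub>R v)))"
      using t(1) by (intro MVT2 DERIV_diff der) auto
    then obtain \<theta> where \<theta>: "0 < \<theta>" "\<theta> < t"
      "?g t - ?g 0 = t * (?h (x + (\<theta> *\<^sub>R u + t *\<^sub>R v)) - ?h (x + (\<theta> *\<^sub>R u + 0 *\<^sub>R v)))" by auto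
    define r where "r k = ?h (x + (\<theta> *\<^sub>R u + k *\<^sub>R v)) - ?h x - ?Dh (\<theta> *\<^sub>R u + k *\<^sub>R v)" for k
    have r: "\<bar>r k\<bar> \<le> T * (t * G)\<^sup>2" if "0 \<le> k" "k \<le> t" for k
    proof -
      have k: "0 \<le> \<theta>" "\<theta> \<le> t" using \<theta> by auto
      have "\<bar>r k\<bar> \<le> T * (norm (\<theta> *\<^sub>R u + k *\<^sub>R v))\<^sup>2"
        using T(2)[of x, OF _ inR[OF k that]] R(1) by (simp add: r_def)
      also have "\<dots> \<le> T * (t * G)\<^sup>2" using nb[OF k that] T(1) by (intro mult_left_mono power_mono) auto
      finally show ?thesis .
    qed
    have lin: "linear ?Dh" by (rule smooth_on_linear_derivative[OF sh assms(3)])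
    have "?g t - ?g 0 = t * (t * ?Dh v + r t - r 0)"
      unfolding \<theta>(3) r_def by (simp add: linear_add[OF lin] linear_cmul[OF lin] linear_0[OF lin] algebra_simps)
    then have "(f (x + t *\<^sub>R u + t *\<^sub>R v) - f (x + t *\<^sub>R u) - f (x + t *\<^sub>R v) + f x) - t\<^sup>2 * ?Dh v = t * (r t - r 0)"
      by (simp add: algebra_simps power2_eq_square)
    also have "\<bar>t * (r t - r 0)\<bar> \<le> t * (2 * (T * (t * G)\<^sup>2))"
      unfolding abs_mult using r[of t] r[of 0] t(1) by (intro mult_mono) auto
    finally show ?thesis by (simp add: power2_eq_square power3_eq_cube mult_ac)
  qed
  moreover have "0 < 2 * T * G\<^sup>2" using T(1) G by simp
  moreover have "0 < \<delta>" using R(1) G by (simp add: \<delta>_def)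
  ultimately show ?thesis by (intro that)
qed

text \<open>The second difference does not distinguish \<open>u\<close> from \<open>v\<close>, and
  divided by t^2 it tends to both mixed derivatives.\<close>

lemma smooth_on_symmetric_derivative:
  fixes f :: "'e::euclidean_space \<Rightarrow> real"
  assumes "open S" "smooth_on S f" "x \<in> S"
  shows "frechet_derivative (\<lambda>z. frechet_derivative f (at z) u) (at x) v
    = frechet_derivative (\<lambda>z. frechet_derivative f (at z) v) (at x) u" (is "?a = ?b")
proof -
  obtain C1 \<delta>1 where 1: "0 < C1" "0 < \<delta>1" "\<And>t. 0 < t \<Longrightarrow> t < \<delta>1 \<Longrightarrow>
    \<bar>(f (x + t *\<^sub>R u + t *\<^sub>R v) - f (x + t *\<^sub>R u) - f (x + t *\<^sub>R v) + f x) - t\<^sup>2 * ?a\<bar> \<le> C1 * t ^ 3"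
    by (rule smooth_on_second_difference[OF assms, of u v]) (rule that)
  obtain C2 \<delta>2 where 2: "0 < C2" "0 < \<delta>2" "\<And>t. 0 < t \<Longrightarrow> t < \<delta>2 \<Longrightarrow>
    \<bar>(f (x + t *\<^sub>R v + t *\<^sub>R u) - f (x + t *\<^sub>R v) - f (x + t *\<^sub>R u) + f x) - t\<^sup>2 * ?b\<bar> \<le> C2 * t ^ 3"
    by (rule smooth_on_second_difference[OF assms, of v u]) (rule that)
  have ev: "\<forall>\<^sub>F t in at_right 0. \<bar>?a - ?b\<bar> \<le> (C1 + C2) * t"
  proof -
    have "\<forall>\<^sub>F t in at_right (0::real). 0 < t" by (simp add: eventually_at_filter)
    moreover have "\<forall>\<^sub>F t in at_right (0::real). t < min \<delta>1 \<delta>2"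
      using 1(2) 2(2) by (intro order_tendstoD[OF tendsto_ident_at]) auto
    ultimately show ?thesis
    proof eventually_elim
      case (elim t)
      let ?\<Delta> = "f (x + t *\<^sub>R u + t *\<^sub>R v) - f (x + t *\<^sub>R u) - f (x + t *\<^sub>R v) + f x"
      have e: "x + t *\<^sub>R v + t *\<^sub>R u = x + t *\<^sub>R u + t *\<^sub>R v" by simp
      have "\<bar>?\<Delta> - t\<^sup>2 * ?a\<bar> \<le> C1 * t ^ 3" by (rule 1(3)) (use elim in auto)
      moreover have "\<bar>?\<Delta> - t\<^sup>2 * ?b\<bar> \<le> C2 * t ^ 3"
        using 2(3)[of t] elim unfolding e by (simp add: algebra_simps)
      ultimately have "\<bar>t\<^sup>2 * ?a - t\<^sup>2 * ?b\<bar> \<le> C1 * t^3 + C2 * t^3" by linarith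
      also have "\<bar>t\<^sup>2 * ?a - t\<^sup>2 * ?b\<bar> = t\<^sup>2 * \<bar>?a - ?b\<bar>"
        unfolding right_diff_distrib[symmetric] abs_mult by simp
      also have "C1 * t^3 + C2 * t^3 = t\<^sup>2 * ((C1 + C2) * t)"
        by (simp add: power2_eq_square power3_eq_cube algebra_simps)
      finally show ?case using elim by simp
    qed
  qed
  have lim: "((\<lambda>t. (C1 + C2) * t) \<longlongrightarrow> (C1 + C2) * 0) (at_right 0)" by (intro tendsto_intros)
  have "\<bar>?a - ?b\<bar> \<le> (C1 + C2) * 0" by (rule tendsto_lowerbound[OF lim ev]) simp
  then show ?thesis by simp
qed

text \<open>Symmetry of the second derivative: differentiating X f = 0 along Y and Y f = 0 along X
  and subtracting leaves [X, Y] f = 0. Applied to u(x) - t, whose level sets are the vertical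
  translates of the graph, and to v - u.\<close>

lemma lie_module_annihilates:
  fixes f :: "'e::euclidean_space \<Rightarrow> real"
  assumes V: "open V" and f: "smooth_on V f" and Xs: "\<And>X. X \<in> set Xs \<Longrightarrow> smooth_on V X"
    and 0: "\<And>X y. X \<in> set Xs \<Longrightarrow> y \<in> V \<Longrightarrow> frechet_derivative f (at y) (X y) = 0"
    and Z: "Z \<in> lie_module V Xs" and y: "y \<in> V"
  shows "frechet_derivative f (at y) (Z y) = 0"
proof -
  let ?D = "\<lambda>z. frechet_derivative f (at z)"
  note lin = smooth_on_linear_derivative[OF f]
  have "\<forall>y\<in>V. ?D y (Z y) = 0" using Z
  proof (induction rule: lie_module.induct)
    case (generator X)
    then show ?case using 0 by blast
  next
    case (bracket X Y)
    have second: "?D y (frechet_derivative X (at y) v) + frechet_derivative (\<lambda>z. ?D z (X y)) (at y) v = 0"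
      if y: "y \<in> V" and X: "X \<in> lie_module V Xs" and X0: "\<forall>y\<in>V. ?D y (X y) = 0" for X y v
    proof -
      have sX: "smooth_on V X" using smooth_on_lie_module[OF V Xs X] .
      note dX = smooth_on_has_derivative[OF sX y]
      note dD = smooth_on_has_derivative[OF smooth_on_frechet_derivative[OF f] y]
      have e: "?D z w = (\<Sum>b\<in>Basis. (w \<bullet> b) * ?D z b)" if "z \<in> V" for z w
        using linear_basis_sum[OF lin[OF that], of w] by simp
      have "((\<lambda>z. \<Sum>b\<in>Basis. (X z \<bullet> b) * ?D z b) has_derivative
          (\<lambda>v. \<Sum>b\<in>Basis. (X y \<bullet> b) * frechet_derivative (\<lambda>z. ?D z b) (at y) v
            + (frechet_derivative X (at y) v \<bullet> b) * ?D y b)) (at y)"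
        by (intro has_derivative_sum has_derivative_mult has_derivative_inner_left dX dD)
      moreover have "((\<lambda>z. \<Sum>b\<in>Basis. (X z \<bullet> b) * ?D z b) has_derivative (\<lambda>v. 0)) (at y)"
        by (rule has_derivative_transform_within_open[OF has_derivative_const[of 0] V y]) (simp add: e[symmetric] X0)
      ultimately have "(\<lambda>v. \<Sum>b\<in>Basis. (X y \<bullet> b) * frechet_derivative (\<lambda>z. ?D z b) (at y) v
            + (frechet_derivative X (at y) v \<bullet> b) * ?D y b) = (\<lambda>v. 0)"
        by (rule has_derivative_unique)
      then have s: "(\<Sum>b\<in>Basis. (X y \<bullet> b) * frechet_derivative (\<lambda>z. ?D z b) (at y) v
            + (frechet_derivative X (at y) v \<bullet> b) * ?D y b) = 0" by (rule fun_cong)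
      have "((\<lambda>z. ?D z (X y)) has_derivative (\<lambda>v. \<Sum>b\<in>Basis. (X y \<bullet> b) * frechet_derivative (\<lambda>z. ?D z b) (at y) v)) (at y)"
      proof (rule has_derivative_transform_within_open[OF _ V y])
        show "((\<lambda>z. \<Sum>b\<in>Basis. (X y \<bullet> b) * ?D z b) has_derivative
          (\<lambda>v. \<Sum>b\<in>Basis. (X y \<bullet> b) * frechet_derivative (\<lambda>z. ?D z b) (at y) v)) (at y)"
          by (intro has_derivative_sum has_derivative_mult_right dD)
      qed (rule e[symmetric])
      then have "frechet_derivative (\<lambda>z. ?D z (X y)) (at y) v
          = (\<Sum>b\<in>Basis. (X y \<bullet> b) * frechet_derivative (\<lambda>z. ?D z b) (at y) v)"
        by (rule fun_cong[OF frechet_derivative_at[symmetric]])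
      then show ?thesis using s by (simp add: e[OF y, of "frechet_derivative X (at y) v"] sum.distrib)
    qed
    show ?case
    proof
      fix y assume y: "y \<in> V"
      have "frechet_derivative (\<lambda>z. ?D z (X y)) (at y) (Y y) = frechet_derivative (\<lambda>z. ?D z (Y y)) (at y) (X y)"
        by (rule smooth_on_symmetric_derivative[OF V f y])
      then show "?D y (lie_bracket X Y y) = 0"
        using second[OF y bracket.hyps(1) bracket.IH(1), of "Y y"] second[OF y bracket.hyps(2) bracket.IH(2), of "X y"]
        by (simp add: lie_bracket_def linear_diff[OF lin[OF y]])
    qed
  qed (simp_all add: linear_0[OF lin] linear_add[OF lin] linear_cmul[OF lin])
  then show ?thesis using y by blast
qed

text \<open>If \<nu> were nonzero, \<open>(\<nu>, 0)\<close> and \<open>(p, -1)\<close> would be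
  independent and orthogonal to the span of the module, which would give dimension at least m + 2 in
  a space of dimension m + 1, where m is \<open>DIM('e)\<close>.\<close>

lemma lie_rank_conormal_eq_0:
  fixes \<nu> p :: "'e::euclidean_space" and V :: "('e \<times> real) set"
  assumes rank: "DIM('e) \<le> lie_rank V Xs y"
    and P: "\<And>Z. Z \<in> lie_module V Xs \<Longrightarrow> (p, -1) \<bullet> Z y = 0"
    and \<nu>: "\<And>Z. Z \<in> lie_module V Xs \<Longrightarrow> (\<nu>, 0) \<bullet> Z y = 0"
  shows "\<nu> = 0"
proof (rule ccontr)
  assume "\<nu> \<noteq> 0"
  let ?A = "{(p, -1), (\<nu>, 0)} :: ('e \<times> real) set" and ?B = "{Z y | Z. Z \<in> lie_module V Xs}"
  have "independent ?A"
  proof -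
    have "(p, -1) \<notin> span {(\<nu>, 0::real)}"
      by (auto simp: span_singleton)
    then show ?thesis using \<open>\<nu> \<noteq> 0\<close> by (simp add: independent_insert zero_prod_def)
  qed
  then have "dim ?A = 2" by (simp add: dim_eq_card_independent)
  moreover have "dim (?A \<union> ?B) = dim ?A + dim ?B"
    by (rule dim_orthogonal_sum) (use P \<nu> in auto)
  moreover have "dim (?A \<union> ?B) \<le> DIM('e) + 1" using dim_subset_UNIV[of "?A \<union> ?B"] by simp
  moreover have "DIM('e) \<le> dim ?B" using rank by (simp add: lie_rank_def)
  ultimately show False by linarith
qed

section \<open>Horizontal sections annihilated by a covector field\<close>

lemma bilinear_basis_sum:
  fixes B :: "'e::euclidean_space \<Rightarrow> 'e \<Rightarrow> real"
  assumes "bilinear B"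
  shows "B v w = (\<Sum>a\<in>Basis. \<Sum>b\<in>Basis. ((v \<bullet> a) * (w \<bullet> b)) * B a b)"
proof -
  have l: "linear (\<lambda>v. B v w)" "\<And>v. linear (B v)" using assms by (auto simp: bilinear_def)
  have "B v w = (\<Sum>a\<in>Basis. (v \<bullet> a) * B a w)" using linear_basis_sum[OF l(1), of v] by simp
  also have "\<dots> = (\<Sum>a\<in>Basis. (v \<bullet> a) * (\<Sum>b\<in>Basis. (w \<bullet> b) * B a b))"
    by (intro sum.cong refl) (simp add: linear_basis_sum[OF l(2), of _ w])
  finally show ?thesis by (simp add: sum_distrib_left mult.assoc)
qed

lemma smooth_on_bilinear_form:
  fixes B :: "'d::euclidean_space \<Rightarrow> 'e::euclidean_space \<Rightarrow> 'e \<Rightarrow> real"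
  assumes V: "open V" and B: "\<And>z. z \<in> V \<Longrightarrow> bilinear (B z)" "\<And>a b. smooth_on V (\<lambda>z. B z a b)"
    and FG: "smooth_on V F" "smooth_on V G"
  shows "smooth_on V (\<lambda>z. B z (F z) (G z))"
proof -
  have "smooth_on V (\<lambda>z. \<Sum>a\<in>Basis. \<Sum>b\<in>Basis. ((F z \<bullet> a) * (G z \<bullet> b)) * B z a b)"
    by (intro smooth_on_sum V smooth_on_mult B(2) smooth_on_bounded_linear[OF V bounded_linear_inner_left] FG)
  then show ?thesis
    by (subst smooth_on_cong[OF V]) (rule bilinear_basis_sum[OF B(1)])
qed

lemma blinfun_inner_right_surj: "\<exists>a. \<eta> = blinfun_inner_right a" for \<eta> :: "'e::euclidean_space \<Rightarrow>\<^sub>L real"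
proof
  show "\<eta> = blinfun_inner_right (\<Sum>b\<in>Basis. blinfun_apply \<eta> b *\<^sub>R b)"
    by (subst blinfun_eq_sum_Basis[of \<eta>])
      (simp add: linear_sum[OF bounded_linear.linear[OF bounded_linear_blinfun_inner_right]]
        linear_cmul[OF bounded_linear.linear[OF bounded_linear_blinfun_inner_right]])
qed

text \<open>The Euclidean inner product identifies covectors with vectors; this is the cometric as a
  matrix in the coordinates.\<close>

definition vec_form :: "'e::euclidean_space coinner \<Rightarrow> 'e \<Rightarrow> 'e \<Rightarrow> real" where
  "vec_form \<gamma> a b = \<gamma> (blinfun_inner_right a) (blinfun_inner_right b)"

lemma bilinear_vec_form: "bilinear \<gamma> \<Longrightarrow> bilinear (vec_form \<gamma>)"
  unfolding bilinear_def vec_form_def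
  using linear_compose[OF bounded_linear.linear[OF bounded_linear_blinfun_inner_right]]
  by (auto simp: o_def)

lemma inner_sharp:
  assumes "bilinear \<gamma>"
  shows "v \<bullet> sharp \<gamma> (blinfun_inner_right a) = vec_form \<gamma> v a"
  using sharp_eq(2)[of \<gamma> "blinfun_inner_right v" "blinfun_inner_right a"] assms
  by (simp add: bilinear_def vec_form_def)

lemma sharp_vec_form:
  assumes "bilinear \<gamma>"
  shows "sharp \<gamma> (blinfun_inner_right a) = (\<Sum>b\<in>Basis. vec_form \<gamma> b a *\<^sub>R b)"
  using sharp_eq(1)[of \<gamma> "blinfun_inner_right a"] assms
  by (simp add: bilinear_def vec_form_def)

lemma horizontal_eq: "horizontal \<gamma> = range (\<lambda>a. sharp \<gamma> (blinfun_inner_right a))"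
proof (intro equalityI subsetI)
  fix v assume "v \<in> horizontal \<gamma>"
  then obtain \<eta> where "v = sharp \<gamma> \<eta>" by (auto simp: horizontal_def)
  moreover obtain a where "\<eta> = blinfun_inner_right a" using blinfun_inner_right_surj by blast
  ultimately show "v \<in> range (\<lambda>a. sharp \<gamma> (blinfun_inner_right a))" by simp
qed (auto simp: horizontal_def)

lemma linear_sharp:
  assumes "bilinear \<gamma>"
  shows "linear (\<lambda>a. sharp \<gamma> (blinfun_inner_right a))"
proof -
  note b = bilinear_vec_form[OF assms]
  show ?thesis
    by (intro linearI) (simp_all add: sharp_vec_form[OF assms] bilinear_radd[OF b] bilinear_rmul[OF b]
      scaleR_add_left sum.distrib scaleR_sum_right)
qed

text \<open>Diagonal dominance of the matrix of the numbers \<open>e' \<bullet> F e\<close>: the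
  diagonal exceeds q/2, while the threshold makes the other entries of a row add up to at most q/2,
  so the largest coefficient of a vanishing combination is zero.\<close>

lemma list_independent_near_orthonormal:
  fixes F :: "'e::euclidean_space \<Rightarrow> 'e"
  assumes E: "finite E" and q: "0 < q"
    and near: "\<And>e e'. e \<in> E \<Longrightarrow> e' \<in> E \<Longrightarrow> \<bar>e' \<bullet> F e - (if e = e' then q else 0)\<bar> < q / (2 * (real (card E) + 1))"
  shows "inj_on F E" "independent (F ` E)"
proof -
  let ?\<epsilon> = "q / (2 * (real (card E) + 1))"
  have e2: "?\<epsilon> \<le> q / 2" using q by (simp add: field_simps)
  show inj: "inj_on F E"
  proof (rule inj_onI, rule ccontr)
    fix e e' assume e: "e \<in> E" "e' \<in> E" "F e = F e'" "e \<noteq> e'"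
    have "\<bar>e \<bullet> F e - q\<bar> < ?\<epsilon>" using near[OF e(1) e(1)] by simp
    moreover have "\<bar>e \<bullet> F e'\<bar> < ?\<epsilon>" using near[OF e(2) e(1)] e(4) by simp
    ultimately show False using e2 unfolding e(3) by linarith
  qed
  have fin: "finite (F ` E)" using E by simp
  show "independent (F ` E)"
  proof (rule independent_if_scalars_zero[OF fin])
    fix f x assume s: "(\<Sum>x\<in>F ` E. f x *\<^sub>R x) = 0" and x: "x \<in> F ` E"
    define c where "c e = f (F e)" for e
    have s0: "(\<Sum>e\<in>E. c e *\<^sub>R F e) = 0" using s by (simp add: sum.reindex[OF inj] c_def)
    have ne: "E \<noteq> {}" using x by auto
    obtain m where m: "m \<in> E" "\<And>e. e \<in> E \<Longrightarrow> \<bar>c e\<bar> \<le> \<bar>c m\<bar>"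
      using Max_in[of "(\<lambda>e. \<bar>c e\<bar>) ` E"] Max_ge[of "(\<lambda>e. \<bar>c e\<bar>) ` E"] E ne by fastforce
    have "0 = m \<bullet> (\<Sum>e\<in>E. c e *\<^sub>R F e)" by (simp add: s0)
    also have "\<dots> = (\<Sum>e\<in>E. c e * (m \<bullet> F e))" by (simp add: inner_sum_right)
    also have "\<dots> = c m * (m \<bullet> F m) + (\<Sum>e\<in>E - {m}. c e * (m \<bullet> F e))" using E m(1) by (simp add: sum.remove)
    finally have eq: "c m * (m \<bullet> F m) = - (\<Sum>e\<in>E - {m}. c e * (m \<bullet> F e))" by simp
    have "\<bar>\<Sum>e\<in>E - {m}. c e * (m \<bullet> F e)\<bar> \<le> (\<Sum>e\<in>E - {m}. \<bar>c m\<bar> * ?\<epsilon>)"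
    proof (rule order_trans[OF sum_abs], rule sum_mono)
      fix e assume e: "e \<in> E - {m}"
      then have "\<bar>m \<bullet> F e\<bar> \<le> ?\<epsilon>" using near[of e m] m(1) by auto
      then show "\<bar>c e * (m \<bullet> F e)\<bar> \<le> \<bar>c m\<bar> * ?\<epsilon>" unfolding abs_mult using e m(2) by (intro mult_mono) auto
    qed
    also have "\<dots> \<le> \<bar>c m\<bar> * (q / 2)"
    proof -
      have "real (card (E - {m})) \<le> real (card E)" using E by (simp add: card_mono)
      then have "real (card (E - {m})) * ?\<epsilon> \<le> real (card E) * ?\<epsilon>" using q by (intro mult_right_mono) auto
      also have "\<dots> \<le> q / 2" using q by (simp add: field_simps)
      finally have "\<bar>c m\<bar> * (real (card (E - {m})) * ?\<epsilon>) \<le> \<bar>c m\<bar> * (q / 2)" by (intro mult_left_mono) auto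
      then show ?thesis by (simp add: mult_ac)
    qed
    finally have "\<bar>c m\<bar> * \<bar>m \<bullet> F m\<bar> \<le> \<bar>c m\<bar> * (q / 2)" using eq by (metis abs_minus_cancel abs_mult)
    moreover have "\<bar>m \<bullet> F m - q\<bar> < ?\<epsilon>" using near[OF m(1) m(1)] by simp
    then have "q / 2 < \<bar>m \<bullet> F m\<bar>" using e2 by linarith
    ultimately have "c m = 0" by (metis abs_ge_zero less_eq_real_def linorder_not_le mult_less_cancel_left_pos zero_less_abs_iff)
    then have "c e = 0" if "e \<in> E" for e using m(2)[OF that] by simp
    then show "f x = 0" using x by (auto simp: c_def)
  qed
qed

text \<open>An orthonormal family of \<open>r\<close> horizontal vectors orthogonal to
  \<open>P y\<close> is extended by keeping the covectors that produce it fixed and correcting them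
  along \<open>P\<close>. Independence at \<open>y\<close> persists nearby by diagonal dominance.
  The conormal of a graph will take the place of \<open>P\<close>.\<close>

lemma adapted_sections:
  fixes \<gamma> :: "'e::euclidean_space \<Rightarrow> 'e coinner" and P :: "'e \<Rightarrow> 'e"
  assumes V0: "open V0" "y \<in> V0" and bil: "\<And>z. z \<in> V0 \<Longrightarrow> bilinear (\<gamma> z)"
    and sym: "\<And>z \<omega> \<eta>. z \<in> V0 \<Longrightarrow> \<gamma> z \<omega> \<eta> = \<gamma> z \<eta> \<omega>"
    and sm: "\<And>\<omega> \<eta>. smooth_on V0 (\<lambda>z. \<gamma> z \<omega> \<eta>)" and P: "smooth_on V0 P"
    and pos: "0 < vec_form (\<gamma> y) (P y) (P y)" and dim: "dim (horizontal (\<gamma> y)) = Suc r"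
  obtains V Xs where "open V" "y \<in> V" "V \<subseteq> V0" "length Xs = r" "independent_sections \<gamma> V Xs"
    "\<And>X z. X \<in> set Xs \<Longrightarrow> z \<in> V \<Longrightarrow> P z \<bullet> X z = 0"
proof -
  define B where "B z = vec_form (\<gamma> z)" for z
  define sh where "sh z a = sharp (\<gamma> z) (blinfun_inner_right a)" for z a
  have bB: "bilinear (B z)" if "z \<in> V0" for z using bilinear_vec_form[OF bil[OF that]] by (simp add: B_def)
  have sB: "smooth_on V0 (\<lambda>z. B z a b)" for a b by (simp add: B_def vec_form_def sm)
  note sBF = smooth_on_bilinear_form[of V0 B, OF V0(1) bB sB]
  have ish: "v \<bullet> sh z a = B z v a" if "z \<in> V0" for v z a
    using inner_sharp[OF bil[OF that]] by (simp add: sh_def B_def)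
  have ssh: "smooth_on V0 (\<lambda>z. sh z (F z))" if "smooth_on V0 F" for F
  proof -
    have "smooth_on V0 (\<lambda>z. \<Sum>b\<in>Basis. B z b (F z) *\<^sub>R b)"
      by (intro smooth_on_sum V0(1) smooth_on_scaleR sBF that smooth_on_const)
    moreover have "sh z (F z) = (\<Sum>b\<in>Basis. B z b (F z) *\<^sub>R b)" if "z \<in> V0" for z
      using that by (simp add: sh_def B_def sharp_vec_form[OF bil])
    ultimately show ?thesis using smooth_on_cong[OF V0(1), of "\<lambda>z. sh z (F z)"] by simp
  qed
  define Q where "Q z = B z (P z) (P z)" for z
  define W where "W = horizontal (\<gamma> y) \<inter> {v. P y \<bullet> v = 0}"
  have subh: "subspace (horizontal (\<gamma> y))"
    unfolding horizontal_eq by (rule linear_subspace_image[OF linear_sharp[OF bil[OF V0(2)]] subspace_UNIV])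
  have subW: "subspace W" unfolding W_def by (intro subspace_inter subh subspace_hyperplane)
  have "P y \<noteq> 0" using pos bilinear_lzero[OF bB[OF V0(2)]] by (auto simp: B_def)
  then have dh: "dim {v. P y \<bullet> v = 0} = DIM('e) - 1" by (rule dim_hyperplane)
  \<comment> \<open>A hyperplane cuts the dimension of the horizontal space by at most one.\<close>
  have "r \<le> dim W"
    using dim_sums_Int[OF subh subspace_hyperplane[of "P y"]] dim dh
      dim_subset_UNIV[of "{x + z |x z. x \<in> horizontal (\<gamma> y) \<and> z \<in> {v. P y \<bullet> v = 0}}"]
      DIM_positive[where 'a = 'e]
    unfolding W_def by linarith
  obtain E0 where E0: "E0 \<subseteq> W" "pairwise orthogonal E0" "\<And>x. x \<in> E0 \<Longrightarrow> norm x = 1" "card E0 = dim W"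
    by (rule orthonormal_basis_subspace[OF subW]) (rule that)
  obtain E where E: "E \<subseteq> E0" "card E = r" "finite E"
    using obtain_subset_with_card_n[of r E0] \<open>r \<le> dim W\<close> E0(4) by metis
  obtain es where es: "distinct es" "set es = E" using finite_distinct_list[OF E(3)] by blast
  have "\<forall>e\<in>E. \<exists>a. e = sh y a" using E(1) E0(1) by (auto simp: W_def horizontal_eq sh_def)
  then obtain \<omega> where \<omega>: "\<And>e. e \<in> E \<Longrightarrow> e = sh y (\<omega> e)" by metis
  \<comment> \<open>The covector \<open>\<omega> e\<close> is made orthogonal to \<open>P\<close>
    for the form \<open>B\<close> and scaled by \<open>Q\<close>, which avoids a division; at
    \<open>y\<close> the result is \<open>Q y\<close> times \<open>e\<close>.\<close>
  define X where "X e z = Q z *\<^sub>R sh z (\<omega> e) - B z (\<omega> e) (P z) *\<^sub>R sh z (P z)" for e z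
  have sX: "smooth_on V0 (X e)" for e
    unfolding X_def Q_def
    by (intro smooth_on_diff smooth_on_scaleR V0(1) sBF ssh P smooth_on_const)
  have Xy: "X e y = Q y *\<^sub>R e" if "e \<in> E" for e
  proof -
    have "P y \<bullet> e = 0" using that E(1) E0(1) by (auto simp: W_def)
    then have "B y (P y) (\<omega> e) = 0" using ish[OF V0(2), of "P y" "\<omega> e"] \<omega>[OF that] by simp
    then have "B y (\<omega> e) (P y) = 0" by (simp add: B_def vec_form_def sym[OF V0(2)])
    then show ?thesis using \<omega>[OF that] by (simp add: X_def)
  qed
  have PX: "P z \<bullet> X e z = 0" if "z \<in> V0" for e z
  proof -
    have "P z \<bullet> X e z = Q z * B z (P z) (\<omega> e) - B z (\<omega> e) (P z) * Q z"
      by (simp add: X_def inner_diff_right ish[OF that] Q_def)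
    then show ?thesis by (simp add: B_def vec_form_def sym[OF that])
  qed
  have Qpos: "0 < Q y" using pos by (simp add: Q_def B_def)
  define \<epsilon> where "\<epsilon> = Q y / (2 * (real (card E) + 1))"
  have \<epsilon>: "0 < \<epsilon>" using Qpos by (simp add: \<epsilon>_def)
  define V where "V = (\<Inter>(e, e')\<in>E \<times> E. {z \<in> V0. \<bar>e' \<bullet> X e z - (if e = e' then Q y else 0)\<bar> < \<epsilon>}) \<inter> V0"
  have "open {z \<in> V0. \<bar>e' \<bullet> X e z - k\<bar> < \<epsilon>}" for e e' k
  proof -
    have "continuous_on V0 (\<lambda>z. \<bar>e' \<bullet> X e z - k\<bar>)"
      by (intro continuous_intros smooth_on_continuous_on[OF sX])
    then have "open ((\<lambda>z. \<bar>e' \<bullet> X e z - k\<bar>) -` {..<\<epsilon>} \<inter> V0)"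
      by (rule continuous_on_open_vimage[OF V0(1), THEN iffD1, rule_format]) (rule open_lessThan)
    moreover have "(\<lambda>z. \<bar>e' \<bullet> X e z - k\<bar>) -` {..<\<epsilon>} \<inter> V0 = {z \<in> V0. \<bar>e' \<bullet> X e z - k\<bar> < \<epsilon>}" by auto
    ultimately show ?thesis by simp
  qed
  then have "open V" unfolding V_def
    by (intro open_Int open_INT V0(1) finite_cartesian_product E(3)) (simp add: split_beta)
  have on: "e' \<bullet> e = (if e = e' then 1 else 0)" if "e \<in> E" "e' \<in> E" for e e'
  proof -
    have "e \<in> E0" "e' \<in> E0" using that E(1) by auto
    then show ?thesis using E0(2) E0(3)[of e] by (auto simp: pairwise_def orthogonal_def norm_eq_1)
  qed
  have "y \<in> V" unfolding V_def using V0(2) \<epsilon> by (auto simp: Xy on)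
  have "V \<subseteq> V0" by (auto simp: V_def)
  have near: "\<bar>e' \<bullet> X e z - (if e = e' then Q y else 0)\<bar> < Q y / (2 * (real (card E) + 1))"
    if "z \<in> V" "e \<in> E" "e' \<in> E" for z e e'
    using that unfolding V_def \<epsilon>_def by auto
  note ind = list_independent_near_orthonormal[OF E(3) Qpos near]
  have hor: "X e z \<in> horizontal (\<gamma> z)" if "z \<in> V" for e z
  proof -
    have z: "z \<in> V0" using that \<open>V \<subseteq> V0\<close> by blast
    have sub: "subspace (horizontal (\<gamma> z))"
      unfolding horizontal_eq by (rule linear_subspace_image[OF linear_sharp[OF bil[OF z]] subspace_UNIV])
    have "sh z a \<in> horizontal (\<gamma> z)" for a by (simp add: sh_def horizontal_eq)
    then show ?thesis unfolding X_def by (intro subspace_diff subspace_scale sub)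
  qed
  have 1: "independent_sections \<gamma> V (map X es)"
    unfolding independent_sections_def
  proof (intro conjI ballI)
    fix Y z assume "Y \<in> set (map X es)" "z \<in> V"
    then show "Y z \<in> horizontal (\<gamma> z)" using hor by auto
  next
    fix Y assume "Y \<in> set (map X es)"
    then show "smooth_on V Y" using smooth_on_subset[OF sX \<open>V \<subseteq> V0\<close>] by auto
  next
    fix z assume z: "z \<in> V"
    have "distinct (map (\<lambda>e. X e z) es)" using ind(1)[OF z] es by (simp add: distinct_map)
    then show "distinct (map (\<lambda>Y. Y z) (map X es))" by (simp add: o_def)
    show "independent (set (map (\<lambda>Y. Y z) (map X es)))"
      using ind(2)[OF z] es(2) by (simp add: image_image)
  qed
  have 2: "length (map X es) = r" using es E(2) by (simp add: distinct_card[symmetric])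
  have 3: "P z \<bullet> Y z = 0" if "Y \<in> set (map X es)" "z \<in> V" for Y z
    using PX \<open>V \<subseteq> V0\<close> that by auto
  show ?thesis
  proof (rule that[of V "map X es", OF \<open>open V\<close> \<open>y \<in> V\<close> \<open>V \<subseteq> V0\<close> 2 1])
    fix Y z assume "Y \<in> set (map X es)" "z \<in> V"
    then show "P z \<bullet> Y z = 0" by (rule 3[of Y z])
  qed
qed

section \<open>The comparison operator\<close>

lemma bilinear_psd_Cauchy_Schwarz:
  fixes c :: "'e::real_vector \<Rightarrow> 'e \<Rightarrow> real"
  assumes bil: "bilinear c" and sym: "\<And>a b. c a b = c b a" and psd: "\<And>a. 0 \<le> c a a"
  shows "(c a b)\<^sup>2 \<le> c a a * c b b"
proof -
  have q: "0 \<le> c a a - 2 * t * c a b + t\<^sup>2 * c b b" for t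
    using psd[of "a - t *\<^sub>R b"]
    by (simp add: bilinear_lsub[OF bil] bilinear_rsub[OF bil] bilinear_lmul[OF bil] bilinear_rmul[OF bil]
        sym[of b a] power2_eq_square algebra_simps)
  show ?thesis
  proof (cases "c b b = 0")
    case True
    have "c a b = 0"
    proof (rule ccontr)
      assume "c a b \<noteq> 0"
      \<comment> \<open>With \<open>c b b = 0\<close> the quadratic is affine in t, and at this t it
        equals -1.\<close>
      then show False using q[of "(c a a + 1) / (2 * c a b)"] True by (simp add: field_simps)
    qed
    then show ?thesis using True by simp
  next
    case False
    then have p: "0 < c b b" using psd[of b] by linarith
    have "0 \<le> c a a - (c a b)\<^sup>2 / c b b"
      using q[of "c a b / c b b"] p by (simp add: field_simps power2_eq_square)
    then show ?thesis using p by (simp add: field_simps)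
  qed
qed

text \<open>Lagrange's reduction by completing squares: one basis direction after the other is
  removed, \<open>D\<close> containing those on which the form may still be nonzero. A direction of
  square zero is null by Cauchy-Schwarz.\<close>

lemma bilinear_psd_sum_of_squares:
  fixes c :: "'e::euclidean_space \<Rightarrow> 'e \<Rightarrow> real"
  assumes "bilinear c" and "\<And>a b. c a b = c b a" and "\<And>a. 0 \<le> c a a"
  obtains ss where "\<And>a b. c a b = (\<Sum>s\<leftarrow>ss. (s \<bullet> a) * (s \<bullet> b))"
proof -
  have "\<exists>ss. \<forall>a b. c a b = (\<Sum>s\<leftarrow>ss. (s \<bullet> a) * (s \<bullet> b))"
    if "finite D" "bilinear c" "\<And>a b. c a b = c b a" "\<And>a. 0 \<le> c a a"
      "\<And>b \<xi>. b \<in> Basis - D \<Longrightarrow> c b \<xi> = 0" for D and c :: "'e \<Rightarrow> 'e \<Rightarrow> real"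
    using that
  proof (induction D arbitrary: c rule: finite_induct)
    case empty
    have "c a b = 0" for a b
      by (subst bilinear_basis_sum[OF empty(1)]) (simp add: empty(4))
    then show ?case by (intro exI[of _ "[]"]) simp
  next
    case (insert d D)
    note bil = insert.prems(1) and sym = insert.prems(2) and psd = insert.prems(3)
    note CS = bilinear_psd_Cauchy_Schwarz[OF bil sym psd]
    show ?case
    proof (cases "c d d = 0")
      case True
      then have "c d \<xi> = 0" for \<xi> using CS[of d \<xi>] by simp
      then have z: "c b \<xi> = 0" if "b \<in> Basis - D" for b \<xi>
        using that insert.prems(4)[of b \<xi>] by (cases "b = d") auto
      show ?thesis by (rule insert.IH[OF bil sym psd z])
    next
      case False
      then have p: "0 < c d d" using psd[of d] by linarith
      define c' where "c' a b = c a b - c a d * c b d / c d d" for a b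
      have "bilinear c'"
        unfolding bilinear_def c'_def
        by (auto intro!: linearI simp: bilinear_ladd[OF bil] bilinear_radd[OF bil] bilinear_lmul[OF bil]
            bilinear_rmul[OF bil] algebra_simps add_divide_distrib diff_divide_distrib)
      moreover have "c' a b = c' b a" for a b by (simp add: c'_def sym[of a b] mult.commute)
      moreover have "0 \<le> c' a a" for a
        using CS[of a d] p by (simp add: c'_def field_simps power2_eq_square)
      moreover have "c' b \<xi> = 0" if "b \<in> Basis - D" for b \<xi>
        using that insert.prems(4) p by (cases "b = d") (auto simp: c'_def sym[of \<xi> d])
      ultimately obtain ss where ss: "\<And>a b. c' a b = (\<Sum>s\<leftarrow>ss. (s \<bullet> a) * (s \<bullet> b))"
        using insert.IH[of c'] by metis
      define s where "s = (\<Sum>b\<in>Basis. (c b d / sqrt (c d d)) *\<^sub>R b)"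
      have sa: "s \<bullet> a = c a d / sqrt (c d d)" for a
      proof -
        have l: "linear (\<lambda>a. c a d)" using bil by (simp add: bilinear_def)
        have "c a d = (\<Sum>b\<in>Basis. (a \<bullet> b) * c b d)" using linear_basis_sum[OF l, of a] by simp
        moreover have "s \<bullet> a = (\<Sum>b\<in>Basis. (a \<bullet> b) * c b d / sqrt (c d d))"
          unfolding s_def inner_sum_left by (intro sum.cong refl) (simp add: inner_commute)
        ultimately show ?thesis by (simp add: sum_divide_distrib)
      qed
      have "c a b = (\<Sum>s\<leftarrow>s # ss. (s \<bullet> a) * (s \<bullet> b))" for a b
        using ss[of a b] p by (simp add: sa c'_def)
      then show ?thesis by blast
    qed
  qed
  from this[OF finite_Basis assms] obtain ss where "\<forall>a b. c a b = (\<Sum>s\<leftarrow>ss. (s \<bullet> a) * (s \<bullet> b))" by auto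
  then show ?thesis using that by blast
qed

text \<open>With the form written as a sum of squares of functionals given by vectors s, the trace
  becomes the sum of the numbers \<open>s \<bullet> M s\<close>. It gives the sign of the second
  order term at a minimum.\<close>

lemma bilinear_psd_trace_nonneg:
  fixes c :: "'e::euclidean_space \<Rightarrow> 'e \<Rightarrow> real"
  assumes c: "bilinear c" "\<And>a b. c a b = c b a" "\<And>a. 0 \<le> c a a"
    and M: "linear M" "\<And>\<xi>. 0 \<le> M \<xi> \<bullet> \<xi>"
  shows "0 \<le> (\<Sum>b\<in>Basis. c b (M b))"
proof -
  obtain ss where ss: "\<And>a b. c a b = (\<Sum>s\<leftarrow>ss. (s \<bullet> a) * (s \<bullet> b))"
    by (rule bilinear_psd_sum_of_squares[OF c]) (rule that)
  have "(\<Sum>b\<in>Basis. c b (M b)) = (\<Sum>s\<leftarrow>ss. \<Sum>b\<in>Basis. (s \<bullet> b) * (s \<bullet> M b))"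
    unfolding ss by (induction ss) (auto simp: sum.distrib)
  also have "\<dots> = (\<Sum>s\<leftarrow>ss. s \<bullet> M s)"
    by (subst (2) linear_basis_sum[OF M(1)]) (simp add: inner_sum_right)
  also have "0 \<le> (\<Sum>s\<leftarrow>ss. s \<bullet> M s)"
    using M(2) by (intro sum_list_nonneg) (auto simp: inner_commute)
  finally show ?thesis .
qed

section \<open>Gradients, local minima and the flux operator\<close>

definition grad :: "('e::euclidean_space \<Rightarrow> real) \<Rightarrow> 'e \<Rightarrow> 'e" where
  "grad w x = (\<Sum>b\<in>Basis. frechet_derivative w (at x) b *\<^sub>R b)"

lemma smooth_on_grad: "open U \<Longrightarrow> smooth_on U w \<Longrightarrow> smooth_on U (grad w)"
  unfolding grad_def[abs_def]
  by (intro smooth_on_sum smooth_on_scaleR smooth_on_frechet_derivative smooth_on_const)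

lemma grad_inner:
  assumes "smooth_on U w" "x \<in> U"
  shows "frechet_derivative w (at x) v = grad w x \<bullet> v"
  using linear_basis_sum[OF smooth_on_linear_derivative[OF assms], of v]
  by (simp add: grad_def inner_sum_left inner_commute[of v] mult.commute)

lemma grad_has_derivative:
  assumes "smooth_on U w" "x \<in> U"
  shows "(w has_derivative (\<lambda>v. grad w x \<bullet> v)) (at x)"
proof -
  have "frechet_derivative w (at x) = (\<lambda>v. grad w x \<bullet> v)" by (rule ext) (rule grad_inner[OF assms])
  then show ?thesis using smooth_on_has_derivative[OF assms] by simp
qed

text \<open>Second derivative test along the line in direction \<xi>: a negative slope of the
  derivative at the minimum would make \<open>f\<close> decrease right after it.\<close>

lemma local_min_derivatives:
  fixes f :: "'e::euclidean_space \<Rightarrow> real"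
  assumes s: "0 < s" and f: "\<And>x. x \<in> ball x1 s \<Longrightarrow> (f has_derivative (\<lambda>\<xi>. g x \<bullet> \<xi>)) (at x)"
    and g: "(g has_derivative g') (at x1)" and min: "\<And>x. x \<in> ball x1 s \<Longrightarrow> f x1 \<le> f x"
  shows "g x1 = 0" "0 \<le> g' \<xi> \<bullet> \<xi>"
proof -
  have "(\<lambda>\<xi>. g x1 \<bullet> \<xi>) = (\<lambda>v. 0)"
    by (rule differential_zero_maxmin[of x1 "ball x1 s" f]) (use s f min in auto)
  then have "g x1 \<bullet> g x1 = 0" by (rule fun_cong)
  then show g0: "g x1 = 0" by simp
  show "0 \<le> g' \<xi> \<bullet> \<xi>"
  proof (rule ccontr)
    assume neg: "\<not> 0 \<le> g' \<xi> \<bullet> \<xi>"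
    have n0: "\<xi> \<noteq> 0" using neg by auto
    define \<phi> where "\<phi> t = f (x1 + t *\<^sub>R \<xi>)" for t :: real
    define \<psi> where "\<psi> t = g (x1 + t *\<^sub>R \<xi>) \<bullet> \<xi>" for t :: real
    have l: "((\<lambda>t. x1 + t *\<^sub>R \<xi>) has_derivative (\<lambda>h. h *\<^sub>R \<xi>)) (at t)" for t :: real
      by (auto intro!: derivative_eq_intros)
    have inb: "x1 + t *\<^sub>R \<xi> \<in> ball x1 s" if "\<bar>t\<bar> < s / norm \<xi>" for t
      using that n0 by (simp add: dist_norm field_simps)
    have d\<phi>: "(\<phi> has_real_derivative \<psi> t) (at t)" if "\<bar>t\<bar> < s / norm \<xi>" for t
      using has_derivative_compose[OF l f[OF inb[OF that]]]
      by (simp add: has_field_derivative_def \<phi>_def[abs_def] \<psi>_def mult_commute_abs)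
    have "linear g'" using g by (rule has_derivative_linear)
    moreover have "(g has_derivative g') (at (x1 + 0 *\<^sub>R \<xi>))" using g by simp
    note has_derivative_inner_left[OF has_derivative_compose[OF l this], of \<xi>]
    ultimately have "(\<psi> has_real_derivative g' \<xi> \<bullet> \<xi>) (at 0)"
      by (simp add: has_field_derivative_def \<psi>_def[abs_def] mult_commute_abs linear_cmul)
    from DERIV_neg_dec_right[OF this] neg obtain d where d: "0 < d" "\<And>h. 0 < h \<Longrightarrow> h < d \<Longrightarrow> \<psi> h < \<psi> 0"
      by auto
    define k where "k = s / norm \<xi>"
    have "0 < k" using s n0 by (simp add: k_def)
    define t where "t = min d k / 2"
    have "0 < t" "t < d" "t < k" using d(1) \<open>0 < k\<close> by (auto simp: t_def min_def)
    then have t: "0 < t" "t < d" "t < s / norm \<xi>" by (auto simp: k_def)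
    obtain \<theta> where \<theta>: "0 < \<theta>" "\<theta> < t" "\<phi> t - \<phi> 0 = (t - 0) * \<psi> \<theta>"
      using MVT2[of 0 t \<phi> \<psi>] d\<phi> t by auto
    have "\<psi> \<theta> < 0" using d(2)[of \<theta>] \<theta> t(2) by (simp add: \<psi>_def g0)
    then have "\<phi> t < \<phi> 0" using \<theta>(3) mult_pos_neg[OF t(1), of "\<psi> \<theta>"] by simp
    moreover have "\<phi> 0 \<le> \<phi> t" using min[OF inb[of t]] t by (simp add: \<phi>_def)
    ultimately show False by simp
  qed
qed

text \<open>\<open>B x\<close> is the cometric and \<open>A\<close> the density, both independent of the last coordinate; \<open>(grad w x, -1)\<close>
  is the conormal of the graph of \<open>w\<close> and \<open>Q\<close> its squared length. The \<open>symbol\<close> is the derivative of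
  the flux in the gradient.\<close>

locale cometric_box =
  fixes U :: "'e::euclidean_space set" and B :: "'e \<Rightarrow> 'e \<times> real \<Rightarrow> 'e \<times> real \<Rightarrow> real" and A :: "'e \<Rightarrow> real"
  assumes open_U: "open U"
    and bil: "x \<in> U \<Longrightarrow> bilinear (B x)"
    and sym: "x \<in> U \<Longrightarrow> B x a b = B x b a"
    and psd: "x \<in> U \<Longrightarrow> 0 \<le> B x a a"
    and smooth_B: "smooth_on U (\<lambda>x. B x a b)"
    and smooth_A: "smooth_on U A"
    and A_pos: "x \<in> U \<Longrightarrow> 0 < A x"
begin

definition Q :: "'e \<times> 'e \<Rightarrow> real" where "Q z = B (fst z) (snd z, -1) (snd z, -1)"

text \<open>The component along \<open>a\<close> of density times raised unit conormal, for a graph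
  with gradient \<open>snd z\<close>. Only base directions occur: nothing depends on the last
  coordinate, so the derivative of the vertical component in that coordinate is zero.\<close>

definition flux :: "'e \<Rightarrow> 'e \<times> 'e \<Rightarrow> real" where
  "flux a z = A (fst z) * B (fst z) (a, 0) (snd z, -1) * Q z powr (- (1/2))"

definition divergence :: "('e \<Rightarrow> real) \<Rightarrow> 'e \<Rightarrow> real" where
  "divergence w x = (\<Sum>b\<in>Basis. frechet_derivative (\<lambda>x. flux b (x, grad w x)) (at x) b)"

definition symbol :: "'e \<times> 'e \<Rightarrow> 'e \<Rightarrow> 'e \<Rightarrow> real" where
  "symbol z a \<xi> = A (fst z) * Q z powr (- (3/2)) *
     (B (fst z) (a, 0) (\<xi>, 0) * Q z - B (fst z) (a, 0) (snd z, -1) * B (fst z) (\<xi>, 0) (snd z, -1))"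

definition regular :: "('e \<times> 'e) set" where "regular = {z. fst z \<in> U \<and> 0 < Q z}"

lemma Cauchy_Schwarz: "x \<in> U \<Longrightarrow> (B x a b)\<^sup>2 \<le> B x a a * B x b b"
  by (rule bilinear_psd_Cauchy_Schwarz[OF bil sym psd])

lemma smooth_covector: "open S \<Longrightarrow> smooth_on S (\<lambda>z::'e \<times> 'e. (snd z, -1::real))"
proof -
  assume S: "open S"
  have "bounded_linear (\<lambda>z::'e \<times> 'e. (snd z, 0::real))"
    by (intro bounded_linear_Pair bounded_linear_snd bounded_linear_zero)
  from smooth_on_add[OF S bounded_linear_smooth_on[OF S this] smooth_on_const[of S "(0, -1)"]]
  show ?thesis by simp
qed

lemma smooth_form:
  assumes "smooth_on (fst -` U) F" "smooth_on (fst -` U) G"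
  shows "smooth_on (fst -` U :: ('e \<times> 'e) set) (\<lambda>z. B (fst z) (F z) (G z))"
  by (rule smooth_on_bilinear_form[OF open_vimage_fst[OF open_U] _ _ assms])
    (auto intro: bil smooth_on_linear_compose[OF open_U bounded_linear_fst smooth_B])

lemma smooth_Q: "smooth_on (fst -` U) Q"
  unfolding Q_def[abs_def] by (intro smooth_form smooth_covector open_vimage_fst open_U)

lemma open_regular: "open regular"
proof -
  have "open (Q -` {0<..} \<inter> fst -` U)"
    by (rule continuous_on_open_vimage[OF open_vimage_fst[OF open_U], THEN iffD1, rule_format])
      (auto intro: smooth_on_continuous_on smooth_Q)
  moreover have "regular = Q -` {0<..} \<inter> fst -` U" by (auto simp: regular_def)
  ultimately show ?thesis by simp
qed

lemma regular_sub: "regular \<subseteq> fst -` U" by (auto simp: regular_def)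

lemma smooth_flux: "smooth_on regular (flux a)"
  unfolding flux_def[abs_def]
  by (intro smooth_on_mult open_regular smooth_on_powr smooth_on_subset[OF smooth_Q regular_sub]
      smooth_on_subset[OF smooth_form regular_sub]
      smooth_on_subset[OF smooth_on_linear_compose[OF open_U bounded_linear_fst smooth_A] regular_sub]
      smooth_covector open_vimage_fst open_U smooth_on_const) (auto simp: regular_def)

lemma flux_vertical_derivative:
  assumes z: "z \<in> regular"
  shows "frechet_derivative (flux a) (at z) (0, \<xi>) = symbol z a \<xi>"
proof -
  obtain x p where zx: "z = (x, p)" by (cases z)
  have x: "x \<in> U" and Qp: "0 < Q (x, p)" using z by (auto simp: zx regular_def)
  note b = bil[OF x]
  define \<phi> where "\<phi> t = flux a (x, p + t *\<^sub>R \<xi>)" for t :: real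
  have l: "((\<lambda>t. (x, p + t *\<^sub>R \<xi>)) has_derivative (\<lambda>h. (0, h *\<^sub>R \<xi>))) (at 0)"
    by (auto intro!: derivative_eq_intros)
  have D: "(flux a has_derivative frechet_derivative (flux a) (at (x, p))) (at (x, p + 0 *\<^sub>R \<xi>))"
    using smooth_on_has_derivative[OF smooth_flux z] by (simp add: zx)
  have lin: "linear (frechet_derivative (flux a) (at (x, p)))"
    using smooth_on_linear_derivative[OF smooth_flux z] by (simp add: zx)
  have "(\<phi> has_real_derivative frechet_derivative (flux a) (at (x, p)) (0, \<xi>)) (at 0)"
    using has_derivative_compose[OF l D] linear_cmul[OF lin, of _ "(0, \<xi>)"]
    by (simp add: has_field_derivative_def \<phi>_def[abs_def] mult_commute_abs)
  moreover have "(\<phi> has_real_derivative symbol z a \<xi>) (at 0)"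
  proof -
    have e: "(p + t *\<^sub>R \<xi>, -1) = (p, -1) + t *\<^sub>R (\<xi>, 0::real)" for t by simp
    have Qt: "Q (x, p + t *\<^sub>R \<xi>) = Q (x, p) + 2 * t * B x (\<xi>, 0) (p, -1) + t\<^sup>2 * B x (\<xi>, 0) (\<xi>, 0)" for t
      unfolding Q_def fst_conv snd_conv e
      by (simp only: bilinear_ladd[OF b] bilinear_radd[OF b] bilinear_lmul[OF b] bilinear_rmul[OF b] sym[OF x, of "(p, -1)" "(\<xi>, 0)"])
        (simp add: power2_eq_square algebra_simps)
    have Bt: "B x (a, 0) (p + t *\<^sub>R \<xi>, -1) = B x (a, 0) (p, -1) + t * B x (a, 0) (\<xi>, 0)" for t
      unfolding e by (simp only: bilinear_radd[OF b] bilinear_rmul[OF b]) simp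
    define q where "q t = Q (x, p) + 2 * t * B x (\<xi>, 0) (p, -1) + t\<^sup>2 * B x (\<xi>, 0) (\<xi>, 0)" for t
    have \<phi>: "\<phi> = (\<lambda>t. (A x * (B x (a, 0) (p, -1) + t * B x (a, 0) (\<xi>, 0))) * q t powr (- (1/2)))"
      unfolding \<phi>_def flux_def fst_conv snd_conv Qt Bt q_def ..
    have q0: "q 0 = Q (x, p)" by (simp add: q_def)
    have dq: "(q has_real_derivative 2 * B x (\<xi>, 0) (p, -1)) (at 0)"
      unfolding q_def by (auto intro!: derivative_eq_intros)
    have dp: "((\<lambda>t. q t powr (- (1/2))) has_real_derivative
        - (1/2) * q 0 powr (- (1/2) - 1) * (2 * B x (\<xi>, 0) (p, -1))) (at 0)"
      by (rule DERIV_chain2[OF has_real_derivative_powr dq]) (use Qp q0 in simp)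
    have dB: "((\<lambda>t. A x * (B x (a, 0) (p, -1) + t * B x (a, 0) (\<xi>, 0))) has_real_derivative
        A x * B x (a, 0) (\<xi>, 0)) (at 0)"
      by (auto intro!: derivative_eq_intros)
    have p: "Q (x, p) powr (- (1/2)) = Q (x, p) powr (- (3/2)) * Q (x, p)"
      using powr_add[of "Q (x, p)" "- (3/2)" 1] Qp by simp
    show ?thesis
      unfolding \<phi> zx symbol_def fst_conv snd_conv
      by (rule DERIV_cong[OF DERIV_mult[OF dB dp]]) (simp add: q0 p algebra_simps)
  qed
  ultimately show ?thesis by (simp add: zx DERIV_unique)
qed

text \<open>Semidefiniteness is Cauchy-Schwarz for \<open>(a, 0)\<close> and the conormal, so the
  symbol degenerates exactly where equality holds.\<close>

lemma symbol_form:
  assumes "z \<in> regular"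
  shows "bilinear (symbol z)" "symbol z a \<xi> = symbol z \<xi> a" "0 \<le> symbol z a a"
proof -
  have x: "fst z \<in> U" using assms by (auto simp: regular_def)
  note b = bil[OF x]
  have e: "(u + v, 0) = (u, 0) + (v, 0::real)" "(k *\<^sub>R u, 0) = k *\<^sub>R (u, 0::real)" for u v :: 'e and k by auto
  show "bilinear (symbol z)"
    unfolding bilinear_def symbol_def
    by (auto intro!: linearI simp only: e bilinear_ladd[OF b] bilinear_radd[OF b] bilinear_lmul[OF b] bilinear_rmul[OF b])
      (simp_all add: algebra_simps)
  show "symbol z a \<xi> = symbol z \<xi> a" by (simp add: symbol_def sym[OF x, of "(a, 0)" "(\<xi>, 0)"] mult.commute)
  have "0 \<le> B (fst z) (a, 0) (a, 0) * Q z - (B (fst z) (a, 0) (snd z, -1))\<^sup>2"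
    using Cauchy_Schwarz[OF x, of "(a, 0)" "(snd z, -1)"] by (simp add: Q_def)
  then show "0 \<le> symbol z a a"
    using A_pos[OF x] by (simp add: symbol_def power2_eq_square)
qed


lemma smooth_symbol: "smooth_on regular (\<lambda>z. symbol z a \<xi>)"
proof -
  have "smooth_on regular (\<lambda>z. frechet_derivative (flux a) (at z) (0, \<xi>))"
    by (rule smooth_on_frechet_derivative[OF smooth_flux])
  then show ?thesis
    using smooth_on_cong[OF open_regular, of "\<lambda>z. frechet_derivative (flux a) (at z) (0, \<xi>)" "\<lambda>z. symbol z a \<xi>"]
    by (simp add: flux_vertical_derivative)
qed

text \<open>The divergence with the gradient left free but the second derivatives taken from
  \<open>u\<close>. For a function with another gradient it separates the smooth dependence on the
  gradient from the difference of second derivatives, which enters through the symbol.\<close>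

definition principal :: "('e \<Rightarrow> real) \<Rightarrow> 'e \<times> 'e \<Rightarrow> real" where
  "principal u z = (\<Sum>b\<in>Basis. frechet_derivative (flux b) (at z) (b, frechet_derivative (grad u) (at (fst z)) b))"

lemma smooth_principal:
  assumes "smooth_on U u"
  shows "smooth_on regular (principal u)"
proof -
  have s: "smooth_on regular (\<lambda>z. (b, frechet_derivative (grad u) (at (fst z)) b))" for b
  proof -
    have "smooth_on (fst -` U :: ('e \<times> 'e) set) (\<lambda>z. frechet_derivative (grad u) (at (fst z)) b)"
      by (rule smooth_on_linear_compose[OF open_U bounded_linear_fst
            smooth_on_frechet_derivative[OF smooth_on_grad[OF open_U assms]]])
    then have *: "smooth_on regular (\<lambda>z. frechet_derivative (grad u) (at (fst z)) b)"
      by (rule smooth_on_subset[OF _ regular_sub])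
    have "bounded_linear (\<lambda>w::'e. (0::'e, w))"
      by (intro bounded_linear_Pair bounded_linear_zero bounded_linear_ident)
    from smooth_on_add[OF open_regular smooth_on_const[of _ "(b, 0)"] smooth_on_bounded_linear[OF open_regular this *]]
    show ?thesis by simp
  qed
  show ?thesis
    unfolding principal_def[abs_def]
    by (intro smooth_on_sum open_regular smooth_on_directional smooth_flux s)
qed

lemma divergence_eq:
  assumes w: "smooth_on U w" and x: "x \<in> U" and r: "(x, grad w x) \<in> regular"
  shows "divergence w x = (\<Sum>b\<in>Basis. frechet_derivative (flux b) (at (x, grad w x)) (b, frechet_derivative (grad w) (at x) b))"
  unfolding divergence_def
proof (intro sum.cong refl)
  fix b :: 'e
  have "((\<lambda>x. (x, grad w x)) has_derivative (\<lambda>h. (h, frechet_derivative (grad w) (at x) h))) (at x)"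
    by (intro has_derivative_Pair has_derivative_ident smooth_on_has_derivative[OF smooth_on_grad[OF open_U w] x])
  from has_derivative_compose[OF this smooth_on_has_derivative[OF smooth_flux r]]
  have "((\<lambda>x. flux b (x, grad w x)) has_derivative
    (\<lambda>h. frechet_derivative (flux b) (at (x, grad w x)) (h, frechet_derivative (grad w) (at x) h))) (at x)" .
  from fun_cong[OF frechet_derivative_at[OF this], of b]
  show "frechet_derivative (\<lambda>x. flux b (x, grad w x)) (at x) b
    = frechet_derivative (flux b) (at (x, grad w x)) (b, frechet_derivative (grad w) (at x) b)"
    by (rule HOL.sym)
qed

lemma divergence_principal:
  assumes "smooth_on U w" "x \<in> U" "(x, grad w x) \<in> regular"
  shows "divergence w x = principal u (x, grad w x)
    + (\<Sum>b\<in>Basis. symbol (x, grad w x) b (frechet_derivative (grad w) (at x) b - frechet_derivative (grad u) (at x) b))"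
proof -
  let ?z = "(x, grad w x)"
  have key: "frechet_derivative (flux b) (at ?z) (b, k) = frechet_derivative (flux b) (at ?z) (b, k') + symbol ?z b (k - k')" for b k k'
  proof -
    have "frechet_derivative (flux b) (at ?z) (b, k) = frechet_derivative (flux b) (at ?z) ((b, k') + (0, k - k'))" by simp
    then show ?thesis
      by (simp only: linear_add[OF smooth_on_linear_derivative[OF smooth_flux assms(3)]] flux_vertical_derivative[OF assms(3)])
  qed
  show ?thesis
    unfolding divergence_eq[OF assms] principal_def fst_conv sum.distrib[symmetric]
    by (intro sum.cong refl) (rule key)
qed

text \<open>Otherwise \<open>v - u\<close> minus a small multiple of the barrier \<open>exp (-\<alpha> |x - z|\<^sup>2) - exp (-\<alpha> r\<^sup>2)\<close> has a
  local minimum near \<open>y\<close>, where the inequality of the divergences is violated.\<close>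

lemma Hopf_tangency:
  assumes u: "smooth_on U u" and v: "smooth_on U v" and le: "\<And>x. x \<in> U \<Longrightarrow> u x \<le> v x"
    and ru: "\<And>x. x \<in> U \<Longrightarrow> (x, grad u x) \<in> regular" and rv: "\<And>x. x \<in> U \<Longrightarrow> (x, grad v x) \<in> regular"
    and div: "\<And>x. x \<in> U \<Longrightarrow> divergence v x \<le> divergence u x"
    and y: "y \<in> U" "u y = v y" and r: "0 < r" "dist z y = r"
    and strict: "\<And>x. x \<in> cball z r \<Longrightarrow> x \<noteq> y \<Longrightarrow> u x < v x"
  shows "symbol (y, grad u y) (y - z) (y - z) = 0"
proof (rule ccontr)
  assume "symbol (y, grad u y) (y - z) (y - z) \<noteq> 0"
  define p0 where "p0 = grad u y"
  have reg0: "(y, p0) \<in> regular" using ru[OF y(1)] by (simp add: p0_def)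
  define S where "S \<zeta> = symbol \<zeta> (fst \<zeta> - z) (fst \<zeta> - z)" for \<zeta>
  have S0: "0 < S (y, p0)"
    using \<open>symbol (y, grad u y) (y - z) (y - z) \<noteq> 0\<close> symbol_form(3)[OF reg0, of "y - z"]
    unfolding S_def p0_def by simp
  define S0 where "S0 = S (y, p0) / 2"
  have S0p: "0 < S0" "S0 < S (y, p0)" using S0 by (auto simp: S0_def)
  have sS: "smooth_on regular S"
  proof -
    have d: "smooth_on regular (\<lambda>\<zeta>. fst \<zeta> - z)"
      by (rule smooth_on_diff[OF open_regular bounded_linear_smooth_on[OF open_regular bounded_linear_fst] smooth_on_const])
    show ?thesis
      unfolding S_def[abs_def]
      by (rule smooth_on_bilinear_form[of regular symbol, OF open_regular symbol_form(1) smooth_symbol d d])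
  qed
  have "open (S -` {S0<..} \<inter> regular)"
    by (rule continuous_on_open_vimage[OF open_regular, THEN iffD1, rule_format, OF smooth_on_continuous_on[OF sS]]) simp
  moreover have "(y, p0) \<in> S -` {S0<..} \<inter> regular" using S0p reg0 by simp
  ultimately obtain R where R: "0 < R" "cball (y, p0) R \<subseteq> S -` {S0<..} \<inter> regular"
    unfolding open_contains_cball by metis
  have Rr: "cball (y, p0) R \<subseteq> regular" and RS: "\<And>\<zeta>. \<zeta> \<in> cball (y, p0) R \<Longrightarrow> S0 < S \<zeta>" using R(2) by auto
  have sT: "smooth_on regular (\<lambda>\<zeta>. \<Sum>b\<in>Basis. symbol \<zeta> b b)"
    by (intro smooth_on_sum open_regular smooth_symbol)
  obtain C1 where C1: "0 < C1" "\<And>\<zeta>. \<zeta> \<in> cball (y, p0) R \<Longrightarrow> norm (\<Sum>b\<in>Basis. symbol \<zeta> b b) \<le> C1"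
    by (rule smooth_on_compact_bounds[OF sT Rr]) (rule that)
  obtain C2 where C2: "0 < C2" "\<And>\<zeta> \<zeta>'. \<zeta> \<in> cball (y, p0) R \<Longrightarrow> \<zeta>' \<in> cball (y, p0) R \<Longrightarrow>
      norm (principal u \<zeta> - principal u \<zeta>') \<le> C2 * norm (\<zeta> - \<zeta>')"
    by (rule smooth_on_compact_bounds[OF smooth_principal[OF u] Rr]) (rule that)
  obtain \<rho>0 where \<rho>0: "0 < \<rho>0" "cball y \<rho>0 \<subseteq> U" using open_U y(1) unfolding open_contains_cball by metis
  obtain Cg where Cg: "0 < Cg" "\<And>x x'. x \<in> cball y \<rho>0 \<Longrightarrow> x' \<in> cball y \<rho>0 \<Longrightarrow> norm (grad u x - grad u x') \<le> Cg * norm (x - x')"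
    by (rule smooth_on_compact_bounds[OF smooth_on_grad[OF open_U u] \<rho>0(2)]) (rule that)
  \<comment> \<open>The bound by r gives |x - z| \<le> 2 r on the ball. The last two bounds keep
    \<open>(x, grad u x)\<close> within R/2 of \<open>(y, p0)\<close>, which leaves room for a
    barrier gradient of size R/4.\<close>
  define \<rho> where "\<rho> = min (min \<rho>0 r) (min (R / 4) (R / (4 * Cg)))"
  have \<rho>: "0 < \<rho>" "\<rho> \<le> \<rho>0" "\<rho> \<le> r" "\<rho> \<le> R / 4" "\<rho> \<le> R / (4 * Cg)"
    using \<rho>0(1) r(1) R(1) Cg(1) by (auto simp: \<rho>_def)
  have \<rho>U: "cball y \<rho> \<subseteq> U" using \<rho>(2) \<rho>0(2) by auto
  have g4: "norm (grad u x - p0) \<le> R / 4" if "x \<in> cball y \<rho>" for x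
  proof -
    have "norm (grad u x - p0) \<le> Cg * norm (x - y)"
      unfolding p0_def using that \<rho>(1,2) by (intro Cg(2)) auto
    also have "\<dots> \<le> Cg * (R / (4 * Cg))"
      using that \<rho>(5) Cg(1) by (intro mult_left_mono) (auto simp: dist_norm norm_minus_commute)
    also have "\<dots> = R / 4" using Cg(1) by simp
    finally show ?thesis .
  qed
  \<comment> \<open>Makes the second order part 4 \<alpha>^2 S0 of the barrier exceed the trace part
    2 \<alpha> C1 and the first order part 4 \<alpha> r C2 by exactly 2 \<alpha>, up to the common
    factor \<open>\<epsilon> * e x1\<close>.\<close>
  define \<alpha> where "\<alpha> = (C1 + 2 * r * C2 + 1) / (2 * S0)"
  have "0 < C1 + 2 * r * C2 + 1" using C1(1) C2(1) r(1) by (simp add: add_pos_pos)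
  then have \<alpha>: "0 < \<alpha>" "2 * \<alpha> * S0 = C1 + 2 * r * C2 + 1" using S0p(1) by (auto simp: \<alpha>_def)
  define e where "e x = exp (- \<alpha> * ((x - z) \<bullet> (x - z)))" for x
  define h where "h x = e x - exp (- \<alpha> * r\<^sup>2)" for x
  define gh where "gh x = (- 2 * \<alpha> * e x) *\<^sub>R (x - z)" for x
  define gh' where "gh' x \<xi> = (- 2 * \<alpha> * e x) *\<^sub>R \<xi> + (4 * \<alpha>\<^sup>2 * e x * ((x - z) \<bullet> \<xi>)) *\<^sub>R (x - z)" for x \<xi>
  have de: "(e has_derivative (\<lambda>\<xi>. gh x \<bullet> \<xi>)) (at x)" for x
    unfolding e_def[abs_def] gh_def
    by (auto intro!: derivative_eq_intros ext simp: inner_commute algebra_simps)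
  have dh: "(h has_derivative (\<lambda>\<xi>. gh x \<bullet> \<xi>)) (at x)" for x
    unfolding h_def[abs_def] using has_derivative_diff[OF de has_derivative_const] by simp
  have dgh: "(gh has_derivative gh' x) (at x)" for x
  proof -
    have "((\<lambda>x. (- 2 * \<alpha> * e x) *\<^sub>R (x - z)) has_derivative
      (\<lambda>\<xi>. (- 2 * \<alpha> * e x) *\<^sub>R \<xi> + (- 2 * \<alpha> * (gh x \<bullet> \<xi>)) *\<^sub>R (x - z))) (at x)"
      by (rule derivative_eq_intros de refl | simp)+
    then show ?thesis
      by (simp add: gh_def[abs_def] gh'_def[abs_def] power2_eq_square mult_ac)
  qed
  have epos: "0 < e x" for x by (simp add: e_def)
  have e1: "e x \<le> 1" for x using \<alpha>(1) by (simp add: e_def)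
  have hlt: "h x < 1" for x using e1[of x] exp_gt_zero[of "- \<alpha> * r\<^sup>2"] unfolding h_def by linarith
  have hy: "h y = 0"
    using r(2) by (simp add: h_def e_def power2_norm_eq_inner[symmetric] dist_norm norm_minus_commute)
  have hneg: "h x < 0" if "x \<notin> cball z r" for x
  proof -
    have "r\<^sup>2 < (norm (x - z))\<^sup>2" using that r(1) by (intro power_strict_mono) (auto simp: dist_norm norm_minus_commute)
    then show ?thesis using \<alpha>(1) by (simp add: h_def e_def power2_norm_eq_inner)
  qed
  have cont: "continuous_on (cball y \<rho>) (\<lambda>x. v x - u x)"
    by (intro continuous_intros continuous_on_subset[OF smooth_on_continuous_on \<rho>U] u v)
  \<comment> \<open>The boundary of the small ball splits: outside \<open>cball z r\<close> the
    barrier is negative, and on the remaining compact part, which avoids \<open>y\<close>, the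
    difference v - u has a positive lower bound.\<close>
  obtain m0 where m0: "0 < m0" "\<And>x. x \<in> sphere y \<rho> \<inter> cball z r \<Longrightarrow> m0 \<le> v x - u x"
  proof (cases "sphere y \<rho> \<inter> cball z r = {}")
    case True
    then show ?thesis using that[of 1] by auto
  next
    case False
    have c1: "compact (sphere y \<rho> \<inter> cball z r)" by (intro compact_Int) auto
    have c2: "continuous_on (sphere y \<rho> \<inter> cball z r) (\<lambda>x. v x - u x)"
      by (rule continuous_on_subset[OF cont]) auto
    from continuous_attains_inf[OF c1 False c2] obtain x where x: "x \<in> sphere y \<rho> \<inter> cball z r" "\<forall>x'\<in>sphere y \<rho> \<inter> cball z r. v x - u x \<le> v x' - u x'"
      by (rule bexE)
    have "u x < v x" using strict[of x] x(1) \<rho>(1) by auto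
    then show ?thesis using that[of "v x - u x"] x(2) by simp
  qed
  \<comment> \<open>The first bound makes \<epsilon> h smaller than \<open>m0\<close> on the sphere,
    as h < 1. The second keeps the gradient of \<epsilon> h below R/4, since it is at most 4
    \<alpha> r \<epsilon>.\<close>
  define \<epsilon> where "\<epsilon> = min (m0 / 2) (R / (16 * \<alpha> * r))"
  have "0 < R / (16 * \<alpha> * r)" using R(1) \<alpha>(1) r(1) by simp
  then have \<epsilon>: "0 < \<epsilon>" "\<epsilon> < m0" and \<epsilon>2: "\<epsilon> * (4 * \<alpha> * r) \<le> R / 4"
  proof -
    show "0 < \<epsilon>" "\<epsilon> < m0" using \<open>0 < R / (16 * \<alpha> * r)\<close> m0(1) by (auto simp: \<epsilon>_def)
    have "\<epsilon> * (4 * \<alpha> * r) \<le> R / (16 * \<alpha> * r) * (4 * \<alpha> * r)"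
      using \<alpha>(1) r(1) by (intro mult_right_mono) (auto simp: \<epsilon>_def)
    then show "\<epsilon> * (4 * \<alpha> * r) \<le> R / 4" using \<alpha>(1) r(1) by simp
  qed
  define f where "f x = v x - u x - \<epsilon> * h x" for x
  have dfx: "(f has_derivative (\<lambda>\<xi>. (grad v x - grad u x - \<epsilon> *\<^sub>R gh x) \<bullet> \<xi>)) (at x)" if "x \<in> U" for x
    unfolding f_def[abs_def]
    by (auto intro!: derivative_eq_intros grad_has_derivative[OF u that] grad_has_derivative[OF v that] dh
        simp: inner_diff_left)
  have "continuous_on (cball y \<rho>) f"
    by (intro continuous_at_imp_continuous_on ballI) (rule has_derivative_continuous[OF dfx[OF subsetD[OF \<rho>U]]])
  moreover have "cball y \<rho> \<noteq> {}" using \<rho>(1) by simp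
  ultimately have "\<exists>x\<in>cball y \<rho>. \<forall>x'\<in>cball y \<rho>. f x \<le> f x'" by (intro continuous_attains_inf compact_cball)
  then obtain x1 where x1: "x1 \<in> cball y \<rho>" "\<And>x. x \<in> cball y \<rho> \<Longrightarrow> f x1 \<le> f x" by auto
  have "f x1 \<le> 0" using x1(2)[of y] \<rho>(1) y(2) hy by (simp add: f_def)
  have "x1 \<notin> sphere y \<rho>"
  proof
    assume s: "x1 \<in> sphere y \<rho>"
    have x1U: "x1 \<in> U" using x1(1) \<rho>U by auto
    show False
    proof (cases "x1 \<in> cball z r")
      case True
      have "\<epsilon> * h x1 \<le> \<epsilon> * 1" using hlt[of x1] \<epsilon>(1) by (intro mult_left_mono) auto
      then show False using m0(2)[of x1] True s \<epsilon>(2) \<open>f x1 \<le> 0\<close> by (simp add: f_def)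
    next
      case False
      then have "\<epsilon> * h x1 < 0" using hneg \<epsilon>(1) by (simp add: mult_pos_neg)
      then show False using le[OF x1U] \<open>f x1 \<le> 0\<close> by (simp add: f_def)
    qed
  qed
  then have "x1 \<in> ball y \<rho>" using x1(1) by auto
  then obtain s where s: "0 < s" "ball x1 s \<subseteq> ball y \<rho>" by (rule openE[OF open_ball]) (rule that)
  have x1U: "x1 \<in> U" using x1(1) \<rho>U by auto
  note sgu = smooth_on_grad[OF open_U u] and sgv = smooth_on_grad[OF open_U v]
  define M where "M \<xi> = frechet_derivative (grad v) (at x1) \<xi> - frechet_derivative (grad u) (at x1) \<xi> - \<epsilon> *\<^sub>R gh' x1 \<xi>" for \<xi>
  have dM: "((\<lambda>x. grad v x - grad u x - \<epsilon> *\<^sub>R gh x) has_derivative M) (at x1)"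
    unfolding M_def[abs_def]
    by (intro has_derivative_diff has_derivative_scaleR_right dgh smooth_on_has_derivative[OF sgu x1U] smooth_on_has_derivative[OF sgv x1U])
  have sub: "x \<in> cball y \<rho>" "x \<in> U" if "x \<in> ball x1 s" for x
  proof -
    show "x \<in> cball y \<rho>" using subsetD[OF s(2) that] by simp
    then show "x \<in> U" by (rule subsetD[OF \<rho>U])
  qed
  \<comment> \<open>At the interior minimum the first derivative determines
    \<open>grad v x1\<close>, and the second derivative of v - u exceeds that of \<epsilon> h by the
    semidefinite part \<open>M\<close>.\<close>
  have min: "grad v x1 - grad u x1 - \<epsilon> *\<^sub>R gh x1 = 0" "0 \<le> M \<xi> \<bullet> \<xi>" for \<xi>
    using local_min_derivatives[of s x1 f "\<lambda>x. grad v x - grad u x - \<epsilon> *\<^sub>R gh x" M, OF s(1) dfx[OF sub(2)] dM x1(2)[OF sub(1)]]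
    by auto
  have linM: "linear M" by (rule has_derivative_linear[OF dM])
  have gv: "grad v x1 = grad u x1 + \<epsilon> *\<^sub>R gh x1" using min(1) by (simp add: algebra_simps)
  let ?z = "(x1, grad u x1)" and ?z' = "(x1, grad v x1)"
  have "norm (x1 - z) \<le> norm (x1 - y) + norm (y - z)" using norm_triangle_ineq[of "x1 - y" "y - z"] by simp
  also have "\<dots> \<le> 2 * r" using x1(1) \<rho>(3) r(2) by (simp add: dist_norm norm_minus_commute)
  finally have x1z: "norm (x1 - z) \<le> 2 * r" .
  have ngh: "norm (gh x1) \<le> e x1 * (4 * \<alpha> * r)"
  proof -
    have "norm (gh x1) = (2 * \<alpha> * e x1) * norm (x1 - z)" using \<alpha>(1) epos[of x1] by (simp add: gh_def abs_mult)
    also have "\<dots> \<le> (2 * \<alpha> * e x1) * (2 * r)" using x1z \<alpha>(1) epos[of x1] by (intro mult_left_mono) auto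
    finally show ?thesis by (simp add: mult_ac)
  qed
  have ngh2: "norm (\<epsilon> *\<^sub>R gh x1) \<le> R / 4"
  proof -
    have "norm (\<epsilon> *\<^sub>R gh x1) \<le> \<epsilon> * (e x1 * (4 * \<alpha> * r))" using ngh \<epsilon>(1) by (simp add: mult_left_mono)
    also have "\<dots> \<le> \<epsilon> * (1 * (4 * \<alpha> * r))"
      using e1[of x1] \<epsilon>(1) \<alpha>(1) r(1) by (intro mult_left_mono mult_right_mono) auto
    finally show ?thesis using \<epsilon>2 by simp
  qed
  have inR: "(x1, q) \<in> cball (y, p0) R" if "norm (q - p0) \<le> R / 2" for q
  proof -
    have "dist (y, p0) (x1, q) \<le> dist y x1 + dist p0 q"
      unfolding dist_Pair_Pair by (rule sqrt_sum_squares_le_sum) auto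
    then show ?thesis using that x1(1) \<rho>(4) R(1) by (simp add: dist_norm norm_minus_commute)
  qed
  have zR: "?z \<in> cball (y, p0) R" using g4[OF x1(1)] R(1) by (intro inR) auto
  have z'R: "?z' \<in> cball (y, p0) R"
  proof (rule inR)
    have "norm (grad v x1 - p0) \<le> norm (grad u x1 - p0) + norm (\<epsilon> *\<^sub>R gh x1)"
      unfolding gv using norm_triangle_ineq[of "grad u x1 - p0" "\<epsilon> *\<^sub>R gh x1"] by (simp add: algebra_simps)
    then show "norm (grad v x1 - p0) \<le> R / 2" using g4[OF x1(1)] ngh2 by linarith
  qed
  note form = symbol_form[OF rv[OF x1U]]
  define T where "T = (\<Sum>b\<in>Basis. symbol ?z' b b)"
  have tr: "(\<Sum>b\<in>Basis. symbol ?z' b (gh' x1 b)) = e x1 * (4 * \<alpha>\<^sup>2 * S ?z' - 2 * \<alpha> * T)"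
  proof -
    have l: "linear (\<lambda>a. symbol ?z' a (x1 - z))" using form(1) by (simp add: bilinear_def)
    have "S ?z' = (\<Sum>b\<in>Basis. ((x1 - z) \<bullet> b) * symbol ?z' b (x1 - z))"
      using linear_basis_sum[OF l, of "x1 - z"] by (simp add: S_def)
    then show ?thesis
      unfolding gh'_def T_def
      by (simp add: bilinear_radd[OF form(1)] bilinear_rsub[OF form(1)] bilinear_rmul[OF form(1)]
          sum.distrib sum_subtractf sum_distrib_left right_diff_distrib sum_negf mult_ac)
  qed
  have "divergence u x1 = principal u ?z"
    using divergence_principal[OF u x1U ru[OF x1U], of u] by (simp add: bilinear_rzero[OF symbol_form(1)[OF ru[OF x1U]]])
  moreover have "divergence v x1 = principal u ?z' + (\<Sum>b\<in>Basis. symbol ?z' b (M b)) + \<epsilon> * (\<Sum>b\<in>Basis. symbol ?z' b (gh' x1 b))"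
  proof -
    have "frechet_derivative (grad v) (at x1) b - frechet_derivative (grad u) (at x1) b = M b + \<epsilon> *\<^sub>R gh' x1 b" for b
      by (simp add: M_def)
    then show ?thesis
      unfolding divergence_principal[OF v x1U rv[OF x1U], of u]
      by (simp add: bilinear_radd[OF form(1)] bilinear_rmul[OF form(1)] sum.distrib sum_distrib_left)
  qed
  moreover have "0 \<le> (\<Sum>b\<in>Basis. symbol ?z' b (M b))"
    by (rule bilinear_psd_trace_nonneg[OF form linM min(2)])
  moreover have "\<bar>principal u ?z' - principal u ?z\<bar> \<le> C2 * (\<epsilon> * (e x1 * (4 * \<alpha> * r)))"
  proof -
    have "\<bar>principal u ?z' - principal u ?z\<bar> \<le> C2 * norm (?z' - ?z)" using C2(2)[OF z'R zR] by simp
    also have "norm (?z' - ?z) = norm (\<epsilon> *\<^sub>R gh x1)" by (simp add: gv norm_Pair)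
    also have "\<dots> \<le> \<epsilon> * (e x1 * (4 * \<alpha> * r))" using ngh \<epsilon>(1) by (simp add: mult_left_mono)
    finally show ?thesis using C2(1) by (simp add: mult_left_mono)
  qed
  moreover have "\<epsilon> * (e x1 * (4 * \<alpha>\<^sup>2 * S0 - 2 * \<alpha> * C1)) \<le> \<epsilon> * (\<Sum>b\<in>Basis. symbol ?z' b (gh' x1 b))"
  proof -
    have "4 * \<alpha>\<^sup>2 * S0 \<le> 4 * \<alpha>\<^sup>2 * S ?z'" using RS[OF z'R] by (intro mult_left_mono) auto
    moreover have "2 * \<alpha> * T \<le> 2 * \<alpha> * C1" using C1(2)[OF z'R] \<alpha>(1) by (intro mult_left_mono) (auto simp: T_def)
    ultimately show ?thesis unfolding tr using epos[of x1] \<epsilon>(1) by (intro mult_left_mono) auto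
  qed
  ultimately have "\<epsilon> * (e x1 * (4 * \<alpha>\<^sup>2 * S0 - 2 * \<alpha> * C1)) - C2 * (\<epsilon> * (e x1 * (4 * \<alpha> * r))) \<le> divergence v x1 - divergence u x1"
    by linarith
  moreover have "\<epsilon> * (e x1 * (4 * \<alpha>\<^sup>2 * S0 - 2 * \<alpha> * C1)) - C2 * (\<epsilon> * (e x1 * (4 * \<alpha> * r)))
      = \<epsilon> * e x1 * (2 * \<alpha>) * (2 * \<alpha> * S0 - C1 - 2 * r * C2)"
    by (simp add: power2_eq_square algebra_simps)
  moreover have "0 < \<epsilon> * e x1 * (2 * \<alpha>) * (2 * \<alpha> * S0 - C1 - 2 * r * C2)"
    using \<epsilon>(1) epos[of x1] \<alpha> by simp
  ultimately show False using div[OF x1U] by linarith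
qed

end

section \<open>Propagation of contact and the strong maximum principle\<close>

lemma grad_inner_fst:
  fixes w :: "'e::euclidean_space \<Rightarrow> real"
  assumes U: "open U" and w: "smooth_on U w"
  shows "smooth_on (fst -` U) (\<lambda>z::'e \<times> real. w (fst z) - k * snd z)"
    and "fst z \<in> U \<Longrightarrow> frechet_derivative (\<lambda>z::'e \<times> real. w (fst z) - k * snd z) (at z) h = (grad w (fst z), - k) \<bullet> h"
proof -
  have "open (fst -` U :: ('e \<times> real) set)" by (rule open_vimage_fst[OF U])
  then show "smooth_on (fst -` U) (\<lambda>z::'e \<times> real. w (fst z) - k * snd z)"
    by (intro smooth_on_diff smooth_on_mult smooth_on_const smooth_on_linear_compose[OF U bounded_linear_fst w]
        bounded_linear_smooth_on bounded_linear_snd)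
  assume z: "fst z \<in> U"
  have "((\<lambda>z::'e \<times> real. w (fst z) - k * snd z) has_derivative (\<lambda>h. grad w (fst z) \<bullet> fst h - k * snd h)) (at z)"
    by (intro has_derivative_diff has_derivative_mult_right has_derivative_snd has_derivative_ident
        has_derivative_compose[OF has_derivative_fst[OF has_derivative_ident] grad_has_derivative[OF w z]])
  from fun_cong[OF frechet_derivative_at[OF this], of h]
  show "frechet_derivative (\<lambda>z::'e \<times> real. w (fst z) - k * snd z) (at z) h = (grad w (fst z), - k) \<bullet> h"
    by (simp add: inner_prod_def)
qed

text \<open>Shrinking an exterior ball towards its point of contact makes even the closed ball meet
  the contact set only there, as Hopf's argument demands.\<close>

lemma ball_subset_larger_tangent_ball:
  fixes a \<nu> :: "'e::real_inner"
  assumes s: "0 < s" "s < 1" and x: "x \<in> cball (a + s *\<^sub>R \<nu>) (s * norm \<nu>)" "x \<noteq> a"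
  shows "x \<in> ball (a + \<nu>) (norm \<nu>)"
proof -
  define d where "d = x - a"
  have "(norm (d - s *\<^sub>R \<nu>))\<^sup>2 \<le> (s * norm \<nu>)\<^sup>2"
    using x(1) by (intro power_mono) (auto simp: d_def dist_norm norm_minus_commute algebra_simps)
  then have "d \<bullet> d \<le> 2 * s * (d \<bullet> \<nu>)"
    by (simp add: power2_norm_eq_inner power_mult_distrib inner_diff_left inner_diff_right inner_commute power2_eq_square[of s])
  moreover have "0 < d \<bullet> d" using x(2) by (simp add: d_def)
  ultimately have 1: "0 < d \<bullet> \<nu>" using s(1) mult_nonneg_nonpos[of "2 * s" "d \<bullet> \<nu>"] by linarith
  then have "2 * s * (d \<bullet> \<nu>) < 2 * (d \<bullet> \<nu>)" using s(2) by simp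
  then have "(norm (d - \<nu>))\<^sup>2 < (norm \<nu>)\<^sup>2"
    using \<open>d \<bullet> d \<le> 2 * s * (d \<bullet> \<nu>)\<close>
    by (simp add: power2_norm_eq_inner inner_diff_left inner_diff_right inner_commute)
  then have "norm (d - \<nu>) < norm \<nu>" by (rule power_less_imp_less_base) simp
  then show ?thesis by (simp add: d_def dist_norm norm_minus_commute algebra_simps)
qed

context cometric_box
begin

text \<open>The rank condition in the form in which the local argument uses it. The fields
  annihilate the conormal at every height, so they are tangent to all vertical translates of the
  graph; the clause with \<eta> is horizontality in dual form. The prescribed neighbourhood
  \<open>V0\<close> keeps the fields where the contact set is under control.\<close>

definition bracket_generating :: "('e \<Rightarrow> real) \<Rightarrow> bool" where
  "bracket_generating u \<longleftrightarrow> (\<forall>x\<in>U. \<forall>V0. open V0 \<and> (x, u x) \<in> V0 \<longrightarrow>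
     (\<exists>V Xs. open V \<and> (x, u x) \<in> V \<and> V \<subseteq> V0 \<and> V \<subseteq> fst -` U \<and>
       (\<forall>X\<in>set Xs. smooth_on V X \<and> (\<forall>z\<in>V. (grad u (fst z), -1) \<bullet> X z = 0 \<and>
          (\<exists>\<eta>. \<forall>a. a \<bullet> X z = B (fst z) a \<eta>))) \<and>
       DIM('e) \<le> lie_rank V Xs (x, u x)))"

lemma bracket_generating_conormal_eq_0:
  fixes V :: "('e \<times> real) set"
  assumes u: "smooth_on U u" and V: "open V" "z \<in> V" "V \<subseteq> fst -` U"
    and Xs: "\<And>X. X \<in> set Xs \<Longrightarrow> smooth_on V X"
    and P: "\<And>X z. X \<in> set Xs \<Longrightarrow> z \<in> V \<Longrightarrow> (grad u (fst z), -1) \<bullet> X z = 0"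
    and rank: "DIM('e) \<le> lie_rank V Xs z"
    and \<nu>: "\<And>X. X \<in> lie_module V Xs \<Longrightarrow> (\<nu>, 0) \<bullet> X z = 0"
  shows "\<nu> = 0"
proof (rule lie_rank_conormal_eq_0[where p = "grad u (fst z)", OF rank])
  fix Z assume Z: "Z \<in> lie_module V Xs"
  \<comment> \<open>Its level sets are the graph of \<open>u\<close> and its vertical translates, to
    which the fields are tangent.\<close>
  let ?f = "\<lambda>z. u (fst z) - 1 * snd z"
  have D: "frechet_derivative ?f (at z) h = (grad u (fst z), -1) \<bullet> h" if "z \<in> V" for z h
    by (rule grad_inner_fst(2)[OF open_U u]) (use that V(3) in auto)
  have "frechet_derivative ?f (at z) (Z z) = 0"
  proof (rule lie_module_annihilates[OF V(1) smooth_on_subset[OF grad_inner_fst(1)[OF open_U u] V(3)] Xs _ Z V(2)])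
    fix X z assume "X \<in> set Xs" "z \<in> V"
    then show "frechet_derivative ?f (at z) (X z) = 0" using D[of z "X z"] P[of X z] by simp
  qed
  then show "(grad u (fst z), -1) \<bullet> Z z = 0" by (simp only: D[OF V(2)])
qed (rule \<nu>)

text \<open>Equality in Cauchy-Schwarz: the part \<open>N\<close> of \<nu> that is orthogonal to
  \<open>P\<close> is null and hence in the kernel of the form, so \<nu> and \<open>P\<close> act
  proportionally.\<close>

lemma form_null_direction:
  assumes x: "x \<in> U" and Q: "0 < B x P P" and eq: "B x \<nu> \<nu> * B x P P = (B x \<nu> P)\<^sup>2" and \<eta>: "B x P \<eta> = 0"
  shows "B x \<nu> \<eta> = 0"
proof -
  note b = bil[OF x]
  define k where "k = B x \<nu> P / B x P P"
  define N where "N = \<nu> - k *\<^sub>R P"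
  have "B x N N = B x \<nu> \<nu> - 2 * k * B x \<nu> P + k\<^sup>2 * B x P P"
    unfolding N_def using sym[OF x, of P \<nu>]
    by (simp add: bilinear_lsub[OF b] bilinear_rsub[OF b] bilinear_lmul[OF b] bilinear_rmul[OF b] power2_eq_square algebra_simps)
  also have "\<dots> = 0" using eq Q by (simp add: k_def field_simps power2_eq_square)
  finally have "(B x N \<eta>)\<^sup>2 \<le> 0" using Cauchy_Schwarz[OF x, of N \<eta>] by simp
  then have "B x N \<eta> = 0" by simp
  then show ?thesis using \<eta> by (simp add: N_def bilinear_lsub[OF b] bilinear_lmul[OF b])
qed

text \<open>A horizontal field orthogonal to the conormal of \<open>u\<close> is, by
  proportionality, orthogonal to that of \<open>v\<close> as well and thus annihilates v - u. The
  brackets inherit this, and their rank leaves no room for a nonzero gradient of v - u.\<close>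

lemma grad_eq_if_parallel:
  assumes u: "smooth_on U u" and v: "smooth_on U v" and gen: "bracket_generating u"
    and W: "open W" "W \<subseteq> U" "x \<in> W"
    and par: "\<And>x. x \<in> W \<Longrightarrow> \<exists>k. \<forall>a. B x (grad v x, -1) a = k * B x (grad u x, -1) a"
  shows "grad v x = grad u x"
proof -
  have "x \<in> U" "open (fst -` W :: ('e \<times> real) set)" "(x, u x) \<in> fst -` W"
    using W open_vimage_fst[OF W(1)] by auto
  then obtain V Xs where V: "open V" "(x, u x) \<in> V" "V \<subseteq> fst -` W" "V \<subseteq> fst -` U"
    and Xs: "\<And>X. X \<in> set Xs \<Longrightarrow> smooth_on V X"
    and P: "\<And>X z. X \<in> set Xs \<Longrightarrow> z \<in> V \<Longrightarrow> (grad u (fst z), -1) \<bullet> X z = 0"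
    and hor: "\<And>X z. X \<in> set Xs \<Longrightarrow> z \<in> V \<Longrightarrow> \<exists>\<eta>. \<forall>a. a \<bullet> X z = B (fst z) a \<eta>"
    and rank: "DIM('e) \<le> lie_rank V Xs (x, u x)"
    using gen unfolding bracket_generating_def by metis
  have sd: "smooth_on U (\<lambda>x. v x - u x)" by (rule smooth_on_diff[OF open_U v u])
  have gd: "grad (\<lambda>x. v x - u x) x = grad v x - grad u x" if "x \<in> U" for x
  proof -
    have "((\<lambda>x. v x - u x) has_derivative (\<lambda>h. grad v x \<bullet> h - grad u x \<bullet> h)) (at x)"
      by (intro has_derivative_diff grad_has_derivative[OF u that] grad_has_derivative[OF v that])
    from fun_cong[OF frechet_derivative_at[OF this]]
    have "grad (\<lambda>x. v x - u x) x \<bullet> h = (grad v x - grad u x) \<bullet> h" for h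
      by (metis grad_inner[OF sd that] inner_diff_left)
    then show ?thesis by (metis inner_commute vector_eq_rdot)
  qed
  have D: "frechet_derivative (\<lambda>z. (v (fst z) - u (fst z)) - 0 * snd z) (at z) h = (grad v (fst z) - grad u (fst z), 0) \<bullet> h"
    if "z \<in> V" for z h
    using grad_inner_fst(2)[OF open_U sd, of z 0 h] that V(4) gd[of "fst z"] by auto
  have "grad v x - grad u x = 0"
  proof (rule bracket_generating_conormal_eq_0[OF u V(1,2,4) Xs _ rank])
    fix Z assume Z: "Z \<in> lie_module V Xs"
    have "frechet_derivative (\<lambda>z. (v (fst z) - u (fst z)) - 0 * snd z) (at (x, u x)) (Z (x, u x)) = 0"
    proof (rule lie_module_annihilates[OF V(1) smooth_on_subset[OF grad_inner_fst(1)[OF open_U sd] V(4)] Xs _ Z V(2)])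
      fix X z assume X: "X \<in> set Xs" "z \<in> V"
      obtain \<eta> where \<eta>: "\<And>a. a \<bullet> X z = B (fst z) a \<eta>" using hor[OF X] by blast
      have "fst z \<in> W" using X(2) V(3) by auto
      from par[OF this] obtain k where "B (fst z) (grad v (fst z), -1) \<eta> = k * B (fst z) (grad u (fst z), -1) \<eta>" by blast
      then have "(grad v (fst z), -1) \<bullet> X z = 0" using P[OF X] \<eta> by simp
      then show "frechet_derivative (\<lambda>z. (v (fst z) - u (fst z)) - 0 * snd z) (at z) (X z) = 0"
        unfolding D[OF X(2)] using P[OF X] by (simp add: inner_prod_def inner_diff_left)
    qed
    then show "(grad v x - grad u x, 0) \<bullet> Z (x, u x) = 0" using D[OF V(2)] by simp
  next
    show "(grad u (fst z), -1) \<bullet> X z = 0" if "X \<in> set Xs" "z \<in> V" for X z by (rule P[OF that])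
  qed
  then show ?thesis by simp
qed

text \<open>A noncontact point near \<open>y0\<close> has a nearest contact point, and the
  connecting vector is an exterior normal there, which the rank condition forces to vanish.\<close>

lemma strong_maximum_principle:
  assumes u: "smooth_on U u" and v: "smooth_on U v" and le: "\<And>x. x \<in> U \<Longrightarrow> u x \<le> v x"
    and ru: "\<And>x. x \<in> U \<Longrightarrow> (x, grad u x) \<in> regular" and rv: "\<And>x. x \<in> U \<Longrightarrow> (x, grad v x) \<in> regular"
    and div: "\<And>x. x \<in> U \<Longrightarrow> divergence v x \<le> divergence u x"
    and gen: "bracket_generating u" and y0: "y0 \<in> U" "u y0 = v y0"
  shows "\<exists>\<rho>>0. \<forall>x\<in>ball y0 \<rho>. u x = v x"
proof -
  obtain R where R: "0 < R" "cball y0 R \<subseteq> U" using open_U y0(1) unfolding open_contains_cball by metis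
  define Z0 where "Z0 = {x \<in> cball y0 R. v x - u x = 0}"
  have "closed Z0" unfolding Z0_def
    by (intro continuous_closed_preimage_constant closed_cball continuous_intros
        continuous_on_subset[OF smooth_on_continuous_on R(2)] u v)
  define Z where "Z = (fst -` Z0 :: ('e \<times> real) set)"
  have clZ: "closed Z" unfolding Z_def by (rule closed_vimage_fst[OF \<open>closed Z0\<close>])
  have y0Z: "y0 \<in> Z0" using R(1) y0(2) by (simp add: Z0_def)
  have "u x = v x" if x: "x \<in> ball y0 (R / 4)" for x
  proof (rule ccontr)
    assume ne: "u x \<noteq> v x"
    obtain y where y: "y \<in> Z0" "infdist x Z0 = dist x y"
      using infdist_attains_inf[OF \<open>closed Z0\<close>] y0Z by (metis empty_iff)
    define \<nu> where "\<nu> = x - y"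
    have "x \<notin> Z0" using ne by (simp add: Z0_def)
    then have \<nu>0: "\<nu> \<noteq> 0" using y(1) by (auto simp: \<nu>_def)
    have near: "norm \<nu> \<le> dist x p" if "p \<in> Z0" for p
      using infdist_le[OF that, of x] y(2) by (simp add: \<nu>_def dist_norm)
    have "dist y0 y \<le> dist y0 x + dist x y" by (rule dist_triangle)
    also have "dist x y \<le> dist x y0" using near[OF y0Z] by (simp add: \<nu>_def dist_norm)
    also have "dist y0 x + dist x y0 < R" using x R(1) by (simp add: dist_commute)
    finally have yR: "y \<in> ball y0 R" by simp
    have yU: "y \<in> U" using yR R(2) by auto
    let ?V0 = "fst -` ball y0 R :: ('e \<times> real) set"
    have "open ?V0" "(y, u y) \<in> ?V0" using yR by (auto intro: open_vimage_fst)
    then obtain V Xs where V: "open V" "(y, u y) \<in> V" "V \<subseteq> ?V0" "V \<subseteq> fst -` U"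
      and Xs: "\<And>X. X \<in> set Xs \<Longrightarrow> smooth_on V X"
      and P: "\<And>X z. X \<in> set Xs \<Longrightarrow> z \<in> V \<Longrightarrow> (grad u (fst z), -1) \<bullet> X z = 0"
      and hor: "\<And>X z. X \<in> set Xs \<Longrightarrow> z \<in> V \<Longrightarrow> \<exists>\<eta>. \<forall>a. a \<bullet> X z = B (fst z) a \<eta>"
      and rank: "DIM('e) \<le> lie_rank V Xs (y, u y)"
      using gen yU unfolding bracket_generating_def by metis
    have tan: "tangential V Z X" if X: "X \<in> set Xs" for X
      unfolding tangential_def
    proof (intro ballI allI impI)
      fix z n assume z: "z \<in> Z \<inter> V" and disj: "ball (z + n) (norm n) \<inter> Z = {}"
      obtain a t where zat: "z = (a, t)" by (cases z)
      obtain n1 n2 where n: "n = (n1, n2)" by (cases n)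
      have a: "a \<in> Z0" "a \<in> ball y0 R" using z V(3) by (auto simp: zat Z_def)
      have aU: "a \<in> U" using a(2) R(2) by auto
      have out: "norm n \<le> dist (z + n) (p, q)" if "p \<in> Z0" for p q
      proof -
        have "(p, q) \<in> Z" using that by (simp add: Z_def)
        then have "(p, q) \<notin> ball (z + n) (norm n)" using disj by blast
        then show ?thesis by simp
      qed
      \<comment> \<open>The cylinder contains the whole vertical line over \<open>a\<close>. Its
        point at the height of the centre of the exterior ball shows that the normal has no vertical
        component.\<close>
      have "norm n \<le> norm n1" using out[OF a(1), of "t + n2"] by (simp add: zat n dist_norm norm_Pair)
      then have "(norm n)\<^sup>2 \<le> (norm n1)\<^sup>2" by (intro power_mono) auto
      moreover have "(norm n)\<^sup>2 = (norm n1)\<^sup>2 + n2\<^sup>2" by (simp add: n norm_Pair)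
      ultimately have "n2 = 0" by simp
      have n1: "norm n = norm n1" by (simp add: n \<open>n2 = 0\<close>)
      have out1: "norm n1 \<le> dist (a + n1) p" if "p \<in> Z0" for p
        using out[OF that, of t] by (simp add: zat n \<open>n2 = 0\<close> n1 dist_Pair_Pair)
      show "X z \<bullet> n = 0"
      proof (cases "n1 = 0")
        case True
        then show ?thesis by (simp add: n \<open>n2 = 0\<close> zero_prod_def[symmetric])
      next
        case False
        define \<sigma> where "\<sigma> = (R - dist y0 a) / (4 * norm n1)"
        have "0 < \<sigma>" using a(2) False by (simp add: \<sigma>_def)
        \<comment> \<open>The first bound shrinks the exterior ball so that its closure touches
          \<open>Z0\<close> only at \<open>a\<close>; the second keeps it in
          \<open>cball y0 R\<close>, where being outside \<open>Z0\<close> means u < v.\<close>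
        define s where "s = min (1/2) \<sigma>"
        have s: "0 < s" "s < 1" "s \<le> \<sigma>" using \<open>0 < \<sigma>\<close> by (auto simp: s_def)
        have "s * norm n1 \<le> \<sigma> * norm n1" using s(3) by (intro mult_right_mono) auto
        also have "\<dots> = (R - dist y0 a) / 4" using False by (simp add: \<sigma>_def)
        finally have sn: "s * norm n1 \<le> (R - dist y0 a) / 4" .
        have strict: "u p < v p" if p: "p \<in> cball (a + s *\<^sub>R n1) (s * norm n1)" "p \<noteq> a" for p
        proof -
          have "dist (a + n1) p < norm n1" using ball_subset_larger_tangent_ball[OF s(1,2) p] by simp
          then have "p \<notin> Z0" using out1[of p] by auto
          moreover have "dist y0 p \<le> R"
          proof -
            have "dist y0 p \<le> dist y0 a + dist a (a + s *\<^sub>R n1) + dist (a + s *\<^sub>R n1) p"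
              using dist_triangle[of y0 p "a + s *\<^sub>R n1"] dist_triangle[of y0 "a + s *\<^sub>R n1" a] by linarith
            also have "dist a (a + s *\<^sub>R n1) = s * norm n1" using s(1) by (simp add: dist_norm)
            finally show ?thesis using p(1) sn a(2) by simp
          qed
          ultimately show ?thesis using le[of p] R(2) by (auto simp: Z0_def)
        qed
        have "symbol (a, grad u a) (a - (a + s *\<^sub>R n1)) (a - (a + s *\<^sub>R n1)) = 0"
          using a(1) s(1) False
          by (intro Hopf_tangency[OF u v le ru rv div aU _ _ _ strict, of "s * norm n1"]) (auto simp: Z0_def dist_norm)
        then have "symbol (a, grad u a) n1 n1 = 0"
          using s(1) bilinear_lmul[OF symbol_form(1)[OF ru[OF aU]], of "-s" n1]
            bilinear_rmul[OF symbol_form(1)[OF ru[OF aU]], of _ "-s" n1] by simp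
        moreover have Qp: "0 < Q (a, grad u a)" using ru[OF aU] by (simp add: regular_def)
        \<comment> \<open>Vanishing of the symbol is equality in Cauchy-Schwarz for
          \<open>(n1, 0)\<close> and the conormal.\<close>
        ultimately have eq: "B a (n1, 0) (n1, 0) * B a (grad u a, -1) (grad u a, -1) = (B a (n1, 0) (grad u a, -1))\<^sup>2"
          using A_pos[OF aU] by (simp add: symbol_def Q_def power2_eq_square)
        have zV: "z \<in> V" using z by simp
        obtain \<eta> where \<eta>: "\<And>b. b \<bullet> X z = B a b \<eta>" using hor[OF X zV] by (auto simp: zat)
        have "B a (grad u a, -1) \<eta> = 0" using P[OF X zV] \<eta> by (simp add: zat)
        then have "B a (n1, 0) \<eta> = 0"
          using form_null_direction[OF aU _ eq] Qp by (simp add: Q_def)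
        then show ?thesis using \<eta>[of "(n1, 0)"] by (simp add: n \<open>n2 = 0\<close> inner_commute)
      qed
    qed
    have "\<nu> = 0"
    proof (rule bracket_generating_conormal_eq_0[OF u V(1,2,4) Xs _ rank])
      fix W assume W: "W \<in> lie_module V Xs"
      have 1: "tangential V Z W" by (rule tangential_lie_module[of Z V Xs W, OF clZ V(1) Xs tan W])
      have 2: "(y, u y) \<in> Z \<inter> V" using y(1) V(2) by (simp add: Z_def)
      have 3: "ball ((y, u y) + (\<nu>, 0)) (norm (\<nu>, 0::real)) \<inter> Z = {}"
      proof -
        have "\<not> dist ((y, u y) + (\<nu>, 0)) p < norm (\<nu>, 0::real)" if "p \<in> Z" for p
        proof -
          have "norm \<nu> \<le> dist x (fst p)" using near that by (simp add: Z_def)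
          also have "\<dots> = dist (fst ((y, u y) + (\<nu>, 0))) (fst p)" by (simp add: \<nu>_def)
          also have "\<dots> \<le> dist ((y, u y) + (\<nu>, 0)) p" by (rule dist_fst_le)
          finally show ?thesis by simp
        qed
        then show ?thesis by auto
      qed
      show "(\<nu>, 0) \<bullet> W (y, u y) = 0"
        using 1[unfolded tangential_def, rule_format, OF 2 3] by (simp only: inner_commute)
    next
      show "(grad u (fst z), -1) \<bullet> X z = 0" if "X \<in> set Xs" "z \<in> V" for X z by (rule P[OF that])
    qed
    then show False using \<nu>0 by simp
  qed
  then show ?thesis using R(1) by (intro exI[of _ "R / 4"]) auto
qed

end

section \<open>Contact points are not isolated\<close>

text \<open>Compactness makes the covering finite, and every covering set is replaced by a ball with
  centre in \<open>S\<close>. The balls of half the radius already cover, which leaves the outer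
  shells for a cutoff function to rise.\<close>

lemma hausdorff_null_cover:
  fixes S :: "'e::euclidean_space set"
  assumes null: "hausdorff_measure s S' = 0" and S: "compact S" "S \<subseteq> S'" and \<tau>: "0 < \<tau>" and \<theta>: "0 < \<theta>"
  obtains I :: "nat set" and c \<rho> where "finite I" "\<And>i. i \<in> I \<Longrightarrow> c i \<in> S" "\<And>i. i \<in> I \<Longrightarrow> 0 < \<rho> i"
    "\<And>i. i \<in> I \<Longrightarrow> \<rho> i \<le> \<theta>" "S \<subseteq> (\<Union>i\<in>I. ball (c i) (\<rho> i / 2))" "(\<Sum>i\<in>I. \<rho> i ^ s) \<le> \<tau>"
proof -
  define \<omega> where "\<omega> = unit_ball_vol (real s)"
  have \<omega>: "0 < \<omega>" by (simp add: \<omega>_def)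
  \<comment> \<open>Passing from a set of diameter d to a ball of radius 4 (d + t) costs the factor
    4^s, undoing the normalization of the measure costs 2^s / \<omega>, and the summand 1 is for the
    enlargements t.\<close>
  define K where "K = 4 ^ s * (2 ^ s / \<omega> + 1)"
  define \<kappa> where "\<kappa> = \<tau> / K"
  have den: "0 < K" using \<omega> by (simp add: K_def add_pos_pos)
  have \<kappa>: "0 < \<kappa>" using \<tau> den by (simp add: \<kappa>_def)
  let ?f = "\<lambda>U. if U = {} then 0 else unit_ball_vol (real s) * (diameter U / 2) ^ s"
  have "hausdorff_content s (\<theta> / 8) S' \<le> hausdorff_measure s S'"
    unfolding hausdorff_measure_def using \<theta> by (intro SUP_upper) auto
  then have "hausdorff_content s (\<theta> / 8) S' < ennreal \<kappa>" using null \<kappa> by simp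
  then obtain U :: "nat \<Rightarrow> 'e set" where U: "S' \<subseteq> (\<Union>i. U i)" "\<And>i. bounded (U i)" "\<And>i. diameter (U i) \<le> \<theta> / 8"
    and sumU: "(\<Sum>i. ennreal (?f (U i))) < ennreal \<kappa>"
    unfolding hausdorff_content_def INF_less_iff by auto
  define d where "d i = diameter (U i)" for i
  have d0: "0 \<le> d i" for i by (simp add: d_def diameter_ge_0 U(2))
  \<comment> \<open>Sets of diameter 0 require a positive radius. The enlargement of the i-th set
    may raise its power by the i-th term of a geometric series, so that all of them together cost at
    most \<kappa>.\<close>
  have "\<exists>t>0. t \<le> \<theta> / 8 \<and> (d i + t) ^ s \<le> d i ^ s + \<kappa> * (1/2) ^ Suc i" for i
  proof -
    have "((\<lambda>t. (d i + t) ^ s) \<longlongrightarrow> (d i + 0) ^ s) (at_right 0)" by (intro tendsto_intros)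
    then have "\<forall>\<^sub>F t in at_right 0. (d i + t) ^ s < d i ^ s + \<kappa> * (1/2) ^ Suc i"
      using \<kappa> by (intro order_tendstoD) auto
    moreover have "\<forall>\<^sub>F t in at_right (0::real). 0 < t" by (simp add: eventually_at_filter)
    moreover have "\<forall>\<^sub>F t in at_right (0::real). t < \<theta> / 8" using \<theta> by (intro order_tendstoD[OF tendsto_ident_at]) auto
    ultimately have "\<forall>\<^sub>F t in at_right 0. 0 < t \<and> t \<le> \<theta> / 8 \<and> (d i + t) ^ s \<le> d i ^ s + \<kappa> * (1/2) ^ Suc i"
      by eventually_elim auto
    from eventually_happens'[OF _ this] show ?thesis by simp
  qed
  then obtain t where t: "\<And>i. 0 < t i" "\<And>i. t i \<le> \<theta> / 8" "\<And>i. (d i + t i) ^ s \<le> d i ^ s + \<kappa> * (1/2) ^ Suc i"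
    by metis
  define J where "J = {i. U i \<inter> S \<noteq> {}}"
  have "\<forall>i\<in>J. \<exists>p. p \<in> U i \<inter> S" by (auto simp: J_def)
  then obtain c where c: "\<And>i. i \<in> J \<Longrightarrow> c i \<in> U i \<inter> S" by metis
  \<comment> \<open>Diameter and enlargement are each at most \<theta>/8, so this radius is at most
    \<theta>, while half of it still exceeds the diameter.\<close>
  define \<rho> where "\<rho> i = 4 * (d i + t i)" for i
  have cov: "S \<subseteq> (\<Union>i\<in>J. ball (c i) (\<rho> i / 2))"
  proof
    fix x assume x: "x \<in> S"
    then obtain i where i: "x \<in> U i" using U(1) S(2) by auto
    then have iJ: "i \<in> J" using x by (auto simp: J_def)
    have "dist (c i) x \<le> d i" unfolding d_def using diameter_bounded_bound[OF U(2)] c[OF iJ] i by auto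
    also have "\<dots> < \<rho> i / 2" using t(1)[of i] d0[of i] by (simp add: \<rho>_def)
    finally show "x \<in> (\<Union>i\<in>J. ball (c i) (\<rho> i / 2))" using iJ by auto
  qed
  obtain I where I: "I \<subseteq> J" "finite I" "S \<subseteq> (\<Union>i\<in>I. ball (c i) (\<rho> i / 2))"
    by (rule compactE_image[OF S(1) _ cov]) (auto intro: that)
  have f: "?f (U i) = \<omega> * (d i / 2) ^ s" if "i \<in> I" for i
    using that I(1) c[of i] by (auto simp: \<omega>_def d_def)
  have "(\<Sum>i\<in>I. ennreal (?f (U i))) \<le> (\<Sum>i. ennreal (?f (U i)))"
    using I(2) by (intro sum_le_suminf) auto
  then have "(\<Sum>i\<in>I. ennreal (\<omega> * (d i / 2) ^ s)) < ennreal \<kappa>"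
    using sumU f by (simp cong: sum.cong)
  then have "ennreal (\<Sum>i\<in>I. \<omega> * (d i / 2) ^ s) < ennreal \<kappa>"
    using \<omega> d0 by (subst (asm) sum_ennreal) auto
  then have "(\<Sum>i\<in>I. \<omega> * (d i / 2) ^ s) \<le> \<kappa>"
    using \<kappa> by (simp add: ennreal_less_iff sum_nonneg \<omega> d0 less_imp_le)
  moreover have "(\<Sum>i\<in>I. \<omega> * (d i / 2) ^ s) = (\<omega> / 2 ^ s) * (\<Sum>i\<in>I. d i ^ s)"
    by (simp add: sum_distrib_left power_divide)
  ultimately have "(\<omega> / 2 ^ s) * (\<Sum>i\<in>I. d i ^ s) \<le> \<kappa>" by (simp only:)
  then have sd: "(\<Sum>i\<in>I. d i ^ s) \<le> (2 ^ s / \<omega>) * \<kappa>" using \<omega> by (simp add: field_simps)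
  have "(\<Sum>i\<in>I. (1/2::real) ^ Suc i) \<le> (\<Sum>i. (1/2::real) ^ Suc i)"
    using I(2) power_half_series by (intro sum_le_suminf) (auto simp: sums_iff)
  also have "\<dots> = 1" using power_half_series by (simp add: sums_iff)
  finally have h: "(\<Sum>i\<in>I. (1/2::real) ^ Suc i) \<le> 1" .
  have "(\<Sum>i\<in>I. \<rho> i ^ s) = 4 ^ s * (\<Sum>i\<in>I. (d i + t i) ^ s)"
    by (simp only: \<rho>_def power_mult_distrib sum_distrib_left)
  also have "(\<Sum>i\<in>I. (d i + t i) ^ s) \<le> (\<Sum>i\<in>I. d i ^ s + \<kappa> * (1/2) ^ Suc i)" by (intro sum_mono t(3))
  also have "\<dots> = (\<Sum>i\<in>I. d i ^ s) + \<kappa> * (\<Sum>i\<in>I. (1/2) ^ Suc i)"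
    by (simp only: sum.distrib sum_distrib_left)
  also have "\<dots> \<le> (2 ^ s / \<omega>) * \<kappa> + \<kappa> * 1" by (intro add_mono sd mult_left_mono h) (use \<kappa> in simp)
  also have "4 ^ s * ((2 ^ s / \<omega>) * \<kappa> + \<kappa> * 1) = \<kappa> * K" by (simp add: K_def algebra_simps)
  also have "\<dots> = \<tau>" using den by (simp add: \<kappa>_def)
  finally have "(\<Sum>i\<in>I. \<rho> i ^ s) \<le> \<tau>" by simp
  moreover have "\<rho> i \<le> \<theta>" for i using U(3)[of i] t(2)[of i] by (simp add: \<rho>_def d_def)
  moreover have "0 < \<rho> i" for i using t(1)[of i] d0[of i] by (simp add: \<rho>_def)
  moreover have "c i \<in> S" if "i \<in> I" for i using c[of i] that I(1) by auto
  ultimately show ?thesis using that[of I c \<rho>] I by blast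
qed

section \<open>Integration by parts and cutoff functions\<close>

lemma lborel_integral_translation:
  fixes f :: "'e::euclidean_space \<Rightarrow> real"
  assumes "f \<in> borel_measurable borel"
  shows "(\<integral>x. f (c + x) \<partial>lborel) = (\<integral>x. f x \<partial>lborel)"
    and "integrable lborel f \<Longrightarrow> integrable lborel (\<lambda>x. f (c + x))"
proof -
  have "(\<integral>x. f x \<partial>(distr lborel borel ((+) c))) = (\<integral>x. f (c + x) \<partial>lborel)"
    using assms by (intro integral_distr) auto
  then show "(\<integral>x. f (c + x) \<partial>lborel) = (\<integral>x. f x \<partial>lborel)" by (simp add: lborel_distr_plus)
  assume "integrable lborel f"
  then have "integrable (distr lborel borel ((+) c)) f" by (simp add: lborel_distr_plus)
  then show "integrable lborel (\<lambda>x. f (c + x))" by (rule integrable_distr[rotated]) simp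
qed

text \<open>Difference quotients have integral zero by translation invariance and are dominated by a
  bounded function of bounded support, so their limit has integral zero too.\<close>

lemma integral_directional_derivative_eq_0:
  fixes f :: "'e::euclidean_space \<Rightarrow> real"
  assumes f: "Ck_on (Suc 0) UNIV f" and supp: "\<And>x. x \<notin> cball y R \<Longrightarrow> f x = 0"
  shows "integrable lborel (\<lambda>x. frechet_derivative f (at x) b)"
    and "(\<integral>x. frechet_derivative f (at x) b \<partial>lborel) = 0"
proof -
  define g where "g x = frechet_derivative f (at x) b" for x
  have D: "(f has_derivative frechet_derivative f (at x)) (at x)" for x
    using Ck_on_has_derivative[OF f] by simp
  have contf: "continuous_on UNIV f" using Ck_on_SucD[OF f] by simp
  have contg: "continuous_on UNIV g" using f by (simp add: g_def[abs_def])
  have suppg: "g x = 0" if "x \<notin> cball y R" for x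
  proof -
    have "open (- cball y R)" by (rule open_Compl[OF closed_cball])
    have "(f has_derivative (\<lambda>h. 0)) (at x)"
      by (rule has_derivative_transform_within_open[OF has_derivative_const[of 0] \<open>open (- cball y R)\<close>])
        (use that supp in auto)
    from fun_cong[OF frechet_derivative_at[OF this], of b] show ?thesis by (simp add: g_def)
  qed
  have intf: "integrable lborel f"
  proof -
    have "integrable lborel (\<lambda>x. indicator (cball y R) x *\<^sub>R f x)"
      by (intro borel_integrable_compact compact_cball continuous_on_subset[OF contf]) simp
    moreover have "(\<lambda>x. indicator (cball y R) x *\<^sub>R f x) = f" using supp by (auto simp: indicator_def fun_eq_iff)
    ultimately show ?thesis by simp
  qed
  obtain M where M: "\<And>x. \<bar>g x\<bar> \<le> M"
  proof -
    have "compact (g ` cball y R)" by (intro compact_continuous_image continuous_on_subset[OF contg]) auto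
    then have "bounded (g ` cball y R)" by (rule compact_imp_bounded)
    then obtain M where M: "\<forall>z\<in>g ` cball y R. norm z \<le> M" unfolding bounded_iff by (rule exE)
    have "\<bar>g x\<bar> \<le> max M 0" for x using suppg[of x] M by (cases "x \<in> cball y R") (auto simp: le_max_iff_disj)
    then show ?thesis by (rule that)
  qed
  have M0: "0 \<le> M" using M[of 0] by simp
  define t where "t n = inverse (real (Suc n))" for n
  have t: "0 < t n" "t n \<le> 1" for n by (auto simp: t_def inverse_le_1_iff)
  define s where "s n x = (f (t n *\<^sub>R b + x) - f x) / t n" for n x
  have line: "((\<lambda>r. f (r *\<^sub>R b + x)) has_real_derivative g (r *\<^sub>R b + x)) (at r)" for r x
  proof -
    have l: "((\<lambda>r. r *\<^sub>R b + x) has_derivative (\<lambda>h. h *\<^sub>R b)) (at r)" by (auto intro!: derivative_eq_intros)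
    show ?thesis
      using has_derivative_compose[OF l D] linear_cmul[OF has_derivative_linear[OF D[of "r *\<^sub>R b + x"]]]
      by (simp add: has_field_derivative_def g_def mult_commute_abs)
  qed
  \<comment> \<open>The steps \<open>t n\<close> are at most 1, so every quotient vanishes outside
    the ball enlarged by the norm of \<open>b\<close>; the mean value theorem bounds it by
    \<open>M\<close>.\<close>
  let ?w = "\<lambda>x. M * indicator (cball y (R + norm b)) x :: real"
  have bound: "norm (s n x) \<le> ?w x" for n x
  proof (cases "x \<in> cball y (R + norm b)")
    case True
    obtain r where "f (t n *\<^sub>R b + x) - f (0 *\<^sub>R b + x) = (t n - 0) * g (r *\<^sub>R b + x)"
      using MVT2[OF t(1) line, of n x] by auto
    then have "s n x = g (r *\<^sub>R b + x)" using t(1)[of n] by (simp add: s_def)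
    then show ?thesis using M True by simp
  next
    case False
    have "norm (t n *\<^sub>R b) \<le> norm b" using t[of n] by (simp add: mult_left_le_one_le)
    moreover have "dist y x \<le> dist y (t n *\<^sub>R b + x) + norm (t n *\<^sub>R b)"
      using dist_triangle[of y x "t n *\<^sub>R b + x"] by (simp add: dist_norm)
    ultimately have "t n *\<^sub>R b + x \<notin> cball y R" "x \<notin> cball y R" using False norm_ge_zero[of b]
      unfolding mem_cball by linarith+
    then show ?thesis using supp M0 by (simp add: s_def)
  qed
  have lim: "(\<lambda>n. s n x) \<longlonglongrightarrow> g x" for x
  proof -
    have "((\<lambda>h. (f ((0 + h) *\<^sub>R b + x) - f (0 *\<^sub>R b + x)) / h) \<longlongrightarrow> g (0 *\<^sub>R b + x)) (at 0)"
      using line[of x 0] unfolding DERIV_def .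
    moreover have "t \<longlonglongrightarrow> 0" unfolding t_def[abs_def] by (rule LIMSEQ_inverse_real_of_nat)
    then have "filterlim t (at 0) sequentially"
      unfolding filterlim_at using t(1) by (simp add: less_imp_neq[symmetric])
    ultimately have "((\<lambda>n. (f ((0 + t n) *\<^sub>R b + x) - f (0 *\<^sub>R b + x)) / t n) \<longlongrightarrow> g (0 *\<^sub>R b + x)) sequentially"
      by (rule filterlim_compose)
    then show ?thesis by (simp add: s_def)
  qed
  have mf: "f \<in> borel_measurable borel" and mg: "g \<in> borel_measurable lborel"
    using borel_measurable_continuous_onI[OF contf] borel_measurable_continuous_onI[OF contg] by auto
  have ms: "s n \<in> borel_measurable lborel" for n
    unfolding s_def[abs_def] using mf by measurable
  have iw: "integrable lborel ?w"
    using emeasure_lborel_cball_finite[of y "R + norm b"] by (intro integrable_mult_right integrable_real_indicator) auto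
  have s0: "(\<integral>x. s n x \<partial>lborel) = 0" for n
    unfolding s_def using intf lborel_integral_translation[OF mf, of "t n *\<^sub>R b"] by simp
  have "integrable lborel g"
    by (rule integrable_dominated_convergence[where s = s, OF mg ms iw]) (intro always_eventually allI lim bound)+
  then show "integrable lborel (\<lambda>x. frechet_derivative f (at x) b)" by (simp add: g_def[abs_def])
  have "(\<lambda>n. \<integral>x. s n x \<partial>lborel) \<longlonglongrightarrow> (\<integral>x. g x \<partial>lborel)"
    by (rule integral_dominated_convergence[where s = s, OF mg ms iw]) (intro always_eventually allI lim bound)+
  then show "(\<integral>x. frechet_derivative f (at x) b \<partial>lborel) = 0"
    using LIMSEQ_unique[OF _ tendsto_const] by (simp add: s0 g_def LIMSEQ_const_iff)
qed

lemma Ck_on_1_compose: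
  fixes f :: "'e::euclidean_space \<Rightarrow> real"
  assumes S: "open S" and f: "Ck_on (Suc 0) S f"
    and h: "\<And>t. (h has_real_derivative h' t) (at t)" and h': "continuous_on UNIV h'"
  shows "Ck_on (Suc 0) S (\<lambda>x. h (f x))"
    and "x \<in> S \<Longrightarrow> ((\<lambda>x. h (f x)) has_derivative (\<lambda>v. h' (f x) * frechet_derivative f (at x) v)) (at x)"
proof -
  have d: "((\<lambda>x. h (f x)) has_derivative (\<lambda>v. h' (f x) * frechet_derivative f (at x) v)) (at x)" if "x \<in> S" for x
    using has_derivative_compose[OF Ck_on_has_derivative[OF f that], of h "(*) (h' (f x))"] h[of "f x"]
    by (simp add: has_field_derivative_def)
  show "Ck_on (Suc 0) S (\<lambda>x. h (f x))"
  proof (rule Ck_on_SucI[OF S d])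
    fix v
    have "continuous_on S (\<lambda>x. h' (f x))"
      using Ck_on_SucD[OF f] by (intro continuous_on_compose2[OF h']) auto
    then show "Ck_on 0 S (\<lambda>x. h' (f x) * frechet_derivative f (at x) v)"
      using f by (auto intro: continuous_on_mult)
  qed
  show "x \<in> S \<Longrightarrow> ((\<lambda>x. h (f x)) has_derivative (\<lambda>v. h' (f x) * frechet_derivative f (at x) v)) (at x)" by (rule d)
qed

text \<open>The square makes the truncation continuously differentiable, which is the regularity
  that the integration by parts asks of the test field.\<close>

definition sq_pos :: "real \<Rightarrow> real" where "sq_pos t = (max 0 t)\<^sup>2"

lemma sq_pos_derivative: "(sq_pos has_real_derivative 2 * max 0 t) (at t)"
proof (cases t "0::real" rule: linorder_cases)
  case less
  have "((\<lambda>t. 0) has_real_derivative 0) (at t)" by simp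
  then show ?thesis
    by (rule DERIV_cong[OF has_field_derivative_transform_within_open[where S = "{..<0}"]])
      (use less in \<open>auto simp: sq_pos_def\<close>)
next
  case equal
  have "((\<lambda>h. sq_pos (0 + h) / h) \<longlongrightarrow> 0) (at 0)"
  proof (rule tendsto_0_le[of "\<lambda>h. h", where K = 1])
    show "\<forall>\<^sub>F x in at 0. norm (sq_pos (0 + x) / x) \<le> norm x * 1"
      by (rule always_eventually) (auto simp: sq_pos_def max_def power2_eq_square)
  qed (rule tendsto_ident_at)
  then show ?thesis by (simp add: equal DERIV_def sq_pos_def)
next
  case greater
  have "((\<lambda>t. t\<^sup>2) has_real_derivative 2 * t) (at t)" by (auto intro!: derivative_eq_intros)
  then show ?thesis
    by (rule DERIV_cong[OF has_field_derivative_transform_within_open[where S = "{0<..}"]])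
      (use greater in \<open>auto simp: sq_pos_def\<close>)
qed

text \<open>\<open>k\<close> is a sum of bumps, at least 1/4 on the half balls and zero outside all
  balls, and \<open>h\<close> is the squared positive part of 1 - 4 k. The derivative of
  \<open>h\<close> in \<open>k\<close> is at most 8 in absolute value and that of a bump at most
  4/\<rho>, whence 32/\<rho>. A sum of bumps keeps the bound additive however the balls
  overlap.\<close>

lemma cutoff_exists:
  fixes c :: "nat \<Rightarrow> 'e::euclidean_space"
  assumes I: "finite I" and \<rho>: "\<And>i. i \<in> I \<Longrightarrow> 0 < \<rho> i"
  obtains h where "Ck_on (Suc 0) UNIV h" "\<And>x. 0 \<le> h x" "\<And>x. h x \<le> 1"
    "\<And>x. \<forall>i\<in>I. x \<notin> ball (c i) (\<rho> i) \<Longrightarrow> h x = 1"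
    "\<And>x i. i \<in> I \<Longrightarrow> x \<in> ball (c i) (\<rho> i / 2) \<Longrightarrow> h x = 0"
    "\<And>x v. \<bar>frechet_derivative h (at x) v\<bar> \<le> (\<Sum>i\<in>I. 32 / \<rho> i * indicator (ball (c i) (\<rho> i)) x) * norm v"
proof -
  define a where "a i x = 1 - inverse ((\<rho> i)\<^sup>2) * ((x - c i) \<bullet> (x - c i))" for i x
  have da: "(a i has_derivative (\<lambda>v. - 2 * inverse ((\<rho> i)\<^sup>2) * ((x - c i) \<bullet> v))) (at x)" for i x
    unfolding a_def[abs_def] by (auto intro!: derivative_eq_intros simp: inner_commute algebra_simps)
  have fa: "frechet_derivative (a i) (at x) v = - 2 * inverse ((\<rho> i)\<^sup>2) * ((x - c i) \<bullet> v)" for i x v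
    using fun_cong[OF frechet_derivative_at[OF da]] by simp
  have Ca: "Ck_on (Suc 0) UNIV (a i)" for i
    by (rule Ck_on_SucI[OF open_UNIV da]) (auto intro!: continuous_intros)
  have cp: "continuous_on UNIV (\<lambda>t::real. 2 * max 0 t)" by (intro continuous_intros)
  note C1 = Ck_on_1_compose[OF open_UNIV Ca sq_pos_derivative cp]
  define k where "k x = (\<Sum>i\<in>I. sq_pos (a i x))" for x
  have dk: "(k has_derivative (\<lambda>v. \<Sum>i\<in>I. 2 * max 0 (a i x) * frechet_derivative (a i) (at x) v)) (at x)" for x
    unfolding k_def[abs_def] by (intro has_derivative_sum C1(2)) simp
  have fk: "frechet_derivative k (at x) v = (\<Sum>i\<in>I. 2 * max 0 (a i x) * frechet_derivative (a i) (at x) v)" for x v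
    using fun_cong[OF frechet_derivative_at[OF dk]] by simp
  have Ck: "Ck_on (Suc 0) UNIV k"
  proof (rule Ck_on_SucI[OF open_UNIV dk])
    have "continuous_on UNIV (a i)" for i using Ck_on_SucD[OF Ca] by simp
    then show "Ck_on 0 UNIV (\<lambda>x. \<Sum>i\<in>I. 2 * max 0 (a i x) * frechet_derivative (a i) (at x) v)" for v
      unfolding fa by (auto intro!: continuous_intros)
  qed
  have dh: "((\<lambda>t. sq_pos (1 - 4 * t)) has_real_derivative - 8 * max 0 (1 - 4 * t)) (at t)" for t
  proof -
    have "((\<lambda>t. 1 - 4 * t) has_real_derivative - 4) (at t)" by (auto intro!: derivative_eq_intros)
    from DERIV_chain2[OF sq_pos_derivative this] show ?thesis by simp
  qed
  have ch: "continuous_on UNIV (\<lambda>t::real. - 8 * max 0 (1 - 4 * t))" by (intro continuous_intros)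
  note C2 = Ck_on_1_compose[OF open_UNIV Ck dh ch]
  define h where "h x = sq_pos (1 - 4 * k x)" for x
  have k0: "0 \<le> k x" for x by (simp add: k_def sum_nonneg sq_pos_def)
  have out: "a i x \<le> 0" if "i \<in> I" "x \<notin> ball (c i) (\<rho> i)" for i x
  proof -
    have "(\<rho> i)\<^sup>2 \<le> (norm (x - c i))\<^sup>2"
      using that \<rho>[OF that(1)] by (intro power_mono) (auto simp: dist_norm norm_minus_commute)
    then show ?thesis using \<rho>[OF that(1)] by (simp add: a_def power2_norm_eq_inner field_simps)
  qed
  show ?thesis
  proof (rule that[of h])
    show "Ck_on (Suc 0) UNIV h" using C2(1) by (simp add: h_def[abs_def])
    show "0 \<le> h x" for x by (simp add: h_def sq_pos_def)
    show "h x \<le> 1" for x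
      using k0[of x] unfolding h_def sq_pos_def by (intro power_le_one) auto
    show "h x = 1" if "\<forall>i\<in>I. x \<notin> ball (c i) (\<rho> i)" for x
    proof -
      have "k x = 0" unfolding k_def using out that by (intro sum.neutral) (auto simp: sq_pos_def)
      then show ?thesis by (simp add: h_def sq_pos_def)
    qed
    show "h x = 0" if i: "i \<in> I" "x \<in> ball (c i) (\<rho> i / 2)" for x i
    proof -
      have "(norm (x - c i))\<^sup>2 \<le> (\<rho> i / 2)\<^sup>2" using i(2) by (intro power_mono) (auto simp: dist_norm norm_minus_commute)
      then have "4 * ((x - c i) \<bullet> (x - c i)) \<le> (\<rho> i)\<^sup>2" by (simp add: power2_norm_eq_inner field_simps)
      then have "2 * ((x - c i) \<bullet> (x - c i)) \<le> (\<rho> i)\<^sup>2" using inner_ge_zero[of "x - c i"] by linarith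
      then have "1/2 \<le> a i x" using \<rho>[OF i(1)] by (simp add: a_def field_simps)
      then have "(1/2)\<^sup>2 \<le> sq_pos (a i x)" unfolding sq_pos_def by (intro power_mono) auto
      also have "\<dots> \<le> k x" unfolding k_def using I i(1) by (intro member_le_sum) (auto simp: sq_pos_def)
      finally have "1/4 \<le> k x" by (simp add: power2_eq_square)
      then show ?thesis by (simp add: h_def sq_pos_def)
    qed
    show "\<bar>frechet_derivative h (at x) v\<bar> \<le> (\<Sum>i\<in>I. 32 / \<rho> i * indicator (ball (c i) (\<rho> i)) x) * norm v" for x v
    proof -
      have "frechet_derivative h (at x) v = - 8 * max 0 (1 - 4 * k x) * frechet_derivative k (at x) v"
        using fun_cong[OF frechet_derivative_at[OF C2(2)[of x]], of v] by (simp add: h_def[abs_def])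
      also have "\<bar>\<dots>\<bar> = (8 * max 0 (1 - 4 * k x)) * \<bar>frechet_derivative k (at x) v\<bar>" by (simp add: abs_mult)
      also have "\<dots> \<le> 8 * \<bar>frechet_derivative k (at x) v\<bar>" using k0[of x] by (intro mult_right_mono) auto
      also have "\<bar>frechet_derivative k (at x) v\<bar> \<le> (\<Sum>i\<in>I. 4 / \<rho> i * indicator (ball (c i) (\<rho> i)) x * norm v)"
        unfolding fk
      proof (rule order_trans[OF sum_abs], rule sum_mono)
        fix i assume i: "i \<in> I"
        note r = \<rho>[OF i]
        show "\<bar>2 * max 0 (a i x) * frechet_derivative (a i) (at x) v\<bar> \<le> 4 / \<rho> i * indicator (ball (c i) (\<rho> i)) x * norm v"
        proof (cases "x \<in> ball (c i) (\<rho> i)")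
          case False
          then show ?thesis using out[OF i False] by simp
        next
          case True
          have "a i x \<le> 1" by (simp add: a_def)
          have "\<bar>(x - c i) \<bullet> v\<bar> \<le> norm (x - c i) * norm v" by (rule Cauchy_Schwarz_ineq2)
          also have "\<dots> \<le> \<rho> i * norm v" using True by (intro mult_right_mono) (auto simp: dist_norm norm_minus_commute)
          finally have "inverse ((\<rho> i)\<^sup>2) * \<bar>(x - c i) \<bullet> v\<bar> \<le> inverse ((\<rho> i)\<^sup>2) * (\<rho> i * norm v)"
            using r by (intro mult_left_mono) auto
          then have "\<bar>frechet_derivative (a i) (at x) v\<bar> \<le> 2 * (norm v / \<rho> i)"
            using r unfolding fa by (simp add: abs_mult power2_eq_square field_simps)
          then have "(2 * max 0 (a i x)) * \<bar>frechet_derivative (a i) (at x) v\<bar> \<le> 2 * (2 * (norm v / \<rho> i))"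
            using \<open>a i x \<le> 1\<close> r by (intro mult_mono) auto
          then show ?thesis using True by (simp add: abs_mult)
        qed
      qed
      finally show ?thesis by (simp add: sum_distrib_left sum_distrib_right mult.assoc)
    qed
  qed
qed

section \<open>Monotonicity of the flux and the integral inequality\<close>

lemma powr_minus_half: "0 < q \<Longrightarrow> q powr (- (1/2)) = 1 / sqrt q" for q :: real
  by (simp only: powr_minus powr_half_sqrt[OF less_imp_le] inverse_eq_divide)

context cometric_box
begin

text \<open>Cauchy-Schwarz bounds the flux independently of the gradient, even where the conormal is
  close to null. This makes cutoffs around the singular set affordable.\<close>

lemma flux_bound:
  assumes "(x, p) \<in> regular"
  shows "\<bar>flux b (x, p)\<bar> \<le> A x * sqrt (B x (b, 0) (b, 0))"
proof -
  have x: "x \<in> U" and Q: "0 < Q (x, p)" using assms by (auto simp: regular_def)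
  have s: "Q (x, p) powr (- (1/2)) = 1 / sqrt (Q (x, p))"
    by (rule powr_minus_half[OF Q])
  have "(B x (b, 0) (p, -1))\<^sup>2 \<le> B x (b, 0) (b, 0) * Q (x, p)"
    using Cauchy_Schwarz[OF x] by (simp add: Q_def)
  then have "\<bar>B x (b, 0) (p, -1)\<bar> \<le> sqrt (B x (b, 0) (b, 0)) * sqrt (Q (x, p))"
    by (metis real_sqrt_abs real_sqrt_le_mono real_sqrt_mult)
  then have "\<bar>B x (b, 0) (p, -1)\<bar> / sqrt (Q (x, p)) \<le> sqrt (B x (b, 0) (b, 0))"
    using Q by (simp add: field_simps)
  then have "A x * (\<bar>B x (b, 0) (p, -1)\<bar> / sqrt (Q (x, p))) \<le> A x * sqrt (B x (b, 0) (b, 0))"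
    using A_pos[OF x] by (intro mult_left_mono) auto
  then show ?thesis using A_pos[OF x] Q by (simp add: flux_def s abs_mult)
qed

definition monotonicity_defect :: "'e \<Rightarrow> 'e \<Rightarrow> 'e \<Rightarrow> real" where
  "monotonicity_defect x p q = (\<Sum>b\<in>Basis. (flux b (x, q) - flux b (x, p)) * ((q - p) \<bullet> b))"

text \<open>With \<alpha> and \<beta> the lengths of the two conormals and k their product in
  \<open>B\<close>, the defect equals A (\<alpha> + \<beta>) (\<alpha> \<beta> - k) / (\<alpha>
  \<beta>), which is nonnegative by Cauchy-Schwarz. If it vanishes, the second conormal minus
  \<beta>/\<alpha> times the first is null and so lies in the kernel of the form.\<close>

lemma monotonicity_defect:
  assumes p: "(x, p) \<in> regular" and q: "(x, q) \<in> regular"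
  shows "0 \<le> monotonicity_defect x p q"
    and "monotonicity_defect x p q = 0 \<Longrightarrow> \<exists>k. \<forall>a. B x (q, -1) a = k * B x (p, -1) a"
proof -
  have x: "x \<in> U" and Qp: "0 < Q (x, p)" and Qq: "0 < Q (x, q)" using p q by (auto simp: regular_def)
  note b = bil[OF x]
  let ?P = "(p, -1::real)" and ?q = "(q, -1::real)"
  define \<alpha> where "\<alpha> = sqrt (Q (x, p))"
  define \<beta> where "\<beta> = sqrt (Q (x, q))"
  define k where "k = B x ?P ?q"
  have \<alpha>: "0 < \<alpha>" "B x ?P ?P = \<alpha> * \<alpha>" using Qp by (auto simp: \<alpha>_def Q_def)
  have \<beta>: "0 < \<beta>" "B x ?q ?q = \<beta> * \<beta>" using Qq by (auto simp: \<beta>_def Q_def)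
  have s: "Q (x, p) powr (- (1/2)) = 1 / \<alpha>" "Q (x, q) powr (- (1/2)) = 1 / \<beta>"
    unfolding \<alpha>_def \<beta>_def by (rule powr_minus_half[OF Qp], rule powr_minus_half[OF Qq])
  have f: "(\<Sum>c\<in>Basis. B x (c, 0) r * ((q - p) \<bullet> c)) = B x ?q r - B x ?P r" for r
  proof -
    have lin: "linear (\<lambda>v. B x (v, 0) r)"
    proof -
      have e: "(u + v, 0) = (u, 0) + (v, 0::real)" "(k *\<^sub>R u, 0) = k *\<^sub>R (u, 0::real)" for u v :: 'e and k by auto
      show ?thesis by (rule linearI) (simp_all only: e bilinear_ladd[OF b] bilinear_lmul[OF b] real_scaleR_def)
    qed
    have "B x (q - p, 0) r = (\<Sum>c\<in>Basis. B x (c, 0) r * ((q - p) \<bullet> c))"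
      using linear_basis_sum[OF lin, of "q - p"] by (simp add: mult.commute)
    moreover have "(q - p, 0) = ?q - ?P" by simp
    ultimately show ?thesis by (simp only: bilinear_lsub[OF b])
  qed
  have "monotonicity_defect x p q
      = A x * ((\<Sum>c\<in>Basis. B x (c, 0) ?q * ((q - p) \<bullet> c)) / \<beta> - (\<Sum>c\<in>Basis. B x (c, 0) ?P * ((q - p) \<bullet> c)) / \<alpha>)"
    unfolding monotonicity_defect_def flux_def fst_conv snd_conv s
    by (simp add: sum_distrib_left sum_divide_distrib sum_subtractf[symmetric] right_diff_distrib left_diff_distrib mult_ac)
  also have "\<dots> = A x * ((\<beta> * \<beta> - k) / \<beta> - (k - \<alpha> * \<alpha>) / \<alpha>)"
    unfolding f by (simp add: \<alpha> \<beta> k_def sym[OF x, of ?q ?P])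
  also have "(\<beta> * \<beta> - k) / \<beta> - (k - \<alpha> * \<alpha>) / \<alpha> = (\<alpha> + \<beta>) * (\<alpha> * \<beta> - k) / (\<alpha> * \<beta>)"
    using \<alpha> \<beta> by (simp add: field_simps)
  finally have m: "monotonicity_defect x p q = A x * ((\<alpha> + \<beta>) * (\<alpha> * \<beta> - k) / (\<alpha> * \<beta>))" .
  have k2: "k\<^sup>2 \<le> (\<alpha> * \<beta>)\<^sup>2"
    using Cauchy_Schwarz[OF x, of ?P ?q] by (simp add: \<alpha> \<beta> k_def power2_eq_square mult_ac)
  have "k \<le> \<alpha> * \<beta>" by (rule power2_le_imp_le[OF k2]) (use \<alpha>(1) \<beta>(1) in simp)
  then show "0 \<le> monotonicity_defect x p q"
    unfolding m using \<alpha>(1) \<beta>(1) A_pos[OF x] by simp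
  assume "monotonicity_defect x p q = 0"
  then have k: "k = \<alpha> * \<beta>" unfolding m using \<alpha>(1) \<beta>(1) A_pos[OF x] by (auto simp: add_pos_pos)
  define t where "t = \<beta> / \<alpha>"
  have tb: "t * \<alpha> = \<beta>" using \<alpha>(1) by (simp add: t_def)
  define N where "N = ?q - t *\<^sub>R ?P"
  have kk: "B x ?P ?q = \<alpha> * \<beta>" using k by (simp add: k_def)
  have "B x N N = B x ?q ?q - 2 * t * B x ?P ?q + t * t * B x ?P ?P"
    unfolding N_def
    by (simp only: bilinear_lsub[OF b] bilinear_rsub[OF b] bilinear_lmul[OF b] bilinear_rmul[OF b] sym[OF x, of ?q ?P])
      (simp add: algebra_simps)
  also have "\<dots> = \<beta> * \<beta> - 2 * (t * \<alpha>) * \<beta> + (t * \<alpha>) * (t * \<alpha>)" by (simp add: \<alpha>(2) \<beta>(2) kk mult_ac)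
  also have "\<dots> = 0" by (simp add: tb)
  finally have "(B x N a)\<^sup>2 \<le> 0" for a using Cauchy_Schwarz[OF x, of N a] by simp
  then have "B x N a = 0" for a by simp
  then have "B x ?q a = t * B x ?P a" for a
    unfolding N_def by (simp only: bilinear_lsub[OF b] bilinear_lmul[OF b] real_scaleR_def right_minus_eq)
  then show "\<exists>k. \<forall>a. B x (q, -1) a = k * B x (p, -1) a" by blast
qed

lemma Ck_on_smooth: "smooth_on S f \<Longrightarrow> Ck_on k S f"
  by (simp add: smooth_on_def)

text \<open>The test field is \<open>(\<epsilon> - w)\<^sub>+\<^sup>2 \<chi> (F(v) - F(u))\<close> with \<open>w = v - u\<close>, where the cutoff \<open>\<chi>\<close> vanishes
  near the singular set and has a gradient of small integral.\<close>

lemma monotonicity_defect_eq_0: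
  fixes y0 :: 'e
  assumes u: "smooth_on U u" and v: "smooth_on U v" and le: "\<And>x. x \<in> U \<Longrightarrow> u x \<le> v x"
    and R: "0 < R" "cball y0 R \<subseteq> U"
    and S: "compact S" "S \<subseteq> S'" "hausdorff_measure (DIM('e) - 1) S' = 0"
    and ru: "\<And>x. x \<in> U - S \<Longrightarrow> (x, grad u x) \<in> regular" and rv: "\<And>x. x \<in> U - S \<Longrightarrow> (x, grad v x) \<in> regular"
    and div: "\<And>x. x \<in> U - S \<Longrightarrow> divergence v x \<le> divergence u x"
    and \<epsilon>: "0 < \<epsilon>" "\<And>x. x \<in> sphere y0 R \<Longrightarrow> \<epsilon> < v x - u x"
    and x0: "x0 \<in> ball y0 R - S" "v x0 - u x0 < \<epsilon>"
  shows "monotonicity_defect x0 (grad u x0) (grad v x0) = 0"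
proof (rule ccontr)
  assume ne: "monotonicity_defect x0 (grad u x0) (grad v x0) \<noteq> 0"
  let ?G = "ball y0 R - S"
  have "closed S" using S(1) by (rule compact_imp_closed)
  then have oG: "open ?G" by (intro open_Diff open_ball)
  have GU: "?G \<subseteq> U - S" "?G \<subseteq> U" using R(2) by auto
  define w where "w x = v x - u x" for x
  have w0: "0 \<le> w x" if "x \<in> U" for x using le[OF that] by (simp add: w_def)
  have sw: "smooth_on U w" unfolding w_def[abs_def] by (rule smooth_on_diff[OF open_U v u])
  define Fl where "Fl b x = flux b (x, grad v x) - flux b (x, grad u x)" for b x
  have sfl: "smooth_on ?G (\<lambda>x. flux b (x, grad u x))"
    if u: "smooth_on U u" and ru: "\<And>x. x \<in> U - S \<Longrightarrow> (x, grad u x) \<in> regular" for u b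
  proof -
    have sc: "smooth_on ?G (\<lambda>x. (grad u x, -1::real))"
    proof -
      have "bounded_linear (\<lambda>g::'e. (g, 0::real))" by (intro bounded_linear_Pair bounded_linear_ident bounded_linear_zero)
      from smooth_on_add[OF oG smooth_on_bounded_linear[OF oG this smooth_on_subset[OF smooth_on_grad[OF open_U u] GU(2)]]
          smooth_on_const[of ?G "(0, -1)"]]
      show ?thesis by simp
    qed
    have sB: "smooth_on ?G (\<lambda>x. B x (F x) (H x))" if "smooth_on ?G F" "smooth_on ?G H" for F H
      by (rule smooth_on_bilinear_form[of ?G B, OF oG bil[OF subsetD[OF GU(2)]] smooth_on_subset[OF smooth_B GU(2)] that])
    have pos: "0 < B x (grad u x, -1) (grad u x, -1)" if "x \<in> ?G" for x
      using ru[OF subsetD[OF GU(1) that]] by (simp add: regular_def Q_def)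
    show ?thesis
      unfolding flux_def fst_conv snd_conv Q_def
      by (intro smooth_on_mult oG smooth_on_powr sB sc pos smooth_on_const smooth_on_subset[OF smooth_A GU(2)])
  qed
  have sF: "smooth_on ?G (Fl b)" for b
    unfolding Fl_def[abs_def] by (intro smooth_on_diff oG sfl u v ru rv)
  define J where "J x = (\<Sum>b\<in>Basis. Fl b x * (grad w x \<bullet> b))" for x
  have gw: "grad w x = grad v x - grad u x" if "x \<in> U" for x
  proof -
    have "(w has_derivative (\<lambda>h. grad v x \<bullet> h - grad u x \<bullet> h)) (at x)"
      unfolding w_def[abs_def]
      by (intro has_derivative_diff grad_has_derivative[OF u that] grad_has_derivative[OF v that])
    from fun_cong[OF frechet_derivative_at[OF this]]
    have "grad w x \<bullet> h = (grad v x - grad u x) \<bullet> h" for h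
      using grad_inner[OF sw that, of h] by (simp add: inner_diff_left)
    then show ?thesis by (metis inner_commute vector_eq_rdot)
  qed
  have Jm: "J x = monotonicity_defect x (grad u x) (grad v x)" if "x \<in> ?G" for x
    using gw[of x] GU(2) that by (auto simp: J_def Fl_def monotonicity_defect_def)
  have J0: "0 \<le> J x" if "x \<in> ?G" for x
    unfolding Jm[OF that] using GU(1) that by (intro monotonicity_defect(1) ru rv) auto
  have Jpos: "0 < J x0" using J0[OF x0(1)] ne by (simp add: Jm[OF x0(1)])
  define c0 where "c0 = (\<epsilon> - w x0) * J x0 / 2"
  have wx0: "w x0 < \<epsilon>" using x0(2) by (simp add: w_def)
  have c0: "0 < c0" "c0 < (\<epsilon> - w x0) * J x0" using Jpos wx0 by (auto simp: c0_def)
  have cJ: "continuous_on ?G (\<lambda>x. (\<epsilon> - w x) * J x)"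
    unfolding J_def
    by (intro continuous_intros smooth_on_continuous_on smooth_on_subset[OF sw GU(2)] sF
        smooth_on_subset[OF smooth_on_grad[OF open_U sw] GU(2)])
  have "open ((\<lambda>x. (\<epsilon> - w x) * J x) -` {c0<..} \<inter> ?G)"
    by (rule continuous_on_open_vimage[OF oG, THEN iffD1, rule_format, OF cJ]) simp
  moreover have "x0 \<in> (\<lambda>x. (\<epsilon> - w x) * J x) -` {c0<..} \<inter> ?G" using c0 x0(1) by simp
  ultimately obtain \<kappa>2 where \<kappa>2: "0 < \<kappa>2" "cball x0 \<kappa>2 \<subseteq> (\<lambda>x. (\<epsilon> - w x) * J x) -` {c0<..} \<inter> ?G"
    unfolding open_contains_cball by metis
  \<comment> \<open>Halving leaves room: \<open>cball x0 \<kappa>2\<close> avoids \<open>S\<close>,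
    so a ball with centre in \<open>S\<close> and radius at most \<kappa> does not meet
    \<open>ball x0 \<kappa>\<close>, and the cutoff is 1 there.\<close>
  define \<kappa> where "\<kappa> = \<kappa>2 / 2"
  have \<kappa>: "0 < \<kappa>" using \<kappa>2(1) by (simp add: \<kappa>_def)
  have near: "c0 < (\<epsilon> - w x) * J x" "x \<in> ?G" if "x \<in> ball x0 \<kappa>" for x
  proof -
    have "x \<in> cball x0 \<kappa>2" using that \<kappa>2(1) by (simp add: \<kappa>_def)
    then show "c0 < (\<epsilon> - w x) * J x" "x \<in> ?G" using \<kappa>2(2) by auto
  qed
  \<comment> \<open>a bound for the field \<open>F(v) - F(u)\<close>\<close>
  have "\<exists>C. \<forall>x\<in>cball y0 R. A x * sqrt (B x (b, 0) (b, 0)) \<le> C" for b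
  proof -
    have "continuous_on (cball y0 R) (\<lambda>x. A x * sqrt (B x (b, 0) (b, 0)))"
      by (intro continuous_intros smooth_on_continuous_on smooth_on_subset[OF smooth_A R(2)] smooth_on_subset[OF smooth_B R(2)])
    then have "compact ((\<lambda>x. A x * sqrt (B x (b, 0) (b, 0))) ` cball y0 R)" by (intro compact_continuous_image compact_cball)
    then have "bdd_above ((\<lambda>x. A x * sqrt (B x (b, 0) (b, 0))) ` cball y0 R)"
      by (intro bounded_imp_bdd_above compact_imp_bounded)
    then show ?thesis unfolding bdd_above_def by auto
  qed
  then obtain Cb where Cb: "\<And>b x. x \<in> cball y0 R \<Longrightarrow> A x * sqrt (B x (b, 0) (b, 0)) \<le> Cb b" by metis
  define C where "C = (\<Sum>b\<in>(Basis::'e set). 2 * \<bar>Cb b\<bar>) + 1"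
  have C: "0 < C" unfolding C_def by (intro add_nonneg_pos sum_nonneg) auto
  have FC: "(\<Sum>b\<in>Basis. \<bar>Fl b x\<bar>) \<le> C" if "x \<in> ?G" for x
  proof -
    have xr: "x \<in> cball y0 R" "x \<in> U - S" using that GU(1) by auto
    have "\<bar>Fl b x\<bar> \<le> 2 * \<bar>Cb b\<bar>" for b
      using flux_bound[OF ru[OF xr(2)], of b] flux_bound[OF rv[OF xr(2)], of b] Cb[OF xr(1), of b]
      unfolding Fl_def by linarith
    then have "(\<Sum>b\<in>Basis. \<bar>Fl b x\<bar>) \<le> (\<Sum>b\<in>(Basis::'e set). 2 * \<bar>Cb b\<bar>)" by (intro sum_mono)
    then show ?thesis by (simp add: C_def)
  qed
  define n where "n = DIM('e)"
  have n: "n = Suc (n - 1)" by (simp add: n_def)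
  define \<omega> where "\<omega> = unit_ball_vol (real n)"
  have \<omega>: "0 < \<omega>" by (simp add: \<omega>_def)
  define K where "K = \<epsilon>\<^sup>2 * C * 32"
  have K: "0 < K" using \<epsilon>(1) C by (simp add: K_def)
  \<comment> \<open>Makes the error K \<omega> \<tau> caused by the cutoff half of c0 \<omega>
    \<kappa>^n, which is the gain from the ball about \<open>x0\<close>.\<close>
  define \<tau> where "\<tau> = c0 * (\<omega> * \<kappa> ^ n) / (2 * K * \<omega>)"
  have \<tau>: "0 < \<tau>" using c0 \<omega> \<kappa> K by (simp add: \<tau>_def)
  obtain I :: "nat set" and c \<rho> where I: "finite I" "\<And>i. i \<in> I \<Longrightarrow> c i \<in> S" "\<And>i. i \<in> I \<Longrightarrow> 0 < \<rho> i"
    "\<And>i. i \<in> I \<Longrightarrow> \<rho> i \<le> \<kappa>" "S \<subseteq> (\<Union>i\<in>I. ball (c i) (\<rho> i / 2))" "(\<Sum>i\<in>I. \<rho> i ^ (n - 1)) \<le> \<tau>"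
    by (rule hausdorff_null_cover[OF S(3)[folded n_def] S(1,2) \<tau> \<kappa>]) (rule that)
  obtain h where h: "Ck_on (Suc 0) UNIV h" "\<And>x. 0 \<le> h x" "\<And>x. h x \<le> 1"
    "\<And>x. \<forall>i\<in>I. x \<notin> ball (c i) (\<rho> i) \<Longrightarrow> h x = 1"
    "\<And>x i. i \<in> I \<Longrightarrow> x \<in> ball (c i) (\<rho> i / 2) \<Longrightarrow> h x = 0"
    "\<And>x v. \<bar>frechet_derivative h (at x) v\<bar> \<le> (\<Sum>i\<in>I. 32 / \<rho> i * indicator (ball (c i) (\<rho> i)) x) * norm v"
    by (rule cutoff_exists[where c = c and \<rho> = \<rho> and I = I, OF I(1,3)]) (assumption, rule that)
  define p where "p t = sq_pos (\<epsilon> - t)" for t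
  have dp: "(p has_real_derivative - 2 * max 0 (\<epsilon> - t)) (at t)" for t
  proof -
    have "((\<lambda>t. \<epsilon> - t) has_real_derivative - 1) (at t)" by (auto intro!: derivative_eq_intros)
    from DERIV_chain2[OF sq_pos_derivative this] show ?thesis by (simp add: p_def[abs_def])
  qed
  have cp: "continuous_on UNIV (\<lambda>t. - 2 * max 0 (\<epsilon> - t))" by (intro continuous_intros)
  note pw = Ck_on_1_compose[OF oG Ck_on_smooth[OF smooth_on_subset[OF sw GU(2)]] dp cp]
  define Y where "Y b x = (if x \<in> ball y0 R then h x * p (w x) * Fl b x else 0)" for b x
  \<comment> \<open>On this open set the test field vanishes for one of three reasons: the point is
    outside the ball, w exceeds \<epsilon>, or the cutoff is zero. Since w > \<epsilon> on the
    sphere, the set covers the complement of \<open>?G\<close>, and the field is continuously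
    differentiable everywhere.\<close>
  define N where "N = - cball y0 R \<union> (w -` {\<epsilon><..} \<inter> U) \<union> (\<Union>i\<in>I. ball (c i) (\<rho> i / 2))"
  have oN: "open N"
  proof -
    have "open (w -` {\<epsilon><..} \<inter> U)"
      by (rule continuous_on_open_vimage[OF open_U, THEN iffD1, rule_format, OF smooth_on_continuous_on[OF sw]]) simp
    then show ?thesis unfolding N_def by (intro open_Un open_UN ballI open_ball open_Compl closed_cball)
  qed
  have YN: "Y b x = 0" if "x \<in> N" for b x
  proof (cases "x \<in> ball y0 R")
    case True
    then have "p (w x) = 0 \<or> h x = 0" using that h(5) by (auto simp: N_def p_def sq_pos_def)
    then show ?thesis by (auto simp: Y_def)
  qed (simp add: Y_def)
  have cover: "?G \<union> N = UNIV"
  proof -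
    have "x \<in> ?G \<union> N" for x
    proof (cases "x \<in> S")
      case True
      then show ?thesis using I(5) by (auto simp: N_def)
    next
      case False
      consider "x \<in> ball y0 R" | "x \<in> sphere y0 R" | "x \<notin> cball y0 R" by fastforce
      then show ?thesis
      proof cases
        case 2
        then have "x \<in> U" using R(2) by auto
        then show ?thesis using \<epsilon>(2)[OF 2] by (simp add: N_def w_def)
      qed (use False in \<open>auto simp: N_def\<close>)
    qed
    then show ?thesis by blast
  qed
  have YG: "Y b x = h x * p (w x) * Fl b x" if "x \<in> ?G" for b x using that by (simp add: Y_def)
  have CY: "Ck_on (Suc 0) UNIV (Y b)" for b
  proof -
    have "Ck_on (Suc 0) ?G (\<lambda>x. h x * p (w x) * Fl b x)"
      by (intro Ck_on_bilinear[OF oG bounded_bilinear_mult] pw(1) Ck_on_smooth sF Ck_on_subset[OF h(1)]) simp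
    then have 1: "Ck_on (Suc 0) ?G (Y b)" using Ck_on_cong[OF oG YG, where k = "Suc 0"] by simp
    have 2: "Ck_on (Suc 0) N (Y b)" using Ck_on_cong[OF oN YN, where k = "Suc 0"] Ck_on_const[of "Suc 0" N "0::real"] by simp
    show ?thesis using Ck_on_Un[OF oG oN 1 2] by (simp only: cover)
  qed
  define T where "T x = (\<Sum>i\<in>I. 1 / \<rho> i * indicator (ball (c i) (\<rho> i)) x)" for x :: 'e
  have T0: "0 \<le> T x" for x unfolding T_def using I(3) by (intro sum_nonneg) (simp add: less_imp_le)
  have T32: "(\<Sum>i\<in>I. 32 / \<rho> i * indicator (ball (c i) (\<rho> i)) x) = 32 * T x" for x :: 'e
    by (simp add: T_def sum_distrib_left)
  have h1: "h x = 1" if x: "x \<in> ball x0 \<kappa>" for x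
  proof (rule h(4), rule ballI)
    fix i assume i: "i \<in> I"
    show "x \<notin> ball (c i) (\<rho> i)"
    proof
      assume "x \<in> ball (c i) (\<rho> i)"
      then have "dist x (c i) < \<kappa>" using I(4)[OF i] by (simp add: dist_commute)
      then have "dist x0 (c i) \<le> \<kappa>2" using x dist_triangle[of x0 "c i" x] by (simp add: \<kappa>_def)
      then have "c i \<notin> S" using \<kappa>2(2) by auto
      then show False using I(2)[OF i] by simp
    qed
  qed
  \<comment> \<open>The three terms of the product rule: the curvature inequality makes the first
    nonpositive, the derivative of the truncation yields the defect with a negative sign, and the
    derivative of the cutoff is absorbed in \<open>K * T x\<close>.\<close>
  have DG: "(\<Sum>b\<in>Basis. frechet_derivative (Y b) (at x) b) \<le> h x * (- 2 * max 0 (\<epsilon> - w x)) * J x + K * T x"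
    if x: "x \<in> ?G" for x
  proof -
    have xU: "x \<in> U" "x \<in> U - S" using x GU by auto
    have DY: "frechet_derivative (Y b) (at x) b = h x * p (w x) * frechet_derivative (Fl b) (at x) b
        + (h x * (- 2 * max 0 (\<epsilon> - w x) * (grad w x \<bullet> b)) + frechet_derivative h (at x) b * p (w x)) * Fl b x" for b
    proof -
      have g: "frechet_derivative w (at x) v = grad w x \<bullet> v" for v by (rule grad_inner[OF sw xU(1)])
      have "((\<lambda>x. h x * p (w x) * Fl b x) has_derivative (\<lambda>v. h x * p (w x) * frechet_derivative (Fl b) (at x) v
        + (h x * (- 2 * max 0 (\<epsilon> - w x) * frechet_derivative w (at x) v) + frechet_derivative h (at x) v * p (w x)) * Fl b x)) (at x)"
        by (intro has_derivative_mult pw(2)[OF x] smooth_on_has_derivative[OF sF x] Ck_on_has_derivative[OF h(1) UNIV_I])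
      then have "(Y b has_derivative (\<lambda>v. h x * p (w x) * frechet_derivative (Fl b) (at x) v
        + (h x * (- 2 * max 0 (\<epsilon> - w x) * frechet_derivative w (at x) v) + frechet_derivative h (at x) v * p (w x)) * Fl b x)) (at x)"
        by (rule has_derivative_transform_within_open[OF _ oG x]) (rule YG[symmetric])
      from fun_cong[OF frechet_derivative_at[OF this], of b] show ?thesis unfolding g by (rule HOL.sym)
    qed
    have dF: "frechet_derivative (Fl b) (at x) b = frechet_derivative (\<lambda>x. flux b (x, grad v x)) (at x) b
        - frechet_derivative (\<lambda>x. flux b (x, grad u x)) (at x) b" for b
      unfolding Fl_def[abs_def]
      by (rule fun_cong[OF frechet_derivative_at[OF has_derivative_diff[OF smooth_on_has_derivative[OF sfl[OF v rv] x]
          smooth_on_has_derivative[OF sfl[OF u ru] x]]], symmetric])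
    have "(\<Sum>b\<in>Basis. frechet_derivative (Fl b) (at x) b) = divergence v x - divergence u x"
      by (simp add: dF sum_subtractf divergence_def)
    then have a1: "h x * p (w x) * (\<Sum>b\<in>Basis. frechet_derivative (Fl b) (at x) b) \<le> 0"
      using div[OF xU(2)] h(2)[of x] by (intro mult_nonneg_nonpos) (auto simp: p_def sq_pos_def)
    have pe: "0 \<le> p (w x)" "p (w x) \<le> \<epsilon>\<^sup>2"
      using w0[OF xU(1)] \<epsilon>(1) by (auto simp: p_def sq_pos_def intro!: power_mono)
    have a2: "(\<Sum>b\<in>Basis. frechet_derivative h (at x) b * p (w x) * Fl b x) \<le> K * T x"
    proof -
      have "(\<Sum>b\<in>Basis. frechet_derivative h (at x) b * p (w x) * Fl b x) \<le> (\<Sum>b\<in>Basis. (32 * T x) * \<epsilon>\<^sup>2 * \<bar>Fl b x\<bar>)"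
      proof (rule sum_mono)
        fix b :: 'e assume b: "b \<in> Basis"
        have "frechet_derivative h (at x) b * p (w x) * Fl b x \<le> \<bar>frechet_derivative h (at x) b * p (w x) * Fl b x\<bar>"
          by (rule abs_ge_self)
        also have "\<dots> = \<bar>frechet_derivative h (at x) b\<bar> * p (w x) * \<bar>Fl b x\<bar>" using pe(1) by (simp add: abs_mult)
        also have "\<dots> \<le> (32 * T x) * \<epsilon>\<^sup>2 * \<bar>Fl b x\<bar>"
          using h(6)[of x b] b pe T0[of x] unfolding T32 by (intro mult_right_mono mult_mono) auto
        finally show "frechet_derivative h (at x) b * p (w x) * Fl b x \<le> (32 * T x) * \<epsilon>\<^sup>2 * \<bar>Fl b x\<bar>" .
      qed
      also have "\<dots> = (32 * T x) * \<epsilon>\<^sup>2 * (\<Sum>b\<in>Basis. \<bar>Fl b x\<bar>)" by (simp add: sum_distrib_left)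
      also have "\<dots> \<le> (32 * T x) * \<epsilon>\<^sup>2 * C" using T0[of x] by (intro mult_left_mono FC[OF x]) auto
      also have "\<dots> = K * T x" by (simp add: K_def)
      finally show ?thesis .
    qed
    have a3: "(\<Sum>b\<in>Basis. h x * (- 2 * max 0 (\<epsilon> - w x) * (grad w x \<bullet> b)) * Fl b x) = h x * (- 2 * max 0 (\<epsilon> - w x)) * J x"
      unfolding J_def sum_distrib_left by (intro sum.cong refl) (simp only: mult_ac)
    have "(\<Sum>b\<in>Basis. frechet_derivative (Y b) (at x) b) = h x * p (w x) * (\<Sum>b\<in>Basis. frechet_derivative (Fl b) (at x) b)
      + ((\<Sum>b\<in>Basis. h x * (- 2 * max 0 (\<epsilon> - w x) * (grad w x \<bullet> b)) * Fl b x)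
        + (\<Sum>b\<in>Basis. frechet_derivative h (at x) b * p (w x) * Fl b x))"
      unfolding DY distrib_right sum.distrib sum_distrib_left ..
    then show ?thesis using a1 a2 a3 by linarith
  qed
  have pointwise: "(\<Sum>b\<in>Basis. frechet_derivative (Y b) (at x) b) \<le> K * T x - c0 * indicator (ball x0 \<kappa>) x" for x
  proof (cases "x \<in> ?G")
    case False
    then have xN: "x \<in> N" using cover by blast
    have "frechet_derivative (Y b) (at x) b = 0" for b
    proof -
      have "(Y b has_derivative (\<lambda>v. 0)) (at x)"
        by (rule has_derivative_transform_within_open[OF has_derivative_const[of 0] oN xN]) (simp add: YN)
      from fun_cong[OF frechet_derivative_at[OF this], of b] show ?thesis by simp
    qed
    moreover have "x \<notin> ball x0 \<kappa>" using near(2) False by blast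
    ultimately show ?thesis using K T0[of x] by simp
  next
    case True
    have J: "0 \<le> J x" by (rule J0[OF True])
    show ?thesis
    proof (cases "x \<in> ball x0 \<kappa>")
      case False
      have "h x * (- 2 * max 0 (\<epsilon> - w x)) * J x \<le> 0"
        using h(2)[of x] J by (intro mult_nonpos_nonneg mult_nonneg_nonpos) auto
      moreover have ind: "indicator (ball x0 \<kappa>) x = (0::real)" using False by simp
      ultimately show ?thesis unfolding ind using DG[OF True] by linarith
    next
      case in_ball: True
      have "0 < (\<epsilon> - w x) * J x" using near(1)[OF in_ball] c0(1) by linarith
      then have "0 < \<epsilon> - w x" using J by (auto simp: zero_less_mult_iff)
      then have "h x * (- 2 * max 0 (\<epsilon> - w x)) * J x = - 2 * ((\<epsilon> - w x) * J x)"
        using h1[OF in_ball] by (simp add: algebra_simps)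
      moreover have ind: "indicator (ball x0 \<kappa>) x = (1::real)" using in_ball by simp
      ultimately show ?thesis unfolding ind using DG[OF True] near(1)[OF in_ball] c0(1) by linarith
    qed
  qed
  have Y0: "Y b x = 0" if "x \<notin> cball y0 R" for b x using that by (simp add: Y_def)
  have int: "integrable lborel (\<lambda>x. frechet_derivative (Y b) (at x) b)"
    "(\<integral>x. frechet_derivative (Y b) (at x) b \<partial>lborel) = 0" for b
    by (rule integral_directional_derivative_eq_0[OF CY Y0], assumption)+
  have ib: "integrable lborel (indicator (ball z r) :: 'e \<Rightarrow> real)" for z r
    using emeasure_lborel_ball_finite[of z r] by (intro integrable_real_indicator) auto
  have vol: "measure lborel (ball z r) = \<omega> * r ^ n" if "0 \<le> r" for z :: 'e and r
    using content_ball[OF that, of z] by (simp add: \<omega>_def n_def)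
  have iT: "integrable lborel T" unfolding T_def[abs_def] by (intro Bochner_Integration.integrable_sum integrable_mult_right ib)
  have "0 = (\<integral>x. (\<Sum>b\<in>Basis. frechet_derivative (Y b) (at x) b) \<partial>lborel)"
    by (subst Bochner_Integration.integral_sum) (simp_all add: int)
  also have "\<dots> \<le> (\<integral>x. K * T x - c0 * indicator (ball x0 \<kappa>) x \<partial>lborel)"
    by (intro integral_mono Bochner_Integration.integrable_sum int(1) Bochner_Integration.integrable_diff integrable_mult_right iT ib pointwise)
  also have "\<dots> = K * (\<integral>x. T x \<partial>lborel) - c0 * (\<omega> * \<kappa> ^ n)"
    using iT ib \<kappa> by (simp add: vol)
  \<comment> \<open>A ball of radius \<rho> contributes its volume times 1/\<rho>; this is why the
    Hausdorff measure of dimension one less than the slice enters.\<close>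
  also have "(\<integral>x. T x \<partial>lborel) = (\<Sum>i\<in>I. 1 / \<rho> i * (\<omega> * \<rho> i ^ n))"
    unfolding T_def
    by (subst Bochner_Integration.integral_sum) (auto intro!: sum.cong integrable_mult_right ib simp: vol less_imp_le[OF I(3)])
  also have "\<dots> = \<omega> * (\<Sum>i\<in>I. \<rho> i ^ (n - 1))"
    unfolding sum_distrib_left using I(3) by (intro sum.cong refl, subst n) (auto simp: less_imp_neq[symmetric])
  also have "K * (\<omega> * (\<Sum>i\<in>I. \<rho> i ^ (n - 1))) \<le> K * (\<omega> * \<tau>)"
    using I(6) K \<omega> by (intro mult_left_mono) auto
  also have "K * (\<omega> * \<tau>) = c0 * (\<omega> * \<kappa> ^ n) / 2" using K \<omega> by (simp add: \<tau>_def)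
  finally have "c0 * (\<omega> * \<kappa> ^ n) \<le> 0" by linarith
  moreover have "0 < c0 * (\<omega> * \<kappa> ^ n)" using c0(1) \<omega> \<kappa> by simp
  ultimately show False by linarith
qed

end

text \<open>Volume comparison: radii at most 1 satisfy \<rho>^n \<le> \<rho>^(n-1), so a set that is
  null in dimension n - 1 has coverings of arbitrarily small volume. It makes the complement of the
  singular set dense.\<close>

lemma hausdorff_null_no_ball:
  fixes S :: "'e::euclidean_space set"
  assumes S: "compact S" "S \<subseteq> S'" "hausdorff_measure (DIM('e) - 1) S' = 0" and \<kappa>: "0 < \<kappa>"
  shows "\<not> ball x \<kappa> \<subseteq> S"
proof
  assume sub: "ball x \<kappa> \<subseteq> S"
  define n where "n = DIM('e)"
  have n: "n = Suc (n - 1)" by (simp add: n_def)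
  define \<omega> where "\<omega> = unit_ball_vol (real n)"
  have \<omega>: "0 < \<omega>" by (simp add: \<omega>_def)
  have vol: "measure lborel (ball z r) = \<omega> * r ^ n" if "0 \<le> r" for z :: 'e and r
    using content_ball[OF that, of z] by (simp add: \<omega>_def n_def)
  have ib: "integrable lborel (indicator (ball z r) :: 'e \<Rightarrow> real)" for z r
    using emeasure_lborel_ball_finite[of z r] by (intro integrable_real_indicator) auto
  have \<tau>: "0 < \<kappa> ^ n / 2" using \<kappa> by simp
  obtain I :: "nat set" and c \<rho> where I: "finite I" "\<And>i. i \<in> I \<Longrightarrow> c i \<in> S" "\<And>i. i \<in> I \<Longrightarrow> 0 < \<rho> i"
    "\<And>i. i \<in> I \<Longrightarrow> \<rho> i \<le> 1" "S \<subseteq> (\<Union>i\<in>I. ball (c i) (\<rho> i / 2))" "(\<Sum>i\<in>I. \<rho> i ^ (n - 1)) \<le> \<kappa> ^ n / 2"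
    by (rule hausdorff_null_cover[OF S(3)[folded n_def] S(1,2) \<tau> zero_less_one]) (rule that)
  have pw: "indicator (ball x \<kappa>) z \<le> (\<Sum>i\<in>I. indicator (ball (c i) (\<rho> i / 2)) z :: real)" for z
  proof (cases "z \<in> ball x \<kappa>")
    case False
    then show ?thesis by (simp add: sum_nonneg)
  next
    case True
    then obtain i where i: "i \<in> I" "z \<in> ball (c i) (\<rho> i / 2)" using sub I(5) by blast
    have "(indicator (ball (c i) (\<rho> i / 2)) z :: real) \<le> (\<Sum>i\<in>I. indicator (ball (c i) (\<rho> i / 2)) z)"
      by (rule member_le_sum[OF i(1) _ I(1)]) simp
    then show ?thesis using i(2) True by simp
  qed
  have "\<omega> * \<kappa> ^ n = (\<integral>z. indicator (ball x \<kappa>) z \<partial>lborel)" using \<kappa> by (simp add: vol)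
  also have "\<dots> \<le> (\<integral>z. (\<Sum>i\<in>I. indicator (ball (c i) (\<rho> i / 2)) z) \<partial>lborel)"
    by (intro integral_mono Bochner_Integration.integrable_sum ib pw)
  also have "\<dots> = (\<Sum>i\<in>I. \<omega> * (\<rho> i / 2) ^ n)"
    by (subst Bochner_Integration.integral_sum) (auto intro!: sum.cong ib simp: vol less_imp_le[OF I(3)])
  also have "\<dots> \<le> (\<Sum>i\<in>I. \<omega> * \<rho> i ^ (n - 1))"
  proof (intro sum_mono mult_left_mono)
    fix i assume i: "i \<in> I"
    have "(\<rho> i / 2) ^ n \<le> \<rho> i ^ n" using I(3)[OF i] by (intro power_mono) auto
    also have "\<dots> \<le> \<rho> i ^ (n - 1)" using I(3,4)[OF i] by (intro power_decreasing) auto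
    finally show "(\<rho> i / 2) ^ n \<le> \<rho> i ^ (n - 1)" .
  qed (use \<omega> in simp)
  also have "\<dots> = \<omega> * (\<Sum>i\<in>I. \<rho> i ^ (n - 1))" by (simp add: sum_distrib_left)
  also have "\<dots> \<le> \<omega> * (\<kappa> ^ n / 2)" using I(6) \<omega> by (intro mult_left_mono) auto
  finally have "\<omega> * \<kappa> ^ n \<le> \<omega> * \<kappa> ^ n / 2" by simp
  moreover have "0 < \<omega> * \<kappa> ^ n" using \<omega> \<kappa> by simp
  ultimately show False by linarith
qed

lemma cometric_box_subset:
  assumes "cometric_box U B A" "open W" "W \<subseteq> U"
  shows "cometric_box W B A"
proof -
  interpret cometric_box U B A by (rule assms(1))
  show ?thesis
    using assms(2) subsetD[OF assms(3)]
    by unfold_locales (auto intro: bil sym psd A_pos smooth_on_subset[OF smooth_B assms(3)] smooth_on_subset[OF smooth_A assms(3)])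
qed

context cometric_box
begin

text \<open>Below half the minimum of w = v - u on the sphere the defect vanishes off
  \<open>S\<close>, so the conormals are proportional and the gradients agree there. Since
  \<open>S\<close> contains no ball, they agree on a whole ball about \<open>y0\<close>, where w is
  then constant, against strictness. The assumption \<open>gen\<close> speaks of all open subsets
  because the sublevel set of w is found only in the proof.\<close>

lemma no_isolated_contact:
  fixes y0 :: 'e
  assumes u: "smooth_on U u" and v: "smooth_on U v" and le: "\<And>x. x \<in> U \<Longrightarrow> u x \<le> v x"
    and R: "0 < R" "cball y0 R \<subseteq> U"
    and S: "compact S" "S \<subseteq> S'" "hausdorff_measure (DIM('e) - 1) S' = 0"
    and ru: "\<And>x. x \<in> U - S \<Longrightarrow> (x, grad u x) \<in> regular" and rv: "\<And>x. x \<in> U - S \<Longrightarrow> (x, grad v x) \<in> regular"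
    and div: "\<And>x. x \<in> U - S \<Longrightarrow> divergence v x \<le> divergence u x"
    and y0: "u y0 = v y0" and strict: "\<And>x. x \<in> cball y0 R \<Longrightarrow> x \<noteq> y0 \<Longrightarrow> u x < v x"
    and gen: "\<And>W. open W \<Longrightarrow> W \<subseteq> U - S \<Longrightarrow> cometric_box.bracket_generating W B u"
  shows False
proof -
  define w where "w x = v x - u x" for x
  have sw: "smooth_on U w" unfolding w_def[abs_def] by (rule smooth_on_diff[OF open_U v u])
  obtain b0 :: 'e where b0: "b0 \<in> Basis" using nonempty_Basis by blast
  have "y0 + R *\<^sub>R b0 \<in> sphere y0 R" using b0 R(1) by (simp add: dist_norm)
  then have ne: "sphere y0 R \<noteq> {}" by blast
  have "sphere y0 R \<subseteq> U" using R(2) by auto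
  from continuous_attains_inf[OF compact_sphere ne smooth_on_continuous_on[OF smooth_on_subset[OF sw this]]]
  obtain xm where xm: "xm \<in> sphere y0 R" "\<forall>x\<in>sphere y0 R. w xm \<le> w x" by (rule bexE)
  define \<epsilon> where "\<epsilon> = w xm / 2"
  have "0 < w xm" using strict[of xm] xm(1) R(1) by (auto simp: w_def)
  have \<epsilon>: "0 < \<epsilon>" "\<And>x. x \<in> sphere y0 R \<Longrightarrow> \<epsilon> < v x - u x"
  proof -
    show "0 < \<epsilon>" using \<open>0 < w xm\<close> by (simp add: \<epsilon>_def)
    show "\<epsilon> < v x - u x" if "x \<in> sphere y0 R" for x
      using bspec[OF xm(2) that] \<open>0 < w xm\<close> by (simp add: \<epsilon>_def w_def)
  qed
  have "closed S" using S(1) by (rule compact_imp_closed)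
  have oE: "open (w -` {..<\<epsilon>} \<inter> U)"
    by (rule continuous_on_open_vimage[OF open_U, THEN iffD1, rule_format, OF smooth_on_continuous_on[OF sw]]) simp
  define W where "W = (ball y0 R - S) \<inter> (w -` {..<\<epsilon>} \<inter> U)"
  have oW: "open W" unfolding W_def by (intro open_Int open_Diff open_ball \<open>closed S\<close> oE)
  have WU: "W \<subseteq> U - S" "W \<subseteq> U" by (auto simp: W_def)
  interpret W: cometric_box W B A
    by (rule cometric_box_subset[OF _ oW WU(2)]) unfold_locales
  have gradW: "grad v x = grad u x" if x: "x \<in> W" for x
  proof (rule W.grad_eq_if_parallel[OF smooth_on_subset[OF u WU(2)] smooth_on_subset[OF v WU(2)] gen[OF oW WU(1)] oW order_refl x])
    fix x assume x: "x \<in> W"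
    then have xG: "x \<in> ball y0 R - S" "v x - u x < \<epsilon>" "x \<in> U - S" using WU(1) by (auto simp: W_def w_def)
    have "monotonicity_defect x (grad u x) (grad v x) = 0"
      by (rule monotonicity_defect_eq_0[OF u v le R S ru rv div \<epsilon> xG(1,2)])
    then show "\<exists>k. \<forall>a. B x (grad v x, -1) a = k * B x (grad u x, -1) a"
      by (rule monotonicity_defect(2)[OF ru[OF xG(3)] rv[OF xG(3)]])
  qed
  have "y0 \<in> ball y0 R \<inter> (w -` {..<\<epsilon>} \<inter> U)" using R \<epsilon>(1) y0 by (auto simp: w_def)
  moreover have "open (ball y0 R \<inter> (w -` {..<\<epsilon>} \<inter> U))" by (intro open_Int open_ball oE)
  ultimately obtain s where s: "0 < s" "ball y0 s \<subseteq> ball y0 R \<inter> (w -` {..<\<epsilon>} \<inter> U)"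
    unfolding open_contains_ball by metis
  have sU: "ball y0 s \<subseteq> U" using s(2) by auto
  have gr: "grad v x - grad u x = 0" if x: "x \<in> ball y0 s" for x
  proof (rule ccontr)
    assume n0: "grad v x - grad u x \<noteq> 0"
    have cont: "continuous_on (ball y0 s) (\<lambda>x. grad v x - grad u x)"
      by (intro continuous_intros smooth_on_continuous_on smooth_on_subset[OF smooth_on_grad[OF open_U u] sU]
          smooth_on_subset[OF smooth_on_grad[OF open_U v] sU])
    have "open ((\<lambda>x. grad v x - grad u x) -` (- {0}) \<inter> ball y0 s)"
      by (rule continuous_on_open_vimage[OF open_ball, THEN iffD1, rule_format, OF cont]) (simp add: open_Compl)
    moreover have "x \<in> (\<lambda>x. grad v x - grad u x) -` (- {0}) \<inter> ball y0 s" using n0 x by simp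
    ultimately obtain \<kappa> where \<kappa>: "0 < \<kappa>" "ball x \<kappa> \<subseteq> (\<lambda>x. grad v x - grad u x) -` (- {0}) \<inter> ball y0 s"
      unfolding open_contains_ball by metis
    have "ball x \<kappa> \<subseteq> S"
    proof
      fix z assume z: "z \<in> ball x \<kappa>"
      show "z \<in> S"
      proof (rule ccontr)
        assume "z \<notin> S"
        moreover have "z \<in> ball y0 s" using z \<kappa>(2) by blast
        then have "z \<in> ball y0 R \<inter> (w -` {..<\<epsilon>} \<inter> U)" by (rule subsetD[OF s(2)])
        ultimately have "z \<in> W" unfolding W_def by blast
        then show False using gradW z \<kappa>(2) by auto
      qed
    qed
    then show False using hausdorff_null_no_ball[OF S \<kappa>(1)] by blast
  qed
  have "(w has_derivative (\<lambda>h. 0)) (at x within ball y0 s)" if x: "x \<in> ball y0 s" for x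
  proof -
    have xU: "x \<in> U" using x sU by blast
    have "(w has_derivative (\<lambda>h. grad v x \<bullet> h - grad u x \<bullet> h)) (at x)"
      unfolding w_def[abs_def]
      by (intro has_derivative_diff grad_has_derivative[OF u xU] grad_has_derivative[OF v xU])
    then show ?thesis using gr[OF x] by (simp add: inner_diff_left[symmetric] has_derivative_at_withinI)
  qed
  from has_derivative_zero_constant[OF convex_ball this] obtain k where k: "\<And>x. x \<in> ball y0 s \<Longrightarrow> w x = k" by blast
  let ?x = "y0 + (s / 2) *\<^sub>R b0"
  have xs: "?x \<in> ball y0 s" using s(1) b0 by (simp add: dist_norm)
  have "w ?x = w y0" using k[OF xs] k[of y0] s(1) by simp
  moreover have "?x \<in> cball y0 R" using xs s(2) by auto
  moreover have "?x \<noteq> y0" using s(1) b0 by auto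
  ultimately show False using strict[of ?x] y0 by (simp add: w_def)
qed

end

section \<open>Charts invariant under vertical translation\<close>

lemma tangent_space_graph:
  fixes w :: "(real, 'm::finite) vec \<Rightarrow> real"
  assumes D: "open D" and w: "smooth_on D w" and q: "q \<in> D"
  shows "tangent_space (graph_over D w) (q, w q) = {v. (grad w q, -1) \<bullet> v = 0}"
proof (intro equalityI subsetI)
  fix v assume "v \<in> tangent_space (graph_over D w) (q, w q)"
  then obtain c e where e: "0 < e" and c: "\<And>t. t \<in> {-e<..<e} \<Longrightarrow> c t \<in> graph_over D w" and c0: "c 0 = (q, w q)"
    and d: "(c has_vector_derivative v) (at (0::real))"
    unfolding tangent_space_def by blast
  have d1: "((\<lambda>t. fst (c t)) has_derivative (\<lambda>h. h *\<^sub>R fst v)) (at 0)"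
    and d2: "((\<lambda>t. snd (c t)) has_derivative (\<lambda>h. h * snd v)) (at 0)"
    using has_derivative_fst[OF d[unfolded has_vector_derivative_def]] has_derivative_snd[OF d[unfolded has_vector_derivative_def]]
    by auto
  have "(w has_derivative (\<lambda>h. grad w q \<bullet> h)) (at (fst (c 0)))" using grad_has_derivative[OF w q] by (simp add: c0)
  from has_derivative_compose[OF d1 this]
  have "((\<lambda>t. w (fst (c t))) has_derivative (\<lambda>h. h * (grad w q \<bullet> fst v))) (at 0)" by simp
  moreover have "((\<lambda>t. w (fst (c t))) has_derivative (\<lambda>h. h * snd v)) (at 0)"
  proof (rule has_derivative_transform_within_open[OF d2, of "{-e<..<e}"])
    show "snd (c t) = w (fst (c t))" if "t \<in> {-e<..<e}" for t using c[OF that] by (auto simp: graph_over_def)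
  qed (use e in auto)
  ultimately have "(\<lambda>h. h * (grad w q \<bullet> fst v)) = (\<lambda>h. h * snd v)" by (rule has_derivative_unique)
  from fun_cong[OF this, of 1] show "v \<in> {v. (grad w q, -1) \<bullet> v = 0}" by (simp add: inner_prod_def)
next
  fix v assume v: "v \<in> {v. (grad w q, -1::real) \<bullet> v = 0}"
  obtain e where e: "0 < e" "ball q e \<subseteq> D" using D q unfolding open_contains_ball by metis
  define k where "k = e / (norm (fst v) + 1)"
  have np: "0 < norm (fst v) + 1" by (simp add: add_nonneg_pos)
  have k: "0 < k" using e(1) np by (simp add: k_def)
  define c where "c t = (q + t *\<^sub>R fst v, w (q + t *\<^sub>R fst v))" for t :: real
  have "c t \<in> graph_over D w" if t: "t \<in> {-k<..<k}" for t
  proof -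
    have "norm (t *\<^sub>R fst v) \<le> \<bar>t\<bar> * (norm (fst v) + 1)" by (simp add: mult_left_mono)
    also have "\<dots> < k * (norm (fst v) + 1)" using t np by (intro mult_strict_right_mono) auto
    also have "\<dots> = e" using np by (simp add: k_def)
    finally have "q + t *\<^sub>R fst v \<in> ball q e" by (simp add: dist_norm)
    then show ?thesis using e(2) by (auto simp: c_def graph_over_def)
  qed
  moreover have "(c has_vector_derivative v) (at 0)"
  proof -
    have l: "((\<lambda>t. q + t *\<^sub>R fst v) has_derivative (\<lambda>h. h *\<^sub>R fst v)) (at 0)" by (auto intro!: derivative_eq_intros)
    have "(w has_derivative (\<lambda>h. grad w q \<bullet> h)) (at (q + 0 *\<^sub>R fst v))" using grad_has_derivative[OF w q] by simp
    from has_derivative_Pair[OF l has_derivative_compose[OF l this]]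
    have "(c has_derivative (\<lambda>h. (h *\<^sub>R fst v, grad w q \<bullet> (h *\<^sub>R fst v)))) (at 0)" by (simp add: c_def[abs_def])
    moreover have "(\<lambda>h. (h *\<^sub>R fst v, grad w q \<bullet> (h *\<^sub>R fst v))) = (\<lambda>h. h *\<^sub>R v)"
      using v by (auto simp: inner_prod_def fun_eq_iff prod_eq_iff)
    ultimately show ?thesis by (simp add: has_vector_derivative_def)
  qed
  ultimately show "v \<in> tangent_space (graph_over D w) (q, w q)"
    unfolding tangent_space_def using k by (auto simp: c_def intro!: exI[of _ c] exI[of _ k])
qed

text \<open>The tangent space of the graph is the kernel of the conormal, so it contains \<xi> when
  the conormal is in the kernel of the cometric; for a semidefinite form this is the same as being
  null, by Cauchy-Schwarz.\<close>

lemma singular_set_iff: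
  fixes w :: "(real, 'm::finite) vec \<Rightarrow> real"
  assumes D: "open D" and w: "smooth_on D w" and q: "q \<in> D"
    and bil: "bilinear (\<gamma> (q, w q))" and sym: "\<And>\<omega> \<eta>. \<gamma> (q, w q) \<omega> \<eta> = \<gamma> (q, w q) \<eta> \<omega>"
    and psd: "\<And>\<omega>. 0 \<le> \<gamma> (q, w q) \<omega> \<omega>"
  shows "q \<in> singular_set \<gamma> D w \<longleftrightarrow> vec_form (\<gamma> (q, w q)) (grad w q, -1) (grad w q, -1) = 0"
proof -
  let ?P = "(grad w q, -1::real)" and ?B = "vec_form (\<gamma> (q, w q))"
  note CS = bilinear_psd_Cauchy_Schwarz[OF bilinear_vec_form[OF bil]]
  have "horizontal (\<gamma> (q, w q)) \<subseteq> {v. ?P \<bullet> v = 0} \<longleftrightarrow> (\<forall>a. ?B ?P a = 0)"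
    by (simp add: horizontal_eq image_subset_iff inner_sharp[OF bil])
  also have "\<dots> \<longleftrightarrow> ?B ?P ?P = 0"
  proof
    assume 0: "?B ?P ?P = 0"
    have "(?B ?P a)\<^sup>2 \<le> ?B ?P ?P * ?B a a" for a
      by (rule CS) (auto simp: vec_form_def sym psd)
    then show "\<forall>a. ?B ?P a = 0" using 0 by simp
  qed simp
  finally show ?thesis using q by (simp add: singular_set_def tangent_space_graph[OF D w q])
qed

section \<open>Boxes in which the geometry is free of the last coordinate\<close>

lemma sum_Basis_prod:
  fixes f :: "'e::euclidean_space \<times> real \<Rightarrow> real"
  shows "sum f Basis = (\<Sum>b\<in>Basis. f (b, 0)) + f (0, 1)"
proof -
  have "inj_on (\<lambda>u. (u::'e, 0::real)) Basis" by (auto simp: inj_on_def)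
  then show ?thesis
    unfolding Basis_prod_def by (subst sum.union_disjoint) (auto simp: sum.reindex)
qed

text \<open>What the translations give once the geometry is written in the chart. Invariance is
  asked only for small vertical shifts depending on the point, since a translated point may leave
  the chart and the vertical fibres of \<Omega> may be disconnected.\<close>

locale invariant_chart =
  fixes \<Omega> :: "('e::euclidean_space \<times> real) set" and \<gamma> :: "'e \<times> real \<Rightarrow> ('e \<times> real) coinner"
    and \<mu> :: "'e \<times> real \<Rightarrow> ('e \<times> real) list \<Rightarrow> real" and bs :: "('e \<times> real) list"
  assumes open_\<Omega>: "open \<Omega>" and bil_\<gamma>: "y \<in> \<Omega> \<Longrightarrow> bilinear (\<gamma> y)"
    and sym_\<gamma>: "y \<in> \<Omega> \<Longrightarrow> \<gamma> y \<omega> \<eta> = \<gamma> y \<eta> \<omega>" and psd_\<gamma>: "y \<in> \<Omega> \<Longrightarrow> 0 \<le> \<gamma> y \<omega> \<omega>"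
    and smooth_\<gamma>: "smooth_on \<Omega> (\<lambda>y. \<gamma> y \<omega> \<eta>)"
    and alt_\<mu>: "y \<in> \<Omega> \<Longrightarrow> alt_form DIM('e \<times> real) (\<mu> y)" and smooth_\<mu>: "smooth_on \<Omega> (\<lambda>y. \<mu> y bs)"
    and bs: "distinct bs" "set bs = Basis" and \<mu>_nz: "y \<in> \<Omega> \<Longrightarrow> \<mu> y bs \<noteq> 0"
    and inv: "y \<in> \<Omega> \<Longrightarrow> \<exists>e>0. \<forall>a. \<bar>a\<bar> < e \<longrightarrow> y + (0, a) \<in> \<Omega> \<and> \<gamma> (y + (0, a)) = \<gamma> y \<and> \<mu> (y + (0, a)) bs = \<mu> y bs"
begin

text \<open>The sign \<open>\<sigma>\<close> makes the density positive.\<close>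

definition boxed :: "'e \<Rightarrow> real \<Rightarrow> real \<Rightarrow> real \<Rightarrow> bool" where
  "boxed x0 t0 r \<sigma> \<longleftrightarrow> 0 < r \<and> \<bar>\<sigma>\<bar> = 1 \<and> (\<forall>x\<in>ball x0 r. \<forall>t. \<bar>t - t0\<bar> < r \<longrightarrow>
     (x, t) \<in> \<Omega> \<and> \<gamma> (x, t) = \<gamma> (x, t0) \<and> \<mu> (x, t) bs = \<mu> (x, t0) bs \<and> 0 < \<sigma> * \<mu> (x, t0) bs)"

abbreviation "cform t0 \<equiv> \<lambda>x. vec_form (\<gamma> (x, t0))"

abbreviation "dens \<sigma> t0 \<equiv> \<lambda>x. \<sigma> * \<mu> (x, t0) bs"

lemma boxedD:
  assumes "boxed x0 t0 r \<sigma>" "x \<in> ball x0 r" "\<bar>t - t0\<bar> < r"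
  shows "(x, t) \<in> \<Omega>" "\<gamma> (x, t) = \<gamma> (x, t0)" "\<mu> (x, t) bs = \<mu> (x, t0) bs" "0 < \<sigma> * \<mu> (x, t0) bs"
proof -
  have c: "(x, t) \<in> \<Omega> \<and> \<gamma> (x, t) = \<gamma> (x, t0) \<and> \<mu> (x, t) bs = \<mu> (x, t0) bs \<and> 0 < \<sigma> * \<mu> (x, t0) bs"
    using assms(1)[unfolded boxed_def, THEN conjunct2, THEN conjunct2, THEN bspec[OF _ assms(2)]] assms(3)
    by (elim allE[of _ t] impE)
  show "(x, t) \<in> \<Omega>" by (rule c[THEN conjunct1])
  show "\<gamma> (x, t) = \<gamma> (x, t0)" by (rule c[THEN conjunct2, THEN conjunct1])
  show "\<mu> (x, t) bs = \<mu> (x, t0) bs" by (rule c[THEN conjunct2, THEN conjunct2, THEN conjunct1])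
  show "0 < \<sigma> * \<mu> (x, t0) bs" by (rule c[THEN conjunct2, THEN conjunct2, THEN conjunct2])
qed

lemma boxed_pos: "boxed x0 t0 r \<sigma> \<Longrightarrow> 0 < r" "boxed x0 t0 r \<sigma> \<Longrightarrow> \<bar>\<sigma>\<bar> = 1"
  unfolding boxed_def by (elim conjE, assumption)+

lemma boxed_mono:
  assumes "boxed x0 t0 r \<sigma>" "0 < s" "s \<le> r"
  shows "boxed x0 t0 s \<sigma>"
  unfolding boxed_def
proof (intro conjI ballI allI impI assms(2) boxed_pos(2)[OF assms(1)])
  fix x t assume "x \<in> ball x0 s" "\<bar>t - t0\<bar> < s"
  then have *: "x \<in> ball x0 r" "\<bar>t - t0\<bar> < r" using assms(3) by auto
  show "(x, t) \<in> \<Omega>" "\<gamma> (x, t) = \<gamma> (x, t0)" "\<mu> (x, t) bs = \<mu> (x, t0) bs" "0 < \<sigma> * \<mu> (x, t0) bs"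
    by (rule boxedD[OF assms(1) *])+
qed

text \<open>Cometric and density are locally constant along vertical segments, hence constant on an
  interval by connectedness. The density has no zero, so its sign is fixed on a connected
  ball.\<close>

lemma boxed_exists:
  assumes "(x0, t0) \<in> \<Omega>"
  shows "\<exists>r \<sigma>. boxed x0 t0 r \<sigma>"
proof -
  obtain R where R: "0 < R" "ball (x0, t0) R \<subseteq> \<Omega>" using open_\<Omega> assms unfolding open_contains_ball by metis
  define r where "r = R / 2"
  have r: "0 < r" using R(1) by (simp add: r_def)
  have sub: "(x, t) \<in> \<Omega>" if "x \<in> ball x0 r" "\<bar>t - t0\<bar> < r" for x t
  proof -
    have "dist (x0, t0) (x, t) \<le> dist x0 x + dist t0 t"
      unfolding dist_Pair_Pair by (rule sqrt_sum_squares_le_sum) auto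
    also have "\<dots> < R" using that by (simp add: r_def dist_real_def abs_minus_commute)
    finally show ?thesis using R(2) by auto
  qed
  define F where "F x t = (\<gamma> (x, t), \<mu> (x, t) bs)" for x t
  have const: "F x constant_on {t0 - r<..<t0 + r}" if x: "x \<in> ball x0 r" for x
  proof (rule locally_constant_imp_constant[OF connected_Ioo])
    fix t assume t: "t \<in> {t0 - r<..<t0 + r}"
    have "(x, t) \<in> \<Omega>" using sub[OF x, of t] t by auto
    from inv[OF this] obtain e where e: "0 < e" "\<And>a. \<bar>a\<bar> < e \<Longrightarrow> \<gamma> ((x, t) + (0, a)) = \<gamma> (x, t) \<and> \<mu> ((x, t) + (0, a)) bs = \<mu> (x, t) bs"
      by blast
    let ?T = "{t0 - r<..<t0 + r} \<inter> ball t e"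
    have 1: "\<forall>s\<in>?T. F x s = F x t"
    proof
      fix s assume "s \<in> ?T"
      then show "F x s = F x t" using e(2)[of "s - t"] by (auto simp: F_def dist_real_def)
    qed
    have 2: "openin (top_of_set {t0 - r<..<t0 + r}) ?T" by (intro openin_open_Int open_ball)
    have 3: "t \<in> ?T" using t e(1) by simp
    show "\<exists>T. openin (top_of_set {t0 - r<..<t0 + r}) T \<and> t \<in> T \<and> (\<forall>s\<in>T. F x s = F x t)"
      by (intro exI[of _ ?T] conjI 1 2 3)
  qed
  have const2: "\<gamma> (x, t) = \<gamma> (x, t0)" "\<mu> (x, t) bs = \<mu> (x, t0) bs" if x: "x \<in> ball x0 r" and t: "\<bar>t - t0\<bar> < r" for x t
  proof -
    have m: "t \<in> {t0 - r<..<t0 + r}" "t0 \<in> {t0 - r<..<t0 + r}" using t r by auto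
    obtain k where "\<forall>t\<in>{t0 - r<..<t0 + r}. F x t = k" using const[OF x] unfolding constant_on_def by (rule exE)
    from bspec[OF this m(1)] bspec[OF this m(2)] have "F x t = F x t0" by simp
    then show "\<gamma> (x, t) = \<gamma> (x, t0)" "\<mu> (x, t) bs = \<mu> (x, t0) bs" by (simp_all add: F_def)
  qed
  have in0: "(x, t0) \<in> \<Omega>" if "x \<in> ball x0 r" for x using sub[OF that, of t0] r by simp
  have cont: "continuous_on (ball x0 r) (\<lambda>x. \<mu> (x, t0) bs)"
    by (rule continuous_on_compose2[OF smooth_on_continuous_on[OF smooth_\<mu>]]) (auto intro!: continuous_intros in0)
  have conn: "connected ((\<lambda>x. \<mu> (x, t0) bs) ` ball x0 r)" by (intro connected_continuous_image cont) simp
  have nz: "\<mu> (x, t0) bs \<noteq> 0" if "x \<in> ball x0 r" for x using \<mu>_nz[OF in0[OF that]] .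
  define \<sigma> where "\<sigma> = sgn (\<mu> (x0, t0) bs)"
  have x0: "x0 \<in> ball x0 r" using r by simp
  have "0 < \<sigma> * \<mu> (x, t0) bs" if x: "x \<in> ball x0 r" for x
  proof (rule ccontr)
    assume "\<not> 0 < \<sigma> * \<mu> (x, t0) bs"
    then have "(\<mu> (x0, t0) bs \<le> 0 \<and> 0 \<le> \<mu> (x, t0) bs) \<or> (\<mu> (x, t0) bs \<le> 0 \<and> 0 \<le> \<mu> (x0, t0) bs)"
      by (auto simp: \<sigma>_def sgn_if split: if_splits)
    then have "0 \<in> (\<lambda>x. \<mu> (x, t0) bs) ` ball x0 r"
    proof (elim disjE conjE)
      assume "\<mu> (x0, t0) bs \<le> 0" "0 \<le> \<mu> (x, t0) bs"
      then show ?thesis by (rule connectedD_interval[OF conn imageI[OF x0] imageI[OF x]])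
    next
      assume "\<mu> (x, t0) bs \<le> 0" "0 \<le> \<mu> (x0, t0) bs"
      then show ?thesis by (rule connectedD_interval[OF conn imageI[OF x] imageI[OF x0]])
    qed
    then show False using nz by auto
  qed
  moreover have "\<bar>\<sigma>\<bar> = 1" using nz[OF x0] by (simp add: \<sigma>_def abs_sgn_eq)
  ultimately have "boxed x0 t0 r \<sigma>"
    unfolding boxed_def by (intro conjI ballI allI impI r sub const2) auto
  then show ?thesis by (intro exI)
qed

lemma smooth_slice:
  fixes f :: "'e \<times> real \<Rightarrow> real"
  assumes W: "open W" and sub: "\<And>x. x \<in> W \<Longrightarrow> (x, t0) \<in> \<Omega>" and f: "smooth_on \<Omega> f"
  shows "smooth_on W (\<lambda>x. f (x, t0))"
proof -
  have k: "Ck_on k W (\<lambda>x. f (x, t0))" if "Ck_on k \<Omega> f" for k and f :: "'e \<times> real \<Rightarrow> real"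
    using that
  proof (induction k arbitrary: f)
    case 0
    then have "continuous_on \<Omega> f" by simp
    then have "continuous_on W (\<lambda>x. f (x, t0))"
      by (rule continuous_on_compose2) (auto intro!: continuous_intros sub)
    then show ?case by simp
  next
    case (Suc k)
    show ?case
    proof (rule Ck_on_SucI[OF W])
      fix x assume x: "x \<in> W"
      have l: "((\<lambda>x. (x, t0)) has_derivative (\<lambda>h. (h, 0))) (at x)"
        by (intro has_derivative_Pair has_derivative_ident has_derivative_const)
      from has_derivative_compose[OF l Ck_on_has_derivative[OF Suc.prems sub[OF x]]]
      show "((\<lambda>x. f (x, t0)) has_derivative (\<lambda>h. frechet_derivative f (at (x, t0)) (h, 0))) (at x)" .
    next
      fix v show "Ck_on k W (\<lambda>x. frechet_derivative f (at (x, t0)) (v, 0))"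
        using Suc.IH[of "\<lambda>z. frechet_derivative f (at z) (v, 0)"] Suc.prems by simp
    qed
  qed
  then show ?thesis using f by (simp add: smooth_on_def)
qed

lemma boxed_cometric:
  assumes b: "boxed x0 t0 r \<sigma>"
  shows "cometric_box (ball x0 r) (cform t0) (dens \<sigma> t0)"
proof
  have in0: "(x, t0) \<in> \<Omega>" and pos: "0 < \<sigma> * \<mu> (x, t0) bs" if "x \<in> ball x0 r" for x
    using boxedD(1,4)[OF b that, of t0] boxed_pos(1)[OF b] by simp_all
  show "open (ball x0 r)" by simp
  show "bilinear (vec_form (\<gamma> (x, t0)))" if "x \<in> ball x0 r" for x
    by (rule bilinear_vec_form[OF bil_\<gamma>[OF in0[OF that]]])
  show "vec_form (\<gamma> (x, t0)) a b = vec_form (\<gamma> (x, t0)) b a" if "x \<in> ball x0 r" for x a b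
    by (simp add: vec_form_def sym_\<gamma>[OF in0[OF that]])
  show "0 \<le> vec_form (\<gamma> (x, t0)) a a" if "x \<in> ball x0 r" for x a
    by (simp add: vec_form_def psd_\<gamma>[OF in0[OF that]])
  show "smooth_on (ball x0 r) (\<lambda>x. vec_form (\<gamma> (x, t0)) a b)" for a b
    unfolding vec_form_def by (rule smooth_slice[OF open_ball in0 smooth_\<gamma>])
  show "smooth_on (ball x0 r) (\<lambda>x. \<sigma> * \<mu> (x, t0) bs)"
    by (intro smooth_on_mult open_ball smooth_on_const smooth_slice[OF open_ball in0 smooth_\<mu>])
  show "0 < \<sigma> * \<mu> (x, t0) bs" if "x \<in> ball x0 r" for x by (rule pos[OF that])
qed


text \<open>For the defining function w(x) - t the conormal does not depend on the height, and
  neither do cometric and density in the box. The components of the raised unit conormal are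
  therefore functions of the base point, and the vertical one contributes nothing to the divergence.
  The sign \<sigma> multiplies both sides.\<close>

lemma boxed_curvature:
  assumes b: "boxed x0 t0 r \<sigma>" and w: "smooth_on (ball x0 r) w" and x: "x \<in> ball x0 r" and wx: "\<bar>w x - t0\<bar> < r"
    and reg: "(x, grad w x) \<in> cometric_box.regular (ball x0 r) (cform t0)"
  shows "mean_curvature \<gamma> \<mu> (\<lambda>(x, t). w x - t) (x, w x) * (\<sigma> * \<mu> (x, t0) bs)
    = cometric_box.divergence (cform t0) (dens \<sigma> t0) w x"
proof -
  interpret c: cometric_box "ball x0 r" "cform t0" "dens \<sigma> t0" by (rule boxed_cometric[OF b])
  define P where "P x = (grad w x, -1::real)" for x
  define q where "q x = c.Q (x, grad w x)" for x
  have qP: "q x = cform t0 x (P x) (P x)" for x by (simp add: q_def c.Q_def P_def)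
  define G where "G = {x \<in> ball x0 r. 0 < q x}"
  have sP: "smooth_on (ball x0 r) P"
  proof -
    have "bounded_linear (\<lambda>g::'e. (g, 0::real))" by (intro bounded_linear_Pair bounded_linear_ident bounded_linear_zero)
    from smooth_on_add[OF open_ball smooth_on_bounded_linear[OF open_ball this smooth_on_grad[OF open_ball w]]
        smooth_on_const[of _ "(0, -1)"]]
    show ?thesis by (simp add: P_def[abs_def])
  qed
  have sB: "smooth_on (ball x0 r) (\<lambda>x. cform t0 x (F x) (H x))" if "smooth_on (ball x0 r) F" "smooth_on (ball x0 r) H" for F H
    by (rule smooth_on_bilinear_form[of "ball x0 r" "cform t0", OF open_ball c.bil c.smooth_B that])
  have sq: "smooth_on (ball x0 r) q" unfolding qP[abs_def] by (rule sB[OF sP sP])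
  have oG: "open G"
  proof -
    have "open (q -` {0<..} \<inter> ball x0 r)"
      by (rule continuous_on_open_vimage[OF open_ball, THEN iffD1, rule_format, OF smooth_on_continuous_on[OF sq]]) simp
    moreover have "G = q -` {0<..} \<inter> ball x0 r" by (auto simp: G_def)
    ultimately show ?thesis by simp
  qed
  have Gsub: "G \<subseteq> ball x0 r" by (auto simp: G_def)
  have xG: "x \<in> G" using reg x by (simp add: G_def q_def c.regular_def)
  define \<Phi> where "\<Phi> b x = \<mu> (x, t0) bs * (cform t0 x b (P x) * q x powr (- (1/2)))" for b x
  have s\<mu>: "smooth_on (ball x0 r) (\<lambda>x. \<mu> (x, t0) bs)"
  proof (rule smooth_slice[OF open_ball _ smooth_\<mu>])
    show "(x, t0) \<in> \<Omega>" if "x \<in> ball x0 r" for x using boxedD(1)[OF b that, of t0] boxed_pos(1)[OF b] by simp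
  qed
  have s\<Phi>: "smooth_on G (\<Phi> b)" for b
    unfolding \<Phi>_def[abs_def]
    by (intro smooth_on_mult smooth_on_powr oG smooth_on_subset[OF s\<mu> Gsub] smooth_on_subset[OF sB Gsub] smooth_on_const sP
        smooth_on_subset[OF sq Gsub]) (simp add: G_def)
  define V where "V = G \<times> {t0 - r<..<t0 + r}"
  have oV: "open V" unfolding V_def by (intro open_Times oG open_greaterThanLessThan)
  have yV: "(x, w x) \<in> V" using xG wx by (auto simp: V_def)
  have V: "fst z \<in> ball x0 r" "fst z \<in> G" "z \<in> \<Omega>" "\<gamma> z = \<gamma> (fst z, t0)" "\<mu> z bs = \<mu> (fst z, t0) bs" if "z \<in> V" for z
  proof -
    have z: "fst z \<in> ball x0 r" "\<bar>snd z - t0\<bar> < r" using that Gsub by (auto simp: V_def)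
    show "fst z \<in> ball x0 r" "fst z \<in> G" using that Gsub by (auto simp: V_def)
    show "z \<in> \<Omega>" "\<gamma> z = \<gamma> (fst z, t0)" "\<mu> z bs = \<mu> (fst z, t0) bs"
      using boxedD(1,2,3)[OF b z] by simp_all
  qed
  let ?\<phi> = "\<lambda>(x, t). w x - t"
  have dphi: "differential ?\<phi> z = blinfun_inner_right (P (fst z))" if "z \<in> V" for z
  proof (rule blinfun_eqI)
    fix h
    have z: "fst z \<in> ball x0 r" using V(1)[OF that] .
    have "((\<lambda>z. w (fst z) - snd z) has_derivative (\<lambda>h. grad w (fst z) \<bullet> fst h - snd h)) (at z)"
      by (intro has_derivative_diff has_derivative_snd has_derivative_ident
        has_derivative_compose[OF has_derivative_fst[OF has_derivative_ident] grad_has_derivative[OF w z]])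
    moreover have "?\<phi> = (\<lambda>z. w (fst z) - snd z)" by (simp add: fun_eq_iff)
    ultimately have d: "(?\<phi> has_derivative (\<lambda>h. grad w (fst z) \<bullet> fst h - snd h)) (at z)" by (simp only:)
    have "bounded_linear (frechet_derivative ?\<phi> (at z))"
      using has_derivative_bounded_linear[OF d] frechet_derivative_at[OF d] by simp
    then show "blinfun_apply (differential ?\<phi> z) h = blinfun_apply (blinfun_inner_right (P (fst z))) h"
      using fun_cong[OF frechet_derivative_at[OF d], of h]
      by (simp add: differential_def bounded_linear_Blinfun_apply P_def inner_prod_def)
  qed
  let ?\<omega> = "\<lambda>z. differential ?\<phi> z /\<^sub>R conorm (\<gamma> z) (differential ?\<phi> z)"
  have comp: "\<mu> z bs * \<gamma> z (blinfun_inner_right b) (?\<omega> z) = \<Phi> b (fst z)" if z: "z \<in> V" for z b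
  proof -
    have bl: "bilinear (\<gamma> z)" by (rule bil_\<gamma>[OF V(3)[OF z]])
    have qp: "0 < q (fst z)" using V(2)[OF z] by (simp add: G_def)
    have "conorm (\<gamma> z) (differential ?\<phi> z) = sqrt (q (fst z))"
      by (simp add: conorm_def dphi[OF z] qP vec_form_def V(4)[OF z])
    then have "\<gamma> z (blinfun_inner_right b) (?\<omega> z)
        = inverse (sqrt (q (fst z))) * \<gamma> z (blinfun_inner_right b) (blinfun_inner_right (P (fst z)))"
      by (simp only: dphi[OF z] bilinear_rmul[OF bl] real_scaleR_def)
    also have "inverse (sqrt (q (fst z))) = q (fst z) powr (- (1/2))"
      by (simp only: powr_minus_half[OF qp] inverse_eq_divide)
    also have "\<gamma> z (blinfun_inner_right b) (blinfun_inner_right (P (fst z))) = cform t0 (fst z) b (P (fst z))"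
      by (simp only: vec_form_def V(4)[OF z])
    finally have "\<gamma> z (blinfun_inner_right b) (?\<omega> z) = cform t0 (fst z) b (P (fst z)) * q (fst z) powr (- (1/2))"
      by (simp only: mult.commute)
    then show ?thesis by (simp only: \<Phi>_def V(5)[OF z])
  qed
  have der: "((\<lambda>z. \<mu> z bs * \<gamma> z (blinfun_inner_right b) (?\<omega> z)) has_derivative
      (\<lambda>h. frechet_derivative (\<Phi> b) (at x) (fst h))) (at (x, w x))" for b
  proof -
    have "(\<Phi> b has_derivative frechet_derivative (\<Phi> b) (at x)) (at (fst (x, w x)))"
      using smooth_on_has_derivative[OF s\<Phi> xG] by simp
    from has_derivative_compose[OF has_derivative_fst[OF has_derivative_ident] this]
    have "((\<lambda>z. \<Phi> b (fst z)) has_derivative (\<lambda>h. frechet_derivative (\<Phi> b) (at x) (fst h))) (at (x, w x))" .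
    then show ?thesis
      by (rule has_derivative_transform_within_open[OF _ oV yV]) (simp only: comp)
  qed
  have "mean_curvature \<gamma> \<mu> ?\<phi> (x, w x) * \<mu> (x, w x) bs
    = (\<Sum>b\<in>Basis. frechet_derivative (\<lambda>z. \<mu> z bs * \<gamma> z (blinfun_inner_right b) (?\<omega> z)) (at (x, w x)) b)"
  proof (rule mean_curvature_eq[OF oV yV _ _ bs])
    show "linear (\<lambda>\<omega>. \<gamma> z \<omega> \<eta>)" if "z \<in> V" for z \<eta> using bil_\<gamma>[OF V(3)[OF that]] by (simp add: bilinear_def)
    show "alt_form DIM('e \<times> real) (\<mu> z)" if "z \<in> V" for z by (rule alt_\<mu>[OF V(3)[OF that]])
    show "\<mu> (x, w x) bs \<noteq> 0" by (rule \<mu>_nz[OF V(3)[OF yV]])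
    show "(\<lambda>z. \<mu> z bs * \<gamma> z (blinfun_inner_right b) (?\<omega> z)) differentiable at (x, w x)" for b
      using der[of b] by (rule differentiableI)
  qed
  also have "\<dots> = (\<Sum>b\<in>Basis. frechet_derivative (\<Phi> b) (at x) (fst b))"
    by (intro sum.cong refl fun_cong[OF frechet_derivative_at[OF der, symmetric]])
  also have "\<dots> = (\<Sum>b\<in>Basis. frechet_derivative (\<Phi> (b, 0)) (at x) b)"
    by (subst sum_Basis_prod) (simp add: linear_0[OF smooth_on_linear_derivative[OF s\<Phi> xG]])
  finally have mc: "mean_curvature \<gamma> \<mu> ?\<phi> (x, w x) * \<mu> (x, t0) bs = (\<Sum>b\<in>Basis. frechet_derivative (\<Phi> (b, 0)) (at x) b)"
    using V(5)[OF yV] by simp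
  have fl: "frechet_derivative (\<lambda>x. c.flux b (x, grad w x)) (at x) b = \<sigma> * frechet_derivative (\<Phi> (b, 0)) (at x) b" for b
  proof -
    have "(\<lambda>x. c.flux b (x, grad w x)) = (\<lambda>x. \<sigma> * \<Phi> (b, 0) x)"
      by (simp add: fun_eq_iff c.flux_def \<Phi>_def P_def q_def)
    moreover have "((\<lambda>x. \<sigma> * \<Phi> (b, 0) x) has_derivative (\<lambda>h. \<sigma> * frechet_derivative (\<Phi> (b, 0)) (at x) h)) (at x)"
      by (intro has_derivative_mult_right smooth_on_has_derivative[OF s\<Phi> xG])
    ultimately show ?thesis using fun_cong[OF frechet_derivative_at, of "\<lambda>x. \<sigma> * \<Phi> (b, 0) x" _ x b] by simp
  qed
  have "c.divergence w x = \<sigma> * (\<Sum>b\<in>Basis. frechet_derivative (\<Phi> (b, 0)) (at x) b)"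
    unfolding c.divergence_def fl sum_distrib_left ..
  also have "\<dots> = \<sigma> * (mean_curvature \<gamma> \<mu> ?\<phi> (x, w x) * \<mu> (x, t0) bs)" by (simp only: mc)
  finally show ?thesis by (simp add: mult_ac)
qed

text \<open>The conormal of the graph, extended by the same value to all heights, is a smooth field
  on the box. \<open>adapted_sections\<close> yields \<open>k\<close> independent horizontal
  sections orthogonal to it, that is, tangent to every vertical translate, and to these the rank
  condition applies.\<close>

lemma boxed_bracket_generating:
  assumes b: "boxed x0 t0 r \<sigma>" and u: "smooth_on (ball x0 r) u" and W: "open W" "W \<subseteq> ball x0 r"
    and ux: "\<And>x. x \<in> W \<Longrightarrow> \<bar>u x - t0\<bar> < r"
    and reg: "\<And>x. x \<in> W \<Longrightarrow> (x, grad u x) \<in> cometric_box.regular (ball x0 r) (cform t0)"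
    and dim: "\<And>y. y \<in> \<Omega> \<Longrightarrow> dim (horizontal (\<gamma> y)) = Suc k"
    and rank: "\<And>V Xs y. open V \<Longrightarrow> V \<subseteq> \<Omega> \<Longrightarrow> length Xs = k \<Longrightarrow> independent_sections \<gamma> V Xs \<Longrightarrow> y \<in> V \<Longrightarrow> DIM('e) \<le> lie_rank V Xs y"
  shows "cometric_box.bracket_generating W (cform t0) u"
proof -
  interpret c: cometric_box "ball x0 r" "cform t0" "dens \<sigma> t0" by (rule boxed_cometric[OF b])
  interpret W: cometric_box W "cform t0" "dens \<sigma> t0" by (rule cometric_box_subset[OF boxed_cometric[OF b] W])
  show ?thesis
    unfolding W.bracket_generating_def
  proof (intro ballI allI impI)
    fix x V0 assume x: "x \<in> W" and "open V0 \<and> (x, u x) \<in> V0"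
    then have V0: "open V0" "(x, u x) \<in> V0" by auto
    define V1 where "V1 = V0 \<inter> (W \<times> {t0 - r<..<t0 + r})"
    have oV1: "open V1" unfolding V1_def by (intro open_Int V0(1) open_Times W(1) open_greaterThanLessThan)
    have yV1: "(x, u x) \<in> V1" using V0(2) x ux[OF x] by (auto simp: V1_def)
    have V1: "fst z \<in> W" "z \<in> \<Omega>" "\<gamma> z = \<gamma> (fst z, t0)" if "z \<in> V1" for z
    proof -
      have z: "fst z \<in> ball x0 r" "\<bar>snd z - t0\<bar> < r" using that W(2) by (auto simp: V1_def)
      show "fst z \<in> W" using that by (auto simp: V1_def)
      show "z \<in> \<Omega>" "\<gamma> z = \<gamma> (fst z, t0)" using boxedD(1,2)[OF b z] by simp_all
    qed
    have V1\<Omega>: "V1 \<subseteq> \<Omega>" using V1(2) by blast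
    have bil: "bilinear (\<gamma> z)" if "z \<in> V1" for z by (rule bil_\<gamma>[OF V1(2)[OF that]])
    define P where "P z = (grad u (fst z), -1::real)" for z :: "'e \<times> real"
    have sP: "smooth_on V1 P"
    proof -
      have "smooth_on (fst -` ball x0 r :: ('e \<times> real) set) (\<lambda>z. grad u (fst z))"
        by (rule smooth_on_linear_compose[OF open_ball bounded_linear_fst smooth_on_grad[OF open_ball u]])
      then have g: "smooth_on V1 (\<lambda>z. grad u (fst z))"
        by (rule smooth_on_subset) (use V1(1) W(2) in auto)
      have "bounded_linear (\<lambda>g::'e. (g, 0::real))" by (intro bounded_linear_Pair bounded_linear_ident bounded_linear_zero)
      from smooth_on_add[OF oV1 smooth_on_bounded_linear[OF oV1 this g] smooth_on_const[of _ "(0, -1)"]]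
      show ?thesis by (simp add: P_def[abs_def])
    qed
    have pos: "0 < vec_form (\<gamma> (x, u x)) (P (x, u x)) (P (x, u x))"
      using reg[OF x] V1(3)[OF yV1] by (simp add: c.regular_def c.Q_def P_def)
    obtain V Xs where V: "open V" "(x, u x) \<in> V" "V \<subseteq> V1" "length Xs = k" "independent_sections \<gamma> V Xs"
      and PX: "\<And>X z. X \<in> set Xs \<Longrightarrow> z \<in> V \<Longrightarrow> P z \<bullet> X z = 0"
      by (rule adapted_sections[of V1 "(x, u x)" \<gamma> P, OF oV1 yV1 bil sym_\<gamma>[OF V1(2)] smooth_on_subset[OF smooth_\<gamma> V1\<Omega>] sP pos
            dim[OF V1(2)[OF yV1]]]) (assumption, assumption, rule that)
    have hor: "\<exists>\<eta>. \<forall>a. a \<bullet> X z = cform t0 (fst z) a \<eta>" if X: "X \<in> set Xs" "z \<in> V" for X z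
    proof -
      have z1: "z \<in> V1" using X(2) V(3) by blast
      have "X z \<in> horizontal (\<gamma> z)" using V(5) X unfolding independent_sections_def by blast
      then obtain \<eta> where "X z = sharp (\<gamma> z) (blinfun_inner_right \<eta>)" unfolding horizontal_eq by blast
      then have "a \<bullet> X z = cform t0 (fst z) a \<eta>" for a
        using inner_sharp[OF bil[OF z1], of a \<eta>] V1(3)[OF z1] by simp
      then show ?thesis by blast
    qed
    have sm: "smooth_on V X" if "X \<in> set Xs" for X using V(5) that unfolding independent_sections_def by blast
    have rk: "DIM('e) \<le> lie_rank V Xs (x, u x)"
      by (rule rank[OF V(1) _ V(4,5,2)]) (use V(3) V1\<Omega> in blast)
    have "V \<subseteq> V0" "V \<subseteq> fst -` W" using V(3) by (auto simp: V1_def)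
    then show "\<exists>V Xs. open V \<and> (x, u x) \<in> V \<and> V \<subseteq> V0 \<and> V \<subseteq> fst -` W \<and>
       (\<forall>X\<in>set Xs. smooth_on V X \<and> (\<forall>z\<in>V. (grad u (fst z), -1) \<bullet> X z = 0 \<and>
          (\<exists>\<eta>. \<forall>a. a \<bullet> X z = vec_form (\<gamma> (fst z, t0)) a \<eta>))) \<and> DIM('e) \<le> lie_rank V Xs (x, u x)"
      using V(1,2) sm PX hor rk unfolding P_def by (intro exI[of _ V] exI[of _ Xs] conjI ballI)
  qed
qed

end

section \<open>Comparison of the two graphs over a connected slice\<close>

lemma grad_eq_if_touching:
  assumes D: "open D" "x \<in> D" and u: "smooth_on D u" and v: "smooth_on D v"
    and le: "\<And>x. x \<in> D \<Longrightarrow> u x \<le> v x" and eq: "u x = v x"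
  shows "grad u x = grad v x"
proof -
  have "((\<lambda>x. v x - u x) has_derivative (\<lambda>h. grad v x \<bullet> h - grad u x \<bullet> h)) (at x)"
    by (intro has_derivative_diff grad_has_derivative[OF v D(2)] grad_has_derivative[OF u D(2)])
  then have "(\<lambda>h. grad v x \<bullet> h - grad u x \<bullet> h) = (\<lambda>h. 0)"
    by (rule differential_zero_maxmin[OF D(2,1)]) (use le eq in auto)
  from fun_cong[OF this, of "grad v x - grad u x"] have "(grad v x - grad u x) \<bullet> (grad v x - grad u x) = 0"
    by (simp add: inner_diff_left)
  then show ?thesis by simp
qed

context invariant_chart
begin

abbreviation characteristic :: "('e \<Rightarrow> real) \<Rightarrow> 'e \<Rightarrow> bool" where
  "characteristic w x \<equiv> vec_form (\<gamma> (x, w x)) (grad w x, -1) (grad w x, -1) = 0"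

lemma boxed_regular_iff:
  assumes b: "boxed x0 t0 r \<sigma>" and x: "x \<in> W" "W \<subseteq> ball x0 r" and W: "open W" and wx: "\<bar>w x - t0\<bar> < r"
  shows "(x, grad w x) \<in> cometric_box.regular W (cform t0) \<longleftrightarrow> \<not> characteristic w x"
proof -
  interpret c: cometric_box W "cform t0" "dens \<sigma> t0"
    by (rule cometric_box_subset[OF boxed_cometric[OF b] W x(2)])
  have "x \<in> ball x0 r" using x by blast
  then have "\<gamma> (x, w x) = \<gamma> (x, t0)" by (rule boxedD(2)[OF b _ wx])
  then show ?thesis using c.psd[OF x(1), of "(grad w x, -1)"] x(1) by (auto simp: c.regular_def c.Q_def)
qed

text \<open>A box is small in height as well, so one box serves both graphs only near a point where
  they meet. Form and density are returned as mere \<open>B\<close> and \<open>A\<close>, after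
  which heights no longer occur in the local comparison.\<close>

lemma touching_neighbourhood:
  assumes D: "open D" "x0 \<in> D" and u: "smooth_on D u" and v: "smooth_on D v"
    and graph: "\<And>x. x \<in> D \<Longrightarrow> (x, u x) \<in> \<Omega>" and eq: "u x0 = v x0"
    and curv: "\<And>x. x \<in> D \<Longrightarrow> \<not> characteristic u x \<Longrightarrow> \<not> characteristic v x \<Longrightarrow>
      mean_curvature \<gamma> \<mu> (\<lambda>(x, t). v x - t) (x, v x) \<le> mean_curvature \<gamma> \<mu> (\<lambda>(x, t). u x - t) (x, u x)"
    and dim: "\<And>y. y \<in> \<Omega> \<Longrightarrow> dim (horizontal (\<gamma> y)) = Suc k"
    and rank: "\<And>V Xs y. open V \<Longrightarrow> V \<subseteq> \<Omega> \<Longrightarrow> length Xs = k \<Longrightarrow> independent_sections \<gamma> V Xs \<Longrightarrow> y \<in> V \<Longrightarrow> DIM('e) \<le> lie_rank V Xs y"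
  obtains s B A where "0 < s" "ball x0 s \<subseteq> D" "cometric_box (ball x0 s) B A"
    "\<And>x. x \<in> ball x0 s \<Longrightarrow> (x, grad u x) \<in> cometric_box.regular (ball x0 s) B \<longleftrightarrow> \<not> characteristic u x"
    "\<And>x. x \<in> ball x0 s \<Longrightarrow> (x, grad v x) \<in> cometric_box.regular (ball x0 s) B \<longleftrightarrow> \<not> characteristic v x"
    "\<And>x. x \<in> ball x0 s \<Longrightarrow> \<not> characteristic u x \<Longrightarrow> \<not> characteristic v x \<Longrightarrow>
      cometric_box.divergence B A v x \<le> cometric_box.divergence B A u x"
    "\<And>W. open W \<Longrightarrow> W \<subseteq> ball x0 s \<Longrightarrow> \<forall>x\<in>W. \<not> characteristic u x \<Longrightarrow>
      cometric_box.bracket_generating W B u"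
proof -
  define t0 where "t0 = u x0"
  obtain r' \<sigma> where b': "boxed x0 t0 r' \<sigma>"
    using boxed_exists[OF graph[OF D(2)]] unfolding t0_def by (elim exE)
  obtain e where e: "0 < e" "ball x0 e \<subseteq> D" using D unfolding open_contains_ball by metis
  define r where "r = min r' e"
  have r: "0 < r" "r \<le> r'" "r \<le> e" using boxed_pos(1)[OF b'] e(1) by (auto simp: r_def)
  have b: "boxed x0 t0 r \<sigma>" by (rule boxed_mono[OF b' r(1,2)])
  have rD: "ball x0 r \<subseteq> D" using e(2) r(3) by auto
  have u': "smooth_on (ball x0 r) u" and v': "smooth_on (ball x0 r) v"
    by (rule smooth_on_subset[OF u rD] smooth_on_subset[OF v rD])+
  have close: "\<exists>d>0. \<forall>x. dist x x0 < d \<longrightarrow> \<bar>w x - t0\<bar> < r" if w: "smooth_on D w" "w x0 = t0" for w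
  proof -
    have "isCont w x0" using smooth_on_continuous_on[OF w(1)] D continuous_on_eq_continuous_at by blast
    then obtain d where "0 < d" "\<forall>x. dist x x0 < d \<longrightarrow> dist (w x) (w x0) < r"
      unfolding continuous_at_eps_delta using r(1) by blast
    then show ?thesis by (auto simp: w(2) dist_real_def)
  qed
  obtain d1 where d1: "0 < d1" "\<And>x. dist x x0 < d1 \<Longrightarrow> \<bar>u x - t0\<bar> < r" using close[OF u] by (auto simp: t0_def)
  obtain d2 where d2: "0 < d2" "\<And>x. dist x x0 < d2 \<Longrightarrow> \<bar>v x - t0\<bar> < r" using close[OF v] by (auto simp: t0_def eq)
  define s where "s = min r (min d1 d2)"
  have s: "0 < s" "s \<le> r" using r(1) d1(1) d2(1) by (auto simp: s_def)
  have sr: "ball x0 s \<subseteq> ball x0 r" using s(2) by auto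
  have ux: "\<bar>u x - t0\<bar> < r" and vx: "\<bar>v x - t0\<bar> < r" if "x \<in> ball x0 s" for x
    using that d1(2)[of x] d2(2)[of x] by (auto simp: s_def dist_commute)
  note regu = boxed_regular_iff[OF b _ sr open_ball, where w = u] boxed_regular_iff[OF b _ order_refl open_ball, where w = u]
  note regv = boxed_regular_iff[OF b _ sr open_ball, where w = v] boxed_regular_iff[OF b _ order_refl open_ball, where w = v]
  show thesis
  proof (rule that[OF s(1) _ cometric_box_subset[OF boxed_cometric[OF b] open_ball sr]])
    show "ball x0 s \<subseteq> D" using sr rD by blast
    show "(x, grad u x) \<in> cometric_box.regular (ball x0 s) (cform t0) \<longleftrightarrow> \<not> characteristic u x" if "x \<in> ball x0 s" for x
      by (rule regu(1)[OF that ux[OF that]])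
    show "(x, grad v x) \<in> cometric_box.regular (ball x0 s) (cform t0) \<longleftrightarrow> \<not> characteristic v x" if "x \<in> ball x0 s" for x
      by (rule regv(1)[OF that vx[OF that]])
    show "cometric_box.divergence (cform t0) (dens \<sigma> t0) v x \<le> cometric_box.divergence (cform t0) (dens \<sigma> t0) u x"
      if x: "x \<in> ball x0 s" and nu: "\<not> characteristic u x" and nv: "\<not> characteristic v x" for x
    proof -
      have xr: "x \<in> ball x0 r" and xD: "x \<in> D" using x sr rD by blast+
      have dens: "0 \<le> \<sigma> * \<mu> (x, t0) bs" using boxedD(4)[OF b xr, of t0] r(1) by simp
      have ru: "(x, grad u x) \<in> cometric_box.regular (ball x0 r) (cform t0)"
        by (rule iffD2[OF regu(2)[OF xr ux[OF x]] nu])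
      have rv: "(x, grad v x) \<in> cometric_box.regular (ball x0 r) (cform t0)"
        by (rule iffD2[OF regv(2)[OF xr vx[OF x]] nv])
      show ?thesis
        using mult_right_mono[OF curv[OF xD nu nv] dens]
        by (simp only: boxed_curvature[OF b u' xr ux[OF x] ru] boxed_curvature[OF b v' xr vx[OF x] rv])
    qed
    show "cometric_box.bracket_generating W (cform t0) u"
      if W: "open W" "W \<subseteq> ball x0 s" and nu: "\<forall>x\<in>W. \<not> characteristic u x" for W
    proof (rule boxed_bracket_generating[OF b u' W(1) _ _ _ dim rank])
      show Wr: "W \<subseteq> ball x0 r" using W(2) sr by blast
      show ux': "\<bar>u x - t0\<bar> < r" if "x \<in> W" for x by (rule ux[OF subsetD[OF W(2) that]])
      show "(x, grad u x) \<in> cometric_box.regular (ball x0 r) (cform t0)" if "x \<in> W" for x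
        by (rule iffD2[OF regu(2)[OF subsetD[OF Wr that] ux'[OF that]] bspec[OF nu that]])
    qed
  qed
qed

lemma graphs_coincide:
  fixes y0 :: 'e
  assumes D: "open D" "connected D" "y0 \<in> D" and u: "smooth_on D u" and v: "smooth_on D v"
    and graph: "\<And>x. x \<in> D \<Longrightarrow> (x, u x) \<in> \<Omega>"
    and le: "\<And>x. x \<in> D \<Longrightarrow> u x \<le> v x" and y0: "u y0 = v y0" "characteristic u y0"
    and nonchar: "\<And>x. x \<in> D \<Longrightarrow> u x = v x \<Longrightarrow> characteristic u x \<Longrightarrow> x = y0"
    and S': "\<And>x. x \<in> D \<Longrightarrow> characteristic u x \<or> characteristic v x \<Longrightarrow> x \<in> S'"
    and null: "hausdorff_measure (DIM('e) - 1) S' = 0"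
    and curv: "\<And>x. x \<in> D \<Longrightarrow> \<not> characteristic u x \<Longrightarrow> \<not> characteristic v x \<Longrightarrow>
      mean_curvature \<gamma> \<mu> (\<lambda>(x, t). v x - t) (x, v x) \<le> mean_curvature \<gamma> \<mu> (\<lambda>(x, t). u x - t) (x, u x)"
    and dim: "\<And>y. y \<in> \<Omega> \<Longrightarrow> dim (horizontal (\<gamma> y)) = Suc k"
    and rank: "\<And>V Xs y. open V \<Longrightarrow> V \<subseteq> \<Omega> \<Longrightarrow> length Xs = k \<Longrightarrow> independent_sections \<gamma> V Xs \<Longrightarrow> y \<in> V \<Longrightarrow> DIM('e) \<le> lie_rank V Xs y"
    and x: "x \<in> D"
  shows "v x = u x"
proof -
  have open_reg: "open {x \<in> W. (x, grad w x) \<in> cometric_box.regular W B}"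
    if c: "cometric_box W B A" and W: "W \<subseteq> D" and w: "smooth_on D w" for W B A w
  proof -
    interpret cometric_box W B A by (rule c)
    have "continuous_on W (\<lambda>x. (x, grad w x))"
      by (intro continuous_intros smooth_on_continuous_on smooth_on_grad open_U smooth_on_subset[OF w W])
    from this[unfolded continuous_on_open_vimage[OF open_U], THEN spec, THEN mp, OF open_regular]
    show ?thesis by (simp add: vimage_def Int_def conj_commute)
  qed
  have open_eq: "\<exists>\<rho>>0. \<forall>x\<in>ball q \<rho>. u x = v x" if q: "q \<in> D" "q \<noteq> y0" "u q = v q" for q
  proof -
    obtain s B A where s: "0 < s" "ball q s \<subseteq> D" and c: "cometric_box (ball q s) B A"
      and reg: "\<And>x. x \<in> ball q s \<Longrightarrow> (x, grad u x) \<in> cometric_box.regular (ball q s) B \<longleftrightarrow> \<not> characteristic u x"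
        "\<And>x. x \<in> ball q s \<Longrightarrow> (x, grad v x) \<in> cometric_box.regular (ball q s) B \<longleftrightarrow> \<not> characteristic v x"
      and div: "\<And>x. x \<in> ball q s \<Longrightarrow> \<not> characteristic u x \<Longrightarrow> \<not> characteristic v x \<Longrightarrow>
        cometric_box.divergence B A v x \<le> cometric_box.divergence B A u x"
      and gen: "\<And>W. open W \<Longrightarrow> W \<subseteq> ball q s \<Longrightarrow> \<forall>x\<in>W. \<not> characteristic u x \<Longrightarrow>
        cometric_box.bracket_generating W B u"
      by (rule touching_neighbourhood[OF D(1) q(1) u v _ q(3), where k = k], erule graph, erule (2) curv, erule dim, erule (4) rank, rule that)
    define W where "W = {x \<in> ball q s. (x, grad u x) \<in> cometric_box.regular (ball q s) B} \<inter>
      {x \<in> ball q s. (x, grad v x) \<in> cometric_box.regular (ball q s) B}"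
    have oW: "open W" unfolding W_def by (intro open_Int open_reg[OF c s(2)] u v)
    have W: "x \<in> ball q s" "\<not> characteristic u x" "\<not> characteristic v x"
        "(x, grad u x) \<in> cometric_box.regular (ball q s) B" "(x, grad v x) \<in> cometric_box.regular (ball q s) B"
      if "x \<in> W" for x
      using that reg[of x] by (simp_all add: W_def)
    have Wb: "W \<subseteq> ball q s" and WD: "W \<subseteq> D" using W(1) s(2) by blast+
    interpret c: cometric_box "ball q s" B A by (rule c)
    interpret W: cometric_box W B A by (rule cometric_box_subset[OF c oW Wb])
    have nq: "\<not> characteristic u q" using nonchar[OF q(1,3)] q(2) by blast
    \<comment> \<open>Contact makes the gradients equal, so the two graphs are regular at
      \<open>q\<close> together.\<close>
    then have nq': "\<not> characteristic v q" using grad_eq_if_touching[OF D(1) q(1) u v le q(3)] q(3) by simp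
    have "q \<in> ball q s" using s(1) by simp
    then have qW: "q \<in> W" using reg[of q] nq nq' by (simp add: W_def)
    show ?thesis
    proof (rule W.strong_maximum_principle[OF smooth_on_subset[OF u WD] smooth_on_subset[OF v WD] _ _ _ _ gen[OF oW Wb ballI[OF W(2)]] qW q(3)])
      fix x assume x: "x \<in> W"
      show "u x \<le> v x" by (rule le[OF subsetD[OF WD x]])
      show "(x, grad u x) \<in> W.regular" "(x, grad v x) \<in> W.regular"
        using W(4,5)[OF x] x by (simp_all add: W.regular_def c.regular_def)
      show "W.divergence v x \<le> W.divergence u x" by (rule div[OF W(1-3)[OF x]])
    qed
  qed
  have not_strict: False if strict: "\<And>x. x \<in> D \<Longrightarrow> x \<noteq> y0 \<Longrightarrow> u x < v x"
  proof -
    obtain s B A where s: "0 < s" "ball y0 s \<subseteq> D" and c: "cometric_box (ball y0 s) B A"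
      and reg: "\<And>x. x \<in> ball y0 s \<Longrightarrow> (x, grad u x) \<in> cometric_box.regular (ball y0 s) B \<longleftrightarrow> \<not> characteristic u x"
        "\<And>x. x \<in> ball y0 s \<Longrightarrow> (x, grad v x) \<in> cometric_box.regular (ball y0 s) B \<longleftrightarrow> \<not> characteristic v x"
      and div: "\<And>x. x \<in> ball y0 s \<Longrightarrow> \<not> characteristic u x \<Longrightarrow> \<not> characteristic v x \<Longrightarrow>
        cometric_box.divergence B A v x \<le> cometric_box.divergence B A u x"
      and gen: "\<And>W. open W \<Longrightarrow> W \<subseteq> ball y0 s \<Longrightarrow> \<forall>x\<in>W. \<not> characteristic u x \<Longrightarrow>
        cometric_box.bracket_generating W B u"
      by (rule touching_neighbourhood[OF D(1) D(3) u v _ y0(1), where k = k], erule graph, erule (2) curv, erule dim, erule (4) rank, rule that)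
    define U where "U = ball y0 (s / 2)"
    define W where "W = {x \<in> ball y0 s. (x, grad u x) \<in> cometric_box.regular (ball y0 s) B} \<inter>
      {x \<in> ball y0 s. (x, grad v x) \<in> cometric_box.regular (ball y0 s) B}"
    \<comment> \<open>The characteristic points of either graph in a closed ball inside the box: a
      compact set, as the finite covering demands.\<close>
    define S where "S = cball y0 (s / 2) - W"
    have oW: "open W" unfolding W_def by (intro open_Int open_reg[OF c s(2)] u v)
    have cS: "compact S" unfolding S_def by (intro compact_diff compact_cball oW)
    have Us: "U \<subseteq> ball y0 s" and UD: "U \<subseteq> D" and bs: "cball y0 (s / 2) \<subseteq> ball y0 s"
      using s by (auto simp: U_def)
    have US: "x \<in> ball y0 s" "\<not> characteristic u x" "\<not> characteristic v x"
        "(x, grad u x) \<in> cometric_box.regular (ball y0 s) B" "(x, grad v x) \<in> cometric_box.regular (ball y0 s) B"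
      if "x \<in> U - S" for x
    proof -
      have "x \<in> W" using that by (auto simp: U_def S_def)
      then show "x \<in> ball y0 s" "\<not> characteristic u x" "\<not> characteristic v x"
        "(x, grad u x) \<in> cometric_box.regular (ball y0 s) B" "(x, grad v x) \<in> cometric_box.regular (ball y0 s) B"
        using reg[of x] by (simp_all add: W_def)
    qed
    have SS': "S \<subseteq> S'"
    proof
      fix x assume "x \<in> S"
      then have xs: "x \<in> ball y0 s" and "x \<notin> W" using bs by (auto simp: S_def)
      then have "characteristic u x \<or> characteristic v x" using reg[OF xs] by (auto simp only: W_def)
      then show "x \<in> S'" using S' xs s(2) by blast
    qed
    interpret c: cometric_box "ball y0 s" B A by (rule c)
    interpret U: cometric_box U B A by (rule cometric_box_subset[OF c _ Us]) (simp add: U_def)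
    show False
    proof (rule U.no_isolated_contact[OF smooth_on_subset[OF u UD] smooth_on_subset[OF v UD] _ _ _ cS SS' null _ _ _ y0(1)])
      show "u x \<le> v x" if "x \<in> U" for x by (rule le[OF subsetD[OF UD that]])
      show "0 < s / 4" "cball y0 (s / 4) \<subseteq> U" using s(1) by (auto simp: U_def)
      show "u x < v x" if "x \<in> cball y0 (s / 4)" "x \<noteq> y0" for x
        by (rule strict[OF subsetD[OF UD] that(2)]) (use that(1) s(1) in \<open>auto simp: U_def\<close>)
      fix x assume x: "x \<in> U - S"
      show "(x, grad u x) \<in> U.regular" "(x, grad v x) \<in> U.regular"
        using US(4,5)[OF x] x by (simp_all add: U.regular_def c.regular_def)
      show "U.divergence v x \<le> U.divergence u x" by (rule div[OF US(1-3)[OF x]])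
    next
      fix V assume V: "open V" "V \<subseteq> U - S"
      show "cometric_box.bracket_generating V B u"
        by (rule gen[OF V(1)]; intro subsetI ballI US(1,2)) (erule subsetD[OF V(2)])+
    qed
  qed
  define T where "T = {x \<in> D - {y0}. u x = v x}"
  define N where "N = {x \<in> D - {y0}. u x < v x}"
  have oDy: "open (D - {y0})" using D(1) by (rule open_delete)
  have "open T"
    unfolding open_contains_ball
  proof
    fix q assume "q \<in> T"
    then have q: "q \<in> D" "q \<noteq> y0" "u q = v q" by (auto simp: T_def)
    obtain \<rho> where \<rho>: "0 < \<rho>" "\<forall>x\<in>ball q \<rho>. u x = v x" using open_eq[OF q] by (elim exE conjE) (rule that)
    obtain e where e: "0 < e" "ball q e \<subseteq> D - {y0}" using oDy q(1,2) unfolding open_contains_ball by (metis DiffI singletonD)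
    have "ball q (min \<rho> e) \<subseteq> T" using \<rho>(2) e(2) by (auto simp: T_def)
    then show "\<exists>e>0. ball q e \<subseteq> T" using \<rho>(1) e(1) by (intro exI[of _ "min \<rho> e"]) simp
  qed
  have cont: "continuous_on (D - {y0}) u" "continuous_on (D - {y0}) v"
    by (rule continuous_on_subset[OF smooth_on_continuous_on[OF u]] continuous_on_subset[OF smooth_on_continuous_on[OF v]]; blast)+
  have "open ((\<lambda>x. v x - u x) -` {0<..} \<inter> (D - {y0}))"
    using continuous_on_diff[OF cont(2,1)] open_greaterThan unfolding continuous_on_open_vimage[OF oDy] by (elim allE impE)
  also have "(\<lambda>x. v x - u x) -` {0<..} \<inter> (D - {y0}) = N" by (auto simp: N_def)
  finally have "open N" .
  show ?thesis
  proof (cases "DIM('e) = 1")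
    case True
    have y0S: "y0 \<in> S'" by (rule S'[OF D(3)]) (rule disjI1[OF y0(2)])
    have "hausdorff_measure 0 S' = 0" using null True by simp
    \<comment> \<open>With exponent 0 each covering ball costs 1, so the bound 1/2 leaves only an
      empty covering of \<open>y0\<close>.\<close>
    then obtain I :: "nat set" and c \<rho> where I: "finite I" "{y0} \<subseteq> (\<Union>i\<in>I. ball (c i) (\<rho> i / 2))" "(\<Sum>i\<in>I. \<rho> i ^ 0) \<le> (1/2::real)"
      by (rule hausdorff_null_cover[of 0 S' "{y0}" "1/2" 1]) (simp, simp add: y0S, simp, simp, rule that)
    then have "real (card I) \<le> 1/2" by simp
    then have "card I = 0" by linarith
    then show ?thesis using I(1,2) by simp
  next
    case False
    then have "2 \<le> DIM('e)" using DIM_positive[where 'a='e] by linarith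
    then have conn: "connected (D - {y0})" by (rule connected_open_delete[OF D(1,2)])
    have cover: "D - {y0} \<subseteq> T \<union> N" using le by (force simp: T_def N_def)
    have disj: "T \<inter> N \<inter> (D - {y0}) = {}" by (auto simp: T_def N_def)
    from connectedD[OF conn \<open>open T\<close> \<open>open N\<close> disj cover]
    have "T \<inter> (D - {y0}) = {} \<or> N \<inter> (D - {y0}) = {}" .
    moreover have False if "T \<inter> (D - {y0}) = {}"
      by (rule not_strict) (use that cover in \<open>auto simp: N_def\<close>)
    ultimately have "N \<inter> (D - {y0}) = {}" by blast
    then have "x = y0 \<or> x \<in> T" using cover x by blast
    then show ?thesis using y0(1) by (auto simp: T_def)
  qed
qed

end

section \<open>Translation-isometric coordinates\<close>

lemma coordinate_frame_Basis:
  "distinct (coordinate_frame :: 'm::{finite,linorder} ambient list)" "set (coordinate_frame :: 'm ambient list) = Basis"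
proof -
  have "inj_on (\<lambda>i::'m. (axis i 1 :: (real, 'm) vec, 0::real)) UNIV" by (auto simp: inj_on_def axis_eq_axis)
  then show "distinct (coordinate_frame :: 'm ambient list)"
    by (auto simp: coordinate_frame_def distinct_map zero_prod_def)
  have "(Basis :: (real, 'm) vec set) = range (\<lambda>i. axis i 1)" by (auto simp: Basis_vec_def)
  then show "set (coordinate_frame :: 'm ambient list) = Basis"
    by (auto simp: coordinate_frame_def Basis_prod_def image_image)
qed

lemma pullback_translation:
  fixes F :: "'e::euclidean_space \<Rightarrow> 'e"
  assumes "open V" "y \<in> V" "\<And>z. z \<in> V \<Longrightarrow> F z = z + h"
  shows "pullback F y \<omega> = \<omega>"
proof -
  have "((\<lambda>z. z + h) has_derivative (\<lambda>v. v)) (at y)" by (auto intro!: derivative_eq_intros)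
  then have "(F has_derivative (\<lambda>v. v)) (at y)"
    by (rule has_derivative_transform_within_open[OF _ assms(1,2)]) (simp add: assms(3))
  from frechet_derivative_at[OF this] have "frechet_derivative F (at y) = (\<lambda>v. v)" by simp
  then show ?thesis by (intro blinfun_eqI) (simp add: pullback_def bounded_linear_Blinfun_apply)
qed

text \<open>By continuity small translations keep a given point in the chart. In coordinates such a
  translation is a shift of the last coordinate on a whole neighbourhood, so its derivative is the
  identity and preservation of the cometric becomes equality of its components. The density is
  invariant by the choice of coordinates.\<close>

lemma translation_isometric_invariant:
  fixes c :: "('a::topological_space, 'm::{finite,linorder} ambient) chart"
  assumes sub: "subriemannian \<A> g" and iso: "isometric_translations \<A> g \<mu> p\<^sub>0 N \<delta> \<Psi>"
    and co: "translation_isometric_coordinates \<A> \<mu> p\<^sub>0 N \<delta> \<Psi> \<Sigma> c" and y: "y \<in> img_of c"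
  shows "\<exists>e>0. \<forall>a. \<bar>a\<bar> < e \<longrightarrow> y + (0, a) \<in> img_of c \<and> g c (y + (0, a)) = g c y \<and>
    \<mu> c (y + (0, a)) coordinate_frame = \<mu> c y coordinate_frame"
proof -
  have cA: "c \<in> \<A>" and dN: "dom_of c \<subseteq> N" using co by (auto simp: translation_isometric_coordinates_def)
  have shift: "crd c (\<Psi> a q) = crd c q + (0, a)" "vol_density \<mu> c (\<Psi> a q) = vol_density \<mu> c q"
    if "a \<in> {-\<delta><..<\<delta>}" "q \<in> dom_of c" "\<Psi> a q \<in> dom_of c" for a q
    using co that by (auto simp: translation_isometric_coordinates_def prod_eq_iff)
  have "is_chart c" using sub cA by (auto simp: subriemannian_def smooth_structure_def)
  then have od: "open (dom_of c)" and oi: "open (img_of c)" and hom: "homeomorphism (dom_of c) (img_of c) (crd c) (crd_inv c)"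
    by (auto simp: is_chart_def)
  have \<delta>: "0 < \<delta>" and cont: "continuous_on ({-\<delta><..<\<delta>} \<times> N) (\<lambda>(a, q). \<Psi> a q)"
    and \<Psi>0: "\<And>q. q \<in> N \<Longrightarrow> \<Psi> 0 q = q"
    and pres: "\<And>a. a \<in> {-\<delta><..<\<delta>} \<Longrightarrow> preserves_cometric \<A> g N (\<Psi> a)"
    using iso by (auto simp: isometric_translations_def)
  obtain p where p: "p \<in> dom_of c" "y = crd c p" using y by blast
  have pN: "p \<in> N" using p(1) dN by blast
  have "continuous_on {-\<delta><..<\<delta>} (\<lambda>a. case (a, p) of (a, q) \<Rightarrow> \<Psi> a q)"
    by (rule continuous_on_compose2[OF cont]) (auto intro!: continuous_intros pN)
  then have "continuous_on {-\<delta><..<\<delta>} (\<lambda>a. \<Psi> a p)" by simp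
  from this[unfolded continuous_on_open_vimage[OF open_greaterThanLessThan], THEN spec, THEN mp, OF od]
  have "open ((\<lambda>a. \<Psi> a p) -` dom_of c \<inter> {-\<delta><..<\<delta>})" .
  moreover have "0 \<in> (\<lambda>a. \<Psi> a p) -` dom_of c \<inter> {-\<delta><..<\<delta>}" using \<Psi>0[OF pN] p(1) \<delta> by simp
  ultimately obtain e where e: "0 < e" "ball 0 e \<subseteq> (\<lambda>a. \<Psi> a p) -` dom_of c \<inter> {-\<delta><..<\<delta>}"
    unfolding open_contains_ball by (metis (no_types, lifting))
  show ?thesis
  proof (intro exI[of _ e] conjI allI impI e(1))
    fix a :: real assume a: "\<bar>a\<bar> < e"
    then have "a \<in> ball 0 e" by simp
    then have ad: "a \<in> {-\<delta><..<\<delta>}" and ap: "\<Psi> a p \<in> dom_of c" using e(2) by blast+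
    note ya = shift(1)[OF ad p(1) ap, folded p(2)]
    show "y + (0, a) \<in> img_of c" using ap ya by (metis image_eqI)
    show "\<mu> c (y + (0, a)) coordinate_frame = \<mu> c y coordinate_frame"
      using shift(2)[OF ad p(1) ap] by (simp add: vol_density_def ya p(2)[symmetric])
    \<comment> \<open>The pullback involves a derivative, so the shift formula is required on an
      open set and not only at \<open>y\<close>.\<close>
    define V where "V = (\<lambda>z. \<Psi> a (crd_inv c z)) -` dom_of c \<inter> img_of c"
    have inv_dom: "crd_inv c z \<in> dom_of c" "crd c (crd_inv c z) = z" if "z \<in> img_of c" for z
      using hom that by (auto simp: homeomorphism_def)
    have ci: "crd_inv c y = p" using hom p by (auto simp: homeomorphism_def)
    have "continuous_on (img_of c) (\<lambda>z. case (a, crd_inv c z) of (a, q) \<Rightarrow> \<Psi> a q)"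
    proof (rule continuous_on_compose2[OF cont])
      show "continuous_on (img_of c) (\<lambda>z. (a, crd_inv c z))"
        using hom by (intro continuous_intros) (simp add: homeomorphism_def)
      show "(\<lambda>z. (a, crd_inv c z)) ` img_of c \<subseteq> {-\<delta><..<\<delta>} \<times> N"
        using ad inv_dom(1) dN by (auto simp del: greaterThanLessThan_iff)
    qed
    then have "continuous_on (img_of c) (\<lambda>z. \<Psi> a (crd_inv c z))" by simp
    from this[unfolded continuous_on_open_vimage[OF oi], THEN spec, THEN mp, OF od]
    have oV: "open V" unfolding V_def .
    have yV: "y \<in> V" using ap y by (simp add: V_def ci)
    have F: "local_rep c c (\<Psi> a) z = z + (0, a)" if z: "z \<in> V" for z
    proof -
      have "z \<in> img_of c" "\<Psi> a (crd_inv c z) \<in> dom_of c" using z by (auto simp: V_def)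
      then show ?thesis using shift(1)[OF ad inv_dom(1)[of z]] inv_dom(2)[of z] by (simp add: local_rep_def)
    qed
    note pb = pullback_translation[OF oV yV F]
    have "g c (crd c p) (pullback (local_rep c c (\<Psi> a)) (crd c p) \<omega>) (pullback (local_rep c c (\<Psi> a)) (crd c p) \<eta>)
        = g c (crd c (\<Psi> a p)) \<omega> \<eta>" for \<omega> \<eta>
      using pres[OF ad] cA p(1) pN ap unfolding preserves_cometric_def by blast
    then show "g c (y + (0, a)) = g c y" by (intro ext) (simp add: p(2)[symmetric] ya pb)
  qed
qed

theorem theoremJ:
  fixes \<A> :: "('a::{t2_space,second_countable_topology}, 'm::{finite,linorder} ambient) chart set"
    and g :: "('a, 'm ambient) chart \<Rightarrow> 'm ambient \<Rightarrow> 'm ambient coinner"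
    and \<mu> :: "('a, 'm ambient) chart \<Rightarrow> 'm ambient \<Rightarrow> 'm ambient list \<Rightarrow> real"
    and p\<^sub>0 :: 'a and N \<Sigma> :: "'a set" and \<delta> :: real and \<Psi> :: "real \<Rightarrow> 'a \<Rightarrow> 'a"
    and l r :: nat
    and c :: "('a, 'm ambient) chart"
    and D :: "(real, 'm) vec set" and u v w w' :: "(real, 'm) vec \<Rightarrow> real"
  assumes "subriemannian \<A> g" and "volume_form \<A> \<mu>"
    and "isometric_translations \<A> g \<mu> p\<^sub>0 N \<delta> \<Psi>"
    and "hypersurface \<A> \<Sigma>" and "p\<^sub>0 \<in> \<Sigma>"
    and "transversal_translations \<A> N \<Psi> \<Sigma>"
    and "\<forall>c\<in>\<A>. \<forall>y\<in>img_of c. dim (horizontal (g c y)) + l = CARD('m) + 1"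
    and "translation_isometric_coordinates \<A> \<mu> p\<^sub>0 N \<delta> \<Psi> \<Sigma> c"
    and "connected (\<Sigma> \<inter> dom_of c)"
    and "D = slice c"
    and "smooth_on D u" and "smooth_on D v"
    and "graph_over D u \<subseteq> img_of c" and "graph_over D v \<subseteq> img_of c"
    and "(w = u \<and> w' = v) \<or> (w = v \<and> w' = u)"
    and "\<forall>q\<in>D. u q \<le> v q"
    and "singular_set (g c) D w = {0}"
    and "u 0 = 0" and "v 0 = 0"
    and "\<forall>q \<in> D - ({0} \<union> singular_set (g c) D w').
           graph_mean_curvature (g c) (\<mu> c) v q \<le> graph_mean_curvature (g c) (\<mu> c) u q"
    and "hausdorff_measure (CARD('m) - 1) (closure (singular_set (g c) D w')) = 0"
    and "r + l = CARD('m)"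
    and "rank_condition \<A> g r CARD('m)"
  shows "\<forall>q\<in>D. v q = u q"
proof -
  define \<gamma> where "\<gamma> = g c"
  define \<Omega> where "\<Omega> = img_of c"
  note co = assms(8)
  have cA: "c \<in> \<A>" and c0: "p\<^sub>0 \<in> dom_of c" "crd c p\<^sub>0 = 0"
    and S: "\<Sigma> \<inter> dom_of c = {q \<in> dom_of c. snd (crd c q) = 0}"
    using co by (auto simp: translation_isometric_coordinates_def)
  have ch: "open \<Omega>" "continuous_on (dom_of c) (crd c)"
    using assms(1) cA by (auto simp: subriemannian_def smooth_structure_def is_chart_def homeomorphism_def \<Omega>_def)
  have coinner: "bilinear (\<gamma> y)" "\<gamma> y \<omega> \<eta> = \<gamma> y \<eta> \<omega>" "0 \<le> \<gamma> y \<omega> \<omega>" if "y \<in> \<Omega>" for y \<omega> \<eta>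
    using assms(1) cA that unfolding subriemannian_def \<gamma>_def \<Omega>_def by blast+
  have smooth_\<gamma>: "smooth_on \<Omega> (\<lambda>y. \<gamma> y \<omega> \<eta>)" for \<omega> \<eta>
    using assms(1) cA unfolding subriemannian_def \<gamma>_def \<Omega>_def by blast
  have vol: "alt_form DIM('m ambient) (\<mu> c y)" "\<exists>vs. \<mu> c y vs \<noteq> 0" if "y \<in> \<Omega>" for y
    using assms(2) cA that unfolding volume_form_def \<Omega>_def by blast+
  have smooth_\<mu>: "smooth_on \<Omega> (\<lambda>y. \<mu> c y vs)" for vs
    using assms(2) cA unfolding volume_form_def \<Omega>_def by blast
  interpret invariant_chart \<Omega> \<gamma> "\<mu> c" coordinate_frame
  proof
    show "\<mu> c y coordinate_frame \<noteq> 0" if "y \<in> \<Omega>" for y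
      using vol(2)[OF that] alt_form_eq_0[OF vol(1)[OF that] coordinate_frame_Basis] by blast
    show "\<exists>e>0. \<forall>a. \<bar>a\<bar> < e \<longrightarrow> y + (0, a) \<in> \<Omega> \<and> \<gamma> (y + (0, a)) = \<gamma> y \<and>
        \<mu> c (y + (0, a)) coordinate_frame = \<mu> c y coordinate_frame" if "y \<in> \<Omega>" for y
      unfolding \<Omega>_def \<gamma>_def by (rule translation_isometric_invariant[OF assms(1,3) co that[unfolded \<Omega>_def]])
  qed (fact ch(1) coinner smooth_\<gamma> vol(1) smooth_\<mu> coordinate_frame_Basis | rule coinner vol(1); assumption)+
  have D_eq: "D = (\<lambda>x. (x, 0::real)) -` \<Omega>" using assms(10) by (auto simp: slice_def \<Omega>_def)
  have "continuous_on UNIV (\<lambda>x::(real, 'm) vec. (x, 0::real))" by (intro continuous_intros)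
  then have D: "open D" unfolding D_eq by (rule open_vimage[OF ch(1)])
  \<comment> \<open>Connectedness is assumed for the slice as a subset of the manifold and passes to
    \<open>D\<close> as a continuous image.\<close>
  have D_img: "D = (\<lambda>q. fst (crd c q)) ` (\<Sigma> \<inter> dom_of c)"
  proof (intro equalityI subsetI)
    fix x assume "x \<in> D"
    then obtain q where "q \<in> dom_of c" "crd c q = (x, 0)" unfolding D_eq \<Omega>_def by (auto simp: image_iff eq_commute)
    then show "x \<in> (\<lambda>q. fst (crd c q)) ` (\<Sigma> \<inter> dom_of c)" unfolding S by (intro image_eqI[of _ _ q]) auto
  next
    fix x assume "x \<in> (\<lambda>q. fst (crd c q)) ` (\<Sigma> \<inter> dom_of c)"
    then obtain q where q: "q \<in> dom_of c" "snd (crd c q) = 0" "x = fst (crd c q)" unfolding S by blast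
    then have "(x, 0) = crd c q" by (simp add: prod_eq_iff)
    then show "x \<in> D" using q(1) by (auto simp: D_eq \<Omega>_def)
  qed
  have conn: "connected D"
    unfolding D_img by (intro connected_continuous_image assms(9) continuous_intros continuous_on_subset[OF ch(2)]) blast
  have "0 \<in> \<Omega>" unfolding \<Omega>_def using c0 by force
  then have D0: "0 \<in> D" by (simp add: D_eq zero_prod_def)
  have graph: "(x, u x) \<in> \<Omega>" "(x, v x) \<in> \<Omega>" if "x \<in> D" for x
    using assms(13,14) that by (auto simp: graph_over_def \<Omega>_def)
  have sing: "q \<in> singular_set \<gamma> D f \<longleftrightarrow> characteristic f q"
    if f: "smooth_on D f" "(q, f q) \<in> \<Omega>" and q: "q \<in> D" for f q
    by (intro singular_set_iff[where \<gamma> = \<gamma>] D f(1) q coinner[OF f(2)])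
  have sing_u: "q \<in> singular_set \<gamma> D u \<longleftrightarrow> characteristic u q"
    and sing_v: "q \<in> singular_set \<gamma> D v \<longleftrightarrow> characteristic v q" if "q \<in> D" for q
    by (rule sing[OF assms(11) graph(1)[OF that] that] sing[OF assms(12) graph(2)[OF that] that])+
  have le: "u x \<le> v x" if "x \<in> D" for x using assms(16) that by blast
  have touch: "characteristic u x \<longleftrightarrow> characteristic v x" if x: "x \<in> D" "u x = v x" for x
    using grad_eq_if_touching[OF D x(1) assms(11,12) le x(2)] x(2) by simp
  have uv0: "u 0 = v 0" using assms(18,19) by simp
  have single: "(singular_set \<gamma> D u = {0} \<and> w' = v) \<or> (singular_set \<gamma> D v = {0} \<and> w' = u)"
    using assms(15,17) unfolding \<gamma>_def by blast
  \<comment> \<open>Contact at the origin makes it characteristic for both graphs, whichever of them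
    is the one with a single singular point.\<close>
  have char0: "characteristic u 0" using single sing_u[OF D0] sing_v[OF D0] touch[OF D0 uv0] by blast
  have alone: "x = 0" if "x \<in> D" "characteristic u x" "characteristic v x" for x
    using single sing_u[OF that(1)] sing_v[OF that(1)] that(2,3) by blast
  \<comment> \<open>The singular set of \<open>w\<close> is the origin, which also belongs to that
    of \<open>w'\<close>, so smallness of the latter covers both.\<close>
  have in_closure: "x \<in> closure (singular_set \<gamma> D w')" if x: "x \<in> D" "characteristic u x \<or> characteristic v x" for x
  proof (rule subsetD[OF closure_subset])
    have x': "x \<in> singular_set \<gamma> D u \<or> x \<in> singular_set \<gamma> D v"
      using x(2) by (simp only: sing_u[OF x(1)] sing_v[OF x(1)])
    have 0: "0 \<in> singular_set \<gamma> D u" "0 \<in> singular_set \<gamma> D v"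
      using char0 by (simp_all only: sing_u[OF D0] sing_v[OF D0] touch[OF D0 uv0])
    from single show "x \<in> singular_set \<gamma> D w'"
    proof (elim disjE conjE)
      assume "singular_set \<gamma> D u = {0}" "w' = v"
      then show ?thesis using x' 0(2) by (elim disjE) simp_all
    next
      assume "singular_set \<gamma> D v = {0}" "w' = u"
      then show ?thesis using x' 0(1) by (elim disjE) simp_all
    qed
  qed
  have dimR: "DIM((real, 'm) vec) = CARD('m)" by simp
  have "v x = u x" if x: "x \<in> D" for x
  proof (rule graphs_coincide[OF D conn D0 assms(11,12) graph(1) le uv0 char0 _ in_closure _ _ _ _ x, where k = r])
    show "x = 0" if "x \<in> D" "u x = v x" "characteristic u x" for x
      by (rule alone[OF that(1,3) iffD1[OF touch[OF that(1,2)] that(3)]])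
    show "hausdorff_measure (DIM((real, 'm) vec) - 1) (closure (singular_set \<gamma> D w')) = 0"
      using assms(21) unfolding dimR \<gamma>_def .
    show "mean_curvature \<gamma> (\<mu> c) (\<lambda>(x, t). v x - t) (x, v x) \<le> mean_curvature \<gamma> (\<mu> c) (\<lambda>(x, t). u x - t) (x, u x)"
      if x: "x \<in> D" and n: "\<not> characteristic u x" "\<not> characteristic v x" for x
    proof -
      have "x \<noteq> 0" using n(1) char0 by blast
      moreover have "x \<notin> singular_set \<gamma> D w'" 
        using n single by (elim disjE conjE) (simp_all only: sing_u[OF x] sing_v[OF x] not_False_eq_True)
      ultimately have "x \<in> D - ({0} \<union> singular_set \<gamma> D w')" using x by blast
      from bspec[OF assms(20)[folded \<gamma>_def] this] show ?thesis unfolding graph_mean_curvature_def .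
    qed
    show "dim (horizontal (\<gamma> y)) = Suc r" if "y \<in> \<Omega>" for y
    proof -
      have "dim (horizontal (\<gamma> y)) + l = CARD('m) + 1" 
        using bspec[OF bspec[OF assms(7) cA] that[unfolded \<Omega>_def]] unfolding \<gamma>_def .
      then show ?thesis using assms(22) by linarith
    qed
    show "DIM((real, 'm) vec) \<le> lie_rank V Xs y"
      if "open V" "V \<subseteq> \<Omega>" "length Xs = r" "independent_sections \<gamma> V Xs" "y \<in> V" for V Xs y
      using assms(23) cA that unfolding rank_condition_def dimR \<gamma>_def \<Omega>_def by blast
  qed
  then show ?thesis by blast
qed

end
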